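(* Let $A\in\mathcal{H}(E_1,E_0)$ and let $E_1$ be compactly embedded into $E_0$. Let $T>0$, and assume that there are $\gamma\in[0,1]$, $\theta\in(0,1]$ with $(\gamma,\theta)\neq(0,1)$, $\nu\in[0,1)$, $\ell>0$ and a constant $c_T>0$ such that $f:C_{\theta}((0,T],E_\theta)\to C_{\nu}((0,T],E_\gamma)$ is a Lipschitz mapping with $f(0)=0$ satisfying $$\|f(v)-f(w)\|_{C_{\nu}((0,T],E_\gamma)}\le c_T\,L^{\ell}\,\|v-w\|_{C_{\theta}((0,T],E_\theta)}$$ for all $L\in(0,1)$ and all $v,w\in C_{\theta}((0,T],E_\theta)$ with $$\|v\|_{C_{\theta}((0,T],E_\theta)}+\|w\|_{C_{\theta}((0,T],E_\theta)}\le L,\qquad \sup_{t\in(0,T]}\big(\|v(t)\|_0+\|w(t)\|_0\big)\le L .$$ (i) For the problem $$u'=Au+f(u,t),\quad t\in(0,T],\qquad u(0)-b\,u(T)=M, \tag{P1}$$ assume $b\in\mathbb{R}\setminus\{0\}$ and the spectral condition $1\notin b\,e^{T\sigma(A)}$. (ii) For the problem $$u'=Au+f(u,t),\quad t\in(0,T],\qquad u(0)+\int_0^Tb(t)\,u(t)\,\mathrm{d}t=M, \tag{P2}$$ assume $b\in C([0,T],\mathbb{R})$ with $b\neq0$ and the spectral condition $-1\notin\sigma_p\Big(\int_0^Tb(t)\,e^{tA}\,\mathrm{d}t\Big)$. Then there is $m(T)>0$ such that, for each $M\in E_0$ with $\|M\|_0\le m(T)$, problem (P1) respectively problem (P2)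 has a unique mild solution $$u\in C([0,T],E_0)\cap C_\theta((0,T],E_\theta).$$ In addition, if $\gamma>0$, or if $f$ is of the local form $f(u,t)=f(u(t))$ with a function $f:E_\theta\to E_0$ satisfying, for some $\ell>0$ with $0<\theta<\frac{1}{\ell+1}$ and some $c>0$, $$\|f(v)-f(w)\|_{0}\le c\,\big(\|v\|_\theta^\ell+\|w\|_\theta^\ell\big)\,\|v-w\|_{\theta},\quad v,w\in E_\theta,\qquad f(0)=0,$$ then $u\in C^1((0,T],E_0)\cap C((0,T],E_1)$ is a strong solution.
   Context: $E_0,E_1$ are Banach spaces with $E_1$ densely and continuously embedded in $E_0$; $\|\cdot\|_0,\|\cdot\|_1$ are their norms. $A\in\mathcal{H}(E_1,E_0)$ means that $A$ is the generator of an analytic semigroup $(e^{tA})_{t\ge0}$ on $E_0$ with domain $E_1$. $\sigma(\cdot)$ denotes the spectrum and $\sigma_p(\cdot)$ the point spectrum (set of eigenvalues); $e^{T\sigma(A)}=\{e^{T\lambda}:\lambda\in\sigma(A)\}$. For $\theta\in(0,1)$, $(\cdot,\cdot)_\theta$ is an arbitrary admissible interpolation functor of exponent $\theta$ (an interpolation functor of exponent $\theta$ for which $E_1$ is dense in $(E_0,E_1)_\theta$ whenever $E_1$ is dense in $E_0$; e.g. complex interpolation, or real interpolation with finite second parameter), and $E_\theta:=(E_0,E_1)_\theta$ with norm $\|\cdot\|_\theta$; for $\theta=0,1$ these are the given spaces. For $\mu\in\mathbb{R}$, $C_\mu((0,T],E_\theta)$ is the Banach space of all $u\in C((0,T],E_\theta)$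 with $t^\mu u(t)\to0$ in $E_\theta$ as $t\to0^+$, with norm $\|u\|_{C_\mu((0,T],E_\theta)}:=\sup\{t^\mu\|u(t)\|_\theta: t\in(0,T]\}$. Notation: $f(u,t):=f(u)(t)$ for $t\in(0,T]$. A mild solution is a function $u$ satisfying $u(t)=e^{tA}u(0)+\int_0^te^{(t-s)A}f(u,s)\,\mathrm{d}s$ for $t\in[0,T]$ together with the respective nonlocal condition. A strong solution has in addition the regularity $C^1((0,T],E_0)\cap C((0,T],E_1)$ and satisfies the differential equation pointwise on $(0,T]$.
   Formalization: Uniqueness of the mild solution is claimed only in a small ball (radius independent of M) of C([0,T],E_0)∩C_θ((0,T],E_θ), where the solution also lies; in the whole space it fails, e.g. u'=-u+min(u²,4), u(0)=u(T) has solutions u=0 and u=1. *)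

theory Defs
  imports "HOL-Analysis.Analysis"
begin

section \<open>Scalars\<close>

text \<open>
  The space \<open>E\<^sub>0\<close> is a type of class \<open>banach\<close>, hence a real Banach space. To cover both
  scalar fields, a value of the following type says whether the scalars are the reals, or the
  complex numbers acting by the given multiplication.
\<close>

datatype 'a scalars = Real_Scalars | Complex_Scalars "complex \<Rightarrow> 'a \<Rightarrow> 'a"

fun scalars_ok :: "'a::banach scalars \<Rightarrow> bool" where
  "scalars_ok Real_Scalars = True"
| "scalars_ok (Complex_Scalars sc) =
    (vector_space sc \<and> (\<forall>r x. sc (of_real r) x = r *\<^sub>R x) \<and> (\<forall>c x. norm (sc c x) = cmod c * norm x))"

fun field_of :: "'a scalars \<Rightarrow> complex set" where
  "field_of Real_Scalars = \<real>"
| "field_of (Complex_Scalars sc) = UNIV"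

fun smul :: "'a::real_vector scalars \<Rightarrow> complex \<Rightarrow> 'a \<Rightarrow> 'a" where
  "smul Real_Scalars c x = Re c *\<^sub>R x"
| "smul (Complex_Scalars sc) c x = sc c x"

definition subspace_over :: "'a::real_vector scalars \<Rightarrow> 'a set \<Rightarrow> bool" where
  "subspace_over K S \<longleftrightarrow> 0 \<in> S \<and> (\<forall>x\<in>S. \<forall>y\<in>S. x + y \<in> S) \<and> (\<forall>c\<in>field_of K. \<forall>x\<in>S. smul K c x \<in> S)"

definition linear_over :: "'a::real_vector scalars \<Rightarrow> 'a set \<Rightarrow> ('a \<Rightarrow> 'a) \<Rightarrow> bool" where
  "linear_over K S \<Phi> \<longleftrightarrow> (\<forall>x\<in>S. \<forall>y\<in>S. \<Phi> (x + y) = \<Phi> x + \<Phi> y)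
      \<and> (\<forall>c\<in>field_of K. \<forall>x\<in>S. \<Phi> (smul K c x) = smul K c (\<Phi> x))"

text \<open>
  Scalar multiplication of the complexification, \<open>(x, y)\<close> standing for \<open>x + \<i>y\<close>. The
  complexification of an operator \<open>B\<close> is \<open>map_prod B B\<close>. The product norm is only equivalent to
  a complex norm, which does not affect the notions below.
\<close>

definition cplx_scale :: "complex \<Rightarrow> 'a::real_vector \<times> 'a \<Rightarrow> 'a \<times> 'a" where
  "cplx_scale c p = (Re c *\<^sub>R fst p - Im c *\<^sub>R snd p, Re c *\<^sub>R snd p + Im c *\<^sub>R fst p)"


section \<open>Spectra\<close>

text \<open>Operators are given by a domain \<open>D\<close> and a total function whose values off \<open>D\<close> are ignored.\<close>

definition resolvent_set ::
  "(complex \<Rightarrow> 'b::real_normed_vector \<Rightarrow> 'b) \<Rightarrow> 'b set \<Rightarrow> ('b \<Rightarrow> 'b) \<Rightarrow> complex set" where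
  "resolvent_set sc D B = {\<mu>. bij_betw (\<lambda>x. sc \<mu> x - B x) D UNIV
      \<and> bounded_linear (inv_into D (\<lambda>x. sc \<mu> x - B x))}"

definition point_spectrum ::
  "(complex \<Rightarrow> 'b::real_vector \<Rightarrow> 'b) \<Rightarrow> 'b set \<Rightarrow> ('b \<Rightarrow> 'b) \<Rightarrow> complex set" where
  "point_spectrum sc D B = {\<mu>. \<exists>x\<in>D. x \<noteq> 0 \<and> B x = sc \<mu> x}"

text \<open>For real scalars the spectra are those of the complexified operator.\<close>

fun spectrum_over :: "'a::real_normed_vector scalars \<Rightarrow> 'a set \<Rightarrow> ('a \<Rightarrow> 'a) \<Rightarrow> complex set" where
  "spectrum_over Real_Scalars D B = - resolvent_set cplx_scale (D \<times> D) (map_prod B B)"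
| "spectrum_over (Complex_Scalars sc) D B = - resolvent_set sc D B"

fun point_spectrum_over :: "'a::real_vector scalars \<Rightarrow> 'a set \<Rightarrow> ('a \<Rightarrow> 'a) \<Rightarrow> complex set" where
  "point_spectrum_over Real_Scalars D B = point_spectrum cplx_scale (D \<times> D) (map_prod B B)"
| "point_spectrum_over (Complex_Scalars sc) D B = point_spectrum sc D B"


section \<open>Analytic semigroups\<close>

definition c0_semigroup :: "(real \<Rightarrow> 'b::real_normed_vector \<Rightarrow> 'b) \<Rightarrow> bool" where
  "c0_semigroup S \<longleftrightarrow> (\<forall>t\<ge>0. bounded_linear (S t)) \<and> S 0 = id
      \<and> (\<forall>s\<ge>0. \<forall>t\<ge>0. S (s + t) = S s \<circ> S t)
      \<and> (\<forall>x. ((\<lambda>t. S t x) \<longlongrightarrow> x) (at_right 0))"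

definition generator :: "(real \<Rightarrow> 'b::real_normed_vector \<Rightarrow> 'b) \<Rightarrow> 'b set \<Rightarrow> ('b \<Rightarrow> 'b) \<Rightarrow> bool" where
  "generator S D B \<longleftrightarrow> D = {x. \<exists>y. ((\<lambda>t. (S t x - x) /\<^sub>R t) \<longlongrightarrow> y) (at_right 0)}
      \<and> (\<forall>x\<in>D. ((\<lambda>t. (S t x - x) /\<^sub>R t) \<longlongrightarrow> B x) (at_right 0))"

definition sector :: "real \<Rightarrow> complex set" where
  "sector \<delta> = {z. z \<noteq> 0 \<and> \<bar>Arg z\<bar> < \<delta>}"

definition extends_analytically ::
  "(complex \<Rightarrow> 'b::real_normed_vector \<Rightarrow> 'b) \<Rightarrow> (real \<Rightarrow> 'b \<Rightarrow> 'b) \<Rightarrow> bool" where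
  "extends_analytically sc S \<longleftrightarrow> (\<exists>\<delta> Z. 0 < \<delta> \<and> \<delta> \<le> pi / 2
      \<and> (\<forall>t>0. Z (of_real t) = S t)
      \<and> (\<forall>z\<in>sector \<delta>. bounded_linear (Z z) \<and> (\<forall>c x. Z z (sc c x) = sc c (Z z x)))
      \<and> (\<forall>z\<in>sector \<delta>. \<forall>w\<in>sector \<delta>. Z (z + w) = Z z \<circ> Z w)
      \<and> (\<forall>z\<in>sector \<delta>. \<forall>x. \<exists>y. ((\<lambda>\<zeta>. Z \<zeta> x) has_derivative (\<lambda>h. sc h y)) (at z))
      \<and> (\<forall>x. ((\<lambda>z. Z z x) \<longlongrightarrow> x) (at 0 within sector \<delta>)))"

fun analytic_semigroup :: "'a::real_normed_vector scalars \<Rightarrow> (real \<Rightarrow> 'a \<Rightarrow> 'a) \<Rightarrow> bool" where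
  "analytic_semigroup Real_Scalars S =
    (c0_semigroup S \<and> extends_analytically cplx_scale (\<lambda>t. map_prod (S t) (S t)))"
| "analytic_semigroup (Complex_Scalars sc) S = (c0_semigroup S \<and> extends_analytically sc S)"


section \<open>Banach spaces embedded in \<open>E\<^sub>0\<close>\<close>

text \<open>
  A subspace of the ambient type with a norm of its own; values of \<open>nrm\<close> off \<open>carr\<close> are ignored.
\<close>

record 'a nspace =
  carr :: "'a set"
  nrm :: "'a \<Rightarrow> real"

definition whole :: "'a::real_normed_vector nspace" where
  "whole = \<lparr>carr = UNIV, nrm = norm\<rparr>"

definition banach_over :: "'a::real_vector scalars \<Rightarrow> 'a nspace \<Rightarrow> bool" where
  "banach_over K X \<longleftrightarrow> subspace_over K (carr X)
      \<and> (\<forall>x\<in>carr X. 0 \<le> nrm X x \<and> (nrm X x = 0 \<longleftrightarrow> x = 0))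
      \<and> (\<forall>x\<in>carr X. \<forall>y\<in>carr X. nrm X (x + y) \<le> nrm X x + nrm X y)
      \<and> (\<forall>c\<in>field_of K. \<forall>x\<in>carr X. nrm X (smul K c x) = cmod c * nrm X x)
      \<and> (\<forall>s. (\<forall>n. s n \<in> carr X)
            \<and> (\<forall>\<epsilon>>0. \<exists>N. \<forall>m\<ge>N. \<forall>n\<ge>N. nrm X (s m - s n) < \<epsilon>)
          \<longrightarrow> (\<exists>x\<in>carr X. (\<lambda>n. nrm X (s n - x)) \<longlonglongrightarrow> 0))"

definition cont_embedded :: "'a nspace \<Rightarrow> 'a nspace \<Rightarrow> bool" where
  "cont_embedded X Y \<longleftrightarrow> carr X \<subseteq> carr Y \<and> (\<exists>C. \<forall>x\<in>carr X. nrm Y x \<le> C * nrm X x)"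

definition dense_in :: "'a::real_vector nspace \<Rightarrow> 'a nspace \<Rightarrow> bool" where
  "dense_in X Y \<longleftrightarrow> carr X \<subseteq> carr Y
      \<and> (\<forall>y\<in>carr Y. \<forall>\<epsilon>>0. \<exists>x\<in>carr X. nrm Y (y - x) < \<epsilon>)"

definition compactly_embedded :: "'a::real_normed_vector nspace \<Rightarrow> bool" where
  "compactly_embedded X \<longleftrightarrow> cont_embedded X whole \<and> compact (closure {x \<in> carr X. nrm X x \<le> 1})"

definition cont_in :: "'a::real_vector nspace \<Rightarrow> real set \<Rightarrow> (real \<Rightarrow> 'a) \<Rightarrow> bool" where
  "cont_in X I u \<longleftrightarrow> (\<forall>t\<in>I. u t \<in> carr X)
      \<and> (\<forall>t\<in>I. ((\<lambda>s. nrm X (u s - u t)) \<longlongrightarrow> 0) (at t within I))"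


section \<open>Interpolation functors\<close>

definition inter_space :: "'a nspace \<Rightarrow> 'a nspace \<Rightarrow> 'a nspace" where
  "inter_space X0 X1 = \<lparr>carr = carr X0 \<inter> carr X1, nrm = (\<lambda>x. max (nrm X0 x) (nrm X1 x))\<rparr>"

definition sum_space :: "'a::real_vector nspace \<Rightarrow> 'a nspace \<Rightarrow> 'a nspace" where
  "sum_space X0 X1 = \<lparr>carr = {x0 + x1 | x0 x1. x0 \<in> carr X0 \<and> x1 \<in> carr X1},
     nrm = (\<lambda>x. Inf {nrm X0 x0 + nrm X1 x1 | x0 x1. x0 \<in> carr X0 \<and> x1 \<in> carr X1 \<and> x = x0 + x1})\<rparr>"

text \<open>
  Interpolation couples are pairs of Banach spaces continuously embedded in a common Hausdorff
  space, which is here the ambient space. HOL cannot quantify over all Banach spaces, so functors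
  act on the couples in the ambient space only; a functor defined on all couples restricts
  to these.
\<close>

definition couple :: "'a::real_normed_vector scalars \<Rightarrow> 'a nspace \<Rightarrow> 'a nspace \<Rightarrow> bool" where
  "couple K X0 X1 \<longleftrightarrow> banach_over K X0 \<and> banach_over K X1 \<and> cont_embedded X0 whole \<and> cont_embedded X1 whole"

definition maps_with_bound :: "real \<Rightarrow> 'a nspace \<Rightarrow> 'a nspace \<Rightarrow> ('a \<Rightarrow> 'a) \<Rightarrow> bool" where
  "maps_with_bound M X Y \<Phi> \<longleftrightarrow> 0 \<le> M \<and> (\<forall>x\<in>carr X. \<Phi> x \<in> carr Y \<and> nrm Y (\<Phi> x) \<le> M * nrm X x)"

text \<open>
  The last clause is the estimate of the operator norm of \<open>\<Phi>\<close> by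
  \<open>c \<parallel>\<Phi>\<parallel>\<^sub>0\<^bsup>1-\<theta>\<^esup> \<parallel>\<Phi>\<parallel>\<^sub>1\<^bsup>\<theta>\<^esup>\<close>. The constant may depend on the two couples, which admits more functors
  than a uniform constant does.
\<close>

definition interpolation_functor ::
  "'a::real_normed_vector scalars \<Rightarrow> real \<Rightarrow> ('a nspace \<Rightarrow> 'a nspace \<Rightarrow> 'a nspace) \<Rightarrow> bool" where
  "interpolation_functor K \<theta> F \<longleftrightarrow>
     (\<forall>X0 X1. couple K X0 X1 \<longrightarrow> banach_over K (F X0 X1)
        \<and> cont_embedded (inter_space X0 X1) (F X0 X1) \<and> cont_embedded (F X0 X1) (sum_space X0 X1))
   \<and> (\<forall>X0 X1 Y0 Y1. couple K X0 X1 \<and> couple K Y0 Y1 \<longrightarrow>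
       (\<exists>c\<ge>0. \<forall>\<Phi> M0 M1. linear_over K (carr (sum_space X0 X1)) \<Phi>
            \<and> maps_with_bound M0 X0 Y0 \<Phi> \<and> maps_with_bound M1 X1 Y1 \<Phi>
          \<longrightarrow> maps_with_bound (c * M0 powr (1 - \<theta>) * M1 powr \<theta>) (F X0 X1) (F Y0 Y1) \<Phi>))"

definition admissible_functor ::
  "'a::real_normed_vector scalars \<Rightarrow> real \<Rightarrow> ('a nspace \<Rightarrow> 'a nspace \<Rightarrow> 'a nspace) \<Rightarrow> bool" where
  "admissible_functor K \<theta> F \<longleftrightarrow> interpolation_functor K \<theta> F
     \<and> (\<forall>X0 X1. couple K X0 X1 \<and> cont_embedded X1 X0 \<and> dense_in X1 X0 \<longrightarrow> dense_in X1 (F X0 X1))"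

definition interp :: "(real \<Rightarrow> 'a nspace \<Rightarrow> 'a nspace \<Rightarrow> 'a nspace) \<Rightarrow> 'a::real_normed_vector nspace
    \<Rightarrow> real \<Rightarrow> 'a nspace" where
  "interp F E1 \<theta> = (if \<theta> = 0 then whole else if \<theta> = 1 then E1 else F \<theta> whole E1)"


section \<open>Time-weighted spaces and solutions\<close>

text \<open>
  Functions on \<open>(0,T]\<close> are represented by functions on all reals whose values off \<open>(0,T]\<close> are ignored.
\<close>

definition C_weighted :: "real \<Rightarrow> real \<Rightarrow> 'a::real_vector nspace \<Rightarrow> (real \<Rightarrow> 'a) set" where
  "C_weighted \<mu> T X = {u. cont_in X {0<..T} u \<and> ((\<lambda>t. t powr \<mu> * nrm X (u t)) \<longlongrightarrow> 0) (at_right 0)}"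

definition C_norm :: "real \<Rightarrow> real \<Rightarrow> 'a nspace \<Rightarrow> (real \<Rightarrow> 'a) \<Rightarrow> real" where
  "C_norm \<mu> T X u = (SUP t\<in>{0<..T}. t powr \<mu> * nrm X (u t))"

text \<open>
  \<open>S t\<close> is the semigroup operator \<open>e\<^bsup>tA\<^esup>\<close>. The nonlocal condition is stated separately.
\<close>

definition mild_equation :: "(real \<Rightarrow> 'a::banach \<Rightarrow> 'a) \<Rightarrow> real
    \<Rightarrow> ((real \<Rightarrow> 'a) \<Rightarrow> real \<Rightarrow> 'a) \<Rightarrow> (real \<Rightarrow> 'a) \<Rightarrow> bool" where
  "mild_equation S T f u \<longleftrightarrow>
     (\<forall>t\<in>{0..T}. ((\<lambda>s. S (t - s) (f u s)) has_integral (u t - S t (u 0))) {0..t})"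

definition strong_regularity :: "('a::banach \<Rightarrow> 'a) \<Rightarrow> 'a nspace \<Rightarrow> real
    \<Rightarrow> ((real \<Rightarrow> 'a) \<Rightarrow> real \<Rightarrow> 'a) \<Rightarrow> (real \<Rightarrow> 'a) \<Rightarrow> bool" where
  "strong_regularity A E1 T f u \<longleftrightarrow> cont_in E1 {0<..T} u
     \<and> (\<exists>u'. continuous_on {0<..T} u'
          \<and> (\<forall>t\<in>{0<..T}. (u has_vector_derivative u' t) (at t within {0<..T})
               \<and> u' t = A (u t) + f u t))"

definition local_form :: "'a::real_normed_vector nspace \<Rightarrow> real \<Rightarrow> real
    \<Rightarrow> ((real \<Rightarrow> 'a) \<Rightarrow> real \<Rightarrow> 'a) \<Rightarrow> bool" where
  "local_form X \<theta> T f \<longleftrightarrow> (\<exists>g.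
      (\<forall>u\<in>C_weighted \<theta> T X. \<forall>t\<in>{0<..T}. f u t = g (u t))
    \<and> g 0 = 0
    \<and> (\<exists>l>0. \<exists>c>0. 0 < \<theta> \<and> \<theta> < 1 / (l + 1)
        \<and> (\<forall>v\<in>carr X. \<forall>w\<in>carr X.
             norm (g v - g w) \<le> c * (nrm X v powr l + nrm X w powr l) * nrm X (v - w))))"

text \<open>
  Existence and uniqueness for all small data \<open>M\<close>, where \<open>bc u M\<close> is the nonlocal condition and
  \<open>reg u\<close> further regularity of the solution. Uniqueness refers to a ball of
  \<open>C([0,T],E\<^sub>0) \<inter> C\<^sub>\<theta>((0,T],E\<^sub>\<theta>)\<close>. It fails in the whole space: for \<open>u' = -u + u\<^sup>2\<close> and
  \<open>u(0) - u(T) = 0\<close> in a one-dimensional space, both \<open>u = 0\<close> and \<open>u = 1\<close> are solutions.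
\<close>

definition well_posed_small :: "(real \<Rightarrow> 'a::banach \<Rightarrow> 'a) \<Rightarrow> real \<Rightarrow> ((real \<Rightarrow> 'a) \<Rightarrow> real \<Rightarrow> 'a)
    \<Rightarrow> 'a nspace \<Rightarrow> real \<Rightarrow> ((real \<Rightarrow> 'a) \<Rightarrow> 'a \<Rightarrow> bool) \<Rightarrow> ((real \<Rightarrow> 'a) \<Rightarrow> bool) \<Rightarrow> bool" where
  "well_posed_small S T f X \<theta> bc reg \<longleftrightarrow> (\<exists>m>0. \<exists>r>0. \<forall>M. norm M \<le> m \<longrightarrow>
     (let sol = (\<lambda>u. continuous_on {0..T} u \<and> u \<in> C_weighted \<theta> T X \<and> mild_equation S T f u \<and> bc u M
                  \<and> (\<forall>t\<in>{0..T}. norm (u t) \<le> r) \<and> C_norm \<theta> T X u \<le> r)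
      in \<exists>u. sol u \<and> (\<forall>v. sol v \<longrightarrow> (\<forall>t\<in>{0..T}. v t = u t)) \<and> reg u))"

end

theory Submission
  imports Defs "HOL-Computational_Algebra.Fundamental_Theorem_Algebra"
begin

text \<open>
  The Cauchy estimate on the analytic extension and the uniform boundedness principle give
  \<open>\<parallel>e\<^bsup>tA\<^esup>x\<parallel>\<^sub>1 \<le> C t\<^sup>-\<^sup>1 \<parallel>x\<parallel>\<^sub>0\<close>, and interpolation turns this into
  \<open>\<parallel>e\<^bsup>tA\<^esup>x\<parallel>\<^sub>\<theta> \<le> C t\<^bsup>-\<theta>\<^esup> \<parallel>x\<parallel>\<^sub>0\<close> and
  \<open>\<parallel>e\<^bsup>tA\<^esup>x\<parallel>\<^sub>1 \<le> C t\<^bsup>\<gamma>-1\<^esup> \<parallel>x\<parallel>\<^sub>\<gamma>\<close>. With \<open>v\<close> the Duhamel integral of \<open>f(u)\<close>, the mild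
  equation is \<open>u(t) = e\<^bsup>tA\<^esup>u(0) + v(t)\<close>, and the nonlocal condition determines \<open>u(0)\<close> by applying
  \<open>(1 - b e\<^bsup>TA\<^esup>)\<^sup>-\<^sup>1\<close> to \<open>M + b v(T)\<close>, respectively \<open>(1 + \<integral>b(t) e\<^bsup>tA\<^esup>dt)\<^sup>-\<^sup>1\<close> to
  \<open>M - \<integral>b(t) v(t) dt\<close>. These operators are compact perturbations of the identity, so by Fredholm's
  alternative they are invertible once they are injective; a fixed vector of \<open>b e\<^bsup>TA\<^esup>\<close> would produce an
  eigenvalue \<open>\<lambda>\<close> of \<open>A\<close> with \<open>b e\<^bsup>T\<lambda>\<^esup> = 1\<close>. On a small ball the factor \<open>L\<^bsup>\<ell>\<^esup>\<close> makes the resulting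
  map a contraction. Since solutions are Hoelder continuous away from \<open>t = 0\<close>, the forcing
  is regular enough in either case for \<open>u\<close> to be continuous into \<open>E\<^sub>1\<close>, hence differentiable.
\<close>

section \<open>Zabreiko's lemma in Banach subspaces\<close>

text \<open>The spaces between \<open>E1\<close> and \<open>E0\<close> are subspaces carrying their
  own norms, so integrals are formed in \<open>E0\<close> only; membership and bounds in a finer
  norm are recovered afterwards, from completeness of that norm and seminorm estimates of integrals.
  Functors for different exponents need not be related to each other; hence two intermediate spaces
  are never compared directly, and each intermediate smoothing bound comes from one functor applied
  to couples formed from \<open>whole\<close> and \<open>E1\<close>. The domain of \<open>A\<close>
  equals \<open>E1\<close> as a set; that the graph norm is equivalent to \<open>nrm E1\<close> has
  to be proved from completeness of both. Since \<open>f\<close> acts on whole trajectories, a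
  solution cannot be continued step by step in time, and one contraction on all of
  \<open>{0..T}\<close> is used. Real scalars are treated by complexification, whose product norm is
  not homogeneous under complex multiplication; this is the source of the factor 2 in
  \<open>complex_scaling\<close>. Both nonlocal conditions reduce to one form, initial value equal
  to \<open>R (M + \<Lambda> v)\<close> with \<open>v\<close> the Duhamel integral, so that the
  fixed point argument is carried out once.\<close>

lemma smul_of_real: "scalars_ok K \<Longrightarrow> smul K (of_real r) x = r *\<^sub>R x"
  by (cases K) auto

lemma of_real_in_field: "of_real r \<in> field_of K"
  by (cases K) auto

text \<open>Analysis in the subspaces uses real multiples only. Complex multiplication matters for
  spectra, for the analytic extension and for the linearity demanded by the functors, so everything
  else can be stated once over the reals.\<close>

lemma banach_over_real:
  assumes "scalars_ok K" "banach_over K X"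
  shows "banach_over Real_Scalars X"
proof -
  have 1: "r *\<^sub>R x \<in> carr X" if "x \<in> carr X" for r x
    using assms that of_real_in_field[of r K] smul_of_real[OF assms(1), of r x]
    unfolding banach_over_def subspace_over_def by metis
  have 2: "nrm X (r *\<^sub>R x) = \<bar>r\<bar> * nrm X x" if "x \<in> carr X" for r x
    using assms that of_real_in_field[of r K] smul_of_real[OF assms(1), of r x]
    unfolding banach_over_def by (metis norm_of_real)
  show ?thesis
    using assms(2) 1 2 unfolding banach_over_def subspace_over_def
    by (auto elim!: Reals_cases)
qed

locale banach_nspace =
  fixes X :: "'a::real_vector nspace"
  assumes banach: "banach_over Real_Scalars X"
begin

lemma zero_mem [simp]: "0 \<in> carr X"
  and add_mem: "x \<in> carr X \<Longrightarrow> y \<in> carr X \<Longrightarrow> x + y \<in> carr X"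
  using banach unfolding banach_over_def subspace_over_def by auto

lemma scale_mem: "x \<in> carr X \<Longrightarrow> r *\<^sub>R x \<in> carr X"
  using banach of_real_in_field[of r Real_Scalars]
  unfolding banach_over_def subspace_over_def by (metis Re_complex_of_real smul.simps(1))

lemma minus_mem: "x \<in> carr X \<Longrightarrow> - x \<in> carr X"
  using scale_mem[of x "-1"] by simp

lemma diff_mem: "x \<in> carr X \<Longrightarrow> y \<in> carr X \<Longrightarrow> x - y \<in> carr X"
  using add_mem[of x "-y"] minus_mem[of y] by simp

lemma sum_mem: "(\<And>i. i \<in> I \<Longrightarrow> s i \<in> carr X) \<Longrightarrow> sum s I \<in> carr X"
  by (induction I rule: infinite_finite_induct) (auto intro: add_mem)

lemma nrm_ge0: "x \<in> carr X \<Longrightarrow> 0 \<le> nrm X x"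
  and nrm_eq0: "x \<in> carr X \<Longrightarrow> nrm X x = 0 \<longleftrightarrow> x = 0"
  and nrm_triangle: "x \<in> carr X \<Longrightarrow> y \<in> carr X \<Longrightarrow> nrm X (x + y) \<le> nrm X x + nrm X y"
  using banach unfolding banach_over_def by auto

lemma nrm_zero [simp]: "nrm X 0 = 0"
  using nrm_eq0[of 0] by simp

lemma nrm_scale: "x \<in> carr X \<Longrightarrow> nrm X (r *\<^sub>R x) = \<bar>r\<bar> * nrm X x"
  using banach of_real_in_field[of r Real_Scalars]
  unfolding banach_over_def by (metis Re_complex_of_real smul.simps(1) norm_of_real)

lemma nrm_minus: "x \<in> carr X \<Longrightarrow> nrm X (- x) = nrm X x"
  using nrm_scale[of x "-1"] by simp

lemma nrm_diff_le: "x \<in> carr X \<Longrightarrow> y \<in> carr X \<Longrightarrow> nrm X (x - y) \<le> nrm X x + nrm X y"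
  using nrm_triangle[of x "-y"] nrm_minus[of y] minus_mem[of y] by simp

lemma nrm_diff_commute: "x \<in> carr X \<Longrightarrow> y \<in> carr X \<Longrightarrow> nrm X (x - y) = nrm X (y - x)"
  using nrm_minus[of "y - x"] diff_mem by auto

lemma nrm_diff_triangle:
  "x \<in> carr X \<Longrightarrow> y \<in> carr X \<Longrightarrow> z \<in> carr X \<Longrightarrow> nrm X (x - z) \<le> nrm X (x - y) + nrm X (y - z)"
  using nrm_triangle[of "x - y" "y - z"] diff_mem by auto

lemma nrm_le_add_diff: "x \<in> carr X \<Longrightarrow> y \<in> carr X \<Longrightarrow> nrm X x \<le> nrm X y + nrm X (x - y)"
  using nrm_triangle[of y "x - y"] diff_mem by auto

lemma nrm_abs_diff: "x \<in> carr X \<Longrightarrow> y \<in> carr X \<Longrightarrow> \<bar>nrm X x - nrm X y\<bar> \<le> nrm X (x - y)"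
  using nrm_le_add_diff[of x y] nrm_le_add_diff[of y x] nrm_diff_commute[of x y] by simp

lemma nrm_sum: "(\<And>i. i \<in> I \<Longrightarrow> s i \<in> carr X) \<Longrightarrow> nrm X (sum s I) \<le> (\<Sum>i\<in>I. nrm X (s i))"
proof (induction I rule: infinite_finite_induct)
  case (insert i I)
  then have "nrm X (s i + sum s I) \<le> nrm X (s i) + nrm X (sum s I)"
    by (intro nrm_triangle sum_mem) auto
  with insert show ?case by force
qed auto

lemma complete:
  assumes "\<And>n. s n \<in> carr X" "\<And>\<epsilon>. \<epsilon> > 0 \<Longrightarrow> \<exists>N. \<forall>m\<ge>N. \<forall>n\<ge>N. nrm X (s m - s n) < \<epsilon>"
  obtains x where "x \<in> carr X" "(\<lambda>n. nrm X (s n - x)) \<longlonglongrightarrow> 0"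
proof -
  have "\<forall>s. (\<forall>n. s n \<in> carr X) \<and> (\<forall>\<epsilon>>0. \<exists>N. \<forall>m\<ge>N. \<forall>n\<ge>N. nrm X (s m - s n) < \<epsilon>)
      \<longrightarrow> (\<exists>x\<in>carr X. (\<lambda>n. nrm X (s n - x)) \<longlonglongrightarrow> 0)"
    using banach unfolding banach_over_def by (elim conjE)
  then have "\<exists>x\<in>carr X. (\<lambda>n. nrm X (s n - x)) \<longlonglongrightarrow> 0"
    using assms by (elim allE[of _ s] impE) simp_all
  with that show thesis by blast
qed

lemma tendsto_nrm:
  assumes "\<And>n. s n \<in> carr X" "x \<in> carr X" "(\<lambda>n. nrm X (s n - x)) \<longlonglongrightarrow> 0"
  shows "(\<lambda>n. nrm X (s n)) \<longlonglongrightarrow> nrm X x"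
proof -
  have "(\<lambda>n. nrm X (s n) - nrm X x) \<longlonglongrightarrow> 0"
    using assms nrm_abs_diff by (intro Lim_null_comparison[OF _ assms(3)]) auto
  then show ?thesis by (simp add: LIM_zero_iff)
qed

text \<open>Differences of partial sums are dominated by those of the majorant, hence Cauchy. The
  bound on the limit is what turns the dyadic pieces of a convolution into an estimate of the
  whole.\<close>

lemma summable_converges:
  assumes mem: "\<And>n. s n \<in> carr X" and bd: "\<And>n. nrm X (s n) \<le> c n" and c: "summable c"
  obtains x where "x \<in> carr X" "(\<lambda>n. nrm X ((\<Sum>i<n. s i) - x)) \<longlonglongrightarrow> 0" "nrm X x \<le> suminf c"
proof -
  have c0: "0 \<le> c n" for n using bd[of n] nrm_ge0[OF mem, of n] by linarith
  have le: "nrm X ((\<Sum>i<m. s i) - (\<Sum>i<n. s i)) \<le> \<bar>(\<Sum>i<m. c i) - (\<Sum>i<n. c i)\<bar>" if "n \<le> m" for m n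
  proof -
    have "(\<Sum>i<m. s i) - (\<Sum>i<n. s i) = sum s {n..<m}" "(\<Sum>i<m. c i) - (\<Sum>i<n. c i) = sum c {n..<m}"
      using sum_diff_nat_ivl[of 0 n m s] sum_diff_nat_ivl[of 0 n m c] that
      by (auto simp: lessThan_atLeast0)
    moreover have "nrm X (sum s {n..<m}) \<le> (\<Sum>i=n..<m. nrm X (s i))"
      using mem by (intro nrm_sum) auto
    moreover have "\<dots> \<le> sum c {n..<m}" by (intro sum_mono bd)
    ultimately show ?thesis by simp
  qed
  have le': "nrm X ((\<Sum>i<m. s i) - (\<Sum>i<n. s i)) \<le> \<bar>(\<Sum>i<m. c i) - (\<Sum>i<n. c i)\<bar>" for m n
    using le[of n m] le[of m n] nrm_diff_commute[OF sum_mem[of "{..<m}" s] sum_mem[of "{..<n}" s]] mem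
    by (cases "n \<le> m") (auto simp: abs_minus_commute)
  obtain x where x: "x \<in> carr X" "(\<lambda>n. nrm X ((\<Sum>i<n. s i) - x)) \<longlonglongrightarrow> 0"
  proof (rule complete[of "\<lambda>n. \<Sum>i<n. s i"])
    fix \<epsilon> :: real assume "\<epsilon> > 0"
    moreover have "Cauchy (\<lambda>n. \<Sum>i<n. c i)"
      using c by (simp add: summable_iff_convergent convergent_Cauchy)
    ultimately obtain N where "\<forall>m\<ge>N. \<forall>n\<ge>N. \<bar>(\<Sum>i<m. c i) - (\<Sum>i<n. c i)\<bar> < \<epsilon>"
      unfolding Cauchy_def dist_real_def by meson
    then show "\<exists>N. \<forall>m\<ge>N. \<forall>n\<ge>N. nrm X ((\<Sum>i<m. s i) - (\<Sum>i<n. s i)) < \<epsilon>"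
      using le' by (meson order_le_less_trans)
  qed (use mem in \<open>auto intro: sum_mem\<close>)
  have "nrm X (\<Sum>i<n. s i) \<le> suminf c" for n
  proof -
    have "nrm X (\<Sum>i<n. s i) \<le> (\<Sum>i<n. nrm X (s i))" using mem by (intro nrm_sum) auto
    also have "\<dots> \<le> (\<Sum>i<n. c i)" by (intro sum_mono bd)
    also have "\<dots> \<le> suminf c" using c c0 by (intro sum_le_suminf) auto
    finally show ?thesis .
  qed
  moreover have "(\<lambda>n. nrm X (\<Sum>i<n. s i)) \<longlonglongrightarrow> nrm X x"
    using mem x by (intro tendsto_nrm) (auto intro: sum_mem)
  ultimately have "nrm X x \<le> suminf c"
    by (meson LIMSEQ_le_const2)
  with x that show thesis by blast
qed

text \<open>Baire's argument for the countable cover of \<open>X\<close> by the sublevel sets of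
  \<open>p\<close>. If none of them were dense in a ball, nested balls avoiding one sublevel after
  the other would shrink to a point where \<open>p\<close> exceeds every integer.\<close>

lemma ball_in_closure_of_sublevel:
  fixes p :: "'a \<Rightarrow> real"
  shows "\<exists>n::nat. \<exists>x\<in>carr X. \<exists>R>0. \<forall>y\<in>carr X. nrm X (y - x) \<le> R \<longrightarrow>
           (\<forall>\<epsilon>>0. \<exists>z\<in>carr X. nrm X (y - z) < \<epsilon> \<and> p z \<le> n)"
proof (rule ccontr)
  assume asm: "\<not> ?thesis"
  have neg: "\<exists>y\<in>carr X. nrm X (y - x) \<le> R \<and> (\<exists>\<epsilon>>0. \<forall>z\<in>carr X. nrm X (y - z) < \<epsilon> \<longrightarrow> p z > real n)"
    if "x \<in> carr X" "R > 0" for x R and n :: nat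
  proof -
    have "\<not> (\<forall>y\<in>carr X. nrm X (y - x) \<le> R \<longrightarrow>
       (\<forall>\<epsilon>>0. \<exists>z\<in>carr X. nrm X (y - z) < \<epsilon> \<and> p z \<le> real n))"
      using asm that by blast
    then show ?thesis by (simp add: not_le)
  qed
  \<comment> \<open>A state is a centre with a radius. The halvings in \<open>Q\<close> put the next
    ball inside the present one, and the bound \<open>(1/2)^n\<close> in \<open>P\<close> makes the
    centres a Cauchy sequence.\<close>
  define P where "P = (\<lambda>n::nat. \<lambda>(x, R::real). x \<in> carr X \<and> 0 < R \<and> R \<le> (1/2)^n)"
  define Q where "Q = (\<lambda>(n::nat) (x, R) (y, \<rho>). nrm X (y - x) \<le> R / 2 \<and> \<rho> \<le> R / 2 \<and>
      (\<forall>z\<in>carr X. nrm X (y - z) \<le> \<rho> \<longrightarrow> p z > real n))"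
  have "\<exists>h. \<forall>n. P n (h n) \<and> Q n (h n) (h (Suc n))"
  proof (rule dependent_nat_choice)
    show "\<exists>x. P 0 x" unfolding P_def by (intro exI[of _ "(0, 1)"]) auto
    fix xR n assume "P n xR"
    then obtain x R where xR: "xR = (x, R)" "x \<in> carr X" "0 < R" "R \<le> (1/2)^n"
      unfolding P_def by auto
    obtain y \<epsilon> where y: "y \<in> carr X" "nrm X (y - x) \<le> R/2" "\<epsilon> > 0"
        "\<forall>z\<in>carr X. nrm X (y - z) < \<epsilon> \<longrightarrow> p z > real n"
      using neg[of x "R/2" n] xR by auto
    show "\<exists>y\<rho>. P (Suc n) y\<rho> \<and> Q n xR y\<rho>"
      unfolding P_def Q_def using xR y
      by (intro exI[of _ "(y, min (R/2) (\<epsilon>/2))"]) auto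
  qed
  then obtain h where h: "\<And>n. P n (h n)" "\<And>n. Q n (h n) (h (Suc n))" by blast
  define x where "x = (\<lambda>n. fst (h n))"
  define R where "R = (\<lambda>n. snd (h n))"
  have x: "x n \<in> carr X" and R: "0 < R n" "R n \<le> (1/2)^n" for n
    using h(1)[of n] unfolding P_def x_def R_def by (auto simp: case_prod_beta)
  have step: "nrm X (x (Suc n) - x n) \<le> R n / 2" "R (Suc n) \<le> R n / 2"
     and big: "\<And>z. z \<in> carr X \<Longrightarrow> nrm X (x (Suc n) - z) \<le> R (Suc n) \<Longrightarrow> p z > real n" for n
    using h(2)[of n] unfolding Q_def x_def R_def by (auto simp: case_prod_beta)
  \<comment> \<open>Each step costs at most \<open>R n / 2\<close>, which is at most
    \<open>R n - R (Suc n)\<close>, so the distances telescope and all later centres stay in the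
    ball of radius \<open>R n\<close>.\<close>
  have far: "nrm X (x (n + k) - x n) \<le> R n - R (n + k)" for n k
  proof (induction k)
    case (Suc k)
    show ?case
      using nrm_diff_triangle[of "x (n + Suc k)" "x (n + k)" "x n"] x Suc step[of "n + k"] by simp
  qed simp
  have far': "nrm X (x m - x n) \<le> R n" if "n \<le> m" for m n
    using far[of n "m - n"] R(1)[of m] that by simp
  obtain y where y: "y \<in> carr X" "(\<lambda>n. nrm X (x n - y)) \<longlonglongrightarrow> 0"
  proof (rule complete[of x])
    fix \<epsilon> :: real assume "\<epsilon> > 0"
    then obtain N where N: "(1/2::real)^N < \<epsilon> / 2" using real_arch_pow_inv[of "\<epsilon>/2" "1/2"] by auto
    have "nrm X (x m - x n) < \<epsilon>" if "m \<ge> N" "n \<ge> N" for m n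
      using nrm_diff_triangle[of "x m" "x N" "x n", OF x x x] nrm_diff_commute[of "x N" "x n", OF x x]
        far'[OF that(1)] far'[OF that(2)] R(2)[of N] N by linarith
    then show "\<exists>N. \<forall>m\<ge>N. \<forall>n\<ge>N. nrm X (x m - x n) < \<epsilon>" by blast
  qed (use x in auto)
  have "nrm X (x n - y) \<le> R n" for n
  proof -
    have "nrm X (x n - y) \<le> R n + nrm X (x m - y)" if "m \<ge> n" for m
      using nrm_diff_triangle[of "x n" "x m" y, OF x x y(1)] nrm_diff_commute[of "x n" "x m", OF x x] far'[OF that]
      by linarith
    moreover have "(\<lambda>m. R n + nrm X (x m - y)) \<longlonglongrightarrow> R n + 0" by (intro tendsto_intros y)
    ultimately have "nrm X (x n - y) \<le> R n + 0" by (intro LIMSEQ_le_const) auto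
    then show ?thesis by simp
  qed
  then have "p y > real n" for n using big[OF y(1)] by blast
  then show False using reals_Archimedean2[of "p y"] less_asym by blast
qed

text \<open>Zabreiko's lemma. It replaces both the uniform boundedness principle and the closed graph theorem,
  neither of which is available for subspaces with a norm of their own.\<close>

lemma countably_subadditive_bounded:
  fixes p :: "'a \<Rightarrow> real"
  assumes p0: "\<And>x. x \<in> carr X \<Longrightarrow> 0 \<le> p x"
    and sub: "\<And>x y. x \<in> carr X \<Longrightarrow> y \<in> carr X \<Longrightarrow> p (x + y) \<le> p x + p y"
    and scale: "\<And>r x. x \<in> carr X \<Longrightarrow> p (r *\<^sub>R x) = \<bar>r\<bar> * p x"
    and csub: "\<And>s x. (\<And>n. s n \<in> carr X) \<Longrightarrow> x \<in> carr X \<Longrightarrow>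
        (\<lambda>n. nrm X ((\<Sum>i<n. s i) - x)) \<longlonglongrightarrow> 0 \<Longrightarrow> summable (\<lambda>n. p (s n)) \<Longrightarrow> p x \<le> (\<Sum>n. p (s n))"
  obtains C where "C > 0" "\<And>x. x \<in> carr X \<Longrightarrow> p x \<le> C * nrm X x"
proof -
  obtain n x0 R where R: "x0 \<in> carr X" "R > 0"
    and dense: "\<And>y \<epsilon>. y \<in> carr X \<Longrightarrow> nrm X (y - x0) \<le> R \<Longrightarrow> \<epsilon> > 0 \<Longrightarrow>
           \<exists>z\<in>carr X. nrm X (y - z) < \<epsilon> \<and> p z \<le> real n"
    using ball_in_closure_of_sublevel[of p] by blast
  \<comment> \<open>Differences of two points of the sublevel set move the ball to the origin at the
    price of doubling the bound; the summand 1 keeps \<open>N\<close> positive.\<close>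
  define N where "N = 2 * real n + 1"
  have "N > 0" unfolding N_def by simp
  have appr: "\<exists>z\<in>carr X. nrm X (w - z) \<le> \<epsilon> \<and> p z \<le> N" if w: "w \<in> carr X" "nrm X w \<le> R" "\<epsilon> > 0" for w \<epsilon>
  proof -
    obtain z1 where z1: "z1 \<in> carr X" "nrm X ((x0 + w) - z1) < \<epsilon>/2" "p z1 \<le> n"
      using dense[of "x0 + w" "\<epsilon>/2"] w R add_mem by auto
    obtain z2 where z2: "z2 \<in> carr X" "nrm X (x0 - z2) < \<epsilon>/2" "p z2 \<le> n"
      using dense[of "x0" "\<epsilon>/2"] w R by auto
    have "w - (z1 - z2) = ((x0 + w) - z1) - (x0 - z2)" by simp
    then have "nrm X (w - (z1 - z2)) \<le> nrm X ((x0 + w) - z1) + nrm X (x0 - z2)"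
      using z1 z2 R w by (metis nrm_diff_le add_mem diff_mem)
    then have "nrm X (w - (z1 - z2)) \<le> \<epsilon>" using z1 z2 by linarith
    moreover have "p (z1 - z2) \<le> N"
      using sub[of z1 "-1 *\<^sub>R z2"] scale[of z2 "-1"] z1 z2 scale_mem[of z2 "-1"] by (simp add: N_def)
    ultimately show ?thesis using z1 z2 diff_mem by blast
  qed
  \<comment> \<open>Homogeneity of \<open>p\<close> and of the norm transports the approximation to
    radius \<open>R * (1/2)^k\<close>, with a bound on \<open>p\<close> that shrinks at the same
    rate.\<close>
  have appr': "\<exists>z\<in>carr X. nrm X (w - z) \<le> R * (1/2)^Suc k \<and> p z \<le> N * (1/2)^k"
    if w: "w \<in> carr X" "nrm X w \<le> R * (1/2)^k" for w k
  proof -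
    have "nrm X ((2^k) *\<^sub>R w) \<le> R"
      using w nrm_scale[of w "2^k"] by (simp add: field_simps power_one_over)
    then obtain z where z: "z \<in> carr X" "nrm X ((2^k) *\<^sub>R w - z) \<le> R/2" "p z \<le> N"
      using appr[of "(2^k) *\<^sub>R w" "R/2"] w R scale_mem by auto
    have "w - (1/2)^k *\<^sub>R z = (1/2)^k *\<^sub>R ((2^k) *\<^sub>R w - z)"
      by (simp add: scaleR_diff_right power_one_over)
    then have "nrm X (w - (1/2)^k *\<^sub>R z) \<le> (1/2)^k * (R/2)"
      using nrm_scale[of "(2^k) *\<^sub>R w - z" "(1/2)^k"] z w scale_mem diff_mem by simp
    then show ?thesis using z scale[of z "(1/2)^k"] scale_mem[of z "(1/2)^k"]
      by (intro bexI[of _ "(1/2)^k *\<^sub>R z"]) (auto simp: mult.commute)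
  qed
  have bound: "p x \<le> 2 * N" if x: "x \<in> carr X" "nrm X x \<le> R" for x
  proof -
    \<comment> \<open>\<open>h k\<close> is the remainder after \<open>k\<close> approximations. The
      differences \<open>h k - h (Suc k)\<close> are the approximants, so their series telescopes to
      \<open>x\<close> while their \<open>p\<close>-values form a geometric series with sum
      \<open>2 * N\<close>.\<close>
    have "\<exists>h. \<forall>k. (h k \<in> carr X \<and> nrm X (h k) \<le> R * (1/2)^k \<and> (k = 0 \<longrightarrow> h k = x))
       \<and> p (h k - h (Suc k)) \<le> N * (1/2)^k"
    proof (rule dependent_nat_choice)
      show "\<exists>w. w \<in> carr X \<and> nrm X w \<le> R * (1/2)^0 \<and> (0 = (0::nat) \<longrightarrow> w = x)" using x by auto
      fix w k assume "w \<in> carr X \<and> nrm X w \<le> R * (1/2)^k \<and> (k = 0 \<longrightarrow> w = x)"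
      then obtain z where "z \<in> carr X" "nrm X (w - z) \<le> R * (1/2)^Suc k" "p z \<le> N * (1/2)^k" "w \<in> carr X"
        using appr' by blast
      then show "\<exists>y. (y \<in> carr X \<and> nrm X y \<le> R * (1/2)^Suc k \<and> (Suc k = 0 \<longrightarrow> y = x)) \<and> p (w - y) \<le> N * (1/2)^k"
        by (intro exI[of _ "w - z"]) (auto intro: diff_mem)
    qed
    then obtain h where h: "\<And>k. h k \<in> carr X" "\<And>k. nrm X (h k) \<le> R * (1/2)^k" "h 0 = x"
      "\<And>k. p (h k - h (Suc k)) \<le> N * (1/2)^k" by blast
    have tele: "(\<Sum>i<k. h i - h (Suc i)) = x - h k" for k
      by (induction k) (auto simp: h)
    have lim: "(\<lambda>k. nrm X ((\<Sum>i<k. h i - h (Suc i)) - x)) \<longlonglongrightarrow> 0"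
    proof (rule Lim_null_comparison)
      show "\<forall>\<^sub>F k in sequentially. norm (nrm X ((\<Sum>i<k. h i - h (Suc i)) - x)) \<le> R * (1/2)^k"
        using h nrm_ge0[OF h(1)] nrm_minus[OF h(1)] by (auto simp: tele)
      show "(\<lambda>k. R * (1/2)^k) \<longlonglongrightarrow> 0"
        by (intro tendsto_mult_right_zero LIMSEQ_realpow_zero) auto
    qed
    have geo: "(\<lambda>k. N * (1/2)^k) sums (N * 2)"
      using sums_mult[OF geometric_sums[of "1/2::real"], of N] by simp
    have summ: "summable (\<lambda>k. p (h k - h (Suc k)))"
      using h p0 diff_mem by (intro summable_comparison_test'[OF sums_summable[OF geo], of 0]) auto
    have "p x \<le> (\<Sum>k. p (h k - h (Suc k)))"
      using h x diff_mem by (intro csub lim summ) auto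
    also have "\<dots> \<le> (\<Sum>k. N * (1/2)^k)"
      using h(4) by (intro suminf_le summ sums_summable[OF geo]) auto
    finally show ?thesis using sums_unique[OF geo] by simp
  qed
  show thesis
  proof (rule that[of "2 * N / R"])
    fix x assume x: "x \<in> carr X"
    show "p x \<le> 2 * N / R * nrm X x"
    proof (cases "x = 0")
      case True
      then show ?thesis using scale[of 0 0] by simp
    next
      case False
      then have pos: "nrm X x > 0" using nrm_ge0[OF x] nrm_eq0[OF x] by linarith
      have "p ((R / nrm X x) *\<^sub>R x) \<le> 2 * N"
        using x pos R by (intro bound scale_mem) (simp_all add: nrm_scale)
      then show ?thesis using scale[OF x, of "R / nrm X x"] pos R by (simp add: field_simps)
    qed
  qed (use \<open>N > 0\<close> R in simp)
qed

end

section \<open>The ambient space and the uniform boundedness principle\<close>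

lemma whole_simps [simp]: "carr whole = UNIV" "nrm whole = norm"
  by (auto simp: whole_def)

lemma banach_over_whole:
  assumes "scalars_ok K"
  shows "banach_over K (whole :: 'a::banach nspace)"
proof -
  have 1: "norm (smul K c x) = cmod c * norm x" if "c \<in> field_of K" for c and x :: 'a
    using assms that by (cases K) (auto elim!: Reals_cases)
  have 2: "\<exists>x. (\<lambda>n. norm (s n - x)) \<longlonglongrightarrow> 0"
    if "\<forall>\<epsilon>>0. \<exists>N. \<forall>m\<ge>N. \<forall>n\<ge>N. norm (s m - s n) < \<epsilon>" for s :: "nat \<Rightarrow> 'a"
  proof -
    have "Cauchy s" using that unfolding Cauchy_def dist_norm .
    then show ?thesis by (metis Cauchy_convergent LIM_zero convergent_def tendsto_norm_zero)
  qed
  show ?thesis unfolding banach_over_def subspace_over_def using 1 2 norm_triangle_ineq by auto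
qed

text \<open>The pointwise supremum \<open>p\<close> is a finite seminorm, and continuity of each
  \<open>Z i\<close> makes it countably subadditive, so Zabreiko's lemma bounds it. It will be
  applied to the analytic extension on a union of complex disks.\<close>

lemma uniform_boundedness:
  fixes Z :: "'i \<Rightarrow> 'b::banach \<Rightarrow> 'c::real_normed_vector"
  assumes lin: "\<And>i. i \<in> I \<Longrightarrow> bounded_linear (Z i)"
    and bd: "\<And>x. \<exists>B. \<forall>i\<in>I. norm (Z i x) \<le> B"
  obtains C where "C > 0" "\<And>i x. i \<in> I \<Longrightarrow> norm (Z i x) \<le> C * norm x"
proof (cases "I = {}")
  case False
  interpret banach_nspace "whole :: 'b nspace"
    by standard (rule banach_over_whole, simp)
  define p where "p = (\<lambda>x. SUP i\<in>I. norm (Z i x))"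
  have bdd: "bdd_above ((\<lambda>i. norm (Z i x)) ` I)" for x
    using bd[of x] by (auto simp: bdd_above_def)
  have le: "norm (Z i x) \<le> p x" if "i \<in> I" for i x
    unfolding p_def by (rule cSUP_upper[OF that bdd])
  have least: "p x \<le> c" if "\<And>i. i \<in> I \<Longrightarrow> norm (Z i x) \<le> c" for x c
    unfolding p_def using False that by (rule cSUP_least)
  have p0: "0 \<le> p x" for x
    using False le[of _ x] by (meson all_not_in_conv norm_ge_zero order_trans)
  obtain C where "C > 0" "\<And>x. p x \<le> C * norm x"
  proof (rule countably_subadditive_bounded[of p])
    fix x y show "p (x + y) \<le> p x + p y"
    proof (rule least)
      fix i assume i: "i \<in> I"
      have "norm (Z i (x + y)) \<le> norm (Z i x) + norm (Z i y)"
        using linear_add[OF bounded_linear.linear[OF lin[OF i]]] by (metis norm_triangle_ineq)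
      then show "norm (Z i (x + y)) \<le> p x + p y" using le[OF i, of x] le[OF i, of y] by linarith
    qed
  next
    fix r x
    have ub: "p (r *\<^sub>R x) \<le> \<bar>r\<bar> * p x" for r x
    proof (rule least)
      fix i assume i: "i \<in> I"
      show "norm (Z i (r *\<^sub>R x)) \<le> \<bar>r\<bar> * p x"
        using linear_scale[OF bounded_linear.linear[OF lin[OF i]], of r x] le[OF i, of x]
        by (simp add: mult_left_mono)
    qed
    show "p (r *\<^sub>R x) = \<bar>r\<bar> * p x"
    proof (cases "r = 0")
      case True then show ?thesis using ub[of 0 x] p0[of 0] by simp
    next
      case False
      have "p x \<le> \<bar>1/r\<bar> * p (r *\<^sub>R x)" using ub[of "1/r" "r *\<^sub>R x"] False by simp
      then have "\<bar>r\<bar> * p x \<le> p (r *\<^sub>R x)" using False by (simp add: field_simps)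
      with ub[of r x] show ?thesis by linarith
    qed
  next
    fix s :: "nat \<Rightarrow> 'b" and x
    assume lim: "(\<lambda>n. nrm whole ((\<Sum>i<n. s i) - x)) \<longlonglongrightarrow> 0" and summ: "summable (\<lambda>n. p (s n))"
    show "p x \<le> (\<Sum>n. p (s n))"
    proof (rule least)
      fix i assume i: "i \<in> I"
      have "(\<lambda>n. \<Sum>i<n. s i) \<longlonglongrightarrow> x"
        using lim by (simp add: tendsto_norm_zero_iff LIM_zero_iff)
      then have "(\<lambda>n. Z i (\<Sum>j<n. s j)) \<longlonglongrightarrow> Z i x"
        by (rule bounded_linear.tendsto[OF lin[OF i]])
      moreover have "norm (Z i (\<Sum>j<n. s j)) \<le> (\<Sum>n. p (s n))" for n
      proof -
        have "norm (Z i (\<Sum>j<n. s j)) \<le> (\<Sum>j<n. norm (Z i (s j)))"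
          using linear_sum[OF bounded_linear.linear[OF lin[OF i]]] by (metis norm_sum)
        also have "\<dots> \<le> (\<Sum>j<n. p (s j))" by (intro sum_mono le i)
        also have "\<dots> \<le> (\<Sum>n. p (s n))" using summ p0 by (intro sum_le_suminf) auto
        finally show ?thesis .
      qed
      ultimately show "norm (Z i x) \<le> (\<Sum>n. p (s n))"
        by (intro LIMSEQ_le_const2[OF tendsto_norm]) auto
    qed
  qed (use p0 in auto)
  then show thesis using that le order_trans by blast
qed (use that[of 1] in auto)

section \<open>Compact operators\<close>

definition compact_op :: "('a::real_normed_vector \<Rightarrow> 'b::real_normed_vector) \<Rightarrow> bool" where
  "compact_op K \<longleftrightarrow> bounded_linear K \<and> compact (closure (K ` cball 0 1))"

lemma compact_op_subset:
  assumes "bounded_linear K" "K ` cball 0 1 \<subseteq> C" "compact C"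
  shows "compact_op K"
proof -
  have "closure (K ` cball 0 1) \<subseteq> C"
    using assms by (simp add: closure_minimal compact_imp_closed)
  then have "compact (closure (K ` cball 0 1))"
    using compact_Int_closed[OF assms(3), of "closure (K ` cball 0 1)"]
    by (simp add: Int_absorb1)
  with assms show ?thesis by (simp add: compact_op_def)
qed

lemma compact_op_scaleR:
  assumes "compact_op K"
  shows "compact_op (\<lambda>x. c *\<^sub>R K x)"
proof (rule compact_op_subset)
  show "bounded_linear (\<lambda>x. c *\<^sub>R K x)"
    using assms by (intro bounded_linear_const_scaleR) (simp add: compact_op_def)
  show "compact ((*\<^sub>R) c ` closure (K ` cball 0 1))"
    using assms by (intro compact_scaling) (simp add: compact_op_def)
  show "(\<lambda>x. c *\<^sub>R K x) ` cball 0 1 \<subseteq> (*\<^sub>R) c ` closure (K ` cball 0 1)"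
    using closure_subset by fastforce
qed

lemma compact_op_compose:
  assumes K: "compact_op K" and L: "bounded_linear L"
  shows "compact_op (\<lambda>x. K (L x))"
proof -
  have lin: "bounded_linear K" and comp: "compact (closure (K ` cball 0 1))"
    using K by (auto simp: compact_op_def)
  obtain M where M: "M > 0" "\<And>x. norm (L x) \<le> norm x * M"
    using bounded_linear.pos_bounded[OF L] by auto
  show ?thesis
  proof (rule compact_op_subset)
    show "bounded_linear (\<lambda>x. K (L x))" by (rule bounded_linear_compose[OF lin L])
    show "compact ((*\<^sub>R) M ` closure (K ` cball 0 1))" by (rule compact_scaling[OF comp])
    show "(\<lambda>x. K (L x)) ` cball 0 1 \<subseteq> (*\<^sub>R) M ` closure (K ` cball 0 1)"
    proof clarify
      fix x :: 'c assume x: "x \<in> cball 0 1"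
      have "norm (L x) \<le> M" using M(2)[of x] M(1) x by (simp add: mult_left_le_one_le order_trans)
      then have "(1/M) *\<^sub>R L x \<in> cball 0 1" using M(1) by (simp add: field_simps)
      then have "K ((1/M) *\<^sub>R L x) \<in> closure (K ` cball 0 1)"
        by (intro closure_subset[THEN subsetD] imageI)
      moreover have "K (L x) = M *\<^sub>R K ((1/M) *\<^sub>R L x)"
        using M(1) by (simp add: linear_scale[OF bounded_linear.linear[OF lin]])
      ultimately show "K (L x) \<in> (*\<^sub>R) M ` closure (K ` cball 0 1)" by blast
    qed
  qed
qed

text \<open>A finite e/3-net for the approximating operator is a 2e/3-net for \<open>K\<close>. The
  net is stated with closed balls so that the covering survives the passage to the closure, and is
  then enlarged to open balls of radius \<open>e\<close>.\<close>

lemma compact_op_limit: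
  fixes K :: "'a::real_normed_vector \<Rightarrow> 'b::banach"
  assumes lin: "bounded_linear K"
    and appr: "\<And>e. e > 0 \<Longrightarrow> \<exists>B. compact_op B \<and> (\<forall>x. norm x \<le> 1 \<longrightarrow> norm (K x - B x) \<le> e)"
  shows "compact_op K"
proof -
  have "\<exists>k. finite k \<and> closure (K ` cball 0 1) \<subseteq> (\<Union>x\<in>k. ball x e)" if "e > 0" for e
  proof -
    have e3: "e/3 > 0" using that by simp
    obtain B where B: "compact_op B" "\<And>x. norm x \<le> 1 \<Longrightarrow> norm (K x - B x) \<le> e/3"
      using appr[OF e3] by blast
    then have "compact (closure (B ` cball 0 1))" by (simp add: compact_op_def)
    then obtain k where k: "finite k" "closure (B ` cball 0 1) \<subseteq> (\<Union>x\<in>k. ball x (e/3))"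
      using compact_eq_totally_bounded[of "closure (B ` cball 0 1)"] e3 by meson
    have "K ` cball 0 1 \<subseteq> (\<Union>z\<in>k. cball z (2*e/3))"
    proof clarify
      fix x :: 'a assume "x \<in> cball 0 1"
      then have "B x \<in> closure (B ` cball 0 1)" "norm (K x - B x) \<le> e/3"
        using closure_subset[of "B ` cball 0 1"] B(2)[of x] by auto
      then obtain z where "z \<in> k" "dist z (B x) < e/3" using k by force
      moreover have "dist z (K x) \<le> dist z (B x) + norm (K x - B x)"
        by (metis dist_commute dist_norm dist_triangle)
      ultimately show "K x \<in> (\<Union>z\<in>k. cball z (2*e/3))"
        using \<open>norm (K x - B x) \<le> e/3\<close> by (intro UN_I[of z]) auto
    qed
    then have "closure (K ` cball 0 1) \<subseteq> (\<Union>z\<in>k. cball z (2*e/3))"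
      using k by (intro closure_minimal closed_UN) auto
    also have "\<dots> \<subseteq> (\<Union>z\<in>k. ball z e)" using that by (intro UN_mono) auto
    finally show ?thesis using k by blast
  qed
  then have "compact (closure (K ` cball 0 1))"
    unfolding compact_eq_totally_bounded by (simp add: complete_eq_closed)
  with lin show ?thesis by (simp add: compact_op_def)
qed

lemma compact_op_subsequence:
  assumes "compact_op K" "\<And>n::nat. norm (x n) \<le> 1"
  obtains l r where "strict_mono r" "(\<lambda>n. K (x (r n))) \<longlonglongrightarrow> l"
proof -
  have "seq_compact (closure (K ` cball 0 1))"
    using assms by (simp add: compact_op_def compact_eq_seq_compact_metric)
  moreover have "\<forall>n. K (x n) \<in> closure (K ` cball 0 1)"
    using assms(2) closure_subset by (metis image_eqI mem_cball_0 subsetD)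
  ultimately obtain l r where "strict_mono r" "((\<lambda>n. K (x n)) \<circ> r) \<longlonglongrightarrow> l"
    by (rule seq_compactE)
  with that show thesis by (simp add: o_def)
qed

text \<open>The contradiction shared by the two chain arguments below: vectors from Riesz's lemma
  are arranged so that their images under \<open>K\<close> stay a fixed distance apart.\<close>

lemma compact_op_not_separated:
  assumes K: "compact_op K" and x: "\<And>n::nat. norm (x n) \<le> 1" and e: "e > 0"
    and sep: "\<And>m n. m < n \<Longrightarrow> norm (K (x m) - K (x n)) \<ge> e"
  shows False
proof -
  obtain l r where r: "strict_mono r" "(\<lambda>n. K (x (r n))) \<longlonglongrightarrow> l"
    by (rule compact_op_subsequence[OF K, of x]) (use x in auto)
  then have "Cauchy (\<lambda>n. K (x (r n)))" by (simp add: LIMSEQ_imp_Cauchy)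
  then obtain N where "\<forall>m\<ge>N. \<forall>n\<ge>N. dist (K (x (r m))) (K (x (r n))) < e"
    using metric_CauchyD e by blast
  then have "norm (K (x (r N)) - K (x (r (Suc N)))) < e"
    by (simp add: dist_norm)
  moreover have "r N < r (Suc N)" using r by (simp add: strict_mono_def)
  ultimately show False using sep by force
qed

text \<open>Riesz's lemma with constant 1/2: normalise \<open>w - v0\<close>, where
  \<open>v0\<close> in \<open>V\<close> is chosen within twice the distance of \<open>w\<close> from
  \<open>V\<close>.\<close>

lemma riesz_almost_orthogonal:
  fixes V W :: "'a::real_normed_vector set"
  assumes V: "subspace V" "closed V" and W: "subspace W" "V \<subseteq> W" and w: "w \<in> W" "w \<notin> V"
  obtains y where "y \<in> W" "norm y = 1" "\<And>v. v \<in> V \<Longrightarrow> norm (y - v) \<ge> 1/2"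
proof -
  have ne: "V \<noteq> {}" using V subspace_0 by blast
  define d where "d = infdist w V"
  have d: "d > 0" unfolding d_def
    using in_closed_iff_infdist_zero[OF V(2) ne] w infdist_nonneg[of w V] by (simp add: less_le)
  obtain v0 where v0: "v0 \<in> V" "dist w v0 < 2 * d"
  proof (rule ccontr)
    assume "\<not> thesis"
    then have "2 * d \<le> infdist w V" using that
      unfolding infdist_notempty[OF ne] by (intro cINF_greatest[OF ne]) force
    then show False using d unfolding d_def by simp
  qed
  define n where "n = norm (w - v0)"
  have n: "n > 0" "n < 2 * d" using v0 w by (auto simp: n_def dist_norm)
  show thesis
  proof (rule that[of "(1/n) *\<^sub>R (w - v0)"])
    show "(1/n) *\<^sub>R (w - v0) \<in> W" using W w v0 by (intro subspace_scale subspace_diff) auto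
    show "norm ((1/n) *\<^sub>R (w - v0)) = 1" using n by (simp add: n_def)
    fix v assume v: "v \<in> V"
    have "v0 + n *\<^sub>R v \<in> V" using V v v0 by (intro subspace_add subspace_scale)
    then have "d \<le> norm (w - (v0 + n *\<^sub>R v))" unfolding d_def by (metis dist_norm infdist_le)
    also have "w - (v0 + n *\<^sub>R v) = n *\<^sub>R ((1/n) *\<^sub>R (w - v0) - v)" using n by (simp add: algebra_simps)
    finally have "d \<le> n * norm ((1/n) *\<^sub>R (w - v0) - v)" using n by simp
    moreover have "n * (1/2) < d" using n by simp
    ultimately have "n * (1/2) < n * norm ((1/n) *\<^sub>R (w - v0) - v)" by linarith
    then show "1/2 \<le> norm ((1/n) *\<^sub>R (w - v0) - v)" using n by (metis less_imp_le mult_less_cancel_left_pos)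
  qed
qed

text \<open>Adding a vector \<open>a\<close> outside the closed span keeps closedness because the
  coefficient of \<open>a\<close> is controlled by the norm through the distance of \<open>a\<close>
  from the span; coefficients of a convergent sequence then converge.\<close>

lemma closed_span_finite:
  fixes F :: "'a::real_normed_vector set"
  assumes "finite F"
  shows "closed (span F)"
  using assms
proof (induction F)
  case (insert a F)
  let ?V = "span F"
  show ?case
  proof (cases "a \<in> ?V")
    case True
    then show ?thesis using insert by (simp add: span_redundant)
  next
    case False
    define d where "d = infdist a ?V"
    have d: "d > 0" unfolding d_def
      using in_closed_iff_infdist_zero[OF insert.IH, of a] False infdist_nonneg[of a ?V] span_zero
      by (metis empty_iff less_le)
    have key: "\<bar>k\<bar> * d \<le> norm x" if "x - k *\<^sub>R a \<in> ?V" for x k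
    proof (cases "k = 0")
      case False
      have "- (1/k) *\<^sub>R (x - k *\<^sub>R a) \<in> ?V" using that by (rule span_scale)
      then have "d \<le> norm (a - (- (1/k) *\<^sub>R (x - k *\<^sub>R a)))" unfolding d_def by (metis dist_norm infdist_le)
      also have "a - (- (1/k) *\<^sub>R (x - k *\<^sub>R a)) = (1/k) *\<^sub>R x" using False by (simp add: algebra_simps)
      finally show ?thesis using False by (simp add: field_simps)
    qed simp
    show ?thesis unfolding closed_sequential_limits
    proof (intro allI impI, elim conjE)
      fix x l assume "\<forall>n::nat. x n \<in> span (insert a F)" and lim: "x \<longlonglongrightarrow> l"
      then have "\<forall>n. \<exists>k. x n - k *\<^sub>R a \<in> ?V" unfolding span_insert by simp
      then obtain k where k: "\<And>n. x n - k n *\<^sub>R a \<in> ?V" by metis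
      have diff: "\<bar>k m - k n\<bar> * d \<le> norm (x m - x n)" for m n
        using span_diff[OF k[of m] k[of n]] by (intro key) (simp add: algebra_simps)
      have "Cauchy k"
      proof (rule metric_CauchyI)
        fix e :: real assume "e > 0"
        then obtain M where "\<forall>m\<ge>M. \<forall>n\<ge>M. norm (x m - x n) < e * d"
          using metric_CauchyD[OF LIMSEQ_imp_Cauchy[OF lim], of "e * d"] d unfolding dist_norm by auto
        then have "\<bar>k m - k n\<bar> < e" if "m \<ge> M" "n \<ge> M" for m n
          using that diff[of m n] d by (meson mult_less_cancel_right_pos order_le_less_trans)
        then show "\<exists>M. \<forall>m\<ge>M. \<forall>n\<ge>M. dist (k m) (k n) < e" unfolding dist_real_def by blast
      qed
      then obtain c where "k \<longlonglongrightarrow> c" using Cauchy_convergent_iff convergent_def by blast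
      then have "(\<lambda>n. x n - k n *\<^sub>R a) \<longlonglongrightarrow> l - c *\<^sub>R a" by (intro tendsto_intros lim)
      then have "l - c *\<^sub>R a \<in> ?V" by (rule closed_sequentially[OF insert.IH, rotated]) (rule k)
      then show "l \<in> span (insert a F)" unfolding span_insert by blast
    qed
  qed
qed simp

text \<open>Otherwise Riesz's lemma yields infinitely many vectors of \<open>N\<close> in the unit
  ball with mutual distance at least 1/2. As \<open>K\<close> fixes them, their images have no
  convergent subsequence.\<close>

lemma compact_op_fixed_space_finite:
  fixes K :: "'a::real_normed_vector \<Rightarrow> 'a"
  assumes K: "compact_op K" and N: "subspace N" "\<And>x. x \<in> N \<Longrightarrow> K x = x"
  shows "\<exists>F. finite F \<and> N \<subseteq> span F"
proof (rule ccontr)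
  assume neg: "\<not> ?thesis"
  \<comment> \<open>\<open>F\<close> collects all vectors chosen so far and \<open>y\<close> is the
    latest. Distance from \<open>span F\<close> gives distance from every earlier vector at
    once.\<close>
  define P where "P = (\<lambda>n::nat. \<lambda>(F, y::'a). finite F \<and> F \<subseteq> N \<and> y \<in> F \<and> norm y \<le> 1)"
  define Q where "Q = (\<lambda>(n::nat) (F, y::'a) (G, z::'a). F \<subseteq> G \<and> (\<forall>v\<in>span F. norm (z - v) \<ge> 1/2))"
  have "\<exists>h. \<forall>n. P n (h n) \<and> Q n (h n) (h (Suc n))"
  proof (rule dependent_nat_choice)
    show "\<exists>x. P 0 x" unfolding P_def using N(1) by (intro exI[of _ "({0}, 0)"]) (auto simp: subspace_0)
    fix Fy n assume "P n Fy"
    then obtain F y where F: "Fy = (F, y)" "finite F" "F \<subseteq> N" unfolding P_def by auto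
    obtain w where w: "w \<in> N" "w \<notin> span F" using neg F by blast
    obtain z where z: "z \<in> N" "norm z = 1" "\<And>v. v \<in> span F \<Longrightarrow> norm (z - v) \<ge> 1/2"
      using riesz_almost_orthogonal[OF subspace_span closed_span_finite[OF F(2)] N(1) _ w]
        span_minimal[OF F(3) N(1)] by blast
    show "\<exists>y. P (Suc n) y \<and> Q n Fy y"
      unfolding P_def Q_def using F z by (intro exI[of _ "(insert z F, z)"]) auto
  qed
  then obtain h where h: "\<And>n. P n (h n)" "\<And>n. Q n (h n) (h (Suc n))" by blast
  have mono: "fst (h m) \<subseteq> fst (h n)" if "m \<le> n" for m n
    by (rule lift_Suc_mono_le[OF _ that]) (use h(2) in \<open>auto simp: Q_def case_prod_beta\<close>)
  have y: "snd (h n) \<in> fst (h n)" "fst (h n) \<subseteq> N" "norm (snd (h n)) \<le> 1" for n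
    using h(1)[of n] by (auto simp: P_def case_prod_beta)
  have sep: "norm (K (snd (h m)) - K (snd (h n))) \<ge> 1/2" if "m < n" for m n
  proof -
    define k where "k = n - 1"
    have k: "n = Suc k" "m \<le> k" using that by (auto simp: k_def)
    have "snd (h m) \<in> span (fst (h k))" using y(1)[of m] mono[OF k(2)] by (auto intro: span_base)
    then have "norm (snd (h n) - snd (h m)) \<ge> 1/2"
      using h(2)[of k] k by (auto simp: Q_def case_prod_beta)
    moreover have "K (snd (h i)) = snd (h i)" for i using y N(2) by blast
    ultimately show ?thesis by (simp add: norm_minus_commute)
  qed
  show False by (rule compact_op_not_separated[of K "\<lambda>n. snd (h n)" "1/2"]) (use K y sep in auto)
qed

text \<open>With \<open>U\<close> the identity minus \<open>K\<close>, injectivity and compactness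
  bound \<open>U\<close> from below, so all ranges of powers of \<open>U\<close> are closed. If
  \<open>U\<close> were not onto, these ranges would decrease strictly, and Riesz's lemma along the
  chain would contradict compactness.\<close>

lemma compact_op_fredholm:
  fixes K :: "'a::banach \<Rightarrow> 'a"
  assumes K: "compact_op K" and inj: "\<And>x. K x = x \<Longrightarrow> x = 0"
  obtains R where "bounded_linear R" "\<And>x. R (x - K x) = x" "\<And>x. R x - K (R x) = x"
proof -
  have lin: "bounded_linear K" using K by (simp add: compact_op_def)
  define U where "U = (\<lambda>x. x - K x)"
  have linU: "bounded_linear U" unfolding U_def by (intro bounded_linear_sub bounded_linear_ident lin)
  have linearU: "linear U" by (rule bounded_linear.linear[OF linU])
  \<comment> \<open>If unit vectors have \<open>U (x n)\<close> tending to 0, then along a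
    subsequence \<open>x (r n)\<close> and \<open>K (x (r n))\<close> have the same limit, a fixed
    unit vector of \<open>K\<close>.\<close>
  have "\<exists>c>0. \<forall>x. c * norm x \<le> norm (U x)"
  proof (rule ccontr)
    assume neg: "\<not> ?thesis"
    have "\<exists>x. norm x = 1 \<and> norm (U x) < inverse (Suc n)" for n
    proof -
      obtain x where x: "inverse (Suc n) * norm x > norm (U x)" using neg by (metis inverse_positive_iff_positive not_le of_nat_0_less_iff zero_less_Suc)
      then have nz: "norm x > 0" by (metis U_def K inj lin linear_simps(3) diff_zero mult_zero_right norm_ge_zero norm_zero not_less zero_less_norm_iff)
      have "norm (U ((1/norm x) *\<^sub>R x)) = norm (U x) / norm x" by (simp add: linear_scale[OF linearU])
      also have "\<dots> < inverse (Suc n)" using x nz by (simp add: field_simps)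
      finally show ?thesis using nz by (intro exI[of _ "(1/norm x) *\<^sub>R x"]) auto
    qed
    then obtain x where x: "\<And>n. norm (x n) = 1" "\<And>n. norm (U (x n)) < inverse (Suc n)" by metis
    have U0: "(\<lambda>n. U (x n)) \<longlonglongrightarrow> 0"
      by (rule Lim_null_comparison[OF _ LIMSEQ_inverse_real_of_nat]) (intro always_eventually allI less_imp_le x(2))
    obtain l r where r: "strict_mono r" "(\<lambda>n. K (x (r n))) \<longlonglongrightarrow> l"
      by (rule compact_op_subsequence[OF K, of x]) (use x in auto)
    have "(\<lambda>n. U (x (r n)) + K (x (r n))) \<longlonglongrightarrow> 0 + l"
      using LIMSEQ_subseq_LIMSEQ[OF U0 r(1)] r(2) by (intro tendsto_add) (auto simp: o_def)
    then have xl: "(\<lambda>n. x (r n)) \<longlonglongrightarrow> l" by (simp add: U_def)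
    then have "(\<lambda>n. K (x (r n))) \<longlonglongrightarrow> K l" by (rule bounded_linear.tendsto[OF lin])
    then have "K l = l" using r(2) LIMSEQ_unique by blast
    then have "l = 0" by (rule inj)
    moreover have "norm l = 1" using tendsto_norm[OF xl] x(1) by (simp add: LIMSEQ_const_iff)
    ultimately show False by simp
  qed
  then obtain c where c: "c > 0" "\<And>x. c * norm x \<le> norm (U x)" by blast
  define V where "V = (\<lambda>n. range (U ^^ n))"
  have linp: "bounded_linear (U ^^ n)" for n
  proof (induction n)
    case (Suc n)
    show ?case using bounded_linear_compose[OF linU Suc] by (simp add: o_def)
  qed (simp add: id_def bounded_linear_ident)
  have sub: "subspace (V n)" for n
    unfolding V_def by (intro linear_subspace_image bounded_linear.linear[OF linp] subspace_UNIV)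
  have lower: "c ^ n * norm x \<le> norm ((U ^^ n) x)" for n x
  proof (induction n)
    case (Suc n)
    have "c ^ Suc n * norm x \<le> c * norm ((U ^^ n) x)" using Suc c(1) by (simp add: mult.assoc)
    also have "\<dots> \<le> norm ((U ^^ Suc n) x)" using c(2) by simp
    finally show ?case .
  qed simp
  have clos: "closed (V n)" for n
  proof -
    have "complete (V n)"
      unfolding V_def
    proof (rule complete_isometric_image[of "c ^ n"])
      show "\<forall>x\<in>UNIV. c ^ n * norm x \<le> norm ((U ^^ n) x)" using lower by blast
    qed (use c linp complete_UNIV in auto)
    then show ?thesis by (rule complete_imp_closed)
  qed
  have step: "U x \<in> V (Suc n)" if "x \<in> V n" for x n using that by (auto simp: V_def)
  have dec: "V (Suc n) \<subseteq> V n" for n by (auto simp: V_def funpow_swap1)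
  have mono: "V n \<subseteq> V m" if "m \<le> n" for m n using lift_Suc_antimono_le[of V m n] dec that by blast
  have injU: "inj (U ^^ n)" for n
  proof (rule injI)
    fix x y assume "(U ^^ n) x = (U ^^ n) y"
    then have "(U ^^ n) (x - y) = 0" by (simp add: linear_diff[OF bounded_linear.linear[OF linp]])
    then show "x = y" using lower[of n "x - y"] zero_less_power[OF c(1), of n] by (simp add: mult_le_0_iff)
  qed
  have "surj U"
  proof (rule ccontr)
    assume "\<not> surj U"
    then obtain z where z: "z \<notin> range U" by blast
    have "(U ^^ n) z \<notin> V (Suc n)" for n
    proof
      assume "(U ^^ n) z \<in> V (Suc n)"
      then obtain x where "(U ^^ n) z = (U ^^ n) (U x)" by (auto simp: V_def funpow_swap1)
      then show False using injU[of n] z by (metis injD rangeI)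
    qed
    then have "\<exists>y. y \<in> V n \<and> norm y = 1 \<and> (\<forall>v\<in>V (Suc n). norm (y - v) \<ge> 1/2)" for n
      using riesz_almost_orthogonal[OF sub[of "Suc n"] clos[of "Suc n"] sub[of n] dec[of n], of "(U ^^ n) z"]
      by (metis V_def rangeI)
    then obtain y where y: "\<And>n. y n \<in> V n" "\<And>n. norm (y n) = 1"
      "\<And>n v. v \<in> V (Suc n) \<Longrightarrow> norm (y n - v) \<ge> 1/2" by metis
    \<comment> \<open>The difference equals \<open>y m\<close> minus an element of
      \<open>V (Suc m)\<close>, from which \<open>y m\<close> was chosen to be far away.\<close>
    have "norm (K (y m) - K (y n)) \<ge> 1/2" if "m < n" for m n
    proof -
      have "y n \<in> V (Suc m)" "U (y n) \<in> V (Suc m)" "U (y m) \<in> V (Suc m)"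
        using y(1) step mono[of "Suc m" n] mono[of "Suc m" "Suc n"] that by (auto simp: Suc_le_eq)
      then have "U (y m) + (y n - U (y n)) \<in> V (Suc m)"
        by (intro subspace_add subspace_diff sub)
      moreover have "K (y m) - K (y n) = y m - (U (y m) + (y n - U (y n)))" by (simp add: U_def)
      ultimately show ?thesis using y(3) by metis
    qed
    then show False using compact_op_not_separated[OF K, of y "1/2"] y(2) by auto
  qed
  moreover have "inj U" using injU[of 1] by simp
  ultimately have inv: "inv U (U x) = x" "U (inv U x) = x" for x
    by (simp_all add: surj_f_inv_f)
  show thesis
  proof (rule that[of "inv U"])
    show "bounded_linear (inv U)"
    proof (rule bounded_linear_intro[where K = "1/c"])
      show "inv U (x + y) = inv U x + inv U y" for x y
        using inv linear_add[OF linearU] by metis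
      show "inv U (r *\<^sub>R x) = r *\<^sub>R inv U x" for r x
        using inv linear_scale[OF linearU] by metis
      show "norm (inv U x) \<le> norm x * (1/c)" for x
        using c(2)[of "inv U x"] c(1) inv(2)[of x] by (simp add: field_simps)
    qed
  qed (use inv in \<open>auto simp: U_def\<close>)
qed

section \<open>Cauchy estimates for analytic semigroups\<close>

definition circ :: "complex \<Rightarrow> real \<Rightarrow> real \<Rightarrow> complex" where
  "circ c r \<phi> = c + of_real r * cis \<phi>"

lemma circ_mem: "0 \<le> r \<Longrightarrow> r \<le> R \<Longrightarrow> circ c r \<phi> \<in> cball c R"
  by (simp add: circ_def dist_norm norm_mult)

lemma continuous_circ: "continuous_on S (\<lambda>(r, \<phi>). circ c r \<phi>)"
  unfolding circ_def case_prod_beta cis_conv_exp by (intro continuous_intros)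

lemma continuous_circ': "continuous_on S (circ c r)"
  unfolding circ_def cis_conv_exp by (intro continuous_intros)

text \<open>Covers a given complex structure, where the multiplication is isometric, and
  \<open>cplx_scale\<close> on pairs, where the product norm only gives the constant 2.
  Vector-valued complex analysis is done once for both.\<close>

locale complex_scaling =
  fixes sc :: "complex \<Rightarrow> 'b::banach \<Rightarrow> 'b"
  assumes vs: "vector_space sc"
    and sc_of_real: "sc (of_real r) x = r *\<^sub>R x"
    and norm_sc: "norm (sc c x) \<le> 2 * (cmod c * norm x)"
begin

lemma sc_add_left: "sc (c + d) x = sc c x + sc d x"
  and sc_add_right: "sc c (x + y) = sc c x + sc c y"
  and sc_sc: "sc c (sc d x) = sc (c * d) x"
  and sc_one [simp]: "sc 1 x = x"
  using vs by (auto simp: vector_space_def)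

lemma bilinear: "bounded_bilinear sc"
proof
  fix r a b
  show "sc (r *\<^sub>R a) b = r *\<^sub>R sc a b"
    by (metis sc_of_real sc_sc scaleR_conv_of_real)
  show "sc a (r *\<^sub>R b) = r *\<^sub>R sc a b"
    by (metis sc_of_real sc_sc mult.commute)
  show "\<exists>K. \<forall>a b. norm (sc a b) \<le> norm a * norm b * K"
    using norm_sc by (intro exI[of _ 2]) (simp add: mult_ac)
qed (auto simp: sc_add_left sc_add_right)

lemma sc_zero_left [simp]: "sc 0 x = 0" and sc_zero_right [simp]: "sc c 0 = 0"
  and sc_minus_left: "sc (- c) x = - sc c x" and sc_minus_right: "sc c (- x) = - sc c x"
  using bounded_bilinear.zero_left[OF bilinear] bounded_bilinear.zero_right[OF bilinear]
    bounded_bilinear.minus_left[OF bilinear] bounded_bilinear.minus_right[OF bilinear] by auto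

lemmas continuous_on_sc [continuous_intros] = bounded_bilinear.continuous_on[OF bilinear]

lemma bounded_linear_sc: "bounded_linear (sc c)"
  by (rule bounded_bilinear.bounded_linear_right[OF bilinear])

lemma path_derivative:
  assumes F: "(F has_derivative (\<lambda>h. sc h g)) (at (z x))"
    and z: "(z has_vector_derivative z') (at x within S)"
  shows "((\<lambda>x. F (z x)) has_vector_derivative sc z' g) (at x within S)"
proof -
  have "((\<lambda>x. F (z x)) has_derivative (\<lambda>h. sc (h *\<^sub>R z') g)) (at x within S)"
    by (rule has_derivative_compose[OF z[unfolded has_vector_derivative_def] F])
  then show ?thesis
    by (simp add: has_vector_derivative_def bounded_bilinear.scaleR_left[OF bilinear])
qed

lemma sc_cancel: "c \<noteq> 0 \<Longrightarrow> sc c x = 0 \<longleftrightarrow> x = 0"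
  using sc_sc[of "inverse c" c x] by auto

context
  fixes F G :: "complex \<Rightarrow> 'b" and c :: complex and R :: real
  assumes R: "R > 0"
    and F: "\<And>z. z \<in> cball c R \<Longrightarrow> (F has_derivative (\<lambda>h. sc h (G z))) (at z)"
    and G: "continuous_on (cball c R) G"
begin

lemma continuous_F: "continuous_on (cball c R) F"
  by (intro continuous_at_imp_continuous_on ballI) (rule has_derivative_continuous[OF F])

lemma F_arg_derivative:
  assumes "0 \<le> r" "r \<le> R"
  shows "((\<lambda>\<phi>. F (circ c r \<phi>)) has_vector_derivative sc (of_real r * (\<i> * cis \<phi>)) (G (circ c r \<phi>))) (at \<phi> within S)"
proof (rule path_derivative[where z="circ c r" and x=\<phi>, OF F[OF circ_mem[OF assms]]])
  show "(circ c r has_vector_derivative of_real r * (\<i> * cis \<phi>)) (at \<phi> within S)"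
    unfolding has_vector_derivative_def circ_def
    by (rule derivative_eq_intros refl | simp add: fun_eq_iff scaleR_conv_of_real)+
qed

lemma F_radius_derivative:
  assumes "0 \<le> r" "r \<le> R"
  shows "((\<lambda>r. F (circ c r \<phi>)) has_vector_derivative sc (cis \<phi>) (G (circ c r \<phi>))) (at r within S)"
proof (rule path_derivative[where z="\<lambda>r. circ c r \<phi>" and x=r, OF F[OF circ_mem[OF assms]]])
  show "((\<lambda>r. circ c r \<phi>) has_vector_derivative cis \<phi>) (at r within S)"
    unfolding has_vector_derivative_def circ_def
    by (rule derivative_eq_intros refl | simp add: fun_eq_iff scaleR_conv_of_real)+
qed

text \<open>The circle integral \<open>J r\<close> has derivative \<open>J' r\<close>, and
  \<open>\<i> * r\<close> times \<open>J' r\<close> is the integral of the angular derivative of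
  \<open>F\<close> over a full period, hence 0. So \<open>J\<close> is constant down to the
  centre.\<close>

lemma mean_value_circle: "integral {0..2*pi} (\<lambda>\<phi>. F (circ c R \<phi>)) = (2 * pi) *\<^sub>R F c"
proof -
  define J where "J = (\<lambda>r. integral (cbox 0 (2*pi)) (\<lambda>\<phi>. F (circ c r \<phi>)))"
  define J' where "J' = (\<lambda>r. integral (cbox 0 (2*pi)) (\<lambda>\<phi>. sc (cis \<phi>) (G (circ c r \<phi>))))"
  have cont: "continuous_on {0..2*pi} (\<lambda>\<phi>. H (circ c r \<phi>))"
    if "continuous_on (cball c R) H" "0 \<le> r" "r \<le> R" for H :: "complex \<Rightarrow> 'b" and r
    by (rule continuous_on_compose2[OF that(1) continuous_circ']) (use circ_mem that in blast)
  have J: "(J has_vector_derivative J' r) (at r within {0..R})" if "r \<in> {0..R}" for r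
    unfolding J_def J'_def
  proof (rule leibniz_rule_vector_derivative)
    show "(\<lambda>\<phi>. F (circ c r \<phi>)) integrable_on cbox 0 (2*pi)" if "r \<in> {0..R}" for r
      using that cont[OF continuous_F] by (auto intro!: integrable_continuous_real)
    have "continuous_on ({0..R} \<times> cbox 0 (2*pi)) (\<lambda>p. G (case p of (r, \<phi>) \<Rightarrow> circ c r \<phi>))"
      by (rule continuous_on_compose2[OF G continuous_circ]) (use circ_mem in auto)
    moreover have "continuous_on ({0..R} \<times> cbox 0 (2*pi)) (\<lambda>p. cis (snd p))"
      unfolding cis_conv_exp by (intro continuous_intros)
    ultimately show "continuous_on ({0..R} \<times> cbox 0 (2*pi)) (\<lambda>(r, \<phi>). sc (cis \<phi>) (G (circ c r \<phi>)))"
      unfolding case_prod_beta by (intro continuous_intros)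
  qed (use that F_radius_derivative in auto)
  \<comment> \<open>Positive radius is essential here for cancelling
    \<open>of_real r * \<i>\<close>; the fundamental theorem below asks for the derivative only
    inside the interval.\<close>
  have J0: "J' r = 0" if r: "0 < r" "r \<le> R" for r
  proof -
    have "((\<lambda>\<phi>. sc (of_real r * (\<i> * cis \<phi>)) (G (circ c r \<phi>))) has_integral
        F (circ c r (2*pi)) - F (circ c r 0)) {0..2*pi}"
      using r by (intro fundamental_theorem_of_calculus F_arg_derivative) auto
    then have "integral {0..2*pi} (\<lambda>\<phi>. sc (of_real r * \<i>) (sc (cis \<phi>) (G (circ c r \<phi>)))) = 0"
      by (simp add: circ_def sc_sc mult.assoc integral_unique)
    moreover have "(\<lambda>\<phi>. sc (cis \<phi>) (G (circ c r \<phi>))) integrable_on {0..2*pi}"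
      unfolding cis_conv_exp using r
      by (intro integrable_continuous_real continuous_intros cont G) auto
    ultimately have "sc (of_real r * \<i>) (J' r) = 0"
      using integral_linear[OF _ bounded_linear_sc, of "\<lambda>\<phi>. sc (cis \<phi>) (G (circ c r \<phi>))" "{0..2*pi}" "of_real r * \<i>"]
      by (simp add: J'_def o_def)
    then show ?thesis using r by (simp add: sc_cancel)
  qed
  have "((\<lambda>r. 0) has_integral J R - J 0) {0..R}"
  proof (rule fundamental_theorem_of_calculus_interior)
    show "continuous_on {0..R} J"
      using J has_vector_derivative_continuous continuous_on_eq_continuous_within by blast
    fix r assume "r \<in> {0<..<R}"
    then show "(J has_vector_derivative 0) (at r)"
      using J[of r] J0[of r] by (simp add: has_vector_derivative_within_open[of r "{0<..<R}" J, symmetric] has_vector_derivative_within_subset[of J 0 r "{0..R}"] greaterThanLessThan_subseteq_atLeastAtMost_iff)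
  qed (use R in auto)
  then have "J R = J 0" using has_integral_0_eq by fastforce
  then show ?thesis by (simp add: J_def circ_def scaleR_conv_of_real)
qed

end

text \<open>The mean value property of \<open>G\<close> combined with integration by parts in the
  angle expresses \<open>G c\<close> as the first Fourier coefficient of \<open>F\<close> on the
  circle divided by \<open>R\<close>. The second derivative \<open>H\<close> supplies the mean value
  property of \<open>G\<close>; the factor 2 comes from \<open>norm_sc\<close>.\<close>

lemma cauchy_estimate:
  assumes R: "R > 0"
    and F: "\<And>z. z \<in> cball c R \<Longrightarrow> (F has_derivative (\<lambda>h. sc h (G z))) (at z)"
    and G: "\<And>z. z \<in> cball c R \<Longrightarrow> (G has_derivative (\<lambda>h. sc h (H z))) (at z)"
    and H: "continuous_on (cball c R) H"
    and M: "\<And>z. z \<in> cball c R \<Longrightarrow> norm (F z) \<le> M"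
  shows "norm (G c) \<le> 2 * M / R"
proof -
  have contG: "continuous_on (cball c R) G"
    by (intro continuous_at_imp_continuous_on ballI) (rule has_derivative_continuous[OF G])
  have contF: "continuous_on (cball c R) F"
    by (intro continuous_at_imp_continuous_on ballI) (rule has_derivative_continuous[OF F])
  define w where "w = circ c R"
  have w: "w \<phi> \<in> cball c R" for \<phi> unfolding w_def by (rule circ_mem) (use R in auto)
  have wc: "continuous_on S w" for S unfolding w_def by (rule continuous_circ')
  have mean: "integral {0..2*pi} (\<lambda>\<phi>. G (w \<phi>)) = (2 * pi) *\<^sub>R G c"
    unfolding w_def by (rule mean_value_circle[OF R G H])
  have cont: "continuous_on {0..2*pi} (\<lambda>\<phi>. U (w \<phi>))"
    if "continuous_on (cball c R) U" for U :: "complex \<Rightarrow> 'b"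
    by (rule continuous_on_compose2[OF that wc]) (use w in blast)
  define I where "I = integral {0..2*pi} (\<lambda>\<phi>. sc (cis (-\<phi>)) (F (w \<phi>)))"
  have cont2: "continuous_on {0..2*pi} (\<lambda>\<phi>. sc (cis (-\<phi>)) (F (w \<phi>)))"
    unfolding cis_conv_exp by (intro continuous_intros cont contF)
  have I: "((\<lambda>\<phi>. sc (cis (-\<phi>)) (F (w \<phi>))) has_integral I) {0..2*pi}"
    unfolding I_def by (intro integrable_integral integrable_continuous_real cont2)
  \<comment> \<open>Product rule for \<open>cis (-\<phi>)\<close> times \<open>F\<close> on the
    circle. The boundary terms cancel by periodicity, and in the first summand the two exponentials
    cancel, leaving \<open>G\<close> itself.\<close>
  have ftc: "((\<lambda>\<phi>. sc (cis (-\<phi>)) (sc (of_real R * (\<i> * cis \<phi>)) (G (w \<phi>))) + sc (- \<i> * cis (-\<phi>)) (F (w \<phi>)))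
     has_integral sc (cis (-(2*pi))) (F (w (2*pi))) - sc (cis (-0)) (F (w 0))) {0..2*pi}"
  proof (rule fundamental_theorem_of_calculus)
    fix \<phi> :: real
    have 1: "((\<lambda>\<phi>. F (w \<phi>)) has_vector_derivative sc (of_real R * (\<i> * cis \<phi>)) (G (w \<phi>))) (at \<phi> within {0..2*pi})"
      unfolding w_def by (rule F_arg_derivative[OF R F contG]) (use R in auto)
    have 2: "((\<lambda>\<phi>. cis (-\<phi>)) has_vector_derivative - \<i> * cis (-\<phi>)) (at \<phi> within {0..2*pi})"
      unfolding has_vector_derivative_def
      by (rule derivative_eq_intros refl | simp add: fun_eq_iff scaleR_conv_of_real)+
    show "((\<lambda>\<phi>. sc (cis (-\<phi>)) (F (w \<phi>))) has_vector_derivative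
       sc (cis (-\<phi>)) (sc (of_real R * (\<i> * cis \<phi>)) (G (w \<phi>))) + sc (- \<i> * cis (-\<phi>)) (F (w \<phi>))) (at \<phi> within {0..2*pi})"
      by (rule bounded_bilinear.has_vector_derivative[OF bilinear 2 1])
  qed simp
  have "cis (-(2*pi)) = 1" by (simp add: complex_eq_iff)
  note ftc
  also have "sc (cis (-(2*pi))) (F (w (2*pi))) - sc (cis (-0)) (F (w 0)) = 0"
    using \<open>cis (-(2*pi)) = 1\<close> by (simp add: w_def circ_def)
  also have "(\<lambda>\<phi>. sc (cis (-\<phi>)) (sc (of_real R * (\<i> * cis \<phi>)) (G (w \<phi>))) + sc (- \<i> * cis (-\<phi>)) (F (w \<phi>)))
     = (\<lambda>\<phi>. sc (of_real R * \<i>) (G (w \<phi>)) + sc (-\<i>) (sc (cis (-\<phi>)) (F (w \<phi>))))"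
  proof
    fix \<phi> :: real
    have "cis (-\<phi>) * (of_real R * (\<i> * cis \<phi>)) = (cis \<phi> * cis (-\<phi>)) * (of_real R * \<i>)" by (simp only: mult_ac)
    then have "cis (-\<phi>) * (of_real R * (\<i> * cis \<phi>)) = of_real R * \<i>" by (simp add: cis_mult)
    then show "sc (cis (-\<phi>)) (sc (of_real R * (\<i> * cis \<phi>)) (G (w \<phi>))) + sc (- \<i> * cis (-\<phi>)) (F (w \<phi>)) =
        sc (of_real R * \<i>) (G (w \<phi>)) + sc (-\<i>) (sc (cis (-\<phi>)) (F (w \<phi>)))"
      by (simp only: sc_sc)
  qed
  finally have z: "((\<lambda>\<phi>. sc (of_real R * \<i>) (G (w \<phi>)) + sc (-\<i>) (sc (cis (-\<phi>)) (F (w \<phi>)))) has_integral 0) {0..2*pi}" .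
  have gi: "((\<lambda>\<phi>. G (w \<phi>)) has_integral (2 * pi) *\<^sub>R G c) {0..2*pi}"
    using mean by (metis cont contG integrable_continuous_real integrable_integral)
  have "((\<lambda>\<phi>. sc (of_real R * \<i>) (G (w \<phi>)) + sc (-\<i>) (sc (cis (-\<phi>)) (F (w \<phi>)))) has_integral
      sc (of_real R * \<i>) ((2 * pi) *\<^sub>R G c) + sc (-\<i>) I) {0..2*pi}"
    using has_integral_add[OF has_integral_linear[OF gi bounded_linear_sc] has_integral_linear[OF I bounded_linear_sc]]
    by (simp add: o_def)
  then have "sc (of_real R * \<i>) ((2 * pi) *\<^sub>R G c) + sc (-\<i>) I = 0" using z has_integral_unique by blast
  then have "sc \<i> (sc (of_real R * \<i>) ((2 * pi) *\<^sub>R G c) + sc (-\<i>) I) = 0" by simp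
  then have "sc (- of_real R) ((2 * pi) *\<^sub>R G c) + I = 0"
    by (simp add: sc_add_right sc_sc mult_ac)
  then have "I = (R * (2 * pi)) *\<^sub>R G c"
    by (simp add: sc_minus_left sc_of_real mult_ac add_eq_0_iff)
  then have "R * (2 * pi) * norm (G c) = norm I" using R by simp
  also have "\<dots> \<le> (2 * M) * (2 * pi)"
  proof -
    have "norm (sc (cis (-\<phi>)) (F (w \<phi>))) \<le> 2 * M" for \<phi>
      using norm_sc[of "cis (-\<phi>)" "F (w \<phi>)"] M[OF w[of \<phi>]] by simp
    then have "norm I \<le> (2 * M) * (2 * pi - 0)"
      unfolding I_def by (intro integral_bound cont2) auto
    then show ?thesis by simp
  qed
  finally show ?thesis using R by (simp add: field_simps)
qed

text \<open>Continuity of the argument at 1, spread to all \<open>t\<close> by homogeneity. Radii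
  proportional to \<open>t\<close> are what makes the Cauchy estimate produce the factor
  \<open>1 / t\<close>.\<close>

lemma sector_near_reals:
  assumes "\<delta> > 0"
  obtains \<kappa> where "0 < \<kappa>" "\<kappa> \<le> 1/2"
    "\<And>t z. 0 < t \<Longrightarrow> cmod (z - of_real t) \<le> \<kappa> * t \<Longrightarrow> z \<in> sector \<delta>"
proof -
  have "(1::complex) \<notin> \<real>\<^sub>\<le>\<^sub>0" by simp
  then have "isCont Arg 1" by (rule continuous_at_Arg)
  then obtain d where d: "d > 0" "\<And>w. cmod (w - 1) < d \<Longrightarrow> \<bar>Arg w\<bar> < \<delta>"
    using assms unfolding continuous_at_eps_delta dist_norm by force
  define \<kappa> where "\<kappa> = min (d/2) (1/2)"
  show thesis
  proof (rule that[of \<kappa>])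
    fix t :: real and z assume t: "0 < t" and z: "cmod (z - of_real t) \<le> \<kappa> * t"
    define w where "w = z / of_real t"
    have zw: "z = of_real t * w" using t by (simp add: w_def)
    have "z - of_real t = of_real t * (w - 1)" by (simp add: zw algebra_simps)
    then have "t * cmod (w - 1) \<le> t * \<kappa>" using z t by (simp add: norm_mult mult.commute)
    then have w: "cmod (w - 1) \<le> \<kappa>" using t by simp
    then have "w \<noteq> 0" by (auto simp: \<kappa>_def)
    moreover have "\<bar>Arg w\<bar> < \<delta>" using d w by (simp add: \<kappa>_def)
    ultimately show "z \<in> sector \<delta>" using t by (simp add: sector_def zw)
  qed (use d in \<open>auto simp: \<kappa>_def\<close>)
qed

text \<open>On the disks of radius \<open>\<kappa> * t\<close> with \<open>t \<le> T\<close> the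
  extension is bounded pointwise: by strong continuity near 0 and by compactness away from 0.
  Uniform boundedness gives one constant, and the Cauchy estimate on a disk of radius
  \<open>\<kappa> * t / 2\<close> gives the derivative bound.\<close>

lemma analytic_derivative_bound:
  assumes ext: "extends_analytically sc S" and T: "T > 0"
  obtains C where "C > 0" "\<And>t x. 0 < t \<Longrightarrow> t \<le> T \<Longrightarrow> norm (S t x) \<le> C * norm x"
    "\<And>t x. 0 < t \<Longrightarrow> t \<le> T \<Longrightarrow> \<exists>y. ((\<lambda>s. S s x) has_vector_derivative y) (at t) \<and> norm y \<le> C / t * norm x"
    "\<And>t c x. 0 < t \<Longrightarrow> S t (sc c x) = sc c (S t x)"
proof -
  obtain \<delta> Z where \<delta>: "0 < \<delta>" "\<delta> \<le> pi / 2" and ZS: "\<And>t. 0 < t \<Longrightarrow> Z (of_real t) = S t"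
    and lin: "\<And>z. z \<in> sector \<delta> \<Longrightarrow> bounded_linear (Z z)"
    and Zsc: "\<And>z c x. z \<in> sector \<delta> \<Longrightarrow> Z z (sc c x) = sc c (Z z x)"
    and add: "\<And>z w. z \<in> sector \<delta> \<Longrightarrow> w \<in> sector \<delta> \<Longrightarrow> Z (z + w) = Z z \<circ> Z w"
    and diff: "\<And>z x. z \<in> sector \<delta> \<Longrightarrow> \<exists>y. ((\<lambda>\<zeta>. Z \<zeta> x) has_derivative (\<lambda>h. sc h y)) (at z)"
    and zero: "\<And>x. ((\<lambda>z. Z z x) \<longlongrightarrow> x) (at 0 within sector \<delta>)"
  proof -
    obtain \<delta> Z where "0 < \<delta> \<and> \<delta> \<le> pi / 2 \<and> (\<forall>t>0. Z (of_real t) = S t)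
      \<and> (\<forall>z\<in>sector \<delta>. bounded_linear (Z z) \<and> (\<forall>c x. Z z (sc c x) = sc c (Z z x)))
      \<and> (\<forall>z\<in>sector \<delta>. \<forall>w\<in>sector \<delta>. Z (z + w) = Z z \<circ> Z w)
      \<and> (\<forall>z\<in>sector \<delta>. \<forall>x. \<exists>y. ((\<lambda>\<zeta>. Z \<zeta> x) has_derivative (\<lambda>h. sc h y)) (at z))
      \<and> (\<forall>x. ((\<lambda>z. Z z x) \<longlongrightarrow> x) (at 0 within sector \<delta>))"
      using ext unfolding extends_analytically_def by (elim exE)
    then show thesis by (intro that[of \<delta> Z]) simp_all
  qed
  obtain \<kappa> where \<kappa>: "0 < \<kappa>" "\<kappa> \<le> 1/2"
    and sec: "\<And>t z. 0 < t \<Longrightarrow> cmod (z - of_real t) \<le> \<kappa> * t \<Longrightarrow> z \<in> sector \<delta>"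
    using sector_near_reals[OF \<delta>(1)] by auto
  have pos: "of_real t \<in> sector \<delta>" if "t > 0" for t using sec[OF that, of "of_real t"] \<kappa> that by simp
  have contZ: "continuous_on U (\<lambda>z. Z z x)" if "U \<subseteq> sector \<delta>" for U x
  proof (intro continuous_at_imp_continuous_on ballI)
    fix z assume "z \<in> U"
    then obtain y where "((\<lambda>\<zeta>. Z \<zeta> x) has_derivative (\<lambda>h. sc h y)) (at z)" using diff \<open>U \<subseteq> sector \<delta>\<close> by blast
    then show "isCont (\<lambda>z. Z z x) z" by (rule has_derivative_continuous)
  qed
  define Q where "Q = {z. \<exists>t. 0 < t \<and> t \<le> T \<and> cmod (z - of_real t) \<le> \<kappa> * t}"
  have Qsec: "Q \<subseteq> sector \<delta>" unfolding Q_def using sec by blast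
  have bd: "\<exists>B. \<forall>z\<in>Q. norm (Z z x) \<le> B" for x
  proof -
    obtain d where d: "d > 0" "\<And>z. z \<in> sector \<delta> \<Longrightarrow> z \<noteq> 0 \<Longrightarrow> cmod z < d \<Longrightarrow> norm (Z z x - x) < 1"
      using tendstoD[OF zero[of x], of 1] unfolding eventually_at dist_norm by auto
    \<comment> \<open>The disks with centres in \<open>{d/2..T}\<close>, as a continuous image of a
      compact set. Those with smaller centres lie within distance \<open>d\<close> of 0, because
      \<open>\<kappa> \<le> 1/2\<close>.\<close>
    define P where "P = (\<lambda>(t, w). of_real t + of_real (\<kappa> * t) * w) ` ({d/2..T} \<times> cball (0::complex) 1)"
    have comp: "compact P"
      unfolding P_def case_prod_beta
      by (intro compact_continuous_image compact_Times continuous_intros) auto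
    have Psec: "P \<subseteq> sector \<delta>"
    proof
      fix z assume "z \<in> P"
      then obtain t w where tw: "d/2 \<le> t" "cmod w \<le> 1" "z = of_real t + of_real (\<kappa> * t) * w"
        unfolding P_def by auto
      have "cmod (z - of_real t) = \<bar>\<kappa> * t\<bar> * cmod w" by (simp add: tw norm_mult abs_mult)
      also have "\<dots> \<le> \<kappa> * t * 1" using tw d \<kappa> by (intro mult_mono) auto
      finally show "z \<in> sector \<delta>" using sec[of t z] tw d by simp
    qed
    have "bounded ((\<lambda>z. Z z x) ` P)"
      by (intro compact_imp_bounded compact_continuous_image contZ Psec comp)
    then obtain B where B: "\<And>z. z \<in> P \<Longrightarrow> norm (Z z x) \<le> B" unfolding bounded_iff by blast
    have "norm (Z z x) \<le> max B (norm x + 1)" if "z \<in> Q" for z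
    proof -
      obtain t where t: "0 < t" "t \<le> T" "cmod (z - of_real t) \<le> \<kappa> * t" using \<open>z \<in> Q\<close> unfolding Q_def by blast
      show ?thesis
      proof (cases "t < d/2")
        case True
        have "cmod z \<le> cmod (z - of_real t) + t" using t norm_triangle_ineq[of "z - of_real t" "of_real t"] by simp
        also have "\<dots> \<le> 1/2 * t + t" using t \<kappa> by (intro add_mono order_trans[OF t(3)] mult_right_mono) auto
        finally have "cmod z < d" using True t(1) by linarith
        moreover have "z \<in> sector \<delta>" using that Qsec by blast
        moreover then have "z \<noteq> 0" by (simp add: sector_def)
        ultimately have "norm (Z z x - x) < 1" using d by blast
        then show ?thesis using norm_triangle_ineq[of "Z z x - x" x] by simp
      next
        case False
        define w where "w = (z - of_real t) / of_real (\<kappa> * t)"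
        have nz: "\<kappa> * t > 0" using t \<kappa> by simp
        have "cmod w \<le> 1" using t nz by (simp only: w_def norm_divide norm_of_real abs_of_pos[OF nz] divide_le_eq_1_pos)
        moreover have "z = of_real t + of_real (\<kappa> * t) * w"
          using t(1) \<kappa>(1) by (simp add: w_def)
        ultimately have "z \<in> P" unfolding P_def using False t by (intro image_eqI[of _ _ "(t, w)"]) auto
        then show ?thesis using B by fastforce
      qed
    qed
    then show ?thesis by blast
  qed
  obtain M where M: "M > 0" "\<And>z x. z \<in> Q \<Longrightarrow> norm (Z z x) \<le> M * norm x"
    using uniform_boundedness[of Q Z] lin Qsec bd by blast
  define C where "C = max M (4 * M / \<kappa>)"
  \<comment> \<open>The semigroup law carries the derivative at one point \<open>a\<close> to
    \<open>z\<close> by applying \<open>Z (z - a)\<close>. The derivative thus has the form of an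
    orbit again, which supplies the second derivative and its continuity.\<close>
  have shift: "((\<lambda>\<zeta>. Z \<zeta> x) has_derivative (\<lambda>h. sc h (Z (z - a) y))) (at z)"
    if a: "a \<in> sector \<delta>" and za: "z - a \<in> sector \<delta>"
      and nb: "e > 0" "ball a e \<subseteq> sector \<delta>"
      and y: "((\<lambda>\<zeta>. Z \<zeta> x) has_derivative (\<lambda>h. sc h y)) (at a)" for a z e x y
  proof -
    have "((\<lambda>\<zeta>. \<zeta> - (z - a)) has_derivative (\<lambda>h. h)) (at z)"
      by (auto intro!: derivative_eq_intros)
    moreover have "z - (z - a) = a" by simp
    ultimately have "((\<lambda>\<zeta>. Z (\<zeta> - (z - a)) x) has_derivative (\<lambda>h. sc h y)) (at z)"
      using has_derivative_compose[of "\<lambda>\<zeta>. \<zeta> - (z - a)" "\<lambda>h. h" z UNIV "\<lambda>\<zeta>. Z \<zeta> x" "\<lambda>h. sc h y"] y by simp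
    then have "((\<lambda>\<zeta>. Z (z - a) (Z (\<zeta> - (z - a)) x)) has_derivative (\<lambda>h. Z (z - a) (sc h y))) (at z)"
      by (rule bounded_linear.has_derivative[OF lin[OF za]])
    then have "((\<lambda>\<zeta>. Z (z - a) (Z (\<zeta> - (z - a)) x)) has_derivative (\<lambda>h. sc h (Z (z - a) y))) (at z)"
      by (simp add: Zsc[OF za])
    then show ?thesis
    proof (rule has_derivative_transform_within_open[where s="ball z e"])
      fix \<zeta> assume "\<zeta> \<in> ball z e"
      then have "\<zeta> - (z - a) \<in> ball a e" by (simp add: dist_norm algebra_simps)
      then have "\<zeta> - (z - a) \<in> sector \<delta>" using nb by blast
      from add[OF za this] show "Z (z - a) (Z (\<zeta> - (z - a)) x) = Z \<zeta> x" by simp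
    qed (use nb in auto)
  qed
  show thesis
  proof (rule that[of C])
    show "C > 0" using M by (simp add: C_def)
    fix t x assume t: "0 < t" "t \<le> T"
    have "of_real t \<in> Q" unfolding Q_def using t \<kappa> by (intro CollectI exI[of _ t]) auto
    then have "norm (S t x) \<le> M * norm x" using M(2)[of "of_real t" x] ZS[OF t(1)] by simp
    also have "\<dots> \<le> C * norm x" by (intro mult_right_mono) (auto simp: C_def)
    finally show "norm (S t x) \<le> C * norm x" .
  next
    fix t c x assume "0 < (t::real)"
    then show "S t (sc c x) = sc c (S t x)" using Zsc[OF pos] ZS by metis
  next
    fix t x assume t: "0 < t" "t \<le> T"
    \<comment> \<open>Two shifts by \<open>a\<close> are used, one per derivative. Since
      \<open>R + 2 * a = \<kappa> * t\<close>, the twice shifted disk of radius \<open>R\<close>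
      still lies in the sector.\<close>
    define R where "R = \<kappa> * t / 2"
    define a where "a = \<kappa> * t / 4"
    have R: "R > 0" and a: "a > 0" using t \<kappa> by (simp_all add: R_def a_def)
    have near: "z \<in> Q" "z - of_real a \<in> sector \<delta>" "z - of_real a - of_real a \<in> sector \<delta>"
      if "z \<in> cball (of_real t) R" for z
    proof -
      have z: "cmod (z - of_real t) \<le> R" using that by (simp add: dist_norm norm_minus_commute)
      then show "z \<in> Q" unfolding Q_def using t R by (intro CollectI exI[of _ t]) (auto simp: R_def)
      have 1: "cmod (z - of_real a - of_real t) \<le> R + a"
        using norm_triangle_ineq4[of "z - of_real t" "of_real a"] z a by (simp add: algebra_simps)
      have 2: "cmod (z - of_real a - of_real a - of_real t) \<le> R + a + a"
        using norm_triangle_ineq4[of "z - of_real a - of_real t" "of_real a"] 1 a by (simp add: algebra_simps)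
      show "z - of_real a \<in> sector \<delta>" "z - of_real a - of_real a \<in> sector \<delta>"
        by (rule sec[OF t(1)], use 1 2 a in \<open>simp add: R_def a_def\<close>)+
    qed
    have nb: "ball (of_real a) (\<kappa> * a) \<subseteq> sector \<delta>" "\<kappa> * a > 0"
      using sec[OF a] \<kappa> a by (auto simp: dist_norm norm_minus_commute)
    obtain y where y: "((\<lambda>\<zeta>. Z \<zeta> x) has_derivative (\<lambda>h. sc h y)) (at (of_real a))" using diff[OF pos[OF a]] by blast
    obtain y2 where y2: "((\<lambda>\<zeta>. Z \<zeta> y) has_derivative (\<lambda>h. sc h y2)) (at (of_real a))" using diff[OF pos[OF a]] by blast
    define G where "G = (\<lambda>z. Z (z - of_real a) y)"
    define H where "H = (\<lambda>z. Z (z - of_real a - of_real a) y2)"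
    have F': "((\<lambda>\<zeta>. Z \<zeta> x) has_derivative (\<lambda>h. sc h (G z))) (at z)" if "z \<in> cball (of_real t) R" for z
      unfolding G_def using near[OF that] by (intro shift[OF pos[OF a] _ nb(2) nb(1) y])
    have G': "(G has_derivative (\<lambda>h. sc h (H z))) (at z)" if "z \<in> cball (of_real t) R" for z
    proof -
      have "((\<lambda>\<zeta>. Z \<zeta> y) has_derivative (\<lambda>h. sc h (H z))) (at (z - of_real a))"
        unfolding H_def using near[OF that] by (intro shift[OF pos[OF a] _ nb(2) nb(1) y2])
      moreover have "((\<lambda>\<zeta>. \<zeta> - of_real a) has_derivative (\<lambda>h. h)) (at z)"
        by (auto intro!: derivative_eq_intros)
      ultimately show ?thesis unfolding G_def
        using has_derivative_compose[of "\<lambda>\<zeta>. \<zeta> - of_real a" "\<lambda>h. h" z UNIV "\<lambda>\<zeta>. Z \<zeta> y" "\<lambda>h. sc h (H z)"] by simp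
    qed
    have H: "continuous_on (cball (of_real t) R) H"
      unfolding H_def
      by (rule continuous_on_compose2[OF contZ[OF order_refl]]) (use near in \<open>auto intro!: continuous_intros\<close>)
    have "norm (G (of_real t)) \<le> 2 * (M * norm x) / R"
      by (rule cauchy_estimate[OF R F' G' H]) (use M near in auto)
    also have "2 * (M * norm x) / R = 4 * M / \<kappa> / t * norm x" using t \<kappa> by (simp add: R_def field_simps)
    also have "\<dots> \<le> C / t * norm x" using t by (intro mult_right_mono divide_right_mono) (auto simp: C_def)
    finally have le: "norm (G (of_real t)) \<le> C / t * norm x" .
    have "((\<lambda>s. Z (of_real s) x) has_vector_derivative sc 1 (G (of_real t))) (at t)"
      by (rule path_derivative[where z=of_real, OF F']) (use R in \<open>auto intro!: derivative_eq_intros\<close>)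
    then have "((\<lambda>s. Z (of_real s) x) has_vector_derivative G (of_real t)) (at t)" by simp
    then have "((\<lambda>s. S s x) has_vector_derivative G (of_real t)) (at t)"
      by (rule has_vector_derivative_transform_within_open[where S="{0<..}"]) (use t ZS in auto)
    with le show "\<exists>y. ((\<lambda>s. S s x) has_vector_derivative y) (at t) \<and> norm y \<le> C / t * norm x" by blast
  qed
qed

end

section \<open>Transfer of the estimates to both scalar fields\<close>

lemma complex_scaling_Complex:
  "scalars_ok (Complex_Scalars sc) \<Longrightarrow> complex_scaling sc"
  by (simp add: complex_scaling_def)

lemma cplx_scale_of_real: "cplx_scale (of_real r) p = r *\<^sub>R p"
  by (simp add: cplx_scale_def prod_eq_iff)

lemma norm_cplx_scale:
  fixes p :: "'a::real_normed_vector \<times> 'a"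
  shows "norm (cplx_scale c p) \<le> 2 * (cmod c * norm p)"
proof -
  obtain x y where p: "p = (x, y)" by (cases p)
  have "norm (cplx_scale c p) \<le> norm (Re c *\<^sub>R x - Im c *\<^sub>R y) + norm (Re c *\<^sub>R y + Im c *\<^sub>R x)"
    unfolding p cplx_scale_def by (simp add: norm_Pair_le)
  also have "\<dots> \<le> (\<bar>Re c\<bar> * norm x + \<bar>Im c\<bar> * norm y) + (\<bar>Re c\<bar> * norm y + \<bar>Im c\<bar> * norm x)"
    by (intro add_mono order_trans[OF norm_triangle_ineq4] order_trans[OF norm_triangle_ineq]) auto
  also have "\<dots> = (\<bar>Re c\<bar> + \<bar>Im c\<bar>) * (norm x + norm y)" by (simp add: algebra_simps)
  also have "\<dots> \<le> (sqrt 2 * cmod c) * (sqrt 2 * norm p)"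
  proof (intro mult_mono complex_abs_le_norm)
    show "norm x + norm y \<le> sqrt 2 * norm p"
      using complex_abs_le_norm[of "Complex (norm x) (norm y)"] by (simp add: p norm_Pair cmod_def)
  qed auto
  also have "\<dots> = 2 * (cmod c * norm p)" by simp
  finally show ?thesis .
qed

lemma complex_scaling_cplx_scale: "complex_scaling (cplx_scale :: complex \<Rightarrow> 'a::banach \<times> 'a \<Rightarrow> _)"
proof
  show "norm (cplx_scale c x) \<le> 2 * (cmod c * norm x)" for c and x :: "'a \<times> 'a"
    by (rule norm_cplx_scale)
qed (auto simp: cplx_scale_of_real, auto simp: cplx_scale_def algebra_simps prod_eq_iff)

lemma analytic_semigroup_c0: "analytic_semigroup K S \<Longrightarrow> c0_semigroup S"
  by (cases K) auto

text \<open>Functors act only on maps that are linear over the chosen field, so the semigroup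
  operators must be shown to be so. The extension speaks about positive times; time 0 is the
  identity.\<close>

lemma analytic_semigroup_smul:
  assumes "scalars_ok K" "analytic_semigroup K S" "t \<ge> 0" "c \<in> field_of K"
  shows "S t (smul K c x) = smul K c (S t x)"
proof (cases K)
  case Real_Scalars
  then have "bounded_linear (S t)" using assms(2,3) by (simp add: c0_semigroup_def)
  then show ?thesis using Real_Scalars by (simp add: linear_scale[OF bounded_linear.linear])
next
  case (Complex_Scalars sc)
  interpret complex_scaling sc using assms(1) Complex_Scalars by (intro complex_scaling_Complex) simp
  show ?thesis
  proof (cases "t = 0")
    case True
    then show ?thesis using assms(2) Complex_Scalars by (simp add: c0_semigroup_def)
  next
    case False
    have "extends_analytically sc S" using assms(2) Complex_Scalars by simp
    then show ?thesis using analytic_derivative_bound[of S t] False assms(3) Complex_Scalars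
      by (metis less_eq_real_def smul.simps(2))
  qed
qed

text \<open>For real scalars the bounds of the complexified semigroup are restricted to pairs
  \<open>(x, 0)\<close>, whose product norm is that of \<open>x\<close>, and read off in the first
  component.\<close>

lemma analytic_semigroup_derivative_bound:
  assumes "scalars_ok K" "analytic_semigroup K S" "T > 0"
  obtains C where "C > 0" "\<And>t x. 0 < t \<Longrightarrow> t \<le> T \<Longrightarrow> norm (S t x) \<le> C * norm x"
    "\<And>t x. 0 < t \<Longrightarrow> t \<le> T \<Longrightarrow> \<exists>y. ((\<lambda>s. S s x) has_vector_derivative y) (at t) \<and> norm y \<le> C / t * norm x"
proof (cases K)
  case (Complex_Scalars sc)
  interpret complex_scaling sc using assms(1) Complex_Scalars by (intro complex_scaling_Complex) simp
  have "extends_analytically sc S" using assms(2) Complex_Scalars by simp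
  then show thesis
  proof (rule analytic_derivative_bound[OF _ assms(3)])
    fix C assume "C > 0" "\<And>t x. 0 < t \<Longrightarrow> t \<le> T \<Longrightarrow> norm (S t x) \<le> C * norm x"
      "\<And>t x. 0 < t \<Longrightarrow> t \<le> T \<Longrightarrow> \<exists>y. ((\<lambda>s. S s x) has_vector_derivative y) (at t) \<and> norm y \<le> C / t * norm x"
    then show thesis by (rule that)
  qed
next
  case Real_Scalars
  interpret complex_scaling "cplx_scale :: complex \<Rightarrow> 'a \<times> 'a \<Rightarrow> _" by (rule complex_scaling_cplx_scale)
  have ext: "extends_analytically cplx_scale (\<lambda>t. map_prod (S t) (S t))" using assms(2) Real_Scalars by simp
  show thesis
  proof (rule analytic_derivative_bound[OF ext assms(3)])
    fix C assume C: "C > 0"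
      "\<And>t p. 0 < t \<Longrightarrow> t \<le> T \<Longrightarrow> norm (map_prod (S t) (S t) p) \<le> C * norm p"
      "\<And>t p. 0 < t \<Longrightarrow> t \<le> T \<Longrightarrow> \<exists>y. ((\<lambda>s. map_prod (S s) (S s) p) has_vector_derivative y) (at t) \<and> norm y \<le> C / t * norm p"
    show thesis
    proof (rule that[OF C(1)])
      fix t x assume t: "0 < t" "t \<le> T"
      have nx: "norm (x::'a, 0::'a) = norm x" by (simp add: norm_Pair)
      show "norm (S t x) \<le> C * norm x"
        using order_trans[OF norm_fst_le C(2)[OF t, of "(x, 0)", unfolded map_prod_simp]] nx by simp
      obtain y where y: "((\<lambda>s. map_prod (S s) (S s) (x, 0)) has_vector_derivative y) (at t)"
        "norm y \<le> C / t * norm (x, 0::'a)" using C(3)[OF t, of "(x, 0)"] by blast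
      have "((\<lambda>s. fst (map_prod (S s) (S s) (x, 0))) has_vector_derivative fst y) (at t)"
        by (rule bounded_linear.has_vector_derivative[OF bounded_linear_fst y(1)])
      moreover have "norm (fst y) \<le> C / t * norm x"
        using order_trans[OF norm_fst_le[of "fst y" "snd y"]] y(2) nx by simp
      ultimately show "\<exists>y. ((\<lambda>s. S s x) has_vector_derivative y) (at t) \<and> norm y \<le> C / t * norm x"
        by (intro exI[of _ "fst y"]) simp
    qed
  qed
qed

section \<open>Smoothing estimates on the domain of the generator\<close>

lemma has_vector_derivative_iff_quotient:
  "(f has_vector_derivative y) (at t within U) \<longleftrightarrow> ((\<lambda>s. (f s - f t) /\<^sub>R (s - t)) \<longlongrightarrow> y) (at t within U)"
proof -
  have "(f has_vector_derivative y) (at t within U) \<longleftrightarrow>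
     ((\<lambda>s. norm (f s - f t - (s - t) *\<^sub>R y) / norm (s - t)) \<longlongrightarrow> 0) (at t within U)"
    unfolding has_vector_derivative_def has_derivative_iff_norm by (simp add: bounded_linear_scaleR_left)
  also have "\<dots> \<longleftrightarrow> ((\<lambda>s. norm ((f s - f t) /\<^sub>R (s - t) - y)) \<longlongrightarrow> 0) (at t within U)"
  proof (rule tendsto_cong)
    have "\<forall>\<^sub>F s in at t within U. s \<noteq> t" by (simp add: eventually_at_filter)
    then show "\<forall>\<^sub>F s in at t within U. norm (f s - f t - (s - t) *\<^sub>R y) / norm (s - t) = norm ((f s - f t) /\<^sub>R (s - t) - y)"
    proof eventually_elim
      case (elim s)
      then have "(f s - f t) /\<^sub>R (s - t) - y = (f s - f t - (s - t) *\<^sub>R y) /\<^sub>R (s - t)"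
        by (simp add: scaleR_diff_right)
      then show ?case by (simp add: divide_inverse mult.commute)
    qed
  qed
  also have "\<dots> \<longleftrightarrow> ((\<lambda>s. (f s - f t) /\<^sub>R (s - t)) \<longlongrightarrow> y) (at t within U)"
    by (simp add: tendsto_norm_zero_iff LIM_zero_iff)
  finally show ?thesis .
qed

text \<open>The working interface: everything later arguments take from the generation hypothesis,
  with one constant \<open>C\<close> in all bounds up to time \<open>T\<close>. The complex
  extension is hidden behind it.\<close>

locale smoothing_semigroup = E1: banach_nspace E1
  for S :: "real \<Rightarrow> 'a::banach \<Rightarrow> 'a" and E1 :: "'a nspace" and A :: "'a \<Rightarrow> 'a" and T C :: real +
  assumes T: "T > 0" and C: "C \<ge> 1"
    and lin: "t \<ge> 0 \<Longrightarrow> bounded_linear (S t)"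
    and S_zero [simp]: "S 0 x = x"
    and S_add: "s \<ge> 0 \<Longrightarrow> t \<ge> 0 \<Longrightarrow> S (s + t) x = S s (S t x)"
    and S_cont: "continuous_on {0..} (\<lambda>t. S t x)"
    and S_bound: "0 \<le> t \<Longrightarrow> t \<le> T \<Longrightarrow> norm (S t x) \<le> C * norm x"
    and S_smooth: "0 < t \<Longrightarrow> S t x \<in> carr E1"
    and S_smooth_bound: "0 < t \<Longrightarrow> t \<le> T \<Longrightarrow> nrm E1 (S t x) \<le> C / t * norm x"
    and S_E1_bound: "0 \<le> t \<Longrightarrow> t \<le> T \<Longrightarrow> x \<in> carr E1 \<Longrightarrow> nrm E1 (S t x) \<le> C * nrm E1 x"
    and E1_emb: "x \<in> carr E1 \<Longrightarrow> norm x \<le> C * nrm E1 x"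
    and A_bound: "x \<in> carr E1 \<Longrightarrow> norm (A x) \<le> C * nrm E1 x"
    and graph_bound: "x \<in> carr E1 \<Longrightarrow> nrm E1 x \<le> C * (norm x + norm (A x))"
    and A_add: "x \<in> carr E1 \<Longrightarrow> y \<in> carr E1 \<Longrightarrow> A (x + y) = A x + A y"
    and A_scale: "x \<in> carr E1 \<Longrightarrow> A (r *\<^sub>R x) = r *\<^sub>R A x"
    and A_commute: "x \<in> carr E1 \<Longrightarrow> t \<ge> 0 \<Longrightarrow> S t x \<in> carr E1 \<and> A (S t x) = S t (A x)"
    and S_deriv: "0 < t \<Longrightarrow> ((\<lambda>s. S s x) has_vector_derivative A (S t x)) (at t)"
    and S_ftc: "x \<in> carr E1 \<Longrightarrow> t \<ge> 0 \<Longrightarrow> ((\<lambda>s. S s (A x)) has_integral (S t x - x)) {0..t}"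
    and A_closed: "(\<And>n. \<xi> n \<in> carr E1) \<Longrightarrow> \<xi> \<longlonglongrightarrow> x \<Longrightarrow> (\<lambda>n. A (\<xi> n)) \<longlonglongrightarrow> y \<Longrightarrow> x \<in> carr E1 \<and> A x = y"

locale parabolic =
  fixes K :: "'a::banach scalars" and E1 :: "'a nspace" and S :: "real \<Rightarrow> 'a \<Rightarrow> 'a" and A :: "'a \<Rightarrow> 'a" and T :: real
  assumes scalars: "scalars_ok K"
    and E1_banach: "banach_over K E1"
    and E1_embedded: "cont_embedded E1 whole"
    and semigroup: "analytic_semigroup K S"
    and gen: "generator S (carr E1) A"
    and T: "T > 0"
begin

sublocale E1: banach_nspace E1
  by standard (rule banach_over_real[OF scalars E1_banach])

text \<open>The horizon \<open>T'\<close> is free so that differentiability of orbits follows at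
  every positive time and not just up to \<open>T\<close>.\<close>

lemma derivative_bound:
  assumes "T' > 0"
  shows "\<exists>C>0. (\<forall>t x. 0 < t \<longrightarrow> t \<le> T' \<longrightarrow> norm (S t x) \<le> C * norm x) \<and> (\<forall>t x. 0 < t \<longrightarrow> t \<le> T' \<longrightarrow>
    (\<exists>y. ((\<lambda>s. S s x) has_vector_derivative y) (at t) \<and> norm y \<le> C / t * norm x))"
proof (rule analytic_semigroup_derivative_bound[OF scalars semigroup assms])
  fix C assume "C > 0" "\<And>t x. 0 < t \<Longrightarrow> t \<le> T' \<Longrightarrow> norm (S t x) \<le> C * norm x"
    "\<And>t x. 0 < t \<Longrightarrow> t \<le> T' \<Longrightarrow> \<exists>y. ((\<lambda>s. S s x) has_vector_derivative y) (at t) \<and> norm y \<le> C / t * norm x"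
  then show ?thesis by (intro exI[of _ C]) simp
qed

lemma c0: "c0_semigroup S"
  by (rule analytic_semigroup_c0[OF semigroup])

lemma lin: "t \<ge> 0 \<Longrightarrow> bounded_linear (S t)"
  using c0 by (simp add: c0_semigroup_def)

lemma S_zero [simp]: "S 0 x = x"
  using c0 by (simp add: c0_semigroup_def)

lemma S_add: "s \<ge> 0 \<Longrightarrow> t \<ge> 0 \<Longrightarrow> S (s + t) x = S s (S t x)"
  using c0 by (simp add: c0_semigroup_def)

lemma S_right_zero: "((\<lambda>t. S t x) \<longlongrightarrow> x) (at_right 0)"
  using c0 by (simp add: c0_semigroup_def)

lemma generatorI:
  assumes "((\<lambda>t. (S t x - x) /\<^sub>R t) \<longlongrightarrow> y) (at_right 0)"
  shows "x \<in> carr E1" "A x = y"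
proof -
  show x: "x \<in> carr E1" using gen assms unfolding generator_def by blast
  then have "((\<lambda>t. (S t x - x) /\<^sub>R t) \<longlongrightarrow> A x) (at_right 0)" using gen unfolding generator_def by blast
  then show "A x = y" using assms tendsto_unique trivial_limit_at_right_real by blast
qed

lemma generatorD: "x \<in> carr E1 \<Longrightarrow> ((\<lambda>t. (S t x - x) /\<^sub>R t) \<longlongrightarrow> A x) (at_right 0)"
  using gen unfolding generator_def by blast

lemma A_add: "x \<in> carr E1 \<Longrightarrow> y \<in> carr E1 \<Longrightarrow> A (x + y) = A x + A y"
proof (rule generatorI(2))
  assume xy: "x \<in> carr E1" "y \<in> carr E1"
  have "\<forall>\<^sub>F t in at_right 0. (S t (x + y) - (x + y)) /\<^sub>R t = (S t x - x) /\<^sub>R t + (S t y - y) /\<^sub>R t"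
    using eventually_at_right_less
  proof eventually_elim
    case (elim t)
    then show ?case using linear_add[OF bounded_linear.linear[OF lin[of t]], of x y]
      by (simp add: algebra_simps)
  qed
  then show "((\<lambda>t. (S t (x + y) - (x + y)) /\<^sub>R t) \<longlongrightarrow> A x + A y) (at_right 0)"
    using tendsto_add[OF generatorD[OF xy(1)] generatorD[OF xy(2)]] by (simp add: tendsto_cong)
qed

lemma A_scale: "x \<in> carr E1 \<Longrightarrow> A (r *\<^sub>R x) = r *\<^sub>R A x"
proof (rule generatorI(2))
  assume x: "x \<in> carr E1"
  have "\<forall>\<^sub>F t in at_right 0. (S t (r *\<^sub>R x) - r *\<^sub>R x) /\<^sub>R t = r *\<^sub>R ((S t x - x) /\<^sub>R t)"
    using eventually_at_right_less
  proof eventually_elim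
    case (elim t)
    then show ?case using linear_scale[OF bounded_linear.linear[OF lin[of t]], of r x]
      by (simp add: algebra_simps)
  qed
  then show "((\<lambda>t. (S t (r *\<^sub>R x) - r *\<^sub>R x) /\<^sub>R t) \<longlongrightarrow> r *\<^sub>R A x) (at_right 0)"
    using tendsto_scaleR[OF tendsto_const generatorD[OF x], of r] by (simp add: tendsto_cong)
qed

lemma A_commute:
  assumes "x \<in> carr E1" "t \<ge> 0"
  shows "S t x \<in> carr E1" "A (S t x) = S t (A x)"
proof -
  have "((\<lambda>h. S t ((S h x - x) /\<^sub>R h)) \<longlongrightarrow> S t (A x)) (at_right 0)"
    by (rule bounded_linear.tendsto[OF lin[OF assms(2)] generatorD[OF assms(1)]])
  moreover have "\<forall>\<^sub>F h in at_right 0. (S h (S t x) - S t x) /\<^sub>R h = S t ((S h x - x) /\<^sub>R h)"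
    using eventually_at_right_less
  proof eventually_elim
    case (elim h)
    note l = bounded_linear.linear[OF lin[OF assms(2)]]
    show ?case using S_add[of h t x] S_add[of t h x] elim assms(2)
      by (simp add: linear_scale[OF l] linear_diff[OF l] add.commute)
  qed
  ultimately have "((\<lambda>h. (S h (S t x) - S t x) /\<^sub>R h) \<longlongrightarrow> S t (A x)) (at_right 0)"
    by (simp add: tendsto_cong)
  then show "S t x \<in> carr E1" "A (S t x) = S t (A x)" using generatorI by blast+
qed

text \<open>By the semigroup law the right difference quotient of the orbit at \<open>t\<close> is
  the quotient defining the generator at \<open>S t x\<close>. Differentiability of the orbit
  therefore puts \<open>S t x\<close> into the domain.\<close>

lemma S_derivative:
  assumes t: "t > 0"
  shows "S t x \<in> carr E1" "((\<lambda>s. S s x) has_vector_derivative A (S t x)) (at t)"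
proof -
  obtain y where y: "((\<lambda>s. S s x) has_vector_derivative y) (at t)"
    using derivative_bound[OF t] t by blast
  then have "((\<lambda>h. (S (t + h) x - S t x) /\<^sub>R h) \<longlongrightarrow> y) (at 0)"
    using LIM_offset_zero[of "\<lambda>s. (S s x - S t x) /\<^sub>R (s - t)" y t]
    by (simp add: has_vector_derivative_iff_quotient)
  then have "((\<lambda>h. (S (t + h) x - S t x) /\<^sub>R h) \<longlongrightarrow> y) (at_right 0)"
    by (rule filterlim_mono) (auto simp: at_le)
  moreover have "\<forall>\<^sub>F h in at_right 0. (S (t + h) x - S t x) /\<^sub>R h = (S h (S t x) - S t x) /\<^sub>R h"
    using eventually_at_right_less
  proof eventually_elim
    case (elim h)
    then show ?case using S_add[of h t x] t by (simp add: add.commute)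
  qed
  ultimately have "((\<lambda>h. (S h (S t x) - S t x) /\<^sub>R h) \<longlongrightarrow> y) (at_right 0)" 
    by (simp add: tendsto_cong)
  from generatorI[OF this] y show "S t x \<in> carr E1" "((\<lambda>s. S s x) has_vector_derivative A (S t x)) (at t)"
    by auto
qed

lemma S_cont: "continuous_on {0..} (\<lambda>t. S t x)"
  unfolding continuous_on_eq_continuous_within
proof
  fix t :: real assume "t \<in> {0..}"
  then consider "t = 0" | "t > 0" by fastforce
  then show "continuous (at t within {0..}) (\<lambda>t. S t x)"
  proof cases
    case 1
    have "((\<lambda>t. S t x) \<longlongrightarrow> S 0 x) (at 0 within {0..})"
      using S_right_zero[of x] by (simp add: at_within_Ici_at_right)
    then show ?thesis using 1 by (simp add: continuous_within)
  next
    case 2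
    then show ?thesis
      using has_vector_derivative_continuous[OF S_derivative(2)] continuous_at_imp_continuous_at_within by blast
  qed
qed

lemma S_ftc:
  assumes "x \<in> carr E1" "t \<ge> 0"
  shows "((\<lambda>s. S s (A x)) has_integral (S t x - x)) {0..t}"
proof -
  have "((\<lambda>s. S s (A x)) has_integral (S t x - S 0 x)) {0..t}"
  proof (rule fundamental_theorem_of_calculus_interior)
    show "continuous_on {0..t} (\<lambda>t. S t x)" by (rule continuous_on_subset[OF S_cont]) auto
    fix s assume "s \<in> {0<..<t}"
    then show "((\<lambda>t. S t x) has_vector_derivative S s (A x)) (at s)"
      using S_derivative(2)[of s x] A_commute(2)[OF assms(1), of s] by simp
  qed (use assms in auto)
  then show ?thesis by simp
qed

text \<open>Passing to the limit in the integral formula for \<open>S t (s n) - s n\<close> gives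
  the same formula for \<open>x\<close> and \<open>y\<close>; dividing by \<open>t\<close> and
  letting it tend to 0 identifies \<open>y\<close> as the generator value.\<close>

lemma A_closed:
  assumes s: "\<And>n. s n \<in> carr E1" and sx: "s \<longlonglongrightarrow> x" and Ay: "(\<lambda>n. A (s n)) \<longlonglongrightarrow> y"
  shows "x \<in> carr E1 \<and> A x = y"
proof -
  obtain C where C: "C > 0" "\<And>t x. 0 < t \<Longrightarrow> t \<le> T \<Longrightarrow> norm (S t x) \<le> C * norm x"
    using derivative_bound[OF T] by auto
  have cont: "continuous_on {0..t} (\<lambda>r. S r z)" for t z by (rule continuous_on_subset[OF S_cont]) auto
  have eq: "integral {0..t} (\<lambda>r. S r y) = S t x - x" if t: "0 < t" "t \<le> T" for t
  proof -
    have lim: "(\<lambda>n. integral {0..t} (\<lambda>r. S r (A (s n)))) \<longlonglongrightarrow> integral {0..t} (\<lambda>r. S r y)"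
    proof (rule LIM_zero_cancel, rule Lim_null_comparison)
      have "norm (integral {0..t} (\<lambda>r. S r (A (s n))) - integral {0..t} (\<lambda>r. S r y)) \<le> max 1 C * norm (A (s n) - y) * (t - 0)" for n
      proof -
        have "integral {0..t} (\<lambda>r. S r (A (s n))) - integral {0..t} (\<lambda>r. S r y) = integral {0..t} (\<lambda>r. S r (A (s n)) - S r y)"
          by (intro integral_diff[symmetric] integrable_continuous_real cont)
        also have "norm \<dots> \<le> max 1 C * norm (A (s n) - y) * (t - 0)"
        proof (rule integral_bound)
          show "continuous_on {0..t} (\<lambda>r. S r (A (s n)) - S r y)" by (intro continuous_intros cont)
          fix r assume r: "r \<in> {0..t}"
          have "S r (A (s n)) - S r y = S r (A (s n) - y)"
            using r by (simp add: linear_diff[OF bounded_linear.linear[OF lin]])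
          \<comment> \<open>The bound with \<open>C\<close> is available for positive times; at time
            0 the operator is the identity, hence the maximum with 1.\<close>
          moreover have "norm (S r (A (s n) - y)) \<le> max 1 C * norm (A (s n) - y)"
          proof (cases "r = 0")
            case True
            have "1 * norm (A (s n) - y) \<le> max 1 C * norm (A (s n) - y)" by (intro mult_right_mono) auto
            then show ?thesis using True by simp
          next
            case False
            have "C * norm (A (s n) - y) \<le> max 1 C * norm (A (s n) - y)" by (intro mult_right_mono) auto
            then show ?thesis using C(2)[of r "A (s n) - y"] False r t by auto
          qed
          ultimately show "norm (S r (A (s n)) - S r y) \<le> max 1 C * norm (A (s n) - y)" by simp
        qed (use t in auto)
        finally show ?thesis .
      qed
      then show "\<forall>\<^sub>F n in sequentially. norm (integral {0..t} (\<lambda>r. S r (A (s n))) - integral {0..t} (\<lambda>r. S r y)) \<le> max 1 C * norm (A (s n) - y) * (t - 0)"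
        by simp
      show "(\<lambda>n. max 1 C * norm (A (s n) - y) * (t - 0)) \<longlonglongrightarrow> 0"
        using tendsto_norm_zero[OF LIM_zero[OF Ay]]
        by (intro tendsto_mult_left_zero tendsto_mult_right_zero)
    qed
    have int: "integral {0..t} (\<lambda>r. S r (A (s n))) = S t (s n) - s n" for n
      using S_ftc[OF s] t by (intro integral_unique) auto
    have "(\<lambda>n. S t (s n) - s n) \<longlonglongrightarrow> S t x - x"
      using t by (intro tendsto_diff sx bounded_linear.tendsto[OF lin]) auto
    then show ?thesis using LIMSEQ_unique lim[unfolded int] by blast
  qed
  have "((\<lambda>t. integral {0..t} (\<lambda>r. S r y)) has_vector_derivative S 0 y) (at 0 within {0..T})"
    using T by (intro integral_has_vector_derivative cont) auto
  then have "((\<lambda>t. (integral {0..t} (\<lambda>r. S r y)) /\<^sub>R t) \<longlongrightarrow> y) (at 0 within {0..T})"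
    by (simp add: has_vector_derivative_iff_quotient)
  then have "((\<lambda>t. (integral {0..t} (\<lambda>r. S r y)) /\<^sub>R t) \<longlongrightarrow> y) (at_right 0)"
    using T by (simp add: at_within_Icc_at_right)
  moreover have "\<forall>\<^sub>F t in at_right 0. (integral {0..t} (\<lambda>r. S r y)) /\<^sub>R t = (S t x - x) /\<^sub>R t"
    using eventually_at_right_less[of 0] eventually_at_right_real[OF T]
    by eventually_elim (simp add: eq)
  ultimately have "((\<lambda>t. (S t x - x) /\<^sub>R t) \<longlongrightarrow> y) (at_right 0)" by (simp add: tendsto_cong)
  from generatorI[OF this] show ?thesis by simp
qed

text \<open>Completeness in this norm is closedness of \<open>A\<close>. The hypotheses fix the
  domain of \<open>A\<close> as a set only, so this norm and \<open>nrm E1\<close> are compared by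
  two applications of Zabreiko's lemma.\<close>

definition graph_space :: "'a nspace" where
  "graph_space = \<lparr>carr = carr E1, nrm = (\<lambda>x. norm x + norm (A x))\<rparr>"

lemma graph_space_simps [simp]: "carr graph_space = carr E1" "nrm graph_space x = norm x + norm (A x)"
  by (simp_all add: graph_space_def)

lemma A_zero [simp]: "A 0 = 0"
  using A_scale[of 0 0] by simp

lemma A_minus: "x \<in> carr E1 \<Longrightarrow> A (- x) = - A x"
  using A_scale[of x "-1"] by simp

lemma A_diff: "x \<in> carr E1 \<Longrightarrow> y \<in> carr E1 \<Longrightarrow> A (x - y) = A x - A y"
  using A_add[of x "-y"] A_minus[of y] E1.minus_mem[of y] by simp

lemma A_sum: "(\<And>i. i \<in> I \<Longrightarrow> s i \<in> carr E1) \<Longrightarrow> A (sum s I) = (\<Sum>i\<in>I. A (s i))"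
  by (induction I rule: infinite_finite_induct) (auto simp: A_add E1.sum_mem)

lemma tendsto_graph_space:
  assumes "(\<lambda>n. nrm graph_space (s n)) \<longlonglongrightarrow> 0"
  shows "s \<longlonglongrightarrow> 0" "(\<lambda>n. A (s n)) \<longlonglongrightarrow> 0"
  using assms by (auto intro!: Lim_null_comparison[OF _ assms])

lemma graph_space_banach: "banach_over Real_Scalars graph_space"
  unfolding banach_over_def subspace_over_def
proof (intro conjI ballI allI impI)
  fix x y assume xy: "x \<in> carr graph_space" "y \<in> carr graph_space"
  show "x + y \<in> carr graph_space" using xy E1.add_mem by simp
  show "nrm graph_space (x + y) \<le> nrm graph_space x + nrm graph_space y"
    using xy A_add norm_triangle_ineq[of x y] norm_triangle_ineq[of "A x" "A y"] by simp
next
  fix c x assume "c \<in> field_of (Real_Scalars :: 'a scalars)" and x: "x \<in> carr graph_space"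
  then obtain r where c: "c = of_real r" by (auto elim: Reals_cases)
  show "smul Real_Scalars c x \<in> carr graph_space" using x E1.scale_mem by (simp add: c)
  show "nrm graph_space (smul Real_Scalars c x) = cmod c * nrm graph_space x"
    using x A_scale by (simp add: c algebra_simps)
next
  fix s :: "nat \<Rightarrow> 'a" assume s: "(\<forall>n. s n \<in> carr graph_space) \<and> (\<forall>\<epsilon>>0. \<exists>N. \<forall>m\<ge>N. \<forall>n\<ge>N. nrm graph_space (s m - s n) < \<epsilon>)"
  then have mem: "\<And>n. s n \<in> carr E1" by simp
  have d: "norm (s m - s n) \<le> nrm graph_space (s m - s n)" "norm (A (s m) - A (s n)) \<le> nrm graph_space (s m - s n)" for m n
    using mem by (auto simp: A_diff)
  have "Cauchy s" "Cauchy (\<lambda>n. A (s n))"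
    unfolding Cauchy_def dist_norm using s d by (meson order_le_less_trans)+
  then obtain x y where xy: "s \<longlonglongrightarrow> x" "(\<lambda>n. A (s n)) \<longlonglongrightarrow> y"
    by (auto simp: Cauchy_convergent_iff convergent_def)
  have x: "x \<in> carr E1" "A x = y" using A_closed[OF mem xy] by auto
  have "(\<lambda>n. nrm graph_space (s n - x)) \<longlonglongrightarrow> 0 + 0"
    using tendsto_add[OF tendsto_norm_zero[OF LIM_zero[OF xy(1)]] tendsto_norm_zero[OF LIM_zero[OF xy(2)]]]
    by (simp add: A_diff mem x)
  then show "\<exists>x\<in>carr graph_space. (\<lambda>n. nrm graph_space (s n - x)) \<longlonglongrightarrow> 0" using x by auto
qed (auto simp: add_nonneg_eq_0_iff)

lemma E1_to_norm:
  assumes "\<And>n. s n \<in> carr E1" "(\<lambda>n. nrm E1 (s n)) \<longlonglongrightarrow> 0"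
  shows "s \<longlonglongrightarrow> 0"
proof -
  obtain c where "\<And>x. x \<in> carr E1 \<Longrightarrow> norm x \<le> c * nrm E1 x"
    using E1_embedded by (auto simp: cont_embedded_def)
  then show ?thesis
    using assms by (intro Lim_null_comparison[OF _ tendsto_mult_right_zero[OF assms(2), of c]]) auto
qed

text \<open>Zabreiko's lemma on the graph space for the seminorm \<open>nrm E1\<close>. A series
  converging in both norms has one sum, because both convergences imply convergence in
  \<open>E0\<close>.\<close>

lemma graph_bound: "\<exists>C>0. \<forall>x\<in>carr E1. nrm E1 x \<le> C * (norm x + norm (A x))"
proof -
  interpret G: banach_nspace graph_space by standard (rule graph_space_banach)
  obtain C where "C > 0" "\<And>x. x \<in> carr graph_space \<Longrightarrow> nrm E1 x \<le> C * nrm graph_space x"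
  proof (rule G.countably_subadditive_bounded[of "nrm E1"])
    fix s x assume s: "\<And>n. s n \<in> carr graph_space" and x: "x \<in> carr graph_space"
      and lim: "(\<lambda>n. nrm graph_space ((\<Sum>i<n. s i) - x)) \<longlonglongrightarrow> 0"
      and summ: "summable (\<lambda>n. nrm E1 (s n))"
    obtain x' where x': "x' \<in> carr E1" "(\<lambda>n. nrm E1 ((\<Sum>i<n. s i) - x')) \<longlonglongrightarrow> 0" "nrm E1 x' \<le> (\<Sum>n. nrm E1 (s n))"
      by (rule E1.summable_converges[of s "\<lambda>n. nrm E1 (s n)"]) (use s summ in auto)
    have "(\<lambda>n. (\<Sum>i<n. s i) - x') \<longlonglongrightarrow> 0"
      using s x' by (intro E1_to_norm E1.diff_mem E1.sum_mem) auto
    moreover have "(\<lambda>n. (\<Sum>i<n. s i) - x) \<longlonglongrightarrow> 0" by (rule tendsto_graph_space(1)[OF lim])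
    ultimately have "x = x'" by (intro LIMSEQ_unique[of "\<lambda>n. \<Sum>i<n. s i"]) (simp_all add: LIM_zero_iff)
    then show "nrm E1 x \<le> (\<Sum>n. nrm E1 (s n))" using x' by simp
  qed (auto simp: E1.nrm_ge0 E1.nrm_triangle E1.nrm_scale)
  then show ?thesis by auto
qed

text \<open>Zabreiko's lemma on \<open>E1\<close> for the seminorm \<open>norm (A x)\<close>;
  closedness of \<open>A\<close> identifies the sum of the series of images with
  \<open>A x\<close>.\<close>

lemma A_bound: "\<exists>C>0. \<forall>x\<in>carr E1. norm (A x) \<le> C * nrm E1 x"
proof -
  obtain C where "C > 0" "\<And>x. x \<in> carr E1 \<Longrightarrow> norm (A x) \<le> C * nrm E1 x"
  proof (rule E1.countably_subadditive_bounded[of "\<lambda>x. norm (A x)"])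
    fix s x assume s: "\<And>n. s n \<in> carr E1" and x: "x \<in> carr E1"
      and lim: "(\<lambda>n. nrm E1 ((\<Sum>i<n. s i) - x)) \<longlonglongrightarrow> 0"
      and summ: "summable (\<lambda>n. norm (A (s n)))"
    have "(\<lambda>n. (\<Sum>i<n. s i) - x) \<longlonglongrightarrow> 0"
      using s x lim by (intro E1_to_norm E1.diff_mem E1.sum_mem) auto
    then have "(\<lambda>n. \<Sum>i<n. s i) \<longlonglongrightarrow> x" by (simp add: LIM_zero_iff)
    moreover have "(\<lambda>n. A (\<Sum>i<n. s i)) \<longlonglongrightarrow> (\<Sum>n. A (s n))"
      using summable_LIMSEQ[OF summable_norm_cancel[OF summ]] s by (simp add: A_sum)
    moreover have "\<And>n. (\<Sum>i<n. s i) \<in> carr E1" using s by (simp add: E1.sum_mem)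
    ultimately have "A x = (\<Sum>n. A (s n))" using A_closed[of "\<lambda>n. \<Sum>i<n. s i"] by blast
    then show "norm (A x) \<le> (\<Sum>n. norm (A (s n)))" using summable_norm[OF summ] by simp
  qed (auto simp: A_add A_scale norm_triangle_ineq)
  then show ?thesis by auto
qed

lemma smoothing: "\<exists>C. smoothing_semigroup S E1 A T C"
proof -
  obtain Cs where Cs: "Cs > 0" "\<And>t x. 0 < t \<Longrightarrow> t \<le> T \<Longrightarrow> norm (S t x) \<le> Cs * norm x"
     "\<And>t x. 0 < t \<Longrightarrow> t \<le> T \<Longrightarrow> \<exists>y. ((\<lambda>s. S s x) has_vector_derivative y) (at t) \<and> norm y \<le> Cs / t * norm x"
    using derivative_bound[OF T] by auto
  have der: "norm (A (S t x)) \<le> Cs / t * norm x" if "0 < t" "t \<le> T" for t x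
  proof -
    obtain y where y: "((\<lambda>s. S s x) has_vector_derivative y) (at t)" "norm y \<le> Cs / t * norm x"
      using Cs(3) \<open>0 < t\<close> \<open>t \<le> T\<close> by blast
    have "A (S t x) = y" by (rule vector_derivative_unique_at[OF S_derivative(2)[OF that(1)] y(1)])
    with y show ?thesis by simp
  qed
  obtain Ce where Ce: "\<And>x. x \<in> carr E1 \<Longrightarrow> norm x \<le> Ce * nrm E1 x"
    using E1_embedded by (auto simp: cont_embedded_def)
  obtain Cg where Cg: "Cg > 0" "\<And>x. x \<in> carr E1 \<Longrightarrow> nrm E1 x \<le> Cg * (norm x + norm (A x))"
    using graph_bound by blast
  obtain Ca where Ca: "Ca > 0" "\<And>x. x \<in> carr E1 \<Longrightarrow> norm (A x) \<le> Ca * nrm E1 x"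
    using A_bound by blast
  define M where "M = max 1 Cs"
  have M: "M \<ge> 1" "Cs \<le> M" by (auto simp: M_def)
  have S_b: "norm (S t x) \<le> M * norm x" if "0 \<le> t" "t \<le> T" for t x
  proof (cases "t = 0")
    case True
    then show ?thesis using M mult_right_mono[of 1 M "norm x"] by simp
  next
    case False
    then show ?thesis using Cs(2)[of t x] that mult_right_mono[OF M(2), of "norm x"] by simp
  qed
  \<comment> \<open>One summand for each clause of the locale. The one with \<open>T + 1\<close>
    comes from \<open>1 + 1 / t \<le> (T + 1) / t\<close>, the last from estimating the graph norm
    of \<open>x\<close> by \<open>nrm E1 x\<close>.\<close>
  define C where "C = M + \<bar>Ce\<bar> + Cg + Ca + Cg * M * (T + 1) + Cg * M * (\<bar>Ce\<bar> + Ca)"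
  have p: "0 \<le> Cg * M * (T + 1)" "0 \<le> Cg * M * (\<bar>Ce\<bar> + Ca)" using Cg Ca M T by auto
  have le: "M \<le> C" "\<bar>Ce\<bar> \<le> C" "Cg \<le> C" "Ca \<le> C" "Cg * M * (T + 1) \<le> C" "Cg * M * (\<bar>Ce\<bar> + Ca) \<le> C"
    unfolding C_def using p M Cg(1) Ca(1) by linarith+
  have "smoothing_semigroup S E1 A T C"
  proof
    show "T > 0" by (rule T)
    show "1 \<le> C" using le M by linarith
    fix t :: real and x
    show "0 \<le> t \<Longrightarrow> t \<le> T \<Longrightarrow> norm (S t x) \<le> C * norm x"
      using S_b[of t x] mult_right_mono[OF le(1), of "norm x"] by simp
    show "nrm E1 (S t x) \<le> C / t * norm x" if t: "0 < t" "t \<le> T"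
    proof -
      have "nrm E1 (S t x) \<le> Cg * (norm (S t x) + norm (A (S t x)))" by (intro Cg S_derivative t)
      also have "\<dots> \<le> Cg * (M * norm x + M / t * norm x)"
        using t M Cg by (intro mult_left_mono add_mono S_b order_trans[OF der] mult_right_mono divide_right_mono) auto
      also have "\<dots> = Cg * M * (t + 1) / t * norm x" using t by (simp add: field_simps)
      also have "\<dots> \<le> Cg * M * (T + 1) / t * norm x"
        using t M Cg by (intro mult_right_mono divide_right_mono mult_left_mono) auto
      also have "\<dots> \<le> C / t * norm x"
        using t le by (intro mult_right_mono divide_right_mono) auto
      finally show ?thesis .
    qed
    show "nrm E1 (S t x) \<le> C * nrm E1 x" if t: "0 \<le> t" "t \<le> T" and x: "x \<in> carr E1"
    proof -
      have "nrm E1 (S t x) \<le> Cg * (norm (S t x) + norm (A (S t x)))" by (intro Cg A_commute t x)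
      also have "\<dots> = Cg * (norm (S t x) + norm (S t (A x)))" using A_commute[OF x t(1)] by simp
      also have "\<dots> \<le> Cg * (M * norm x + M * norm (A x))"
        using Cg t by (intro mult_left_mono add_mono S_b) auto
      also have "\<dots> \<le> Cg * (M * (\<bar>Ce\<bar> * nrm E1 x) + M * (Ca * nrm E1 x))"
        using Cg M Ca(2)[OF x] order_trans[OF Ce[OF x] mult_right_mono[of Ce "\<bar>Ce\<bar>"]] E1.nrm_ge0[OF x]
        by (intro mult_left_mono add_mono) auto
      also have "\<dots> = Cg * M * (\<bar>Ce\<bar> + Ca) * nrm E1 x" by (simp add: algebra_simps)
      also have "\<dots> \<le> C * nrm E1 x" by (intro mult_right_mono le E1.nrm_ge0 x)
      finally show ?thesis .
    qed
    show "norm x \<le> C * nrm E1 x" if x: "x \<in> carr E1"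
      using Ce[OF x] mult_right_mono[OF le(2) E1.nrm_ge0[OF x]]
        mult_right_mono[OF abs_ge_self[of Ce] E1.nrm_ge0[OF x]] by linarith
    show "norm (A x) \<le> C * nrm E1 x" if x: "x \<in> carr E1"
      using Ca(2)[OF x] mult_right_mono[OF le(4) E1.nrm_ge0[OF x]] by linarith
    show "nrm E1 x \<le> C * (norm x + norm (A x))" if x: "x \<in> carr E1"
      using Cg(2)[OF x] mult_right_mono[OF le(3), of "norm x + norm (A x)"] by simp
    show "x \<in> carr E1 \<and> A x = y" if "\<And>n. \<xi> n \<in> carr E1" "\<xi> \<longlonglongrightarrow> x" "(\<lambda>n. A (\<xi> n)) \<longlonglongrightarrow> y" for \<xi> x y
      by (rule A_closed[OF that])
  qed (simp_all add: linear_add[OF bounded_linear.linear[OF lin]] linear_scale[OF bounded_linear.linear[OF lin]]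
      bounded_linear.bounded[OF lin] S_add S_cont A_add A_scale A_commute S_ftc S_derivative)
  then show ?thesis by blast
qed

end

section \<open>Spectral conditions and linear nonlocal problems\<close>

text \<open>There are \<open>card F + 1\<close> vectors in the span of \<open>F\<close>; a
  repetition among them is already a relation. Applied to the iterates of \<open>A\<close> on a
  vector, it gives an annihilating polynomial.\<close>

lemma linear_relation_in_finite_span:
  fixes v :: "nat \<Rightarrow> 'b::real_vector"
  assumes F: "finite F" and v: "\<And>k. v k \<in> span F"
  shows "\<exists>n c. (\<exists>k\<le>n. c k \<noteq> 0) \<and> (\<Sum>k\<le>n. c k *\<^sub>R v k) = 0"
proof (cases "inj_on v {..card F}")
  case False
  then obtain i j where ij: "i \<le> card F" "j \<le> card F" "i \<noteq> j" "v i = v j" by (auto simp: inj_on_def)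
  define c where "c = (\<lambda>k. if k = i then 1 else if k = j then -1 else (0::real))"
  have "(\<Sum>k\<le>card F. c k *\<^sub>R v k) = (\<Sum>k\<in>{i, j}. c k *\<^sub>R v k)"
    using ij by (intro sum.mono_neutral_right) (auto simp: c_def)
  also have "\<dots> = 0" using ij by (simp add: c_def)
  finally show ?thesis using ij by (intro exI[of _ "card F"] exI[of _ c]) (auto simp: c_def)
next
  case True
  have "\<not> independent (v ` {..card F})"
  proof
    assume "independent (v ` {..card F})"
    then have "card (v ` {..card F}) \<le> card F"
      using independent_span_bound[OF F, of "v ` {..card F}"] v by blast
    then show False using card_image[OF True] by simp
  qed
  then obtain u where u: "\<exists>w\<in>v ` {..card F}. u w \<noteq> 0" "(\<Sum>w\<in>v ` {..card F}. u w *\<^sub>R w) = 0"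
    using dependent_finite[of "v ` {..card F}"] by auto
  have "(\<Sum>k\<le>card F. u (v k) *\<^sub>R v k) = 0" using u(2) sum.reindex[OF True, of "\<lambda>w. u w *\<^sub>R w"] by (simp add: o_def)
  then show ?thesis using u(1) by (intro exI[of _ "card F"] exI[of _ "\<lambda>k. u (v k)"]) auto
qed

context complex_scaling
begin

text \<open>Split off a root \<open>\<mu>\<close> of the annihilating polynomial \<open>p\<close>.
  Either \<open>B - \<mu>\<close> kills \<open>x\<close>, and \<open>x\<close> is an eigenvector, or
  its image is a nonzero vector annihilated by the quotient of lower degree.\<close>

lemma polynomial_eigenvector:
  fixes B :: "'b \<Rightarrow> 'b"
  assumes N: "\<And>x y. x \<in> N \<Longrightarrow> y \<in> N \<Longrightarrow> x + y \<in> N" "\<And>c x. x \<in> N \<Longrightarrow> sc c x \<in> N"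
    and B: "\<And>x. x \<in> N \<Longrightarrow> B x \<in> N" "\<And>x y. x \<in> N \<Longrightarrow> y \<in> N \<Longrightarrow> B (x + y) = B x + B y"
      "\<And>c x. x \<in> N \<Longrightarrow> B (sc c x) = sc c (B x)"
    and p: "p \<noteq> 0" "degree p \<le> n" and x: "x \<in> N" "x \<noteq> 0"
    and rel: "(\<Sum>k\<le>n. sc (coeff p k) ((B ^^ k) x)) = 0"
  shows "\<exists>\<mu>. \<exists>y\<in>N. y \<noteq> 0 \<and> B y = sc \<mu> y"
  using p x rel
proof (induction n arbitrary: p x)
  case 0
  then have "coeff p 0 \<noteq> 0" by (metis bot_nat_0.extremum_uniqueI leading_coeff_0_iff)
  with 0 show ?case by (simp add: sc_cancel)
next
  case (Suc n)
  show ?case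
  proof (cases "degree p = 0")
    case True
    then have "coeff p 0 \<noteq> 0" using Suc.prems by (metis leading_coeff_0_iff)
    moreover have "(\<Sum>k\<le>Suc n. sc (coeff p k) ((B ^^ k) x)) = (\<Sum>k\<in>{0}. sc (coeff p k) ((B ^^ k) x))"
      using True by (intro sum.mono_neutral_right) (auto simp: coeff_eq_0)
    ultimately show ?thesis using Suc.prems by (simp add: sc_cancel)
  next
    case False
    then obtain \<mu> where "poly p \<mu> = 0"
      using fundamental_theorem_of_algebra[of p] by (auto simp: constant_degree)
    then obtain q where q: "p = [:-\<mu>, 1:] * q" using poly_eq_0_iff_dvd by (metis dvdE)
    have q0: "q \<noteq> 0" using q Suc.prems by auto
    then have "degree p = Suc (degree q)" using q degree_mult_eq[of "[:-\<mu>, 1:]" q] by simp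
    then have dq: "degree q \<le> n" using Suc.prems by simp
    define w where "w = B x + sc (-\<mu>) x"
    have w: "w \<in> N" unfolding w_def by (intro N B Suc.prems)
    have mem: "(B ^^ k) x \<in> N" for k by (induction k) (auto intro: B Suc.prems)
    have pw: "(B ^^ k) w = (B ^^ Suc k) x + sc (-\<mu>) ((B ^^ k) x)" for k
    proof (induction k)
      case (Suc k)
      have "(B ^^ Suc k) w = B ((B ^^ Suc k) x + sc (-\<mu>) ((B ^^ k) x))" by (simp add: Suc)
      also have "\<dots> = B ((B ^^ Suc k) x) + B (sc (-\<mu>) ((B ^^ k) x))" by (intro B N mem)
      finally show ?case using B(3)[OF mem] by simp
    qed (simp add: w_def)
    have "(\<Sum>k\<le>Suc n. sc (coeff p k) ((B ^^ k) x)) =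
        (\<Sum>k\<le>Suc n. sc (- \<mu> * coeff q k) ((B ^^ k) x)) + (\<Sum>k\<le>Suc n. sc (coeff (pCons 0 q) k) ((B ^^ k) x))"
      unfolding sum.distrib[symmetric] by (intro sum.cong refl) (simp add: q sc_add_left[symmetric])
    also have "(\<Sum>k\<le>Suc n. sc (- \<mu> * coeff q k) ((B ^^ k) x)) = (\<Sum>k\<le>n. sc (- \<mu> * coeff q k) ((B ^^ k) x))"
      using dq by (simp add: coeff_eq_0)
    also have "(\<Sum>k\<le>Suc n. sc (coeff (pCons 0 q) k) ((B ^^ k) x)) = (\<Sum>k\<le>n. sc (coeff q k) ((B ^^ Suc k) x))"
      by (subst sum.atMost_Suc_shift) simp
    also have "(\<Sum>k\<le>n. sc (- \<mu> * coeff q k) ((B ^^ k) x)) + (\<Sum>k\<le>n. sc (coeff q k) ((B ^^ Suc k) x)) =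
        (\<Sum>k\<le>n. sc (coeff q k) ((B ^^ k) w))"
      unfolding sum.distrib[symmetric] pw by (intro sum.cong refl) (simp add: sc_add_right sc_sc mult.commute)
    finally have rel': "(\<Sum>k\<le>n. sc (coeff q k) ((B ^^ k) w)) = 0" using Suc.prems by simp
    show ?thesis
    proof (cases "w = 0")
      case True
      then have "B x = sc \<mu> x" by (simp add: w_def sc_minus_left)
      then show ?thesis using Suc.prems by blast
    next
      case False
      show ?thesis by (rule Suc.IH[OF q0 dq w False rel'])
    qed
  qed
qed

text \<open>On the eigenspace of the compact operator \<open>S T\<close> the generator acts as an endomorphism of a
  finite-dimensional space, hence has an eigenvector there.\<close>

lemma semigroup_eigenvector:
  fixes S :: "real \<Rightarrow> 'b \<Rightarrow> 'b" and A :: "'b \<Rightarrow> 'b" and b T :: real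
  assumes T: "T > 0" and comp: "compact_op (S T)"
    and S0: "\<And>x. S 0 x = x"
    and Ssc: "\<And>c x. S T (sc c x) = sc c (S T x)"
    and dom: "\<And>x. S T x \<in> D"
    and D: "\<And>x y. x \<in> D \<Longrightarrow> y \<in> D \<Longrightarrow> x + y \<in> D" "\<And>c x. x \<in> D \<Longrightarrow> sc c x \<in> D"
    and A: "\<And>x y. x \<in> D \<Longrightarrow> y \<in> D \<Longrightarrow> A (x + y) = A x + A y" "\<And>c x. x \<in> D \<Longrightarrow> A (sc c x) = sc c (A x)"
    and AS: "\<And>t x. x \<in> D \<Longrightarrow> t > 0 \<Longrightarrow> A (S t x) = S t (A x)"
    and Slin: "\<And>t c x. t \<ge> 0 \<Longrightarrow> S t (sc c x) = sc c (S t x)"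
    and der: "\<And>t x. t > 0 \<Longrightarrow> ((\<lambda>s. S s x) has_vector_derivative A (S t x)) (at t)"
    and cont: "\<And>x. continuous_on {0..T} (\<lambda>t. S t x)"
    and x: "x \<noteq> 0" "b *\<^sub>R S T x = x"
  obtains \<mu> y where "y \<in> D" "y \<noteq> 0" "A y = sc \<mu> y" "of_real b * exp (of_real T * \<mu>) = 1"
proof -
  define N where "N = {x. b *\<^sub>R S T x = x}"
  have lin: "linear (S T)" using comp by (simp add: compact_op_def bounded_linear.linear)
  have sub: "subspace N"
  proof (rule subspaceI)
    fix c x assume "x \<in> N"
    moreover have "b *\<^sub>R S T (c *\<^sub>R x) = c *\<^sub>R (b *\<^sub>R S T x)" by (simp add: linear_scale[OF lin])
    ultimately show "c *\<^sub>R x \<in> N" by (simp add: N_def)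
  qed (auto simp: N_def linear_0[OF lin] linear_add[OF lin] scaleR_add_right)
  have ND: "x \<in> D" if "x \<in> N" for x
    using that D(2)[OF dom[of x], of "of_real b"] by (simp add: N_def sc_of_real)
  have Nsc: "sc c x \<in> N" if "x \<in> N" for c x
    using that by (simp add: N_def Ssc bounded_bilinear.scaleR_right[OF bilinear, symmetric])
  have NA: "A x \<in> N" if "x \<in> N" for x
  proof -
    have "b *\<^sub>R S T (A x) = sc (of_real b) (A (S T x))" using AS[OF ND[OF that] T] by (simp add: sc_of_real)
    also have "\<dots> = A (sc (of_real b) (S T x))" by (rule A(2)[OF dom, symmetric])
    finally show ?thesis using that by (simp add: N_def sc_of_real)
  qed
  have compb: "compact_op (\<lambda>x. b *\<^sub>R S T x)" by (rule compact_op_scaleR[OF comp])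
  have "\<exists>F. finite F \<and> N \<subseteq> span F"
    by (rule compact_op_fixed_space_finite[OF compb sub]) (simp add: N_def)
  then obtain F where F: "finite F" "N \<subseteq> span F" by blast
  have xN: "x \<in> N" using x by (simp add: N_def)
  have mem: "(A ^^ k) x \<in> N" for k by (induction k) (auto intro: xN NA)
  obtain n c where c: "\<exists>k\<le>n. c k \<noteq> 0" "(\<Sum>k\<le>n. c k *\<^sub>R ((A ^^ k) x)) = 0"
    using linear_relation_in_finite_span[OF F(1), of "\<lambda>k. (A ^^ k) x"] mem F(2) by blast
  define p :: "complex poly" where "p = (\<Sum>k\<le>n. monom (of_real (c k)) k)"
  have co: "coeff p k = (if k \<le> n then of_real (c k) else 0)" for k
    unfolding p_def coeff_sum by (simp add: sum.delta)
  have "p \<noteq> 0" using c(1) co by (metis coeff_0 of_real_eq_0_iff)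
  moreover have "degree p \<le> n" by (rule degree_le) (simp add: co)
  moreover have "(\<Sum>k\<le>n. sc (coeff p k) ((A ^^ k) x)) = 0" using c(2) by (simp add: co sc_of_real)
  ultimately obtain \<mu> y where y: "y \<in> N" "y \<noteq> 0" "A y = sc \<mu> y"
    using polynomial_eigenvector[of N A p n x, OF subspace_add[OF sub] Nsc NA A(1)[OF ND ND] A(2)[OF ND] _ _ xN x(1)] by auto
  \<comment> \<open>This function has derivative 0, so \<open>S T y\<close> is
    \<open>exp (T * \<mu>)\<close> times \<open>y\<close>. Together with \<open>y\<close> being
    fixed by \<open>b *\<^sub>R S T\<close> this is the eigenvalue relation claimed.\<close>
  define g where "g = (\<lambda>t. sc (exp (- (of_real t * \<mu>))) (S t y))"
  have "((\<lambda>t. 0) has_integral (g T - g 0)) {0..T}"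
  proof (rule fundamental_theorem_of_calculus_interior)
    show "continuous_on {0..T} g" unfolding g_def by (intro continuous_intros cont)
    fix t assume t: "t \<in> {0<..<T}"
    have "A (S t y) = sc \<mu> (S t y)" using AS[OF ND[OF y(1)], of t] t y by (simp add: Slin)
    then have 1: "((\<lambda>s. S s y) has_vector_derivative sc \<mu> (S t y)) (at t)" using der[of t y] t by simp
    have 2: "((\<lambda>t. exp (- (of_real t * \<mu>))) has_vector_derivative (- \<mu> * exp (- (of_real t * \<mu>)))) (at t)"
    proof -
      have "((\<lambda>t. - (of_real t * \<mu>)) has_vector_derivative - \<mu>) (at t)"
        unfolding has_vector_derivative_def
        by (auto intro!: derivative_eq_intros simp: fun_eq_iff scaleR_conv_of_real)
      from field_vector_diff_chain_at[OF this DERIV_exp] show ?thesis by (simp add: o_def)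
    qed
    show "(g has_vector_derivative 0) (at t)" unfolding g_def
      using bounded_bilinear.has_vector_derivative[OF bilinear 2 1]
      by (simp add: sc_sc sc_add_left[symmetric] mult.commute)
  qed (use T in auto)
  then have "g T = g 0" using has_integral_0_eq by fastforce
  then have gT: "sc (exp (- (of_real T * \<mu>))) (S T y) = y" by (simp add: g_def S0)
  have "S T y = sc (exp (of_real T * \<mu>) * exp (- (of_real T * \<mu>))) (S T y)" by (simp add: exp_minus)
  also have "\<dots> = sc (exp (of_real T * \<mu>)) y" by (simp only: sc_sc[symmetric] gT)
  finally have "y = sc (of_real b * exp (of_real T * \<mu>)) y" using y(1)
    by (simp add: N_def sc_sc[symmetric] sc_of_real)
  then have "sc (of_real b * exp (of_real T * \<mu>) - 1) y = 0"
    by (metis bounded_bilinear.diff_left[OF bilinear] eq_iff_diff_eq_0 sc_one)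
  then have "of_real b * exp (of_real T * \<mu>) = 1" using sc_cancel y(2) by (metis eq_iff_diff_eq_0)
  with y ND that show thesis by blast
qed

end

lemma compact_op_map_prod:
  assumes K: "compact_op K"
  shows "compact_op (map_prod K K)"
proof -
  have lin: "bounded_linear K" and comp: "compact (closure (K ` cball 0 1))"
    using K by (auto simp: compact_op_def)
  show ?thesis
  proof (rule compact_op_subset)
    have "bounded_linear (\<lambda>p. (K (fst p), K (snd p)))"
      by (intro bounded_linear_Pair bounded_linear_compose[OF lin] bounded_linear_fst bounded_linear_snd)
    then show "bounded_linear (map_prod K K)" by (simp add: map_prod_def case_prod_unfold)
    show "compact (closure (K ` cball 0 1) \<times> closure (K ` cball 0 1))" by (intro compact_Times comp)
    show "map_prod K K ` cball 0 1 \<subseteq> closure (K ` cball 0 1) \<times> closure (K ` cball 0 1)"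
    proof (rule subsetI)
      fix q assume "q \<in> map_prod K K ` cball 0 1"
      then obtain x y where q: "q = (K x, K y)" and "(x, y) \<in> cball 0 1" by auto
      then have "x \<in> cball 0 1" "y \<in> cball 0 1"
        using norm_fst_le[of x y] norm_snd_le[of y x] by auto
      then show "q \<in> closure (K ` cball 0 1) \<times> closure (K ` cball 0 1)"
        using closure_subset[of "K ` cball 0 1"] by (auto simp: q)
    qed
  qed
qed

section \<open>Compactness of the semigroup and the spectral condition\<close>

context parabolic
begin

lemma S_compact:
  assumes comp: "compactly_embedded E1" and t: "0 < t" "t \<le> T"
  shows "compact_op (S t)"
proof -
  obtain C where "smoothing_semigroup S E1 A T C" using smoothing by blast
  then interpret smoothing_semigroup S E1 A T C .
  have Ct: "C / t > 0" using C t by simp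
  show ?thesis
  proof (rule compact_op_subset)
    show "bounded_linear (S t)" using lin t by simp
    show "compact ((*\<^sub>R) (C / t) ` closure {x \<in> carr E1. nrm E1 x \<le> 1})"
      using comp by (intro compact_scaling) (simp add: compactly_embedded_def)
    show "S t ` cball 0 1 \<subseteq> (*\<^sub>R) (C / t) ` closure {x \<in> carr E1. nrm E1 x \<le> 1}"
    proof clarify
      fix x :: 'a assume "x \<in> cball 0 1"
      then have "nrm E1 (S t x) \<le> C / t"
        using S_smooth_bound[OF t, of x] mult_left_mono[of "norm x" 1 "C / t"] Ct by simp
      then have "(t / C) *\<^sub>R S t x \<in> {x \<in> carr E1. nrm E1 x \<le> 1}"
        using S_smooth[OF t(1), of x] t C by (simp add: E1.scale_mem E1.nrm_scale field_simps)
      then have "(t / C) *\<^sub>R S t x \<in> closure {x \<in> carr E1. nrm E1 x \<le> 1}"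
        by (rule closure_subset[THEN subsetD])
      then show "S t x \<in> (*\<^sub>R) (C / t) ` closure {x \<in> carr E1. nrm E1 x \<le> 1}"
        using t C by (intro image_eqI[of _ _ "(t / C) *\<^sub>R S t x"]) auto
    qed
  qed
qed

text \<open>An eigenvalue of \<open>A\<close> belongs to the spectrum since \<open>\<mu> - A\<close>
  is not injective. For real scalars the eigenvector is sought in the complexification, starting
  from the pair \<open>(x, 0)\<close>.\<close>

lemma spectral_injective:
  assumes comp: "compactly_embedded E1"
    and spec: "1 \<notin> (\<lambda>\<mu>. of_real b * exp (of_real T * \<mu>)) ` spectrum_over K (carr E1) A"
    and x: "b *\<^sub>R S T x = x"
  shows "x = 0"
proof (rule ccontr)
  assume "x \<noteq> 0"
  obtain C where "smoothing_semigroup S E1 A T C" using smoothing by blast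
  then interpret smoothing_semigroup S E1 A T C .
  have cont: "continuous_on {0..T} (\<lambda>t. S t x)" for x by (rule continuous_on_subset[OF S_cont]) auto
  show False
  proof (cases K)
    case (Complex_Scalars sc)
    interpret complex_scaling sc using scalars Complex_Scalars by (intro complex_scaling_Complex) simp
    have Ssc: "S t (sc c x) = sc c (S t x)" if "t \<ge> 0" for t c x
      using analytic_semigroup_smul[OF scalars semigroup that, of c x] Complex_Scalars by simp
    have E1sc: "sc c x \<in> carr E1" if "x \<in> carr E1" for c x
      using E1_banach that by (simp add: Complex_Scalars banach_over_def subspace_over_def)
    have Asc: "A (sc c x) = sc c (A x)" if x: "x \<in> carr E1" for c x
    proof (rule generatorI(2))
      have "\<forall>\<^sub>F t in at_right 0. (S t (sc c x) - sc c x) /\<^sub>R t = sc c ((S t x - x) /\<^sub>R t)"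
        using eventually_at_right_less
      proof eventually_elim
        case (elim t)
        then show ?case using Ssc[of t c x]
          by (simp add: bounded_bilinear.scaleR_right[OF bilinear] bounded_bilinear.diff_right[OF bilinear])
      qed
      then show "((\<lambda>t. (S t (sc c x) - sc c x) /\<^sub>R t) \<longlongrightarrow> sc c (A x)) (at_right 0)"
        using bounded_linear.tendsto[OF bounded_linear_sc generatorD[OF x], of c] by (simp add: tendsto_cong)
    qed
    obtain \<mu> y where y: "y \<in> carr E1" "y \<noteq> 0" "A y = sc \<mu> y" "of_real b * exp (of_real T * \<mu>) = 1"
      by (rule semigroup_eigenvector[of T S "carr E1" A x b])
        (use T S_compact[OF comp T order_refl] Ssc S_derivative E1.add_mem E1sc A_add Asc A_commute cont x \<open>x \<noteq> 0\<close> in simp_all)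
    have "\<not> inj_on (\<lambda>x. sc \<mu> x - A x) (carr E1)"
    proof
      assume "inj_on (\<lambda>x. sc \<mu> x - A x) (carr E1)"
      from inj_onD[OF this, of y 0] y A_zero show False by simp
    qed
    then have "\<mu> \<in> spectrum_over K (carr E1) A"
      by (simp add: Complex_Scalars resolvent_set_def bij_betw_def)
    with spec y(4) show False by force
  next
    case Real_Scalars
    interpret complex_scaling "cplx_scale :: complex \<Rightarrow> 'a \<times> 'a \<Rightarrow> _" by (rule complex_scaling_cplx_scale)
    let ?S = "\<lambda>t. map_prod (S t) (S t)" and ?A = "map_prod A A"
    have linS: "linear (S t)" if "t \<ge> 0" for t using lin[OF that] by (rule bounded_linear.linear)
    have Ssc: "?S t (cplx_scale c p) = cplx_scale c (?S t p)" if "t \<ge> 0" for t c p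
      by (simp add: cplx_scale_def linear_add[OF linS[OF that]] linear_diff[OF linS[OF that]] linear_scale[OF linS[OF that]])
    have E1sc: "cplx_scale c p \<in> carr E1 \<times> carr E1" if "p \<in> carr E1 \<times> carr E1" for c p
      using that by (auto simp: cplx_scale_def intro!: E1.diff_mem E1.add_mem E1.scale_mem)
    have Asc: "?A (cplx_scale c p) = cplx_scale c (?A p)" if "p \<in> carr E1 \<times> carr E1" for c p
      using that by (auto simp: cplx_scale_def A_diff A_add A_scale E1.scale_mem)
    have der: "((\<lambda>s. ?S s p) has_vector_derivative ?A (?S t p)) (at t)" if "t > 0" for t p
      using has_vector_derivative_Pair[OF S_deriv[OF that, of "fst p"] S_deriv[OF that, of "snd p"]]
      by (simp add: map_prod_def case_prod_unfold)
    have cont': "continuous_on {0..T} (\<lambda>t. ?S t p)" for p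
      using continuous_on_Pair[OF cont[of "fst p"] cont[of "snd p"]] by (simp add: map_prod_def case_prod_unfold)
    have Aadd: "?A (p + q) = ?A p + ?A q" if "p \<in> carr E1 \<times> carr E1" "q \<in> carr E1 \<times> carr E1" for p q
      using that by (auto simp: A_add)
    have dom: "?S T p \<in> carr E1 \<times> carr E1" for p using S_derivative(1)[OF T] by (cases p) auto
    have ac: "?A (?S t p) = ?S t (?A p)" if "p \<in> carr E1 \<times> carr E1" "t > 0" for t p
      using that by (auto simp: A_commute)
    have dadd: "p + q \<in> carr E1 \<times> carr E1" if "p \<in> carr E1 \<times> carr E1" "q \<in> carr E1 \<times> carr E1" for p q
      using that by (auto intro: E1.add_mem)
    have s0: "?S 0 p = p" for p by (cases p) simp
    have x0: "(x, 0) \<noteq> (0 :: 'a \<times> 'a)" using \<open>x \<noteq> 0\<close> by (simp add: zero_prod_def)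
    have xb: "b *\<^sub>R ?S T (x, 0) = (x, 0)" using x linear_0[OF linS, of T] T by simp
    obtain \<mu> y where y: "y \<in> carr E1 \<times> carr E1" "y \<noteq> 0" "?A y = cplx_scale \<mu> y" "of_real b * exp (of_real T * \<mu>) = 1"
      by (rule semigroup_eigenvector[of T ?S "carr E1 \<times> carr E1" ?A "(x, 0)" b,
           OF T compact_op_map_prod[OF S_compact[OF comp T order_refl]] s0 Ssc dom dadd E1sc Aadd Asc ac Ssc der cont' x0 xb])
         (use T in auto)
    have "\<not> inj_on (\<lambda>p. cplx_scale \<mu> p - ?A p) (carr E1 \<times> carr E1)"
    proof
      assume "inj_on (\<lambda>p. cplx_scale \<mu> p - ?A p) (carr E1 \<times> carr E1)"
      from inj_onD[OF this, of y 0] y A_zero show False by (simp add: zero_prod_def cplx_scale_def)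
    qed
    then have "\<mu> \<in> spectrum_over K (carr E1) A"
      by (simp add: Real_Scalars resolvent_set_def bij_betw_def)
    with spec y(4) show False by force
  qed
qed

end

section \<open>Weighted integrals of the semigroup\<close>

context smoothing_semigroup
begin

lemma S_linear: "t \<ge> 0 \<Longrightarrow> linear (S t)"
  by (rule bounded_linear.linear[OF lin])

lemma S_diff: "t \<ge> 0 \<Longrightarrow> S t (x - y) = S t x - S t y"
  by (rule linear_diff[OF S_linear])

lemma S_integral: "t \<ge> 0 \<Longrightarrow> f integrable_on U \<Longrightarrow> S t (integral U f) = integral U (\<lambda>s. S t (f s))"
  using integral_linear[OF _ lin, of f U t] by (simp add: o_def)

lemma continuous_on_S:
  assumes r: "continuous_on U r" "\<And>s. s \<in> U \<Longrightarrow> 0 \<le> r s \<and> r s \<le> T" and g: "continuous_on U g"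
  shows "continuous_on U (\<lambda>s. S (r s) (g s))"
  unfolding continuous_on_def
proof
  fix s0 assume s0: "s0 \<in> U"
  have mem: "\<forall>\<^sub>F s in at s0 within U. s \<in> U" by (simp add: eventually_at_filter)
  have "((\<lambda>s. S (r s) (g s - g s0)) \<longlongrightarrow> 0) (at s0 within U)"
  proof (rule Lim_null_comparison)
    show "\<forall>\<^sub>F s in at s0 within U. norm (S (r s) (g s - g s0)) \<le> C * norm (g s - g s0)"
      using mem by eventually_elim (use S_bound r in auto)
    have "((\<lambda>s. g s - g s0) \<longlongrightarrow> 0) (at s0 within U)"
      using g s0 by (intro LIM_zero) (simp add: continuous_on_def)
    then show "((\<lambda>s. C * norm (g s - g s0)) \<longlongrightarrow> 0) (at s0 within U)"
      by (intro tendsto_mult_right_zero tendsto_norm_zero)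
  qed
  moreover have "((\<lambda>s. S (r s) (g s0)) \<longlongrightarrow> S (r s0) (g s0)) (at s0 within U)"
    using continuous_on_compose2[OF S_cont[of "g s0"] r(1)] r(2) s0 by (auto simp: continuous_on_def)
  ultimately have "((\<lambda>s. S (r s) (g s - g s0) + S (r s) (g s0)) \<longlongrightarrow> 0 + S (r s0) (g s0)) (at s0 within U)"
    by (rule tendsto_add)
  moreover have "\<forall>\<^sub>F s in at s0 within U. S (r s) (g s - g s0) + S (r s) (g s0) = S (r s) (g s)"
    using mem by eventually_elim (use r(2) in \<open>simp add: S_diff\<close>)
  ultimately show "((\<lambda>s. S (r s) (g s)) \<longlongrightarrow> S (r s0) (g s0)) (at s0 within U)"
    by (simp add: tendsto_cong)
qed

text \<open>The shift \<open>d\<close> prepares the factorisation in which \<open>S d\<close> is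
  pulled out of an integral over \<open>{d..T}\<close>, leaving the kernel
  \<open>S (t - d)\<close>.\<close>

lemma weighted_integral_bounded_linear:
  fixes b :: "real \<Rightarrow> real"
  assumes b: "continuous_on {a..c} b" and a: "d \<le> a" "c - d \<le> T"
  shows "bounded_linear (\<lambda>x. integral {a..c} (\<lambda>t. b t *\<^sub>R S (t - d) x))"
proof (cases "a \<le> c")
  case True
  have cont: "continuous_on {a..c} (\<lambda>t. b t *\<^sub>R S (t - d) x)" for x
    using a by (intro continuous_intros b continuous_on_S) auto
  have "bounded (b ` {a..c})" by (intro compact_imp_bounded compact_continuous_image b compact_Icc)
  then obtain B where B: "\<And>t. t \<in> {a..c} \<Longrightarrow> \<bar>b t\<bar> \<le> B"
    unfolding bounded_iff by (auto simp del: atLeastAtMost_iff)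
  note int = integrable_continuous_real[OF cont]
  show ?thesis
  proof (rule bounded_linear_intro)
    fix x y
    have "integral {a..c} (\<lambda>t. b t *\<^sub>R S (t - d) (x + y)) = integral {a..c} (\<lambda>t. b t *\<^sub>R S (t - d) x + b t *\<^sub>R S (t - d) y)"
      using a by (intro integral_cong) (simp add: linear_add[OF S_linear] scaleR_add_right)
    then show "integral {a..c} (\<lambda>t. b t *\<^sub>R S (t - d) (x + y)) =
        integral {a..c} (\<lambda>t. b t *\<^sub>R S (t - d) x) + integral {a..c} (\<lambda>t. b t *\<^sub>R S (t - d) y)"
      by (simp add: integral_add int)
  next
    fix r x
    have "integral {a..c} (\<lambda>t. b t *\<^sub>R S (t - d) (r *\<^sub>R x)) = integral {a..c} (\<lambda>t. r *\<^sub>R (b t *\<^sub>R S (t - d) x))"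
      using a by (intro integral_cong) (simp add: linear_scale[OF S_linear])
    then show "integral {a..c} (\<lambda>t. b t *\<^sub>R S (t - d) (r *\<^sub>R x)) = r *\<^sub>R integral {a..c} (\<lambda>t. b t *\<^sub>R S (t - d) x)"
      by (simp only: integral_cmul)
  next
    fix x
    have "norm (b t *\<^sub>R S (t - d) x) \<le> B * (C * norm x)" if "t \<in> {a..c}" for t
    proof -
      have "\<bar>b t\<bar> * norm (S (t - d) x) \<le> B * (C * norm x)"
        using that a B[OF that] by (intro mult_mono S_bound) auto
      then show ?thesis by simp
    qed
    then have "norm (integral {a..c} (\<lambda>t. b t *\<^sub>R S (t - d) x)) \<le> B * (C * norm x) * (c - a)"
      by (intro integral_bound cont True)
    then show "norm (integral {a..c} (\<lambda>t. b t *\<^sub>R S (t - d) x)) \<le> norm x * (B * C * (c - a))"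
      by (simp add: mult_ac)
  qed
qed (simp add: bounded_linear_zero)

text \<open>Compactness of \<open>S t\<close> gives no uniform control as \<open>t\<close> tends to
  0. Cutting off \<open>{0..d}\<close> leaves \<open>S d\<close> composed with a bounded operator,
  which is compact, and the piece removed has small norm.\<close>

lemma weighted_integral_compact:
  fixes b :: "real \<Rightarrow> real"
  assumes b: "continuous_on {0..T} b" and comp: "\<And>t. 0 < t \<Longrightarrow> t \<le> T \<Longrightarrow> compact_op (S t)"
  shows "compact_op (\<lambda>x. integral {0..T} (\<lambda>t. b t *\<^sub>R S t x))"
proof (rule compact_op_limit)
  show "bounded_linear (\<lambda>x. integral {0..T} (\<lambda>t. b t *\<^sub>R S t x))"
    using weighted_integral_bounded_linear[OF b, of 0] by simp
  have cont: "continuous_on {0..T} (\<lambda>t. b t *\<^sub>R S t x)" for x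
    by (intro continuous_intros b continuous_on_S) auto
  have "bounded (b ` {0..T})" by (intro compact_imp_bounded compact_continuous_image b compact_Icc)
  then obtain B where B: "\<And>t. t \<in> {0..T} \<Longrightarrow> \<bar>b t\<bar> \<le> B"
    unfolding bounded_iff by (auto simp del: atLeastAtMost_iff)
  have B0: "B \<ge> 0" using B[of 0] T by auto
  fix e :: real assume e: "e > 0"
  \<comment> \<open>Chosen so that \<open>B * C * d \<le> e\<close>; the summand 1 avoids a zero
    denominator when \<open>B\<close> is 0.\<close>
  define d where "d = min T (e / (B * C + 1))"
  have BC: "B * C \<ge> 0" using B0 C by simp
  have d: "0 < d" "d \<le> T" using e T BC by (auto simp: d_def)
  have de: "B * C * d \<le> e"
  proof -
    have "(B * C + 1) * d \<le> (B * C + 1) * (e / (B * C + 1))" unfolding d_def using BC by (intro mult_left_mono) auto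
    also have "\<dots> = e" using BC by simp
    finally show ?thesis using d by (simp add: distrib_right)
  qed
  have bd: "continuous_on {d..T} b" by (rule continuous_on_subset[OF b]) (use d in auto)
  show "\<exists>K. compact_op K \<and> (\<forall>x. norm x \<le> 1 \<longrightarrow> norm (integral {0..T} (\<lambda>t. b t *\<^sub>R S t x) - K x) \<le> e)"
  proof (intro exI conjI allI impI)
    show "compact_op (\<lambda>x. S d (integral {d..T} (\<lambda>t. b t *\<^sub>R S (t - d) x)))"
      by (rule compact_op_compose[OF comp[OF d] weighted_integral_bounded_linear[OF bd]]) (use d in auto)
    fix x :: 'a assume x: "norm x \<le> 1"
    have "S d (integral {d..T} (\<lambda>t. b t *\<^sub>R S (t - d) x)) = integral {d..T} (\<lambda>t. S d (b t *\<^sub>R S (t - d) x))"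
      using d by (intro S_integral integrable_continuous_real continuous_intros bd continuous_on_S) auto
    also have "\<dots> = integral {d..T} (\<lambda>t. b t *\<^sub>R S t x)"
    proof (rule integral_cong)
      fix t assume "t \<in> {d..T}"
      then show "S d (b t *\<^sub>R S (t - d) x) = b t *\<^sub>R S t x"
        using d S_add[of d "t - d" x] by (simp add: linear_scale[OF S_linear])
    qed
    also have "\<dots> = integral {0..T} (\<lambda>t. b t *\<^sub>R S t x) - integral {0..d} (\<lambda>t. b t *\<^sub>R S t x)"
      using Henstock_Kurzweil_Integration.integral_combine[of 0 d T "\<lambda>t. b t *\<^sub>R S t x"] d
        integrable_continuous_real[OF cont[of x]] by (simp add: algebra_simps)
    finally have eq: "integral {0..T} (\<lambda>t. b t *\<^sub>R S t x) - S d (integral {d..T} (\<lambda>t. b t *\<^sub>R S (t - d) x))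
        = integral {0..d} (\<lambda>t. b t *\<^sub>R S t x)" by simp
    have "norm (b t *\<^sub>R S t x) \<le> B * C" if "t \<in> {0..d}" for t
    proof -
      have "norm (S t x) \<le> C * 1" using that d x C by (intro order_trans[OF S_bound] mult_left_mono) auto
      then show ?thesis using B[of t] that d B0 by (auto intro!: mult_mono)
    qed
    then have "norm (integral {0..d} (\<lambda>t. b t *\<^sub>R S t x)) \<le> B * C * (d - 0)"
      using d by (intro integral_bound continuous_on_subset[OF cont]) auto
    then show "norm (integral {0..T} (\<lambda>t. b t *\<^sub>R S t x) - S d (integral {d..T} (\<lambda>t. b t *\<^sub>R S (t - d) x))) \<le> e"
      using de by (simp add: eq)
  qed
qed

end

section \<open>Inverses of the two boundary operators\<close>

context parabolic
begin

lemma boundary_inverse: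
  assumes comp: "compactly_embedded E1"
    and spec: "1 \<notin> (\<lambda>\<mu>. of_real b * exp (of_real T * \<mu>)) ` spectrum_over K (carr E1) A"
  shows "\<exists>R. bounded_linear R \<and> (\<forall>x. R (x - b *\<^sub>R S T x) = x) \<and> (\<forall>x. R x - b *\<^sub>R S T (R x) = x)"
proof -
  have "compact_op (\<lambda>x. b *\<^sub>R S T x)" by (rule compact_op_scaleR[OF S_compact[OF comp T order_refl]])
  then show ?thesis
  proof (rule compact_op_fredholm)
    show "x = 0" if "b *\<^sub>R S T x = x" for x by (rule spectral_injective[OF comp spec that])
    fix R assume "bounded_linear R" "\<And>x. R (x - b *\<^sub>R S T x) = x" "\<And>x. R x - b *\<^sub>R S T (R x) = x"
    then show ?thesis by (intro exI[of _ R] conjI allI)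
  qed
qed

text \<open>Fredholm's alternative for the negative of the integral operator: a fixed vector of it
  would be an eigenvector for -1. For real scalars the pair \<open>(x, 0)\<close> witnesses this in
  the complexification.\<close>

lemma integral_inverse:
  fixes b :: "real \<Rightarrow> real"
  assumes comp: "compactly_embedded E1" and b: "continuous_on {0..T} b"
    and spec: "- 1 \<notin> point_spectrum_over K UNIV (\<lambda>x. integral {0..T} (\<lambda>t. b t *\<^sub>R S t x))"
  shows "\<exists>R. bounded_linear R \<and> (\<forall>x. R (x + integral {0..T} (\<lambda>t. b t *\<^sub>R S t x)) = x) \<and>
    (\<forall>x. R x + integral {0..T} (\<lambda>t. b t *\<^sub>R S t (R x)) = x)"
proof -
  obtain C where "smoothing_semigroup S E1 A T C" using smoothing by blast
  then interpret smoothing_semigroup S E1 A T C .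
  define B where "B = (\<lambda>x. integral {0..T} (\<lambda>t. b t *\<^sub>R S t x))"
  have "compact_op B" unfolding B_def by (rule weighted_integral_compact[OF b S_compact[OF comp]])
  then have cB: "compact_op (\<lambda>x. (-1) *\<^sub>R B x)" by (rule compact_op_scaleR)
  have inj: "x = 0" if x: "(-1) *\<^sub>R B x = x" for x
  proof (rule ccontr)
    assume nz: "x \<noteq> 0"
    have Bx: "B x = - x" using x by (metis scaleR_minus1_left minus_minus)
    have "- 1 \<in> point_spectrum_over K UNIV B"
    proof (cases K)
      case (Complex_Scalars sc)
      interpret complex_scaling sc using scalars Complex_Scalars by (intro complex_scaling_Complex) simp
      show ?thesis using nz Bx sc_minus_left[of 1] by (auto simp: Complex_Scalars point_spectrum_def)
    next
      case Real_Scalars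
      have "B 0 = 0" using \<open>compact_op B\<close> by (simp add: compact_op_def linear_0[OF bounded_linear.linear])
      then have "(x, 0) \<noteq> 0" "map_prod B B (x, 0) = cplx_scale (- 1) (x, 0)"
        using nz Bx by (auto simp: cplx_scale_def zero_prod_def)
      then show ?thesis unfolding Real_Scalars point_spectrum_over.simps point_spectrum_def by blast
    qed
    with spec show False unfolding B_def by simp
  qed
  obtain R where R: "bounded_linear R" "\<And>x. R (x - (-1) *\<^sub>R B x) = x" "\<And>x. R x - (-1) *\<^sub>R B (R x) = x"
    using compact_op_fredholm[OF cB inj] by blast
  show ?thesis by (rule exI[of _ R]) (use R in \<open>simp add: B_def\<close>)
qed

end

section \<open>Convolutions with smoothing kernels\<close>

lemma integral_powr_difference:
  fixes a s t M \<nu> :: real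
  assumes "a < s" "s \<le> t" "\<nu> < 1"
  shows "((\<lambda>r. M * (r - a) powr (-\<nu>)) has_integral
     M / (1 - \<nu>) * (t - a) powr (1 - \<nu>) - M / (1 - \<nu>) * (s - a) powr (1 - \<nu>)) {s..t}"
proof (rule fundamental_theorem_of_calculus[where f="\<lambda>r. M / (1 - \<nu>) * (r - a) powr (1 - \<nu>)"])
  fix r assume r: "r \<in> {s..t}"
  have "((\<lambda>r. (r - a) powr (1 - \<nu>)) has_real_derivative (1 - \<nu>) * (r - a) powr (1 - \<nu> - 1) * 1) (at r)"
    by (rule DERIV_chain2[OF has_real_derivative_powr]) (use r assms in \<open>auto intro!: derivative_eq_intros\<close>)
  from DERIV_cmult[OF this, of "M / (1 - \<nu>)"]
  have "((\<lambda>r. M / (1 - \<nu>) * (r - a) powr (1 - \<nu>)) has_real_derivative M * (r - a) powr (-\<nu>)) (at r)"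
    using assms by simp
  then show "((\<lambda>r. M / (1 - \<nu>) * (r - a) powr (1 - \<nu>)) has_vector_derivative M * (r - a) powr (-\<nu>)) (at r within {s..t})"
    by (simp add: has_real_derivative_iff_has_vector_derivative has_vector_derivative_at_within)
qed (use assms in auto)

text \<open>The integrals over \<open>{s..b}\<close> are Cauchy as \<open>s\<close> tends to
  \<open>a\<close>, by integrating the power majorant. Their limit gives a primitive continuous up
  to \<open>a\<close>, and the fundamental theorem with interior derivatives yields integrability on
  the closed interval.\<close>

lemma improper_integral:
  fixes k :: "real \<Rightarrow> 'b::banach"
  assumes ab: "a < b" and k: "continuous_on {a<..b} k" and \<nu>: "\<nu> < 1" and M: "M \<ge> 0"
    and bd: "\<And>s. s \<in> {a<..b} \<Longrightarrow> norm (k s) \<le> M * (s - a) powr (-\<nu>)"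
  shows "k integrable_on {a..b}" "norm (integral {a..b} k) \<le> M / (1 - \<nu>) * (b - a) powr (1 - \<nu>)"
proof -
  define F where "F = (\<lambda>s. integral {s..b} k)"
  have cont: "continuous_on {s..t} k" if "a < s" "t \<le> b" for s t
    by (rule continuous_on_subset[OF k]) (use that in auto)
  have M1: "M / (1 - \<nu>) \<ge> 0" using M \<nu> by simp
  have Fd: "norm (F s - F t) \<le> M / (1 - \<nu>) * (t - a) powr (1 - \<nu>)" if "a < s" "s \<le> t" "t \<le> b" for s t
  proof -
    have "F s - F t = integral {s..t} k"
      unfolding F_def using that Henstock_Kurzweil_Integration.integral_combine[of s t b k]
        integrable_continuous_real[OF cont[OF that(1) order_refl]] by (simp add: algebra_simps)
    also have "norm \<dots> \<le> integral {s..t} (\<lambda>r. M * (r - a) powr (-\<nu>))"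
      using that by (intro integral_norm_bound_integral integrable_continuous_real cont bd
          has_integral_integrable[OF integral_powr_difference] \<nu>) auto
    also have "\<dots> = M / (1 - \<nu>) * (t - a) powr (1 - \<nu>) - M / (1 - \<nu>) * (s - a) powr (1 - \<nu>)"
      by (rule integral_unique[OF integral_powr_difference]) (use that \<nu> in auto)
    also have "\<dots> \<le> M / (1 - \<nu>) * (t - a) powr (1 - \<nu>)"
      using mult_nonneg_nonneg[OF M1, of "(s - a) powr (1 - \<nu>)"] by simp
    finally show ?thesis .
  qed
  define s where "s = (\<lambda>n::nat. a + (b - a) / (n + 1))"
  have s: "a < s n" "s n \<le> b" for n
    using ab mult_left_mono[of 1 "1 + real n" "b - a"] by (auto simp: s_def field_simps)
  have s_dec: "s m \<le> s n" if "n \<le> m" for m n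
    using ab that by (auto simp: s_def intro!: divide_left_mono)
  have s_lim: "s \<longlonglongrightarrow> a"
  proof -
    have "(\<lambda>n. a + (b - a) * inverse (real (Suc n))) \<longlonglongrightarrow> a + (b - a) * 0"
      by (rule tendsto_add[OF tendsto_const tendsto_mult[OF tendsto_const LIMSEQ_inverse_real_of_nat]])
    then show ?thesis by (simp add: s_def[abs_def] divide_inverse add.commute)
  qed
  have p_lim: "(\<lambda>n. M / (1 - \<nu>) * (s n - a) powr (1 - \<nu>)) \<longlonglongrightarrow> 0"
  proof -
    have "(\<lambda>n. s n - a) \<longlonglongrightarrow> 0" using s_lim by (simp add: LIM_zero_iff)
    then have "(\<lambda>n. (s n - a) powr (1 - \<nu>)) \<longlonglongrightarrow> 0"
      using \<nu> s(1) by (intro tendsto_zero_powrI[OF _ tendsto_const]) (auto simp: less_imp_le)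
    then show ?thesis by (rule tendsto_mult_right_zero)
  qed
  have "Cauchy (\<lambda>n. F (s n))"
  proof (rule metric_CauchyI)
    fix e :: real assume "e > 0"
    then obtain N where N: "M / (1 - \<nu>) * (s N - a) powr (1 - \<nu>) < e / 2"
      using order_tendstoD(2)[OF p_lim, of "e/2"] by (auto simp: eventually_sequentially)
    have "dist (F (s m)) (F (s n)) < e" if "m \<ge> N" "n \<ge> N" for m n
      using Fd[OF s(1) s_dec[OF that(1)] s(2)] Fd[OF s(1) s_dec[OF that(2)] s(2)] N
        dist_triangle2[of "F (s m)" "F (s n)" "F (s N)"] unfolding dist_norm by linarith
    then show "\<exists>N. \<forall>m\<ge>N. \<forall>n\<ge>N. dist (F (s m)) (F (s n)) < e" by blast
  qed
  then obtain L where L: "(\<lambda>n. F (s n)) \<longlonglongrightarrow> L" by (auto simp: Cauchy_convergent_iff convergent_def)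
  have FL: "norm (L - F t) \<le> M / (1 - \<nu>) * (t - a) powr (1 - \<nu>)" if t: "a < t" "t \<le> b" for t
  proof (rule Lim_norm_ubound[OF _ tendsto_diff[OF L tendsto_const]])
    have "\<forall>\<^sub>F n in sequentially. s n < t" by (rule order_tendstoD(2)[OF s_lim t(1)])
    then show "\<forall>\<^sub>F n in sequentially. norm (F (s n) - F t) \<le> M / (1 - \<nu>) * (t - a) powr (1 - \<nu>)"
      by eventually_elim (use Fd s t in auto)
  qed auto
  \<comment> \<open>The primitive normalised to vanish at \<open>a\<close>, where \<open>F\<close>
    may not behave well: the value of \<open>k\<close> at the singular end point is arbitrary. Its
    value at \<open>b\<close> is \<open>L\<close>.\<close>
  define G where "G = (\<lambda>t. if t = a then 0 else L - F t)"
  have derF: "(F has_vector_derivative - k t) (at t within {c..b})" if "a < c" "t \<in> {c..b}" for t c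
    unfolding F_def by (rule integral_has_vector_derivative'[OF cont[OF that(1) order_refl] that(2)])
  have "(k has_integral (G b - G a)) {a..b}"
  proof (rule fundamental_theorem_of_calculus_interior)
    show "continuous_on {a..b} G"
      unfolding continuous_on_eq_continuous_within
    proof
      fix t assume t: "t \<in> {a..b}"
      show "continuous (at t within {a..b}) G"
      proof (cases "t = a")
        case True
        have "(G \<longlongrightarrow> 0) (at a within {a..b})"
        proof (rule Lim_null_comparison)
          have "\<forall>\<^sub>F x in at a within {a..b}. x \<in> {a..b} \<and> x \<noteq> a" by (simp add: eventually_at_filter)
          then show "\<forall>\<^sub>F x in at a within {a..b}. norm (G x) \<le> M / (1 - \<nu>) * (x - a) powr (1 - \<nu>)"
            by eventually_elim (use FL in \<open>auto simp: G_def\<close>)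
          have "((\<lambda>x. x - a) \<longlongrightarrow> a - a) (at a within {a..b})" by (intro tendsto_intros)
          moreover have "\<forall>\<^sub>F x in at a within {a..b}. 0 \<le> x - a" by (simp add: eventually_at_filter)
          ultimately have "((\<lambda>x. (x - a) powr (1 - \<nu>)) \<longlongrightarrow> 0) (at a within {a..b})"
            using \<nu> by (intro tendsto_zero_powrI[OF _ tendsto_const]) auto
          then show "((\<lambda>x. M / (1 - \<nu>) * (x - a) powr (1 - \<nu>)) \<longlongrightarrow> 0) (at a within {a..b})"
            by (rule tendsto_mult_right_zero)
        qed
        then show ?thesis by (simp add: True continuous_within G_def)
      next
        case False
        define c where "c = (a + t) / 2"
        have c: "a < c" "t \<in> {c<..b}" using False t by (auto simp: c_def)
        have "continuous (at t within {c..b}) F"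
          using has_vector_derivative_continuous[OF derF[OF c(1)]] c by auto
        then have "continuous (at t within {c..b}) (\<lambda>t. L - F t)" by (intro continuous_intros)
        then have "((\<lambda>t. L - F t) \<longlongrightarrow> L - F t) (at t within {c..b})" by (simp add: continuous_within)
        also have "at t within {c..b} = at t within {a..b}"
          by (rule at_within_nhd[of _ "{c<..}"]) (use c in auto)
        finally have "((\<lambda>t. L - F t) \<longlongrightarrow> G t) (at t within {a..b})" using False by (simp add: G_def)
        moreover have "\<forall>\<^sub>F x in at t within {a..b}. L - F x = G x"
        proof -
          have "\<forall>\<^sub>F x in at t within {a..b}. x > c" using c by (intro order_tendstoD(1)[OF tendsto_ident_at]) auto
          then show ?thesis by eventually_elim (use c in \<open>auto simp: G_def\<close>)
        qed
        ultimately show ?thesis by (simp add: continuous_within tendsto_cong)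
      qed
    qed
    fix t assume t: "t \<in> {a<..<b}"
    define c where "c = (a + t) / 2"
    have c: "a < c" "t \<in> {c<..<b}" using t by (auto simp: c_def)
    have "(F has_vector_derivative - k t) (at t)"
      using derF[OF c(1), of t] c(2) at_within_Icc_at[of c t b] by simp
    then have "((\<lambda>t. L - F t) has_vector_derivative k t) (at t)" by (auto intro!: derivative_eq_intros)
    then show "(G has_vector_derivative k t) (at t)"
      by (rule has_vector_derivative_transform_within_open[where S="{a<..}"]) (use t in \<open>auto simp: G_def\<close>)
  qed (use ab in auto)
  then have I: "(k has_integral L) {a..b}" using ab by (simp add: G_def F_def)
  then show "k integrable_on {a..b}" by (rule has_integral_integrable)
  show "norm (integral {a..b} k) \<le> M / (1 - \<nu>) * (b - a) powr (1 - \<nu>)"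
    using FL[of b] ab integral_unique[OF I] by (simp add: F_def)
qed

text \<open>Riemann sums obey the bound by subadditivity, and \<open>p\<close> passes to their limit
  because it is dominated by a multiple of the norm. That multiple \<open>M\<close> disappears from
  the result, so it may be as large as a smoothing constant at a short time.\<close>

lemma seminorm_integral_bound:
  fixes p :: "'b::banach \<Rightarrow> real" and h :: "real \<Rightarrow> 'b"
  assumes add: "\<And>x y. p (x + y) \<le> p x + p y" and scale: "\<And>r x. p (r *\<^sub>R x) = \<bar>r\<bar> * p x"
    and M: "\<And>x. p x \<le> M * norm x"
    and h: "continuous_on {a..b} h" and ab: "a \<le> b" and K: "\<And>s. s \<in> {a..b} \<Longrightarrow> p (h s) \<le> K"
  shows "p (integral {a..b} h) \<le> K * (b - a)"
proof (rule field_le_epsilon)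
  fix e :: real assume e: "e > 0"
  define I where "I = integral {a..b} h"
  have M0: "\<bar>M\<bar> + 1 > 0" by simp
  have "(h has_integral I) {a..b}" unfolding I_def by (intro integrable_integral integrable_continuous_real h)
  then obtain \<gamma> where \<gamma>: "gauge \<gamma>" "\<And>\<D>. \<D> tagged_division_of cbox a b \<Longrightarrow> \<gamma> fine \<D> \<Longrightarrow>
       norm ((\<Sum>(x, k)\<in>\<D>. measure lborel k *\<^sub>R h x) - I) < e / (\<bar>M\<bar> + 1)"
    using e M0 unfolding cbox_interval[symmetric] has_integral by (metis divide_pos_pos)
  obtain \<D> where \<D>: "\<D> tagged_division_of cbox a b" "\<gamma> fine \<D>" using fine_division_exists[OF \<gamma>(1)] by blast
  define s where "s = (\<Sum>(x, k)\<in>\<D>. measure lborel k *\<^sub>R h x)"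
  have p0: "p 0 = 0" using scale[of 0 0] by simp
  have psum: "p (sum w Q) \<le> (\<Sum>q\<in>Q. p (w q))" if "finite Q" for Q :: "(real \<times> real set) set" and w
    using that
  proof (induction Q)
    case (insert q Q)
    then show ?case using add[of "w q" "sum w Q"] by simp
  qed (simp add: p0)
  have "p s \<le> (\<Sum>q\<in>\<D>. p (case q of (x, k) \<Rightarrow> measure lborel k *\<^sub>R h x))"
    unfolding s_def using \<D>(1) by (intro psum) (simp add: tagged_division_of_def tagged_partial_division_of_def)
  also have "\<dots> \<le> (\<Sum>(x, k)\<in>\<D>. K * measure lborel k)"
  proof (intro sum_mono, clarify)
    fix x k assume "(x, k) \<in> \<D>"
    then have "x \<in> {a..b}" using tag_in_interval[OF \<D>(1)] by auto
    then show "p (measure lborel k *\<^sub>R h x) \<le> K * measure lborel k"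
      using mult_left_mono[OF K, of x "measure lborel k"] by (simp add: scale mult.commute)
  qed
  also have "\<dots> = K * (\<Sum>(x, k)\<in>\<D>. measure lborel k)" by (simp add: sum_distrib_left case_prod_unfold)
  also have "(\<Sum>(x, k)\<in>\<D>. measure lborel k) = b - a"
    using additive_content_tagged_division[OF \<D>(1)] ab by simp
  finally have "p s \<le> K * (b - a)" .
  moreover have "p (I - s) \<le> e"
  proof -
    have "M \<le> \<bar>M\<bar> + 1" by simp
    then have "p (I - s) \<le> (\<bar>M\<bar> + 1) * norm (I - s)"
      by (intro order_trans[OF M mult_right_mono]) auto
    also have "\<dots> \<le> (\<bar>M\<bar> + 1) * (e / (\<bar>M\<bar> + 1))"
      using \<gamma>(2)[OF \<D>] by (intro mult_left_mono) (auto simp: s_def norm_minus_commute)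
    also have "\<dots> = e" using M0 by simp
    finally show ?thesis .
  qed
  ultimately show "p (integral {a..b} h) \<le> K * (b - a) + e"
    using add[of s "I - s"] by (simp add: I_def)
qed

section \<open>Time increments and the evolution property\<close>

context smoothing_semigroup
begin

lemma AS_bound: "0 < t \<Longrightarrow> t \<le> T \<Longrightarrow> norm (A (S t x)) \<le> C * (C / t * norm x)"
  using order_trans[OF A_bound[OF S_smooth[of t x]] mult_left_mono[OF S_smooth_bound[of t x]]] C by simp

lemma AS_bounded_linear:
  assumes "0 < t" "t \<le> T"
  shows "bounded_linear (\<lambda>x. A (S t x))"
proof (rule bounded_linear_intro[where K="C * (C / t)"])
  show "A (S t (x + y)) = A (S t x) + A (S t y)" for x y
    using assms by (simp add: linear_add[OF S_linear] A_add S_smooth)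
  show "A (S t (r *\<^sub>R x)) = r *\<^sub>R A (S t x)" for r x
    using assms by (simp add: linear_scale[OF S_linear] A_scale S_smooth)
  show "norm (A (S t x)) \<le> norm x * (C * (C / t))" for x
    using AS_bound[OF assms, of x] by (simp add: mult_ac)
qed

lemma A_minus: "x \<in> carr E1 \<Longrightarrow> A (- x) = - A x"
  using A_scale[of x "-1"] by simp

lemma A_diff: "x \<in> carr E1 \<Longrightarrow> y \<in> carr E1 \<Longrightarrow> A (x - y) = A x - A y"
  using A_add[of x "-y"] A_minus[of y] E1.minus_mem[of y] by simp

lemma S_increment_bound:
  assumes x: "x \<in> carr E1" and h: "0 \<le> h" "h \<le> T"
  shows "norm (S h x - x) \<le> C * norm (A x) * h"
proof -
  have "norm (integral {0..h} (\<lambda>s. S s (A x))) \<le> C * norm (A x) * (h - 0)"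
    using h by (intro integral_bound continuous_on_S S_bound) auto
  then show ?thesis using integral_unique[OF S_ftc[OF x h(1)]] by simp
qed

text \<open>The graph norm of an increment over time \<open>h\<close> costs one power of
  \<open>A\<close> for the factor \<open>h\<close> and another for the norm. Both are paid by
  splitting \<open>S \<epsilon>\<close> into two halves, each giving a factor of order
  \<open>1 / \<epsilon>\<close>. The term with \<open>T\<close> is the lower order part, from
  \<open>\<epsilon> \<le> T\<close>.\<close>

lemma S_increment_smooth:
  assumes h: "0 \<le> h" "h \<le> T" and e: "0 < \<epsilon>" "\<epsilon> \<le> T"
  shows "nrm E1 (S h (S \<epsilon> x) - S \<epsilon> x) \<le> (C^4 * T + 4 * C^6) * (h / \<epsilon>^2) * norm x"
proof -
  define y where "y = S \<epsilon> x"
  have y: "y \<in> carr E1" unfolding y_def by (rule S_smooth[OF e(1)])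
  have Sy: "S h y \<in> carr E1" "A (S h y) = S h (A y)" using A_commute[OF y h(1)] by auto
  define z where "z = A (S (\<epsilon>/2) x)"
  have Ay: "A y = S (\<epsilon>/2) z"
  proof -
    have "y = S (\<epsilon>/2) (S (\<epsilon>/2) x)" unfolding y_def using S_add[of "\<epsilon>/2" "\<epsilon>/2" x] e by simp
    then show ?thesis using A_commute[OF S_smooth[of "\<epsilon>/2" x], of "\<epsilon>/2"] e by (simp add: z_def)
  qed
  have z: "norm z \<le> C * (C / (\<epsilon>/2) * norm x)" unfolding z_def by (rule AS_bound) (use e in auto)
  have AA: "norm (A (A y)) \<le> C * (C / (\<epsilon>/2) * (C * (C / (\<epsilon>/2) * norm x)))"
    unfolding Ay using e C z by (intro order_trans[OF AS_bound] mult_left_mono) auto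
  have "norm (S h (A y) - A y) \<le> C * norm (A (A y)) * h"
    by (rule S_increment_bound) (use h Ay S_smooth[of "\<epsilon>/2" z] e in auto)
  also have "\<dots> \<le> C * (C * (C / (\<epsilon>/2) * (C * (C / (\<epsilon>/2) * norm x)))) * h"
    using C h AA by (intro mult_left_mono mult_right_mono) auto
  also have "\<dots> = 4 * C^5 * (h / \<epsilon>^2) * norm x" using e by (simp add: field_simps power_numeral_reduce)
  finally have 1: "norm (A (S h y - y)) \<le> 4 * C^5 * (h / \<epsilon>^2) * norm x" by (simp add: A_diff Sy y)
  have "norm (S h y - y) \<le> C * norm (A y) * h" by (rule S_increment_bound[OF y h])
  also have "\<dots> \<le> C * (C * (C / \<epsilon> * norm x)) * h"
    unfolding y_def using C h AS_bound[OF e, of x] by (intro mult_left_mono mult_right_mono) auto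
  also have "\<dots> = C^3 * \<epsilon> * (h / \<epsilon>^2) * norm x" using e by (simp add: field_simps power_numeral_reduce)
  also have "\<dots> \<le> C^3 * T * (h / \<epsilon>^2) * norm x"
    using C h e by (intro mult_left_mono mult_right_mono) auto
  finally have 2: "norm (S h y - y) \<le> C^3 * T * (h / \<epsilon>^2) * norm x" .
  have "nrm E1 (S h y - y) \<le> C * (norm (S h y - y) + norm (A (S h y - y)))"
    by (intro graph_bound E1.diff_mem Sy y)
  also have "\<dots> \<le> C * (C^3 * T * (h / \<epsilon>^2) * norm x + 4 * C^5 * (h / \<epsilon>^2) * norm x)"
    using C 1 2 by (intro mult_left_mono add_mono) auto
  also have "\<dots> = (C^4 * T + 4 * C^6) * (h / \<epsilon>^2) * norm x" by (simp add: algebra_simps power_numeral_reduce)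
  finally show ?thesis by (simp add: y_def)
qed

lemma continuous_kernel:
  "continuous_on {a..t} k \<Longrightarrow> t - a \<le> T \<Longrightarrow> t \<le> c \<Longrightarrow> c - a \<le> T \<Longrightarrow> continuous_on {a..t} (\<lambda>s. S (c - s) (k s))"
  by (intro continuous_on_S continuous_intros) auto

definition duhamel :: "(real \<Rightarrow> 'a) \<Rightarrow> real \<Rightarrow> 'a" where
  "duhamel g t = integral {0..t} (\<lambda>s. S (t - s) (g s))"

text \<open>The mild equation restarted at every time \<open>a\<close>. For \<open>a > 0\<close> the
  window \<open>{a..t}\<close> avoids the singularity of the forcing at time 0, which is how
  regularity for positive times is obtained.\<close>

definition evolves :: "(real \<Rightarrow> 'a) \<Rightarrow> (real \<Rightarrow> 'a) \<Rightarrow> bool" where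
  "evolves u g \<longleftrightarrow> (\<forall>a t. 0 \<le> a \<longrightarrow> a \<le> t \<longrightarrow> t \<le> T \<longrightarrow>
     u t = S (t - a) (u a) + integral {a..t} (\<lambda>s. S (t - s) (g s)))"

lemma evolvesD: "evolves u g \<Longrightarrow> 0 \<le> a \<Longrightarrow> a \<le> t \<Longrightarrow> t \<le> T \<Longrightarrow>
     u t = S (t - a) (u a) + integral {a..t} (\<lambda>s. S (t - s) (g s))"
  unfolding evolves_def by blast

lemma evolvesI:
  assumes u: "\<And>t. 0 \<le> t \<Longrightarrow> t \<le> T \<Longrightarrow> u t = S t (u 0) + duhamel g t"
    and int: "\<And>t. 0 \<le> t \<Longrightarrow> t \<le> T \<Longrightarrow> (\<lambda>s. S (t - s) (g s)) integrable_on {0..t}"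
  shows "evolves u g"
  unfolding evolves_def
proof (intro allI impI)
  fix a t assume at: "0 \<le> a" "a \<le> t" "t \<le> T"
  have "S (t - a) (duhamel g a) = integral {0..a} (\<lambda>s. S (t - a) (S (a - s) (g s)))"
    unfolding duhamel_def using at by (intro S_integral int) auto
  also have "\<dots> = integral {0..a} (\<lambda>s. S (t - s) (g s))"
  proof (rule integral_cong)
    fix s assume "s \<in> {0..a}"
    then show "S (t - a) (S (a - s) (g s)) = S (t - s) (g s)"
      using at S_add[of "t - a" "a - s" "g s"] by simp
  qed
  finally have "duhamel g t = S (t - a) (duhamel g a) + integral {a..t} (\<lambda>s. S (t - s) (g s))"
    using Henstock_Kurzweil_Integration.integral_combine[OF at(1,2) int] at by (simp add: duhamel_def)
  moreover have "S (t - a) (S a (u 0)) = S t (u 0)" using S_add[of "t - a" a "u 0"] at by simp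
  ultimately show "u t = S (t - a) (u a) + integral {a..t} (\<lambda>s. S (t - s) (g s))"
    using u[of t] u[of a] at by (simp add: linear_add[OF S_linear])
qed

end

text \<open>\<open>Y\<close> is the space in which convolutions are measured. It will be
  \<open>E\<^sub>\<theta>\<close> for existence and \<open>E1\<close> itself for strong
  regularity.\<close>

locale target_space = smoothing_semigroup S E1 A T C + Y: banach_nspace Y
  for S :: "real \<Rightarrow> 'a::banach \<Rightarrow> 'a" and E1 :: "'a nspace" and A :: "'a \<Rightarrow> 'a" and T C :: real and Y :: "'a nspace" +
  fixes CY :: real
  assumes CY: "CY \<ge> 1"
    and Y_emb: "x \<in> carr Y \<Longrightarrow> norm x \<le> CY * nrm Y x"
    and E1_Y: "x \<in> carr E1 \<Longrightarrow> x \<in> carr Y \<and> nrm Y x \<le> CY * nrm E1 x"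
    and S_Y: "x \<in> carr Y \<Longrightarrow> 0 \<le> t \<Longrightarrow> t \<le> T \<Longrightarrow> S t x \<in> carr Y \<and> nrm Y (S t x) \<le> CY * nrm Y x"
begin

lemma S_smooth_Y: "0 < t \<Longrightarrow> S t x \<in> carr Y"
  using E1_Y[OF S_smooth] by blast

lemma S_smooth_bound_Y: "0 < t \<Longrightarrow> t \<le> T \<Longrightarrow> nrm Y (S t x) \<le> CY * (C / t) * norm x"
  using E1_Y[OF S_smooth[of t x]] mult_left_mono[OF S_smooth_bound[of t x], of CY] CY by simp

text \<open>The sum of the geometric series with ratio \<open>(1/2) powr (1 - \<alpha>)\<close>, by
  which the dyadic pieces of a convolution decay.\<close>

definition conv_const :: "real \<Rightarrow> real" where
  "conv_const \<alpha> = 1 / (1 - (1/2) powr (1 - \<alpha>))"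

lemma conv_const_pos: "\<alpha> < 1 \<Longrightarrow> (1/2::real) powr (1 - \<alpha>) < 1" "\<alpha> < 1 \<Longrightarrow> conv_const \<alpha> > 0"
proof -
  assume "\<alpha> < 1"
  then show "(1/2::real) powr (1 - \<alpha>) < 1" using powr_less_mono2[of "1 - \<alpha>" "1/2" 1] by simp
  then show "conv_const \<alpha> > 0" by (simp add: conv_const_def)
qed

text \<open>The interval is cut dyadically at its right end point. On each piece one smoothing operator
  can be pulled out of the integral, so that only integrals with values in \<open>E\<^sub>0\<close> occur.\<close>

lemma convolution_bound:
  assumes at: "a < t" "t - a \<le> T" and k: "continuous_on {a..t} k" and \<alpha>: "0 \<le> \<alpha>" "\<alpha> < 1" and G: "G \<ge> 0"
    and bd: "\<And>s. a \<le> s \<Longrightarrow> s < t \<Longrightarrow> nrm Y (S (t - s) (k s)) \<le> G * (t - s) powr (-\<alpha>)"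
  shows "integral {a..t} (\<lambda>s. S (t - s) (k s)) \<in> carr Y"
    "nrm Y (integral {a..t} (\<lambda>s. S (t - s) (k s))) \<le> conv_const \<alpha> * (t - a) powr (1 - \<alpha>) * G"
proof -
  define q where "q = (1/2::real) powr (1 - \<alpha>)"
  have q: "0 < q" "q < 1" using conv_const_pos(1)[OF \<alpha>(2)] by (auto simp: q_def)
  define r where "r = (\<lambda>n::nat. (t - a) * (1/2)^n)"
  have r: "r n > 0" "r (Suc n) = r n / 2" "r n \<le> t - a" for n
    using at power_le_one[of "1/2::real" n] mult_left_mono[of "(1/2)^n" 1 "t - a"] by (auto simp: r_def)
  have rq: "r n powr (1 - \<alpha>) = (t - a) powr (1 - \<alpha>) * q ^ n" for n
    using at by (simp add: r_def q_def powr_mult powr_powr powr_realpow[symmetric] mult.commute)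
  define p where "p = (\<lambda>n. t - r n)"
  have p: "a \<le> p n" "p n \<le> p (Suc n)" "p n < t" for n using r[of n] r(2)[of n] by (auto simp: p_def)
  have p0: "p 0 = a" by (simp add: p_def r_def)
  define F where "F = (\<lambda>s. S (t - s) (k s))"
  have contF: "continuous_on {a..t} F" unfolding F_def by (rule continuous_kernel[OF k]) (use at in auto)
  define w where "w = (\<lambda>n. integral {p n..p (Suc n)} F)"
  have w: "w n \<in> carr Y \<and> nrm Y (w n) \<le> G * r (Suc n) powr (1 - \<alpha>)" for n
  proof -
    define \<tau> where "\<tau> = r (Suc n)"
    have \<tau>: "0 < \<tau>" "\<tau> \<le> T" "\<tau> = p (Suc n) - p n" "p (Suc n) = t - \<tau>"
      using r[of "Suc n"] r(2)[of n] at by (auto simp: \<tau>_def p_def)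
    \<comment> \<open>On this piece the time left until \<open>t\<close> is at least
      \<open>\<tau>\<close>, so \<open>S \<tau>\<close> can be taken out of the kernel; it maps into
      \<open>Y\<close> while \<open>h\<close> is integrated in \<open>E0\<close>.\<close>
    define h where "h = (\<lambda>s. S (t - \<tau> - s) (k s))"
    have contk: "continuous_on {p n..p (Suc n)} k"
      by (rule continuous_on_subset[OF k]) (use p[of n] p(3)[of "Suc n"] in auto)
    have conth: "continuous_on {p n..p (Suc n)} h"
      unfolding h_def by (rule continuous_kernel[OF contk]) (use p[of n] \<tau> at in linarith)+
    have eq: "F s = S \<tau> (h s)" if "s \<in> {p n..p (Suc n)}" for s
    proof -
      have "0 \<le> t - \<tau> - s" using that \<tau>(4) by simp
      then show ?thesis using S_add[of \<tau> "t - \<tau> - s" "k s"] \<tau>(1) by (simp add: F_def h_def)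
    qed
    have "w n = integral {p n..p (Suc n)} (\<lambda>s. S \<tau> (h s))"
      unfolding w_def by (intro integral_cong eq)
    also have "\<dots> = S \<tau> (integral {p n..p (Suc n)} h)"
      by (rule S_integral[symmetric, OF less_imp_le[OF \<tau>(1)] integrable_continuous_real[OF conth]])
    finally have wn: "w n = S \<tau> (integral {p n..p (Suc n)} h)" .
    have "nrm Y (S \<tau> (integral {p n..p (Suc n)} h)) \<le> G * \<tau> powr (-\<alpha>) * (p (Suc n) - p n)"
    proof (rule seminorm_integral_bound[where M="CY * (C / \<tau>)"])
      show "nrm Y (S \<tau> (x + y)) \<le> nrm Y (S \<tau> x) + nrm Y (S \<tau> y)" for x y
        using \<tau>(1) by (simp add: linear_add[OF S_linear] Y.nrm_triangle S_smooth_Y)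
      show "nrm Y (S \<tau> (c *\<^sub>R x)) = \<bar>c\<bar> * nrm Y (S \<tau> x)" for c x
        using \<tau>(1) by (simp add: linear_scale[OF S_linear] Y.nrm_scale S_smooth_Y)
      show "nrm Y (S \<tau> x) \<le> CY * (C / \<tau>) * norm x" for x by (rule S_smooth_bound_Y[OF \<tau>(1,2)])
      show "nrm Y (S \<tau> (h s)) \<le> G * \<tau> powr (-\<alpha>)" if s: "s \<in> {p n..p (Suc n)}" for s
      proof -
        have "nrm Y (F s) \<le> G * (t - s) powr (-\<alpha>)" unfolding F_def
          using s p[of n] p(3)[of "Suc n"] by (intro bd) auto
        also have "\<dots> \<le> G * \<tau> powr (-\<alpha>)"
          using s \<tau>(1,4) \<alpha> G by (intro mult_left_mono powr_mono2') auto
        finally show ?thesis using eq[OF s] by simp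
      qed
    qed (use conth p[of n] in auto)
    also have "\<dots> = G * \<tau> powr (1 - \<alpha>)"
      using \<tau>(1) unfolding \<tau>(3)[symmetric] by (simp add: powr_diff powr_minus divide_inverse mult_ac)
    finally show ?thesis using wn S_smooth_Y[OF \<tau>(1)] by (simp add: \<tau>_def)
  qed
  have sums: "(\<lambda>n. (t - a) powr (1 - \<alpha>) * G * q ^ n) sums ((t - a) powr (1 - \<alpha>) * G * (1 / (1 - q)))"
    using q by (intro sums_mult geometric_sums) auto
  have le: "nrm Y (w n) \<le> (t - a) powr (1 - \<alpha>) * G * q ^ n" for n
  proof -
    have "nrm Y (w n) \<le> G * ((t - a) powr (1 - \<alpha>) * q ^ Suc n)" using w[of n] rq[of "Suc n"] by simp
    also have "\<dots> \<le> G * ((t - a) powr (1 - \<alpha>) * q ^ n)"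
      using q G by (intro mult_left_mono) (auto simp: mult_left_le_one_le)
    finally show ?thesis by (simp add: mult_ac)
  qed
  obtain x where x: "x \<in> carr Y" "(\<lambda>n. nrm Y ((\<Sum>i<n. w i) - x)) \<longlonglongrightarrow> 0"
    "nrm Y x \<le> (\<Sum>n. (t - a) powr (1 - \<alpha>) * G * q ^ n)"
    using Y.summable_converges[of w "\<lambda>n. (t - a) powr (1 - \<alpha>) * G * q ^ n"] w le sums_summable[OF sums] by blast
  have part: "(\<Sum>i<n. w i) = integral {a..p n} F" for n
  proof (induction n)
    case (Suc n)
    have "integral {a..p n} F + integral {p n..p (Suc n)} F = integral {a..p (Suc n)} F"
      using p[of n] p[of "Suc n"] at
      by (intro Henstock_Kurzweil_Integration.integral_combine integrable_continuous_real continuous_on_subset[OF contF]) auto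
    then show ?case using Suc by (simp add: w_def)
  qed (simp add: p0)
  have "r \<longlonglongrightarrow> (t - a) * 0" unfolding r_def by (intro tendsto_intros LIMSEQ_realpow_zero) auto
  then have "p \<longlonglongrightarrow> t - 0" unfolding p_def by (intro tendsto_intros) simp
  then have plim: "p \<longlonglongrightarrow> t" by simp
  \<comment> \<open>The partial sums converge in \<open>Y\<close> to \<open>x\<close> and in
    \<open>E0\<close> to the full integral; the embedding makes the two limits equal.\<close>
  have "continuous_on {a..t} (\<lambda>x. integral {a..x} F)"
    by (intro indefinite_integral_continuous_1 integrable_continuous_real contF)
  then have "(\<lambda>n. integral {a..p n} F) \<longlonglongrightarrow> integral {a..t} F"
    by (rule continuous_on_tendsto_compose[OF _ plim]) (use at p in \<open>auto intro!: always_eventually less_imp_le\<close>)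
  moreover have "(\<lambda>n. (\<Sum>i<n. w i)) \<longlonglongrightarrow> x"
  proof (rule LIM_zero_cancel, rule Lim_null_comparison)
    have "(\<Sum>i<n. w i) - x \<in> carr Y" for n using w x by (intro Y.diff_mem Y.sum_mem) auto
    then show "\<forall>\<^sub>F n in sequentially. norm ((\<Sum>i<n. w i) - x) \<le> CY * nrm Y ((\<Sum>i<n. w i) - x)"
      using Y_emb by auto
    show "(\<lambda>n. CY * nrm Y ((\<Sum>i<n. w i) - x)) \<longlonglongrightarrow> 0" by (rule tendsto_mult_right_zero[OF x(2)])
  qed
  ultimately have "integral {a..t} F = x" using LIMSEQ_unique by (simp add: part)
  then show "integral {a..t} (\<lambda>s. S (t - s) (k s)) \<in> carr Y"
    "nrm Y (integral {a..t} (\<lambda>s. S (t - s) (k s))) \<le> conv_const \<alpha> * (t - a) powr (1 - \<alpha>) * G"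
    using x sums_unique[OF sums] by (simp_all add: F_def conv_const_def q_def)
qed

end

section \<open>Mild solutions in time-weighted spaces\<close>

lemma cont_in_continuous_on:
  fixes X :: "'a::real_normed_vector nspace"
  assumes "banach_over Real_Scalars X" and emb: "\<And>x. x \<in> carr X \<Longrightarrow> norm x \<le> c * nrm X x" and u: "cont_in X I u"
  shows "continuous_on I u"
  unfolding continuous_on_def
proof
  interpret banach_nspace X by standard fact
  fix t assume t: "t \<in> I"
  show "(u \<longlongrightarrow> u t) (at t within I)"
  proof (rule LIM_zero_cancel, rule Lim_null_comparison)
    have "\<forall>\<^sub>F s in at t within I. s \<in> I" by (simp add: eventually_at_filter)
    then show "\<forall>\<^sub>F s in at t within I. norm (u s - u t) \<le> c * nrm X (u s - u t)"
      by eventually_elim (use u t in \<open>auto simp: cont_in_def intro!: emb diff_mem\<close>)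
    show "((\<lambda>s. c * nrm X (u s - u t)) \<longlongrightarrow> 0) (at t within I)"
      using u t by (intro tendsto_mult_right_zero) (simp add: cont_in_def)
  qed
qed

text \<open>\<open>X\<close> holds the values of the forcing. The exponent \<open>\<alpha>\<close>
  measures smoothing from \<open>X\<close> to \<open>Y\<close> and must be integrable, while
  \<open>\<theta>\<close> measures smoothing from \<open>E0\<close> to \<open>Y\<close> and may
  equal 1. Their order keeps \<open>t powr (\<theta> - \<alpha>)\<close> bounded on
  \<open>{0<..T}\<close>.\<close>

locale weighted_forcing = target_space S E1 A T C Y CY + X: banach_nspace X
  for S :: "real \<Rightarrow> 'a::banach \<Rightarrow> 'a" and E1 :: "'a nspace" and A :: "'a \<Rightarrow> 'a" and T C :: real
    and Y :: "'a nspace" and CY :: real and X :: "'a nspace" +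
  fixes \<alpha> \<theta> \<nu> :: real
  assumes \<alpha>: "0 \<le> \<alpha>" "\<alpha> < 1" "\<alpha> \<le> \<theta>" and \<theta>: "0 < \<theta>" "\<theta> \<le> 1" and \<nu>: "0 \<le> \<nu>" "\<nu> < 1"
    and X_emb: "x \<in> carr X \<Longrightarrow> norm x \<le> CY * nrm X x"
    and X_S: "x \<in> carr X \<Longrightarrow> 0 < t \<Longrightarrow> t \<le> T \<Longrightarrow> nrm Y (S t x) \<le> CY * t powr (-\<alpha>) * nrm X x"
    and S_0Y: "0 < t \<Longrightarrow> t \<le> T \<Longrightarrow> nrm Y (S t x) \<le> CY * t powr (-\<theta>) * norm x"
begin

definition forcing :: "real \<Rightarrow> (real \<Rightarrow> 'a) \<Rightarrow> bool" where
  "forcing N g \<longleftrightarrow> 0 \<le> N \<and> continuous_on {0<..T} g \<and>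
     (\<forall>s\<in>{0<..T}. g s \<in> carr X \<and> nrm X (g s) \<le> N * s powr (-\<nu>))"

lemma forcingD:
  assumes "forcing N g"
  shows "0 \<le> N" "continuous_on {0<..T} g" "\<And>s. 0 < s \<Longrightarrow> s \<le> T \<Longrightarrow> g s \<in> carr X"
    "\<And>s. 0 < s \<Longrightarrow> s \<le> T \<Longrightarrow> nrm X (g s) \<le> N * s powr (-\<nu>)"
    "\<And>s. 0 < s \<Longrightarrow> s \<le> T \<Longrightarrow> norm (g s) \<le> CY * N * s powr (-\<nu>)"
proof -
  show *: "0 \<le> N" "continuous_on {0<..T} g" "\<And>s. 0 < s \<Longrightarrow> s \<le> T \<Longrightarrow> g s \<in> carr X"
    "\<And>s. 0 < s \<Longrightarrow> s \<le> T \<Longrightarrow> nrm X (g s) \<le> N * s powr (-\<nu>)"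
    using assms by (auto simp: forcing_def)
  fix s assume s: "0 < s" "s \<le> T"
  have "norm (g s) \<le> CY * (N * s powr (-\<nu>))"
    using order_trans[OF X_emb[OF *(3)[OF s]] mult_left_mono[OF *(4)[OF s], of CY]] CY by simp
  then show "norm (g s) \<le> CY * N * s powr (-\<nu>)" by (simp add: mult.assoc)
qed

lemma kernel:
  assumes g: "forcing N g" and t: "0 < t" "t \<le> T"
  shows "(\<lambda>s. S (t - s) (g s)) integrable_on {0..t}"
    "norm (duhamel g t) \<le> C * CY / (1 - \<nu>) * N * t powr (1 - \<nu>)"
proof -
  have cont: "continuous_on {0<..t} (\<lambda>s. S (t - s) (g s))"
    by (rule continuous_on_S[OF _ _ continuous_on_subset[OF forcingD(2)[OF g]]])
      (use t in \<open>auto intro!: continuous_intros\<close>)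
  have M: "C * CY * N \<ge> 0" using C CY forcingD(1)[OF g] by simp
  have bd: "norm (S (t - s) (g s)) \<le> C * CY * N * (s - 0) powr (-\<nu>)" if "s \<in> {0<..t}" for s
  proof -
    have "norm (S (t - s) (g s)) \<le> C * norm (g s)" using that t by (intro S_bound) auto
    also have "\<dots> \<le> C * (CY * N * s powr (-\<nu>))"
      using that t C by (intro mult_left_mono forcingD(5)[OF g]) auto
    finally show ?thesis by (simp add: mult.assoc)
  qed
  show "(\<lambda>s. S (t - s) (g s)) integrable_on {0..t}"
    by (rule improper_integral(1)[OF t(1) cont \<nu>(2) M bd])
  show "norm (duhamel g t) \<le> C * CY / (1 - \<nu>) * N * t powr (1 - \<nu>)"
    using improper_integral(2)[OF t(1) cont \<nu>(2) M bd] by (simp add: duhamel_def)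
qed

lemma kernel_integrable:
  assumes g: "forcing N g" and t: "0 \<le> t" "t \<le> T"
  shows "(\<lambda>s. S (t - s) (g s)) integrable_on {0..t}"
  using kernel(1)[OF g, of t] t integrable_on_refl[of "\<lambda>s. S (0 - s) (g s)" 0]
  by (cases "t = 0") (auto simp: cbox_interval)

lemma duhamel_zero [simp]: "duhamel g 0 = 0"
  by (simp add: duhamel_def)

lemma evolves_mild:
  assumes g: "forcing N g"
  shows "evolves (\<lambda>t. S t u0 + duhamel g t) g"
  by (rule evolvesI) (use kernel_integrable[OF g] in auto)

lemma window_bound:
  assumes g: "forcing N g" and a: "0 < a" "a < t" "t \<le> T"
  shows "integral {a..t} (\<lambda>s. S (t - s) (g s)) \<in> carr Y"
    "nrm Y (integral {a..t} (\<lambda>s. S (t - s) (g s))) \<le> conv_const \<alpha> * (t - a) powr (1 - \<alpha>) * (CY * N * a powr (-\<nu>))"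
proof -
  have cont: "continuous_on {a..t} g" by (rule continuous_on_subset[OF forcingD(2)[OF g]]) (use a in auto)
  have bd: "nrm Y (S (t - s) (g s)) \<le> CY * N * a powr (-\<nu>) * (t - s) powr (-\<alpha>)" if s: "a \<le> s" "s < t" for s
  proof -
    have s': "0 < s" "s \<le> T" using s a by auto
    have "nrm Y (S (t - s) (g s)) \<le> CY * (t - s) powr (-\<alpha>) * nrm X (g s)"
      using s a by (intro X_S forcingD(3)[OF g]) auto
    also have "\<dots> \<le> CY * (t - s) powr (-\<alpha>) * (N * s powr (-\<nu>))"
      using CY by (intro mult_left_mono forcingD(4)[OF g s']) auto
    also have "\<dots> \<le> CY * (t - s) powr (-\<alpha>) * (N * a powr (-\<nu>))"
      using CY forcingD(1)[OF g] s a \<nu> by (intro mult_left_mono powr_mono2') auto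
    finally show ?thesis by (simp add: mult_ac)
  qed
  have G: "0 \<le> CY * N * a powr (-\<nu>)" using CY forcingD(1)[OF g] by simp
  have ta: "t - a \<le> T" using a by simp
  show "integral {a..t} (\<lambda>s. S (t - s) (g s)) \<in> carr Y"
    "nrm Y (integral {a..t} (\<lambda>s. S (t - s) (g s))) \<le> conv_const \<alpha> * (t - a) powr (1 - \<alpha>) * (CY * N * a powr (-\<nu>))"
    using convolution_bound[OF a(2) ta cont \<alpha>(1,2) G bd] by auto
qed

lemma evolves_in_Y:
  assumes u: "evolves u g" and g: "forcing N g" and t: "0 < t" "t \<le> T"
  shows "u t \<in> carr Y"
  using evolvesD[OF u, of "t/2" t] window_bound(1)[OF g, of "t/2" t] S_smooth_Y[of "t/2" "u (t/2)"] t
  by (auto intro: Y.add_mem)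

text \<open>The first summand bounds the Duhamel integral in \<open>E0\<close>; the second and third
  bound the first and second half of it in \<open>Y\<close>, the doublings absorbing the powers of
  \<open>t/2\<close>.\<close>

definition duhamel_const :: real where
  "duhamel_const = C * CY / (1 - \<nu>) + 2 * CY * (C * CY / (1 - \<nu>)) + 2 * conv_const \<alpha> * CY * max 1 T"

lemma duhamel_const: "0 \<le> duhamel_const"
  using C CY \<nu> conv_const_pos(2)[OF \<alpha>(2)] by (simp add: duhamel_const_def)

text \<open>The integral is split at \<open>t/2\<close>: the first half stays away from the singularity of the kernel,
  the second half from that of the forcing.\<close>

lemma duhamel_bounds:
  assumes g: "forcing N g" and t: "0 < t" "t \<le> T"
  shows "duhamel g t \<in> carr Y" "norm (duhamel g t) \<le> duhamel_const * N * t powr (1 - \<nu>)"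
    "t powr \<theta> * nrm Y (duhamel g t) \<le> duhamel_const * N * t powr (1 - \<nu>)"
proof -
  note N = forcingD(1)[OF g]
  define K0 where "K0 = C * CY / (1 - \<nu>)"
  define W where "W = conv_const \<alpha>"
  have K0: "K0 \<ge> 0" using C CY \<nu> by (simp add: K0_def)
  have W: "W > 0" using conv_const_pos(2)[OF \<alpha>(2)] by (simp add: W_def)
  have d: "duhamel_const = K0 + (2 * CY * K0 + 2 * W * CY * max 1 T)" by (simp add: duhamel_const_def K0_def W_def)
  have Np: "0 \<le> N * t powr (1 - \<nu>)" using N by simp
  have pos: "0 \<le> 2 * CY * K0 + 2 * W * CY * max 1 T" using CY K0 W by simp
  have "norm (duhamel g t) \<le> K0 * (N * t powr (1 - \<nu>))" using kernel(2)[OF g t] by (simp add: K0_def mult.assoc)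
  also have "\<dots> \<le> duhamel_const * (N * t powr (1 - \<nu>))" using pos Np by (intro mult_right_mono) (auto simp: d)
  finally show "norm (duhamel g t) \<le> duhamel_const * N * t powr (1 - \<nu>)" by (simp add: mult.assoc)
  have "evolves (\<lambda>t. S t 0 + duhamel g t) g" by (rule evolves_mild[OF g])
  from evolvesD[OF this, of "t/2" t] have split: "duhamel g t = S (t/2) (duhamel g (t/2)) + integral {t/2..t} (\<lambda>s. S (t - s) (g s))"
    using t by (simp add: linear_0[OF S_linear])
  define w where "w = integral {t/2..t} (\<lambda>s. S (t - s) (g s))"
  define v where "v = S (t/2) (duhamel g (t/2))"
  have t2: "0 < t/2" "t/2 < t" "t/2 \<le> T" using t by auto
  have w: "w \<in> carr Y" "nrm Y w \<le> W * (t - t/2) powr (1 - \<alpha>) * (CY * N * (t/2) powr (-\<nu>))"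
    unfolding w_def W_def using window_bound[OF g t2(1,2) t(2)] by auto
  have v: "v \<in> carr Y" unfolding v_def by (rule S_smooth_Y[OF t2(1)])
  show "duhamel g t \<in> carr Y" using split v w by (auto simp: v_def w_def intro: Y.add_mem)
  have "t powr \<theta> * nrm Y v \<le> t powr \<theta> * (CY * (t/2) powr (-\<theta>) * (K0 * N * (t/2) powr (1 - \<nu>)))"
    unfolding v_def
    using CY kernel(2)[OF g t2(1,3)] by (intro mult_left_mono order_trans[OF S_0Y[OF t2(1,3)]]) (auto simp: K0_def)
  also have "\<dots> = (t powr \<theta> * (t/2) powr (-\<theta>)) * (CY * K0 * N * (t/2) powr (1 - \<nu>))" by (simp add: mult_ac)
  also have "t powr \<theta> * (t/2) powr (-\<theta>) = 2 powr \<theta>" using t by (simp add: powr_divide powr_minus field_simps)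
  also have "2 powr \<theta> * (CY * K0 * N * (t/2) powr (1 - \<nu>)) \<le> 2 * (CY * K0 * N * t powr (1 - \<nu>))"
  proof (intro mult_mono)
    show "2 powr \<theta> \<le> (2::real)" using powr_mono[OF \<theta>(2), of 2] by simp
    show "(t/2) powr (1 - \<nu>) \<le> t powr (1 - \<nu>)" using t \<nu> by (intro powr_mono2) auto
  qed (use CY K0 N in auto)
  finally have 1: "t powr \<theta> * nrm Y v \<le> 2 * CY * K0 * (N * t powr (1 - \<nu>))" by (simp add: mult_ac)
  have "t powr \<theta> * nrm Y w \<le> t powr \<theta> * (W * (t/2) powr (1 - \<alpha>) * (CY * N * (t/2) powr (-\<nu>)))"
    using w(2) by (intro mult_left_mono) auto
  also have "\<dots> = W * CY * N * (t powr \<theta> * (t/2) powr (1 - \<alpha>) * (t/2) powr (-\<nu>))" by (simp add: mult_ac)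
  also have "\<dots> \<le> W * CY * N * (2 * max 1 T * t powr (1 - \<nu>))"
  proof (intro mult_left_mono)
    have a: "(t/2) powr (1 - \<alpha>) \<le> t powr (1 - \<alpha>)" using t \<alpha> by (intro powr_mono2) auto
    have b: "(t/2) powr (-\<nu>) \<le> 2 * t powr (-\<nu>)"
    proof -
      have "(t/2) powr (-\<nu>) = 2 powr \<nu> * t powr (-\<nu>)" using t by (simp add: powr_divide powr_minus field_simps)
      moreover have "2 powr \<nu> \<le> (2::real)" using powr_mono[of \<nu> 1 "2::real"] \<nu> by simp
      ultimately show ?thesis by (simp add: mult_right_mono)
    qed
    have c: "t powr (\<theta> - \<alpha>) \<le> max 1 T"
    proof (cases "t \<le> 1")
      case True
      then show ?thesis using powr_mono2[of "\<theta> - \<alpha>" t 1] t \<alpha> by simp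
    next
      case False
      have "t powr (\<theta> - \<alpha>) \<le> t powr 1" using False \<theta> \<alpha> by (intro powr_mono) auto
      then show ?thesis using t by simp
    qed
    have "t powr \<theta> * (t/2) powr (1 - \<alpha>) * (t/2) powr (-\<nu>) \<le> t powr \<theta> * t powr (1 - \<alpha>) * (2 * t powr (-\<nu>))"
      using a b by (intro mult_mono) auto
    also have "\<dots> = 2 * t powr (\<theta> - \<alpha>) * t powr (1 - \<nu>)" using t by (simp add: powr_add[symmetric] algebra_simps)
    also have "\<dots> \<le> 2 * max 1 T * t powr (1 - \<nu>)" using c by (intro mult_right_mono mult_left_mono) auto
    finally show "t powr \<theta> * (t/2) powr (1 - \<alpha>) * (t/2) powr (-\<nu>) \<le> 2 * max 1 T * t powr (1 - \<nu>)" .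
  qed (use W CY N in auto)
  finally have 2: "t powr \<theta> * nrm Y w \<le> 2 * W * CY * max 1 T * (N * t powr (1 - \<nu>))" by (simp add: mult_ac)
  have "t powr \<theta> * nrm Y (duhamel g t) \<le> t powr \<theta> * nrm Y v + t powr \<theta> * nrm Y w"
    using Y.nrm_triangle[OF v w(1)] split by (simp add: v_def w_def distrib_left[symmetric] mult_left_mono)
  also have "\<dots> \<le> (2 * CY * K0 + 2 * W * CY * max 1 T) * (N * t powr (1 - \<nu>))"
    using 1 2 by (simp add: distrib_right)
  also have "\<dots> \<le> duhamel_const * (N * t powr (1 - \<nu>))" using K0 Np by (intro mult_right_mono) (auto simp: d)
  finally show "t powr \<theta> * nrm Y (duhamel g t) \<le> duhamel_const * N * t powr (1 - \<nu>)" by (simp add: mult.assoc)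
qed

text \<open>The difference of \<open>u\<close> at two times splits into the increment of a smoothed
  past state, the contribution of the last \<open>\<epsilon>\<close> time units before
  \<open>s\<close>, and that of \<open>{s..t}\<close>. A choice of \<open>\<epsilon>\<close>
  depending on \<open>t - s\<close> makes all three of Hoelder type.\<close>

lemma evolves_holder:
  assumes u: "evolves u g" and g: "forcing N g" and a: "0 < a" "a \<le> T"
    and U: "\<And>t. 0 \<le> t \<Longrightarrow> t \<le> T \<Longrightarrow> norm (u t) \<le> U"
  shows "\<exists>K\<ge>0. \<forall>s\<in>{a..T}. \<forall>t\<in>{a..T}. nrm Y (u t - u s) \<le> K * \<bar>t - s\<bar> powr ((1 - \<alpha>) / 4)"
proof -
  note N = forcingD(1)[OF g]
  define \<rho> where "\<rho> = (1 - \<alpha>) / 4"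
  have \<rho>: "0 < \<rho>" "\<rho> \<le> 1/2" "\<rho> \<le> 1 - \<alpha>" "(1 - \<alpha>) * (1/4) = \<rho>" using \<alpha> by (auto simp: \<rho>_def)
  \<comment> \<open>All windows will start at \<open>a/2\<close> or later, so the weight of the
    forcing is bounded by its value at \<open>a/2\<close>.\<close>
  define W where "W = conv_const \<alpha> * (CY * N * (a/2) powr (-\<nu>))"
  have W: "W \<ge> 0" using conv_const_pos(2)[OF \<alpha>(2)] CY N by (simp add: W_def)
  have win: "integral {b..t} (\<lambda>s. S (t - s) (g s)) \<in> carr Y \<and>
     nrm Y (integral {b..t} (\<lambda>s. S (t - s) (g s))) \<le> W * (t - b) powr (1 - \<alpha>)"
    if "a/2 \<le> b" "b < t" "t \<le> T" for b t
  proof -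
    have b: "0 < b" using that a by simp
    have "nrm Y (integral {b..t} (\<lambda>s. S (t - s) (g s))) \<le> conv_const \<alpha> * (t - b) powr (1 - \<alpha>) * (CY * N * b powr (-\<nu>))"
      by (rule window_bound(2)[OF g b that(2,3)])
    also have "\<dots> \<le> conv_const \<alpha> * (t - b) powr (1 - \<alpha>) * (CY * N * (a/2) powr (-\<nu>))"
      using that a CY N \<nu> conv_const_pos(2)[OF \<alpha>(2)] by (intro mult_left_mono powr_mono2') auto
    finally show ?thesis using window_bound(1)[OF g b that(2,3)] by (simp add: W_def mult_ac)
  qed
  have U0: "U \<ge> 0" using U[of 0] norm_ge_zero[of "u 0"] T by linarith
  define D where "D = CY * (C^4 * T + 4 * C^6) * (T / (a/2)^2) * U"
  have D: "D \<ge> 0" using CY C T U0 by (simp add: D_def)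
  define K where "K = D + (CY + 1) * W * (a/2) powr (1 - \<alpha>) + W * T powr (1 - \<alpha>)"
  have K: "K \<ge> 0" using D W CY by (simp add: K_def)
  \<comment> \<open>The time difference is divided by \<open>T\<close> so that
    \<open>\<kappa> \<le> 1\<close>; then every larger power of \<open>\<kappa>\<close> is dominated
    by \<open>\<kappa> powr \<rho>\<close>.\<close>
  have main: "nrm Y (u t - u s) \<le> K * ((t - s) / T) powr \<rho>" if st: "a \<le> s" "s < t" "t \<le> T" for s t
  proof -
    define h where "h = t - s"
    define \<kappa> where "\<kappa> = h / T"
    have h: "0 < h" "h \<le> T" using st a by (auto simp: h_def)
    have hk: "h = T * \<kappa>" using T by (simp add: \<kappa>_def)
    have \<kappa>: "0 < \<kappa>" "\<kappa> \<le> 1" using h T by (auto simp: \<kappa>_def)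
    \<comment> \<open>balances the error \<open>h / \<epsilon>\<^sup>2\<close> of the smooth part against \<open>\<epsilon>\<^sup>1\<^sup>-\<^sup>\<alpha>\<close> for the recent past\<close>
    define \<epsilon> where "\<epsilon> = (a/2) * \<kappa> powr (1/4)"
    have k4: "0 < \<kappa> powr (1/4)" "\<kappa> powr (1/4) \<le> 1" using \<kappa> powr_mono2[of "1/4" \<kappa> 1] by auto
    then have \<epsilon>: "0 < \<epsilon>" "\<epsilon> \<le> a/2" using a mult_left_mono[OF k4(2), of "a/2"] by (auto simp: \<epsilon>_def)
    define w where "w = integral {s - \<epsilon>..s} (\<lambda>r. S (s - r) (g r))"
    define z where "z = integral {s..t} (\<lambda>r. S (t - r) (g r))"
    define y where "y = u (s - \<epsilon>)"
    have w: "w \<in> carr Y" "nrm Y w \<le> W * \<epsilon> powr (1 - \<alpha>)"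
      using win[of "s - \<epsilon>" s] \<epsilon> st a by (auto simp: w_def)
    have z: "z \<in> carr Y" "nrm Y z \<le> W * h powr (1 - \<alpha>)"
      using win[of s t] st a by (auto simp: z_def h_def)
    have us: "u s = S \<epsilon> y + w" using evolvesD[OF u, of "s - \<epsilon>" s] \<epsilon> st a by (simp add: y_def w_def)
    have "u t = S h (u s) + z" using evolvesD[OF u, of s t] st a by (simp add: h_def z_def)
    then have eq: "u t - u s = (S h (S \<epsilon> y) - S \<epsilon> y) + (S h w - w + z)"
      using h by (simp add: us linear_add[OF S_linear])
    have Shw: "S h w \<in> carr Y" "nrm Y (S h w) \<le> CY * nrm Y w" using S_Y[OF w(1)] h by auto
    have m1: "S h (S \<epsilon> y) - S \<epsilon> y \<in> carr E1"
      using A_commute[OF S_smooth[OF \<epsilon>(1)], of h] h S_smooth[OF \<epsilon>(1)] by (auto intro: E1.diff_mem)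
    have "nrm Y (S h (S \<epsilon> y) - S \<epsilon> y) \<le> CY * nrm E1 (S h (S \<epsilon> y) - S \<epsilon> y)" using E1_Y[OF m1] by simp
    also have "\<dots> \<le> CY * ((C^4 * T + 4 * C^6) * (h / \<epsilon>^2) * norm y)"
      using h \<epsilon> CY a by (intro mult_left_mono S_increment_smooth) auto
    also have "\<dots> \<le> CY * ((C^4 * T + 4 * C^6) * (h / \<epsilon>^2) * U)"
      using CY C T h \<epsilon> st a U[of "s - \<epsilon>"] by (intro mult_left_mono) (auto simp: y_def)
    also have "h / \<epsilon>^2 = (T / (a/2)^2) * \<kappa> powr (1/2)"
    proof -
      have "\<epsilon>^2 = (a/2)^2 * \<kappa> powr (1/2)"
        using \<kappa> by (simp add: \<epsilon>_def power_mult_distrib power2_eq_square powr_add[symmetric])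
      moreover have "\<kappa> = \<kappa> powr (1/2) * \<kappa> powr (1/2)" using \<kappa> by (simp add: powr_add[symmetric])
      ultimately have "h / \<epsilon>^2 = T * (\<kappa> powr (1/2) * \<kappa> powr (1/2)) / ((a/2)^2 * \<kappa> powr (1/2))"
        by (simp only: hk)
      then show ?thesis using \<kappa> a by (simp add: field_simps)
    qed
    finally have b1: "nrm Y (S h (S \<epsilon> y) - S \<epsilon> y) \<le> D * \<kappa> powr (1/2)" by (simp add: D_def mult_ac)
    have "\<kappa> powr (1/2) \<le> \<kappa> powr \<rho>" using \<kappa> \<rho> by (intro powr_mono') auto
    from order_trans[OF b1 mult_left_mono[OF this D]]
    have b1: "nrm Y (S h (S \<epsilon> y) - S \<epsilon> y) \<le> D * \<kappa> powr \<rho>" .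
    have "\<epsilon> powr (1 - \<alpha>) = (a/2) powr (1 - \<alpha>) * \<kappa> powr \<rho>"
    proof -
      have "\<epsilon> powr (1 - \<alpha>) = (a/2) powr (1 - \<alpha>) * (\<kappa> powr (1/4)) powr (1 - \<alpha>)"
        unfolding \<epsilon>_def by (rule powr_mult)
      also have "(\<kappa> powr (1/4)) powr (1 - \<alpha>) = \<kappa> powr \<rho>" by (simp add: powr_powr \<rho>_def)
      finally show ?thesis .
    qed
    then have b2: "nrm Y w \<le> W * (a/2) powr (1 - \<alpha>) * \<kappa> powr \<rho>" using w(2) by (simp add: mult.assoc)
    have "h powr (1 - \<alpha>) = T powr (1 - \<alpha>) * \<kappa> powr (1 - \<alpha>)" using T \<kappa> by (simp add: hk powr_mult)
    also have "\<dots> \<le> T powr (1 - \<alpha>) * \<kappa> powr \<rho>" using \<kappa> \<rho> by (intro mult_left_mono powr_mono') auto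
    finally have b3: "nrm Y z \<le> W * T powr (1 - \<alpha>) * \<kappa> powr \<rho>"
      using z(2) mult_left_mono[OF _ W] by (fastforce simp: mult.assoc)
    have "nrm Y (u t - u s) \<le> nrm Y (S h (S \<epsilon> y) - S \<epsilon> y) + nrm Y (S h w - w + z)"
      unfolding eq by (rule Y.nrm_triangle[OF conjunct1[OF E1_Y[OF m1]] Y.add_mem[OF Y.diff_mem[OF Shw(1) w(1)] z(1)]])
    also have "nrm Y (S h w - w + z) \<le> (nrm Y (S h w) + nrm Y w) + nrm Y z"
      using Shw w z by (intro order_trans[OF Y.nrm_triangle] add_right_mono Y.nrm_diff_le Y.diff_mem) auto
    finally have "nrm Y (u t - u s) \<le> nrm Y (S h (S \<epsilon> y) - S \<epsilon> y) + ((CY + 1) * nrm Y w + nrm Y z)"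
      using Shw by (simp add: distrib_right)
    also have "\<dots> \<le> D * \<kappa> powr \<rho> + ((CY + 1) * (W * (a/2) powr (1 - \<alpha>) * \<kappa> powr \<rho>) + W * T powr (1 - \<alpha>) * \<kappa> powr \<rho>)"
      using b1 b2 b3 CY by (intro add_mono mult_left_mono) auto
    also have "\<dots> = K * \<kappa> powr \<rho>" by (simp add: K_def algebra_simps)
    finally show ?thesis by (simp add: \<kappa>_def h_def)
  qed
  have mem: "u t \<in> carr Y" if "t \<in> {a..T}" for t using evolves_in_Y[OF u g, of t] that a by auto
  show ?thesis
  proof (intro exI[of _ "K * (1/T) powr \<rho>"] conjI ballI)
    show "0 \<le> K * (1/T) powr \<rho>" using K by simp
    fix s t assume st: "s \<in> {a..T}" "t \<in> {a..T}"
    have sc: "(d / T) powr \<rho> = (1/T) powr \<rho> * d powr \<rho>" if "d \<ge> 0" for d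
      using that T powr_mult[of "1/T" d \<rho>] by simp
    consider "s = t" | "s < t" | "t < s" by linarith
    then show "nrm Y (u t - u s) \<le> K * (1/T) powr \<rho> * \<bar>t - s\<bar> powr ((1 - \<alpha>) / 4)"
    proof cases
      case 1
      then show ?thesis by simp
    next
      case 2
      then show ?thesis using main[of s t] st sc[of "t - s"] by (simp add: \<rho>_def mult.assoc)
    next
      case 3
      then show ?thesis using main[of t s] st sc[of "s - t"] Y.nrm_diff_commute[OF mem[OF st(1)] mem[OF st(2)]]
        by (simp add: \<rho>_def mult.assoc)
    qed
  qed
qed

lemma evolves_cont_in:
  assumes u: "evolves u g" and g: "forcing N g" and U: "\<And>t. 0 \<le> t \<Longrightarrow> t \<le> T \<Longrightarrow> norm (u t) \<le> U"
  shows "cont_in Y {0<..T} u"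
  unfolding cont_in_def
proof (intro conjI ballI)
  fix t assume t: "t \<in> {0<..T}"
  then show "u t \<in> carr Y" using evolves_in_Y[OF u g] by simp
  define \<rho> where "\<rho> = (1 - \<alpha>) / 4"
  obtain K where K: "\<And>s r. s \<in> {t/2..T} \<Longrightarrow> r \<in> {t/2..T} \<Longrightarrow> nrm Y (u r - u s) \<le> K * \<bar>r - s\<bar> powr \<rho>"
    using evolves_holder[OF u g _ _ U, of "t/2"] t unfolding \<rho>_def by (auto simp del: atLeastAtMost_iff)
  show "((\<lambda>s. nrm Y (u s - u t)) \<longlongrightarrow> 0) (at t within {0<..T})"
  proof (rule Lim_null_comparison)
    have "\<forall>\<^sub>F s in at t within {0<..T}. s > t/2 \<and> s \<in> {0<..T}"
      using order_tendstoD(1)[OF tendsto_ident_at, of "t/2" t "{0<..T}"] t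
      by (auto simp: eventually_at_filter elim: eventually_mono)
    then show "\<forall>\<^sub>F s in at t within {0<..T}. norm (nrm Y (u s - u t)) \<le> K * \<bar>s - t\<bar> powr \<rho>"
    proof eventually_elim
      case (elim s)
      then have "u s - u t \<in> carr Y" using t evolves_in_Y[OF u g] by (intro Y.diff_mem) auto
      with K[of t s] elim t show ?case by (simp add: Y.nrm_ge0)
    qed
    have "((\<lambda>s. \<bar>s - t\<bar>) \<longlongrightarrow> \<bar>t - t\<bar>) (at t within {0<..T})" by (intro tendsto_intros)
    then have "((\<lambda>s. \<bar>s - t\<bar> powr \<rho>) \<longlongrightarrow> 0) (at t within {0<..T})"
      using \<alpha> by (intro tendsto_zero_powrI[OF _ tendsto_const]) (auto simp: \<rho>_def)
    then show "((\<lambda>s. K * \<bar>s - t\<bar> powr \<rho>) \<longlongrightarrow> 0) (at t within {0<..T})" by (rule tendsto_mult_right_zero)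
  qed
qed

text \<open>The Duhamel part is of order \<open>t powr (1 - \<nu>)\<close> in both norms. For the
  orbit of \<open>u0\<close> boundedness of the weighted norm is immediate, but its vanishing at 0
  uses density: approximate \<open>u0\<close> by an element of \<open>E1\<close>, whose orbit stays
  bounded in \<open>Y\<close>.\<close>

lemma mild_solution_space:
  assumes g: "forcing N g" and dense: "dense_in E1 whole"
  shows "continuous_on {0..T} (\<lambda>t. S t u0 + duhamel g t)"
    "(\<lambda>t. S t u0 + duhamel g t) \<in> C_weighted \<theta> T Y"
proof -
  note N = forcingD(1)[OF g]
  define u where "u = (\<lambda>t. S t u0 + duhamel g t)"
  define d where "d = duhamel_const * N"
  have d: "d \<ge> 0" using duhamel_const N by (simp add: d_def)
  have ev: "evolves u g" unfolding u_def by (rule evolves_mild[OF g])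
  have dz: "((\<lambda>t. d * t powr (1 - \<nu>)) \<longlongrightarrow> 0) (at_right 0)"
  proof -
    have "((\<lambda>t::real. t powr (1 - \<nu>)) \<longlongrightarrow> 0) (at_right 0)"
      using \<nu> eventually_at_right_less[of "0::real"]
      by (intro tendsto_zero_powrI[OF tendsto_ident_at tendsto_const]) (auto elim: eventually_mono)
    then show ?thesis by (rule tendsto_mult_right_zero)
  qed
  have near: "\<forall>\<^sub>F t in at_right 0. 0 < t \<and> t \<le> T"
    using eventually_at_right_real[OF T] by eventually_elim auto
  have U: "norm (u t) \<le> C * norm u0 + d * T powr (1 - \<nu>)" if "0 \<le> t" "t \<le> T" for t
  proof (cases "t = 0")
    case True
    have "1 * norm u0 \<le> C * norm u0" using C by (intro mult_right_mono) auto
    moreover have "0 \<le> d * T powr (1 - \<nu>)" using d by simp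
    ultimately show ?thesis using True by (simp add: u_def)
  next
    case False
    have "norm (u t) \<le> C * norm u0 + d * t powr (1 - \<nu>)"
      unfolding u_def d_def using that False duhamel_bounds(2)[OF g, of t]
      by (intro order_trans[OF norm_triangle_ineq] add_mono S_bound) auto
    also have "\<dots> \<le> C * norm u0 + d * T powr (1 - \<nu>)"
      using that d \<nu> by (intro add_left_mono mult_left_mono powr_mono2) auto
    finally show ?thesis .
  qed
  have ci: "cont_in Y {0<..T} u" by (rule evolves_cont_in[OF ev g U])
  have dlim: "(duhamel g \<longlongrightarrow> 0) (at_right 0)"
  proof (rule Lim_null_comparison[OF _ dz])
    show "\<forall>\<^sub>F t in at_right 0. norm (duhamel g t) \<le> d * t powr (1 - \<nu>)"
      using near by eventually_elim (use duhamel_bounds(2)[OF g] in \<open>auto simp: d_def\<close>)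
  qed
  have S0: "((\<lambda>t. S t x) \<longlongrightarrow> x) (at_right 0)" for x
    using S_cont[of x] by (simp add: continuous_on_def at_within_Ici_at_right[symmetric]) force
  have "(u \<longlongrightarrow> u0 + 0) (at_right 0)" unfolding u_def by (intro tendsto_add S0 dlim)
  then have at0: "(u \<longlongrightarrow> u 0) (at 0 within {0..T})" using T by (simp add: u_def at_within_Icc_at_right)
  show "continuous_on {0..T} (\<lambda>t. S t u0 + duhamel g t)"
    unfolding u_def[symmetric] continuous_on_def
  proof
    fix t assume t: "t \<in> {0..T}"
    show "(u \<longlongrightarrow> u t) (at t within {0..T})"
    proof (cases "t = 0")
      case False
      have "(u \<longlongrightarrow> u t) (at t within {0<..T})"
        using cont_in_continuous_on[OF Y.banach Y_emb ci] t False by (simp add: continuous_on_def)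
      also have "at t within {0<..T} = at t within {0..T}"
        by (rule at_within_nhd[of _ "{0<..}"]) (use t False in auto)
      finally show ?thesis .
    qed (use at0 in simp)
  qed
  have SY: "t powr \<theta> * nrm Y (S t x) \<le> CY * norm x" if "0 < t" "t \<le> T" for t x
  proof -
    have "t powr \<theta> * nrm Y (S t x) \<le> t powr \<theta> * (CY * t powr (-\<theta>) * norm x)"
      by (intro mult_left_mono S_0Y that) auto
    also have "\<dots> = CY * norm x" using that by (simp add: powr_minus)
    finally show ?thesis .
  qed
  have "((\<lambda>t. t powr \<theta> * nrm Y (S t u0)) \<longlongrightarrow> 0) (at_right 0)"
  proof (rule tendstoI)
    fix e :: real assume e: "e > 0"
    have "e / (2 * CY) > 0" using e CY by simp
    then obtain x where x: "x \<in> carr E1" "norm (u0 - x) < e / (2 * CY)"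
      using dense unfolding dense_in_def whole_simps by blast
    have xY: "x \<in> carr Y" using E1_Y[OF x(1)] by simp
    have "((\<lambda>t. t powr \<theta>) \<longlongrightarrow> 0) (at_right (0::real))"
      using \<theta> eventually_at_right_less[of "0::real"]
      by (intro tendsto_zero_powrI[OF tendsto_ident_at tendsto_const]) (auto elim: eventually_mono)
    then have "((\<lambda>t. t powr \<theta> * (CY * nrm Y x)) \<longlongrightarrow> 0) (at_right 0)" by (rule tendsto_mult_left_zero)
    then have "\<forall>\<^sub>F t in at_right 0. t powr \<theta> * (CY * nrm Y x) < e/2" using e by (intro order_tendstoD(2)) auto
    with near show "\<forall>\<^sub>F t in at_right 0. dist (t powr \<theta> * nrm Y (S t u0)) 0 < e"
    proof eventually_elim
      case (elim t)
      have mem: "S t u0 \<in> carr Y" "S t (u0 - x) \<in> carr Y" "S t x \<in> carr Y" using elim S_smooth_Y by auto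
      have "nrm Y (S t u0) \<le> nrm Y (S t (u0 - x)) + nrm Y (S t x)"
        using Y.nrm_triangle[OF mem(2,3)] elim by (simp add: S_diff)
      then have "t powr \<theta> * nrm Y (S t u0) \<le> t powr \<theta> * nrm Y (S t (u0 - x)) + t powr \<theta> * nrm Y (S t x)"
        by (simp add: distrib_left[symmetric] mult_left_mono)
      also have "\<dots> \<le> CY * norm (u0 - x) + t powr \<theta> * (CY * nrm Y x)"
        using elim SY S_Y[OF xY] by (intro add_mono mult_left_mono) auto
      also have "\<dots> < e/2 + e/2" using elim x(2) CY by (intro add_le_less_mono) (auto simp: field_simps)
      finally show ?case using Y.nrm_ge0[OF mem(1)] by simp
    qed
  qed
  moreover have "((\<lambda>t. t powr \<theta> * nrm Y (duhamel g t)) \<longlongrightarrow> 0) (at_right 0)"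
  proof (rule Lim_null_comparison[OF _ dz])
    show "\<forall>\<^sub>F t in at_right 0. norm (t powr \<theta> * nrm Y (duhamel g t)) \<le> d * t powr (1 - \<nu>)"
      using near by eventually_elim (use duhamel_bounds[OF g] Y.nrm_ge0 in \<open>auto simp: d_def\<close>)
  qed
  ultimately have sum: "((\<lambda>t. t powr \<theta> * nrm Y (S t u0) + t powr \<theta> * nrm Y (duhamel g t)) \<longlongrightarrow> 0) (at_right 0)"
    using tendsto_add by fastforce
  have "((\<lambda>t. t powr \<theta> * nrm Y (u t)) \<longlongrightarrow> 0) (at_right 0)"
  proof (rule Lim_null_comparison[OF _ sum])
    show "\<forall>\<^sub>F t in at_right 0. norm (t powr \<theta> * nrm Y (u t)) \<le> t powr \<theta> * nrm Y (S t u0) + t powr \<theta> * nrm Y (duhamel g t)"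
      using near
    proof eventually_elim
      case (elim t)
      have mem: "S t u0 \<in> carr Y" "duhamel g t \<in> carr Y" using elim S_smooth_Y duhamel_bounds(1)[OF g] by auto
      have "t powr \<theta> * nrm Y (u t) \<le> t powr \<theta> * (nrm Y (S t u0) + nrm Y (duhamel g t))"
        unfolding u_def by (intro mult_left_mono Y.nrm_triangle mem) auto
      then show ?case using Y.nrm_ge0[OF Y.add_mem[OF mem]] by (simp add: u_def distrib_left)
    qed
  qed
  with ci show "(\<lambda>t. S t u0 + duhamel g t) \<in> C_weighted \<theta> T Y" by (simp add: C_weighted_def u_def)
qed

end

section \<open>The contraction argument\<close>

context banach_nspace
begin

lemma cont_in_diff:
  assumes "cont_in X I u" "cont_in X I v"
  shows "cont_in X I (\<lambda>t. u t - v t)"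
  unfolding cont_in_def
proof (intro conjI ballI)
  fix t assume t: "t \<in> I"
  show "u t - v t \<in> carr X" using assms t by (auto simp: cont_in_def intro: diff_mem)
  have lim: "((\<lambda>s. nrm X (u s - u t) + nrm X (v s - v t)) \<longlongrightarrow> 0 + 0) (at t within I)"
    using assms t by (intro tendsto_add) (auto simp: cont_in_def)
  show "((\<lambda>s. nrm X (u s - v s - (u t - v t))) \<longlongrightarrow> 0) (at t within I)"
  proof (rule Lim_null_comparison[OF _ lim[simplified]])
    have "\<forall>\<^sub>F s in at t within I. s \<in> I" by (simp add: eventually_at_filter)
    then show "\<forall>\<^sub>F s in at t within I. norm (nrm X (u s - v s - (u t - v t))) \<le> nrm X (u s - u t) + nrm X (v s - v t)"
    proof eventually_elim
      case (elim s)
      have mem: "u s - u t \<in> carr X" "v s - v t \<in> carr X" using assms elim t by (auto simp: cont_in_def intro: diff_mem)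
      have "u s - v s - (u t - v t) = (u s - u t) - (v s - v t)" by simp
      show ?case unfolding \<open>u s - v s - (u t - v t) = _\<close>
        using nrm_diff_le[OF mem] nrm_ge0[OF diff_mem[OF mem]] by simp
    qed
  qed
qed

lemma C_weighted_mem: "u \<in> C_weighted \<mu> T X \<Longrightarrow> 0 < t \<Longrightarrow> t \<le> T \<Longrightarrow> u t \<in> carr X"
  by (simp add: C_weighted_def cont_in_def)

lemma C_weighted_diff:
  assumes u: "u \<in> C_weighted \<mu> T X" and v: "v \<in> C_weighted \<mu> T X" and T: "T > 0"
  shows "(\<lambda>t. u t - v t) \<in> C_weighted \<mu> T X"
proof -
  have lim: "((\<lambda>t. t powr \<mu> * nrm X (u t) + t powr \<mu> * nrm X (v t)) \<longlongrightarrow> 0 + 0) (at_right 0)"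
    using u v by (intro tendsto_add) (auto simp: C_weighted_def)
  have "((\<lambda>t. t powr \<mu> * nrm X (u t - v t)) \<longlongrightarrow> 0) (at_right 0)"
  proof (rule Lim_null_comparison[OF _ lim[simplified]])
    show "\<forall>\<^sub>F t in at_right 0. norm (t powr \<mu> * nrm X (u t - v t)) \<le> t powr \<mu> * nrm X (u t) + t powr \<mu> * nrm X (v t)"
      using eventually_at_right_real[OF T]
    proof eventually_elim
      case (elim t)
      have mem: "u t \<in> carr X" "v t \<in> carr X" using elim C_weighted_mem[OF u] C_weighted_mem[OF v] by auto
      have "t powr \<mu> * nrm X (u t - v t) \<le> t powr \<mu> * (nrm X (u t) + nrm X (v t))"
        by (intro mult_left_mono nrm_diff_le mem) auto
      then show ?case using nrm_ge0[OF diff_mem[OF mem]] by (simp add: distrib_left)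
    qed
  qed
  then show ?thesis using u v cont_in_diff by (simp add: C_weighted_def)
qed

lemma C_weighted_zero: "(\<lambda>_. 0) \<in> C_weighted \<mu> T X"
  by (simp add: C_weighted_def cont_in_def)

lemma cont_in_nrm:
  assumes "cont_in X I u"
  shows "continuous_on I (\<lambda>t. nrm X (u t))"
  unfolding continuous_on_def
proof
  fix t assume t: "t \<in> I"
  show "((\<lambda>s. nrm X (u s)) \<longlongrightarrow> nrm X (u t)) (at t within I)"
  proof (rule LIM_zero_cancel, rule Lim_null_comparison)
    have "\<forall>\<^sub>F s in at t within I. s \<in> I" by (simp add: eventually_at_filter)
    then show "\<forall>\<^sub>F s in at t within I. norm (nrm X (u s) - nrm X (u t)) \<le> nrm X (u s - u t)"
      by eventually_elim (use assms t nrm_abs_diff in \<open>auto simp: cont_in_def\<close>)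
    show "((\<lambda>s. nrm X (u s - u t)) \<longlongrightarrow> 0) (at t within I)" using assms t by (simp add: cont_in_def)
  qed
qed

text \<open>The limit at 0 handles small times and compactness the rest. This makes the supremum in
  \<open>C_norm\<close> an actual upper bound.\<close>

lemma C_weighted_bdd:
  assumes u: "u \<in> C_weighted \<mu> T X"
  shows "bdd_above ((\<lambda>t. t powr \<mu> * nrm X (u t)) ` {0<..T})"
proof -
  have "\<forall>\<^sub>F t in at_right 0. t powr \<mu> * nrm X (u t) < 1"
    using u by (intro order_tendstoD(2)) (auto simp: C_weighted_def)
  then obtain d where d: "d > 0" "\<And>t. 0 < t \<Longrightarrow> t < d \<Longrightarrow> t powr \<mu> * nrm X (u t) < 1"
    by (auto simp: eventually_at_right_field)
  have "continuous_on {d..T} (\<lambda>t. nrm X (u t))"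
    using u d by (intro continuous_on_subset[OF cont_in_nrm]) (auto simp: C_weighted_def)
  then have "continuous_on {d..T} (\<lambda>t. t powr \<mu> * nrm X (u t))"
    using d by (intro continuous_intros) auto
  then have "bounded ((\<lambda>t. t powr \<mu> * nrm X (u t)) ` {d..T})"
    by (intro compact_imp_bounded compact_continuous_image) auto
  then obtain B where B: "\<And>t. t \<in> {d..T} \<Longrightarrow> \<bar>t powr \<mu> * nrm X (u t)\<bar> \<le> B"
    unfolding bounded_iff by (auto simp del: atLeastAtMost_iff)
  have "t powr \<mu> * nrm X (u t) \<le> max 1 B" if "t \<in> {0<..T}" for t
    using B[of t] d(2)[of t] that by (cases "t < d") (auto simp: abs_le_iff)
  then show ?thesis unfolding bdd_above_def by (intro exI[of _ "max 1 B"]) auto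
qed

lemma C_norm_upper:
  assumes u: "u \<in> C_weighted \<mu> T X" and t: "0 < t" "t \<le> T"
  shows "t powr \<mu> * nrm X (u t) \<le> C_norm \<mu> T X u"
  unfolding C_norm_def by (rule cSUP_upper[OF _ C_weighted_bdd[OF u]]) (use t in auto)

lemma C_norm_nonneg:
  assumes "u \<in> C_weighted \<mu> T X" "T > 0"
  shows "0 \<le> C_norm \<mu> T X u"
  using C_norm_upper[OF assms order_refl] nrm_ge0[OF C_weighted_mem[OF assms order_refl]]
  by (meson mult_nonneg_nonneg order_trans powr_ge_zero)

end

lemma C_norm_least:
  assumes "T > 0" "\<And>t. 0 < t \<Longrightarrow> t \<le> T \<Longrightarrow> t powr \<mu> * nrm X (u t) \<le> e"
  shows "C_norm \<mu> T X u \<le> e"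
  unfolding C_norm_def by (rule cSUP_least) (use assms in auto)

section \<open>The solution space and Banach's fixed point theorem\<close>

context weighted_forcing
begin

definition sol_space :: "(real \<Rightarrow> 'a) set" where
  "sol_space = {u. continuous_on {0..T} u \<and> u \<in> C_weighted \<theta> T Y}"

text \<open>The closed ball of the intersection norm, written pointwise so that differences of
  functions need no supremum. The \<open>Y\<close> part starts after time 0, where the initial value
  is only in \<open>E0\<close>.\<close>

definition bounded_by :: "(real \<Rightarrow> 'a) \<Rightarrow> real \<Rightarrow> bool" where
  "bounded_by w e \<longleftrightarrow> (\<forall>t\<in>{0..T}. norm (w t) \<le> e) \<and>
     (\<forall>t\<in>{0<..T}. w t \<in> carr Y \<and> t powr \<theta> * nrm Y (w t) \<le> e)"

lemma bounded_byD:
  assumes "bounded_by w e"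
  shows "\<And>t. 0 \<le> t \<Longrightarrow> t \<le> T \<Longrightarrow> norm (w t) \<le> e" "\<And>t. 0 < t \<Longrightarrow> t \<le> T \<Longrightarrow> w t \<in> carr Y"
    "\<And>t. 0 < t \<Longrightarrow> t \<le> T \<Longrightarrow> t powr \<theta> * nrm Y (w t) \<le> e"
  using assms by (auto simp: bounded_by_def)

lemma bounded_by_triangle:
  assumes "bounded_by (\<lambda>t. u t - v t) a" "bounded_by (\<lambda>t. v t - w t) b"
  shows "bounded_by (\<lambda>t. u t - w t) (a + b)"
  unfolding bounded_by_def
proof (intro conjI ballI)
  fix t assume "t \<in> {0..T}"
  then show "norm (u t - w t) \<le> a + b"
    using bounded_byD(1)[OF assms(1), of t] bounded_byD(1)[OF assms(2), of t]
      norm_triangle_ineq[of "u t - v t" "v t - w t"] by simp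
next
  fix t assume t: "t \<in> {0<..T}"
  then have m: "u t - v t \<in> carr Y" "v t - w t \<in> carr Y"
    using bounded_byD(2)[OF assms(1)] bounded_byD(2)[OF assms(2)] by auto
  have eq: "u t - w t = (u t - v t) + (v t - w t)" by simp
  show "u t - w t \<in> carr Y" unfolding eq by (rule Y.add_mem[OF m])
  have "t powr \<theta> * nrm Y (u t - w t) \<le> t powr \<theta> * (nrm Y (u t - v t) + nrm Y (v t - w t))"
    unfolding eq by (intro mult_left_mono Y.nrm_triangle m) auto
  then show "t powr \<theta> * nrm Y (u t - w t) \<le> a + b"
    using bounded_byD(3)[OF assms(1), of t] bounded_byD(3)[OF assms(2), of t] t by (simp add: distrib_left)
qed

lemma sol_space_mem: "u \<in> sol_space \<Longrightarrow> 0 < t \<Longrightarrow> t \<le> T \<Longrightarrow> u t \<in> carr Y"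
  by (auto simp: sol_space_def intro: Y.C_weighted_mem)

text \<open>Completeness with explicit rate. Pointwise limits exist in \<open>E0\<close> and, at
  positive times, in \<open>Y\<close>, and agree by the embedding; uniform closeness then transfers
  both continuity and the vanishing weighted norm at 0.\<close>

lemma sol_space_limit:
  fixes w :: "nat \<Rightarrow> real \<Rightarrow> 'a"
  assumes w: "\<And>n. w n \<in> sol_space" and c: "c \<longlonglongrightarrow> 0"
    and cau: "\<And>n m. n \<le> m \<Longrightarrow> bounded_by (\<lambda>t. w m t - w n t) (c n)"
  obtains u where "u \<in> sol_space" "\<And>n. bounded_by (\<lambda>t. u t - w n t) (c n)"
proof -
  have small: "\<exists>N. c N < e" if "e > 0" for e
    using order_tendstoD(2)[OF c that] by (auto simp: eventually_sequentially)
  define u where "u = (\<lambda>t. lim (\<lambda>n. w n t))"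
  have lim: "(\<lambda>n. w n t) \<longlonglongrightarrow> u t" if t: "0 \<le> t" "t \<le> T" for t
  proof -
    have "Cauchy (\<lambda>n. w n t)"
    proof (rule metric_CauchyI)
      fix e :: real assume "e > 0"
      then obtain N where N: "c N < e/2" using small[of "e/2"] by auto
      have "dist (w m t) (w n t) < e" if "m \<ge> N" "n \<ge> N" for m n
        using bounded_byD(1)[OF cau[OF that(1)] t] bounded_byD(1)[OF cau[OF that(2)] t] N
          dist_triangle2[of "w m t" "w n t" "w N t"] unfolding dist_norm by linarith
      then show "\<exists>N. \<forall>m\<ge>N. \<forall>n\<ge>N. dist (w m t) (w n t) < e" by blast
    qed
    then show ?thesis unfolding u_def by (simp add: Cauchy_convergent_iff convergent_LIMSEQ_iff)
  qed
  have b0: "norm (u t - w n t) \<le> c n" if "0 \<le> t" "t \<le> T" for t n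
  proof (rule Lim_norm_ubound[OF _ tendsto_diff[OF lim[OF that] tendsto_const]])
    show "\<forall>\<^sub>F m in sequentially. norm (w m t - w n t) \<le> c n"
      using eventually_ge_at_top[of n] by eventually_elim (use bounded_byD(1)[OF cau] that in blast)
  qed auto
  have bY: "u t \<in> carr Y \<and> t powr \<theta> * nrm Y (u t - w n t) \<le> c n" if t: "0 < t" "t \<le> T" for t n
  proof -
    note wm = sol_space_mem[OF w t]
    have tp: "t powr \<theta> > 0" using t by simp
    obtain y where y: "y \<in> carr Y" "(\<lambda>m. nrm Y (w m t - y)) \<longlonglongrightarrow> 0"
    proof (rule Y.complete[of "\<lambda>m. w m t"])
      fix e :: real assume "e > 0"
      then obtain N where N: "c N < t powr \<theta> * e / 2" using small[of "t powr \<theta> * e / 2"] tp by auto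
      have "nrm Y (w m t - w n t) < e" if "m \<ge> N" "n \<ge> N" for m n
      proof -
        have "t powr \<theta> * nrm Y (w m t - w n t) \<le> t powr \<theta> * (nrm Y (w m t - w N t) + nrm Y (w N t - w n t))"
          by (intro mult_left_mono Y.nrm_diff_triangle wm) auto
        also have "\<dots> \<le> c N + c N"
          using bounded_byD(3)[OF cau[OF that(1)] t] bounded_byD(3)[OF cau[OF that(2)] t]
            Y.nrm_diff_commute[OF wm[of N] wm[of n]] by (simp add: distrib_left)
        also have "\<dots> < t powr \<theta> * e" using N by simp
        finally show ?thesis using tp by simp
      qed
      then show "\<exists>N. \<forall>m\<ge>N. \<forall>n\<ge>N. nrm Y (w m t - w n t) < e" by blast
    qed (rule wm)
    have "(\<lambda>m. w m t) \<longlonglongrightarrow> y"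
    proof (rule LIM_zero_cancel, rule Lim_null_comparison[OF _ tendsto_mult_right_zero[OF y(2), of CY]])
      show "\<forall>\<^sub>F m in sequentially. norm (w m t - y) \<le> CY * nrm Y (w m t - y)"
        using Y_emb[OF Y.diff_mem[OF wm y(1)]] by simp
    qed
    then have "y = u t" using lim[of t] t LIMSEQ_unique by auto
    have "(\<lambda>m. t powr \<theta> * nrm Y (w m t - w n t)) \<longlonglongrightarrow> t powr \<theta> * nrm Y (y - w n t)"
    proof (intro tendsto_mult_left Y.tendsto_nrm)
      show "(\<lambda>m. nrm Y (w m t - w n t - (y - w n t))) \<longlonglongrightarrow> 0" using y(2) by simp
    qed (auto intro: Y.diff_mem wm y)
    moreover have "\<forall>\<^sub>F m in sequentially. t powr \<theta> * nrm Y (w m t - w n t) \<le> c n"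
      using eventually_ge_at_top[of n] by eventually_elim (use bounded_byD(3)[OF cau] t in blast)
    ultimately have "t powr \<theta> * nrm Y (y - w n t) \<le> c n" by (rule tendsto_upperbound) auto
    then show ?thesis using \<open>y = u t\<close> y by simp
  qed
  have bd: "bounded_by (\<lambda>t. u t - w n t) (c n)" for n
    using b0 bY sol_space_mem[OF w] by (auto simp: bounded_by_def intro: Y.diff_mem)
  have "continuous_on {0..T} u"
  proof (rule uniform_limit_theorem)
    show "uniform_limit {0..T} w u sequentially"
    proof (rule uniform_limitI)
      fix e :: real assume "e > 0"
      then have "\<forall>\<^sub>F n in sequentially. c n < e" by (rule order_tendstoD(2)[OF c])
      then show "\<forall>\<^sub>F n in sequentially. \<forall>t\<in>{0..T}. dist (w n t) (u t) < e"
      proof eventually_elim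
        case (elim n)
        show ?case
        proof
          fix t assume "t \<in> {0..T}"
          then show "dist (w n t) (u t) < e" using b0[of t n] elim by (simp add: dist_norm norm_minus_commute)
        qed
      qed
    qed
    show "\<forall>\<^sub>F n in sequentially. continuous_on {0..T} (w n)" using w by (simp add: sol_space_def)
  qed simp
  moreover have "cont_in Y {0<..T} u"
    unfolding cont_in_def
  proof (intro conjI ballI)
    fix t assume t: "t \<in> {0<..T}"
    then show ut: "u t \<in> carr Y" using bY by simp
    show "((\<lambda>s. nrm Y (u s - u t)) \<longlongrightarrow> 0) (at t within {0<..T})"
    proof (rule tendstoI)
      fix e :: real assume e: "e > 0"
      \<comment> \<open>A lower bound of the weight for all times after \<open>t/2\<close>, which
        turns weighted closeness into closeness in \<open>Y\<close> uniformly near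
        \<open>t\<close>.\<close>
      define q where "q = (t/2) powr \<theta>"
      have q: "q > 0" using t by (simp add: q_def)
      obtain n where n: "c n < q * e / 3" using small[of "q * e / 3"] q e by auto
      have "((\<lambda>s. nrm Y (w n s - w n t)) \<longlongrightarrow> 0) (at t within {0<..T})"
        using w t by (simp add: sol_space_def C_weighted_def cont_in_def)
      then have "\<forall>\<^sub>F s in at t within {0<..T}. nrm Y (w n s - w n t) < e/3"
        using e by (intro order_tendstoD(2)) auto
      moreover have "\<forall>\<^sub>F s in at t within {0<..T}. s > t/2"
        using t by (intro order_tendstoD(1)[OF tendsto_ident_at]) auto
      moreover have "\<forall>\<^sub>F s in at t within {0<..T}. s \<in> {0<..T}" by (simp add: eventually_at_filter)
      ultimately show "\<forall>\<^sub>F s in at t within {0<..T}. dist (nrm Y (u s - u t)) 0 < e"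
      proof eventually_elim
        case (elim s)
        have near: "nrm Y (u r - w n r) < e/3" if "t/2 \<le> r" "r \<in> {0<..T}" for r
        proof -
          have "q * nrm Y (u r - w n r) \<le> r powr \<theta> * nrm Y (u r - w n r)"
            unfolding q_def using that t \<theta> bY[of r] sol_space_mem[OF w, of r n]
            by (intro mult_right_mono powr_mono2 Y.nrm_ge0 Y.diff_mem) auto
          also have "\<dots> \<le> c n" using bY that by simp
          also have "\<dots> < q * (e/3)" using n by simp
          finally show ?thesis using q by simp
        qed
        have mem: "u s \<in> carr Y" "w n s \<in> carr Y" "w n t \<in> carr Y" using elim t bY sol_space_mem[OF w] by auto
        have "nrm Y (u s - u t) \<le> nrm Y (u s - w n s) + (nrm Y (w n s - w n t) + nrm Y (w n t - u t))"
          using Y.nrm_diff_triangle[OF mem(1,2) ut] Y.nrm_diff_triangle[OF mem(2,3) ut] by linarith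
        also have "nrm Y (w n t - u t) = nrm Y (u t - w n t)" by (rule Y.nrm_diff_commute[OF mem(3) ut])
        finally have "nrm Y (u s - u t) < e" using near[of s] near[of t] elim t by auto
        then show ?case using Y.nrm_ge0[OF Y.diff_mem[OF mem(1) ut]] by simp
      qed
    qed
  qed
  moreover have "((\<lambda>t. t powr \<theta> * nrm Y (u t)) \<longlongrightarrow> 0) (at_right 0)"
  proof (rule tendstoI)
    fix e :: real assume e: "e > 0"
    obtain n where n: "c n < e / 2" using small[of "e/2"] e by auto
    have "((\<lambda>t. t powr \<theta> * nrm Y (w n t)) \<longlongrightarrow> 0) (at_right 0)"
      using w by (simp add: sol_space_def C_weighted_def)
    then have "\<forall>\<^sub>F t in at_right 0. t powr \<theta> * nrm Y (w n t) < e/2"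
      using e by (intro order_tendstoD(2)) auto
    with eventually_at_right_real[OF T] show "\<forall>\<^sub>F t in at_right 0. dist (t powr \<theta> * nrm Y (u t)) 0 < e"
    proof eventually_elim
      case (elim t)
      then have t: "0 < t" "t \<le> T" by auto
      have mem: "u t \<in> carr Y" "w n t \<in> carr Y" using bY[OF t] sol_space_mem[OF w t] by auto
      have "t powr \<theta> * nrm Y (u t) \<le> t powr \<theta> * (nrm Y (w n t) + nrm Y (u t - w n t))"
        by (intro mult_left_mono Y.nrm_le_add_diff mem) auto
      then have "t powr \<theta> * nrm Y (u t) < e" using elim bY[OF t, of n] n by (simp add: distrib_left)
      then show ?case using Y.nrm_ge0[OF mem(1)] by simp
    qed
  qed
  ultimately have "u \<in> sol_space" by (simp add: sol_space_def C_weighted_def)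
  then show thesis using bd by (rule that)
qed

text \<open>Banach's iteration is carried out directly because functions are represented on all
  reals while equality and distance concern \<open>{0..T}\<close> only; existence and uniqueness are
  therefore claimed on that interval.\<close>

lemma contraction_fixed_point:
  assumes r: "r > 0"
    and maps: "\<And>u. u \<in> sol_space \<Longrightarrow> bounded_by u r \<Longrightarrow> \<Phi> u \<in> sol_space \<and> bounded_by (\<Phi> u) r"
    and contr: "\<And>u v e. u \<in> sol_space \<Longrightarrow> v \<in> sol_space \<Longrightarrow> bounded_by u r \<Longrightarrow> bounded_by v r \<Longrightarrow>
       e \<ge> 0 \<Longrightarrow> bounded_by (\<lambda>t. u t - v t) e \<Longrightarrow> bounded_by (\<lambda>t. \<Phi> u t - \<Phi> v t) (e / 2)"
  shows "\<exists>u. u \<in> sol_space \<and> bounded_by u r \<and> (\<forall>t\<in>{0..T}. \<Phi> u t = u t)"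
    "\<And>u v t. u \<in> sol_space \<Longrightarrow> v \<in> sol_space \<Longrightarrow> bounded_by u r \<Longrightarrow> bounded_by v r \<Longrightarrow>
       (\<And>t. t \<in> {0..T} \<Longrightarrow> \<Phi> u t = u t) \<Longrightarrow> (\<And>t. t \<in> {0..T} \<Longrightarrow> \<Phi> v t = v t) \<Longrightarrow> t \<in> {0..T} \<Longrightarrow> u t = v t"
proof -
  define w where "w = (\<lambda>n. (\<Phi> ^^ n) (\<lambda>_. 0))"
  have w0: "(\<lambda>_. 0) \<in> sol_space" "bounded_by (\<lambda>_. 0) r"
    using r by (auto simp: sol_space_def Y.C_weighted_zero bounded_by_def)
  have wr: "w n \<in> sol_space \<and> bounded_by (w n) r" for n
  proof (induction n)
    case (Suc n)
    then show ?case using maps[of "w n"] by (simp add: w_def)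
  qed (simp add: w_def w0)
  have step: "bounded_by (\<lambda>t. w (Suc n) t - w n t) (r * (1/2)^n)" for n
  proof (induction n)
    case 0
    show ?case using wr[of 1] by (simp add: w_def)
  next
    case (Suc n)
    have "bounded_by (\<lambda>t. \<Phi> (w (Suc n)) t - \<Phi> (w n) t) (r * (1/2)^n / 2)"
      using wr r by (intro contr Suc) auto
    then show ?case by (simp add: w_def)
  qed
  \<comment> \<open>The tail of the geometric series of steps; \<open>c n - c (n + k)\<close> is
    exactly the sum of the \<open>k\<close> steps after stage \<open>n\<close>.\<close>
  define c where "c = (\<lambda>n. 2 * r * (1/2::real)^n)"
  have c: "c \<longlonglongrightarrow> 0" unfolding c_def by (intro tendsto_mult_right_zero LIMSEQ_realpow_zero) auto
  have cau: "bounded_by (\<lambda>t. w (n + k) t - w n t) (c n - c (n + k))" for n k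
  proof (induction k)
    case 0
    show ?case by (simp add: bounded_by_def)
  next
    case (Suc k)
    have "bounded_by (\<lambda>t. w (Suc (n + k)) t - w n t) (r * (1/2)^(n + k) + (c n - c (n + k)))"
      by (rule bounded_by_triangle[OF step Suc])
    then show ?case by (simp add: c_def)
  qed
  have mono: "bounded_by v a \<Longrightarrow> a \<le> b \<Longrightarrow> bounded_by v b" for v a b
    by (auto simp: bounded_by_def)
  have cau': "bounded_by (\<lambda>t. w m t - w n t) (c n)" if "n \<le> m" for m n
    using mono[OF cau[of n "m - n"], of "c n"] that r by (simp add: c_def)
  obtain u where u: "u \<in> sol_space" "\<And>n. bounded_by (\<lambda>t. u t - w n t) (c n)"
    using sol_space_limit[of w c] wr c cau' by blast
  have lim_le: "x \<le> y" if "\<And>n. x \<le> y + c n" for x y :: real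
  proof -
    have "(\<lambda>n. y + c n) \<longlonglongrightarrow> y + 0" by (intro tendsto_intros c)
    then show ?thesis using that by (intro LIMSEQ_le_const[of "\<lambda>n. y + c n"]) auto
  qed
  have "bounded_by (\<lambda>t. u t - 0) (r + c n)" for n
    using bounded_by_triangle[OF u(2)[of n], of "\<lambda>_. 0" r] wr[of n] by (simp add: add.commute)
  then have ur: "bounded_by u r"
    using lim_le[of _ r] unfolding bounded_by_def by simp
  have "\<Phi> u t = u t" if t: "t \<in> {0..T}" for t
  proof -
    have "norm (\<Phi> u t - u t) \<le> 0 + c n" for n
    proof -
      have c0: "c k \<ge> 0" for k using r by (simp add: c_def)
      have "bounded_by (\<lambda>t. \<Phi> u t - \<Phi> (w n) t) (c n / 2)"
        using wr u ur c0 by (intro contr) auto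
      then have "norm (\<Phi> u t - w (Suc n) t) \<le> c n / 2" using bounded_byD(1) t by (fastforce simp: w_def)
      moreover have "norm (u t - w (Suc n) t) \<le> c n / 2"
        using bounded_byD(1)[OF u(2)[of "Suc n"], of t] t by (simp add: c_def)
      ultimately show ?thesis using norm_triangle_ineq4[of "\<Phi> u t - w (Suc n) t" "u t - w (Suc n) t"] by simp
    qed
    then have "norm (\<Phi> u t - u t) \<le> 0" by (rule lim_le)
    then show ?thesis by simp
  qed
  with u ur show "\<exists>u. u \<in> sol_space \<and> bounded_by u r \<and> (\<forall>t\<in>{0..T}. \<Phi> u t = u t)" by blast
  fix u v t
  assume uv: "u \<in> sol_space" "v \<in> sol_space" "bounded_by u r" "bounded_by v r"
    and fx: "\<And>t. t \<in> {0..T} \<Longrightarrow> \<Phi> u t = u t" "\<And>t. t \<in> {0..T} \<Longrightarrow> \<Phi> v t = v t" and t: "t \<in> {0..T}"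
  \<comment> \<open>Two points of the ball have distance at most \<open>2 * r = c 0\<close>, and
    each application of the contraction halves the bound.\<close>
  have uv_small: "bounded_by (\<lambda>t. u t - v t) (c n)" for n
  proof (induction n)
    case 0
    have "bounded_by (\<lambda>t. u t - 0) r" "bounded_by (\<lambda>t. 0 - v t) r"
      using uv by (auto simp: bounded_by_def Y.minus_mem Y.nrm_minus)
    from bounded_by_triangle[OF this] show ?case by (simp add: c_def)
  next
    case (Suc n)
    have "bounded_by (\<lambda>t. \<Phi> u t - \<Phi> v t) (c n / 2)"
      using uv r Suc by (intro contr) (auto simp: c_def)
    then show ?case using fx by (auto simp: bounded_by_def c_def)
  qed
  have "norm (u t - v t) \<le> 0 + c n" for n using bounded_byD(1)[OF uv_small, of t n] t by simp
  then have "norm (u t - v t) \<le> 0" by (rule lim_le)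
  then show "u t = v t" by simp
qed

end

section \<open>Reduction of both nonlocal problems to a fixed point\<close>

context weighted_forcing
begin

lemma forcing_of_weighted:
  assumes g: "g \<in> C_weighted \<nu> T X"
  shows "forcing (C_norm \<nu> T X g) g"
  unfolding forcing_def
proof (intro conjI ballI)
  show "0 \<le> C_norm \<nu> T X g" by (rule X.C_norm_nonneg[OF g T])
  show "continuous_on {0<..T} g"
    using g by (intro cont_in_continuous_on[OF X.banach X_emb]) (auto simp: C_weighted_def)
  fix s assume s: "s \<in> {0<..T}"
  then show "g s \<in> carr X" using X.C_weighted_mem[OF g] by simp
  show "nrm X (g s) \<le> C_norm \<nu> T X g * s powr (-\<nu>)"
    using X.C_norm_upper[OF g, of s] s by (simp add: powr_minus field_simps)
qed

lemma forcing_mono: "forcing N g \<Longrightarrow> N \<le> M \<Longrightarrow> forcing M g"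
  unfolding forcing_def by (auto intro: order_trans mult_right_mono)

lemma continuous_on_duhamel:
  assumes "forcing N g" "dense_in E1 whole"
  shows "continuous_on {0..T} (duhamel g)"
proof -
  have "continuous_on {0..T} (\<lambda>t. S t 0 + duhamel g t)" by (rule mild_solution_space(1)[OF assms])
  then show ?thesis by (rule continuous_on_eq) (simp add: linear_0[OF S_linear])
qed

lemma duhamel_diff:
  assumes "forcing N g" "forcing M h" "0 \<le> t" "t \<le> T"
  shows "duhamel g t - duhamel h t = duhamel (\<lambda>s. g s - h s) t"
proof -
  have "duhamel (\<lambda>s. g s - h s) t = integral {0..t} (\<lambda>s. S (t - s) (g s) - S (t - s) (h s))"
    unfolding duhamel_def by (intro integral_cong) (simp add: S_diff)
  then show ?thesis
    using integral_diff[OF kernel_integrable[OF assms(1,3,4)] kernel_integrable[OF assms(2,3,4)]]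
    by (simp add: duhamel_def)
qed

text \<open>By linearity only the differences of initial values and forcings enter. The first bound
  feeds the nonlocal functional, the second the map whose fixed points are the solutions.\<close>

lemma mild_difference:
  assumes g: "forcing N g" and h: "forcing M h" and d: "forcing L (\<lambda>t. g t - h t)"
  shows "bounded_by (\<lambda>t. duhamel g t - duhamel h t) (duhamel_const * T powr (1 - \<nu>) * L)"
    "bounded_by (\<lambda>t. (S t x + duhamel g t) - (S t y + duhamel h t))
       ((C + CY) * norm (x - y) + duhamel_const * T powr (1 - \<nu>) * L)"
proof -
  define k where "k = (\<lambda>t. g t - h t)"
  define B where "B = duhamel_const * T powr (1 - \<nu>) * L"
  have d: "forcing L k" using d by (simp add: k_def)
  have dk: "duhamel g t - duhamel h t = duhamel k t" if "0 \<le> t" "t \<le> T" for t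
    unfolding k_def by (rule duhamel_diff[OF g h that])
  have L: "L \<ge> 0" by (rule forcingD(1)[OF d])
  have B0: "B \<ge> 0" using duhamel_const L by (simp add: B_def)
  have pm: "duhamel_const * L * t powr (1 - \<nu>) \<le> B" if "0 < t" "t \<le> T" for t
  proof -
    have "duhamel_const * L * t powr (1 - \<nu>) \<le> duhamel_const * L * T powr (1 - \<nu>)"
      using that duhamel_const L \<nu> by (intro mult_left_mono powr_mono2) auto
    then show ?thesis by (simp add: B_def mult_ac)
  qed
  have b0: "norm (duhamel k t) \<le> B" if "0 \<le> t" "t \<le> T" for t
    using duhamel_bounds(2)[OF d, of t] pm[of t] that B0 by (cases "t = 0") auto
  have bY: "duhamel k t \<in> carr Y" "t powr \<theta> * nrm Y (duhamel k t) \<le> B" if "0 < t" "t \<le> T" for t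
    using duhamel_bounds(1,3)[OF d, of t] pm[of t] that by auto
  show "bounded_by (\<lambda>t. duhamel g t - duhamel h t) (duhamel_const * T powr (1 - \<nu>) * L)"
    unfolding B_def[symmetric] using b0 bY by (auto simp: bounded_by_def dk)
  have eq: "(S t x + duhamel g t) - (S t y + duhamel h t) = S t (x - y) + duhamel k t" if "0 \<le> t" "t \<le> T" for t
    using dk[OF that] by (simp add: S_diff[OF that(1)] algebra_simps)
  show "bounded_by (\<lambda>t. (S t x + duhamel g t) - (S t y + duhamel h t))
       ((C + CY) * norm (x - y) + duhamel_const * T powr (1 - \<nu>) * L)"
    unfolding B_def[symmetric] bounded_by_def
  proof (intro conjI ballI)
    fix t assume t: "t \<in> {0..T}"
    have "norm (S t (x - y) + duhamel k t) \<le> C * norm (x - y) + B"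
      using t by (intro order_trans[OF norm_triangle_ineq] add_mono S_bound b0) auto
    also have "\<dots> \<le> (C + CY) * norm (x - y) + B" using CY by (simp add: distrib_right)
    finally show "norm ((S t x + duhamel g t) - (S t y + duhamel h t)) \<le> (C + CY) * norm (x - y) + B"
      using eq[of t] t by simp
  next
    fix t assume "t \<in> {0<..T}"
    then have t: "0 < t" "t \<le> T" by auto
    have mem: "S t (x - y) \<in> carr Y" by (rule S_smooth_Y[OF t(1)])
    show "(S t x + duhamel g t) - (S t y + duhamel h t) \<in> carr Y"
      using eq[of t] t Y.add_mem[OF mem bY(1)[OF t]] by simp
    have "t powr \<theta> * nrm Y (S t (x - y)) \<le> t powr \<theta> * (CY * t powr (-\<theta>) * norm (x - y))"
      by (intro mult_left_mono S_0Y t) auto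
    also have "\<dots> = CY * norm (x - y)" using t by (simp add: powr_minus)
    finally have 1: "t powr \<theta> * nrm Y (S t (x - y)) \<le> CY * norm (x - y)" .
    have "t powr \<theta> * nrm Y (S t (x - y) + duhamel k t) \<le> t powr \<theta> * (nrm Y (S t (x - y)) + nrm Y (duhamel k t))"
      by (intro mult_left_mono Y.nrm_triangle mem bY t) auto
    also have "\<dots> \<le> CY * norm (x - y) + B" using 1 bY(2)[OF t] by (simp add: distrib_left)
    also have "\<dots> \<le> (C + CY) * norm (x - y) + B" using C by (simp add: distrib_right)
    finally show "t powr \<theta> * nrm Y ((S t x + duhamel g t) - (S t y + duhamel h t)) \<le> (C + CY) * norm (x - y) + B"
      using eq[of t] t by simp
  qed
qed

text \<open>\<open>R\<close> inverts the linear boundary operator and \<open>\<Lambda>\<close> is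
  the part of the nonlocal condition that falls on the Duhamel integral \<open>v\<close>. The
  hypothesis \<open>bc\<close> says that the condition amounts to the initial value
  \<open>R (M + \<Lambda> v)\<close>; inserting this into the mild equation gives the map
  \<open>\<Phi>\<close>.\<close>

lemma well_posed_small_fixed_point:
  fixes f :: "(real \<Rightarrow> 'a) \<Rightarrow> real \<Rightarrow> 'a" and R :: "'a \<Rightarrow> 'a" and \<Lambda> :: "(real \<Rightarrow> 'a) \<Rightarrow> 'a"
    and l cT CL :: real
  assumes dense: "dense_in E1 whole" and l: "l > 0" and cT: "cT > 0" and CL: "CL \<ge> 0"
    and maps: "\<And>u. u \<in> C_weighted \<theta> T Y \<Longrightarrow> f u \<in> C_weighted \<nu> T X"
    and zero: "\<And>t. 0 < t \<Longrightarrow> t \<le> T \<Longrightarrow> f (\<lambda>_. 0) t = 0"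
    and lip: "\<And>L v w. 0 < L \<Longrightarrow> L < 1 \<Longrightarrow> v \<in> C_weighted \<theta> T Y \<Longrightarrow> w \<in> C_weighted \<theta> T Y \<Longrightarrow>
         C_norm \<theta> T Y v + C_norm \<theta> T Y w \<le> L \<Longrightarrow> (\<forall>t\<in>{0<..T}. norm (v t) + norm (w t) \<le> L) \<Longrightarrow>
         C_norm \<nu> T X (\<lambda>t. f v t - f w t) \<le> cT * L powr l * C_norm \<theta> T Y (\<lambda>t. v t - w t)"
    and R: "bounded_linear R"
    and \<Lambda>: "\<And>v w e. continuous_on {0..T} v \<Longrightarrow> continuous_on {0..T} w \<Longrightarrow>
        (\<And>t. t \<in> {0..T} \<Longrightarrow> norm (v t - w t) \<le> e) \<Longrightarrow> norm (\<Lambda> v - \<Lambda> w) \<le> CL * e"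
    and bc: "\<And>u u0 v M. continuous_on {0..T} v \<Longrightarrow> v 0 = 0 \<Longrightarrow>
        (\<And>t. t \<in> {0..T} \<Longrightarrow> u t = S t u0 + v t) \<Longrightarrow> bc u M \<longleftrightarrow> u0 = R (M + \<Lambda> v)"
    and reg: "\<And>u. continuous_on {0..T} u \<Longrightarrow> u \<in> C_weighted \<theta> T Y \<Longrightarrow> mild_equation S T f u \<Longrightarrow> reg u"
    and \<Lambda>0: "\<Lambda> (\<lambda>_. 0) = 0"
  shows "well_posed_small S T f Y \<theta> bc reg"
proof -
  obtain KR where KR: "KR > 0" "\<And>x. norm (R x) \<le> norm x * KR"
    using bounded_linear.pos_bounded[OF R] by blast
  define D where "D = duhamel_const * T powr (1 - \<nu>)"
  have D: "D \<ge> 0" using duhamel_const by (simp add: D_def)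
  \<comment> \<open>The Lipschitz constant from the forcing to \<open>\<Phi>\<close>: the first term
    is the effect through the initial value, the second the direct effect through the Duhamel
    integral.\<close>
  define Q where "Q = (C + CY) * (KR * (CL * D)) + D"
  have Q: "Q \<ge> 0" using C CY KR CL D by (simp add: Q_def)
  define \<Phi> where "\<Phi> = (\<lambda>M u t. S t (R (M + \<Lambda> (duhamel (f u)))) + duhamel (f u) t)"
  have frc: "\<exists>N. forcing N (f u)" if "u \<in> sol_space" for u
    using forcing_of_weighted[OF maps] that by (auto simp: sol_space_def)
  have Rdiff: "norm (R x - R y) \<le> KR * norm (x - y)" for x y
    using KR(2)[of "x - y"] linear_diff[OF bounded_linear.linear[OF R]] by (simp add: mult.commute)

  have \<Phi>_space: "\<Phi> M u \<in> sol_space" if "u \<in> sol_space" for u M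
    using frc[OF that] mild_solution_space[OF _ dense] unfolding \<Phi>_def sol_space_def by blast
  have \<Phi>_diff: "bounded_by (\<lambda>t. \<Phi> M u t - \<Phi> M v t) (Q * N)"
    if u: "u \<in> sol_space" and v: "v \<in> sol_space" and N: "forcing N (\<lambda>t. f u t - f v t)" for u v M N
  proof -
    obtain Nu Nv where g: "forcing Nu (f u)" and h: "forcing Nv (f v)" using frc u v by blast
    have N0: "N \<ge> 0" by (rule forcingD(1)[OF N])
    have "bounded_by (\<lambda>t. duhamel (f u) t - duhamel (f v) t) (D * N)"
      using mild_difference(1)[OF g h N] by (simp add: D_def)
    then have "norm (\<Lambda> (duhamel (f u)) - \<Lambda> (duhamel (f v))) \<le> CL * (D * N)"
      using bounded_byD(1) by (intro \<Lambda> continuous_on_duhamel[OF g dense] continuous_on_duhamel[OF h dense]) auto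
    then have "norm (R (M + \<Lambda> (duhamel (f u))) - R (M + \<Lambda> (duhamel (f v)))) \<le> KR * (CL * (D * N))"
      using KR by (intro order_trans[OF Rdiff] mult_left_mono) auto
    then have "(C + CY) * norm (R (M + \<Lambda> (duhamel (f u))) - R (M + \<Lambda> (duhamel (f v)))) \<le> (C + CY) * (KR * (CL * (D * N)))"
      using C CY by (intro mult_left_mono) auto
    moreover have "Q * N = (C + CY) * (KR * (CL * (D * N))) + D * N" by (simp add: Q_def algebra_simps)
    ultimately have "(C + CY) * norm (R (M + \<Lambda> (duhamel (f u))) - R (M + \<Lambda> (duhamel (f v)))) + D * N \<le> Q * N"
      by linarith
    moreover have "bounded_by (\<lambda>t. \<Phi> M u t - \<Phi> M v t)
        ((C + CY) * norm (R (M + \<Lambda> (duhamel (f u))) - R (M + \<Lambda> (duhamel (f v)))) + D * N)"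
      unfolding \<Phi>_def D_def by (rule mild_difference(2)[OF g h N])
    ultimately show ?thesis unfolding bounded_by_def by fastforce
  qed
  have z: "(\<lambda>_. 0) \<in> sol_space" by (simp add: sol_space_def Y.C_weighted_zero)

  have "((\<lambda>r::real. (2 * r) powr l) \<longlongrightarrow> 0) (at_right 0)"
  proof (rule tendsto_zero_powrI[OF _ tendsto_const _ l])
    show "((\<lambda>r::real. 2 * r) \<longlongrightarrow> 0) (at_right 0)" by (intro tendsto_mult_right_zero tendsto_ident_at)
    show "\<forall>\<^sub>F r in at_right 0. 0 \<le> 2 * (r::real)"
      using eventually_at_right_less[of "0::real"] by eventually_elim simp
  qed
  then have "((\<lambda>r. Q * cT * (2 * r) powr l) \<longlongrightarrow> 0) (at_right 0)" by (rule tendsto_mult_right_zero)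
  then have "\<forall>\<^sub>F r in at_right 0. Q * cT * (2 * r) powr l < 1/2" by (intro order_tendstoD(2)) auto
  moreover have "\<forall>\<^sub>F r in at_right 0. r \<in> {0<..<1/2::real}" by (rule eventually_at_right_real) simp
  ultimately have "\<forall>\<^sub>F r in at_right 0. Q * cT * (2 * r) powr l < 1/2 \<and> r \<in> {0<..<1/2}" by (rule eventually_conj)
  \<comment> \<open>The Lipschitz hypothesis is used with \<open>L = 2 * r\<close>, the sum of the
    bounds on two elements of the ball; hence \<open>r < 1/2\<close>, and smallness of
    \<open>L powr l\<close> gives contraction factor 1/2.\<close>
  then obtain r where r: "Q * cT * (2 * r) powr l < 1/2" "0 < r" "r < 1/2"
    using eventually_happens[of _ "at_right (0::real)"] by auto
  define q where "q = cT * (2 * r) powr l"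
  have q: "q \<ge> 0" "Q * q \<le> 1/2" using cT r by (auto simp: q_def mult.assoc)
  have cn: "C_norm \<theta> T Y w \<le> e" if "bounded_by w e" for w e
    by (rule C_norm_least[OF T]) (rule bounded_byD(3)[OF that])

  have flip: "forcing (q * e) (\<lambda>t. f u t - f v t)"
    if u: "u \<in> sol_space" "bounded_by u r" and v: "v \<in> sol_space" "bounded_by v r"
      and e: "bounded_by (\<lambda>t. u t - v t) e" for u v e
  proof -
    have uw: "u \<in> C_weighted \<theta> T Y" "v \<in> C_weighted \<theta> T Y" using u v by (auto simp: sol_space_def)
    have "C_norm \<nu> T X (\<lambda>t. f u t - f v t) \<le> cT * (2 * r) powr l * C_norm \<theta> T Y (\<lambda>t. u t - v t)"
    proof (rule lip[OF _ _ uw])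
      show "C_norm \<theta> T Y u + C_norm \<theta> T Y v \<le> 2 * r" using cn[OF u(2)] cn[OF v(2)] by simp
      show "\<forall>t\<in>{0<..T}. norm (u t) + norm (v t) \<le> 2 * r"
      proof
        fix t assume "t \<in> {0<..T}"
        then show "norm (u t) + norm (v t) \<le> 2 * r"
          using bounded_byD(1)[OF u(2), of t] bounded_byD(1)[OF v(2), of t] by simp
      qed
    qed (use r in auto)
    also have "\<dots> \<le> q * e" using cn[OF e] q unfolding q_def by (intro mult_left_mono) auto
    finally have "C_norm \<nu> T X (\<lambda>t. f u t - f v t) \<le> q * e" .
    moreover have "(\<lambda>t. f u t - f v t) \<in> C_weighted \<nu> T X"
      using uw by (intro X.C_weighted_diff maps T)
    ultimately show ?thesis using forcing_of_weighted forcing_mono by blast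
  qed
  have mono: "bounded_by w a \<Longrightarrow> a \<le> b \<Longrightarrow> bounded_by w b" for w a b
    by (auto simp: bounded_by_def)
  have contr: "bounded_by (\<lambda>t. \<Phi> M u t - \<Phi> M v t) (e / 2)"
    if "u \<in> sol_space" "v \<in> sol_space" "bounded_by u r" "bounded_by v r" "e \<ge> 0" "bounded_by (\<lambda>t. u t - v t) e" for M u v e
  proof (rule mono[OF \<Phi>_diff[OF that(1,2) flip[OF that(1,3,2,4,6)]]])
    show "Q * (q * e) \<le> e / 2" using mult_right_mono[OF q(2) that(5)] by (simp add: mult.assoc)
  qed

  \<comment> \<open>Leaves \<open>\<Phi> M\<close> at the zero function within \<open>r / 2\<close>;
    the other half of the radius is spent on the contraction from zero to an arbitrary element of
    the ball.\<close>
  define m where "m = r / (2 * ((C + CY) * KR))"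
  have CK: "(C + CY) * KR > 0" using C CY KR by simp
  have m: "m > 0" using r CK by (simp add: m_def)
  have zr: "bounded_by (\<lambda>_. 0) r" using r by (simp add: bounded_by_def)
  have \<Phi>0: "bounded_by (\<Phi> M (\<lambda>_. 0)) (r / 2)" if "norm M \<le> m" for M
  proof -
    \<comment> \<open>The image of the zero function vanishes on \<open>{0<..T}\<close> only; its
      arbitrary value at 0 is removed as a null set.\<close>
    have d0: "duhamel (f (\<lambda>_. 0)) t = 0" if "t \<in> {0..T}" for t
    proof -
      have "duhamel (f (\<lambda>_. 0)) t = integral {0..t} (\<lambda>_. 0)"
        unfolding duhamel_def
        by (rule integral_spike[of "{0}"]) (use zero that in \<open>auto simp: linear_0[OF S_linear]\<close>)
      then show ?thesis by simp
    qed
    obtain N where N: "forcing N (f (\<lambda>_. 0))" using frc[OF z] by blast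
    have "norm (\<Lambda> (duhamel (f (\<lambda>_. 0))) - \<Lambda> (\<lambda>_. 0)) \<le> CL * 0"
      by (rule \<Lambda>[OF continuous_on_duhamel[OF N dense]]) (use d0 in auto)
    then have "\<Lambda> (duhamel (f (\<lambda>_. 0))) = 0" using \<Lambda>0 by simp
    then have eq: "\<Phi> M (\<lambda>_. 0) t = S t (R M)" if "t \<in> {0..T}" for t using d0[OF that] by (simp add: \<Phi>_def)
    have half: "r / (2 * P) * P = r / 2" if "P > 0" for P using that by simp
    have "(C + CY) * norm (R M) \<le> (C + CY) * (m * KR)"
      using KR that C CY by (intro mult_left_mono order_trans[OF KR(2)] mult_right_mono) auto
    also have "\<dots> = m * ((C + CY) * KR)" by (simp only: mult_ac)
    also have "\<dots> = r / 2" unfolding m_def by (rule half[OF CK])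
    finally have le: "(C + CY) * norm (R M) \<le> r / 2" .
    have "forcing 0 (\<lambda>_. 0)" by (simp add: forcing_def)
    from mild_difference(2)[OF this this, of 0 "R M" 0] this
    have "bounded_by (\<lambda>t. S t (R M) + duhamel (\<lambda>_. 0) t - (S t 0 + duhamel (\<lambda>_. 0) t)) ((C + CY) * norm (R M))"
      by simp
    from mono[OF this le] show ?thesis
      by (auto simp: bounded_by_def eq linear_0[OF S_linear])
  qed
  have maps': "\<Phi> M u \<in> sol_space \<and> bounded_by (\<Phi> M u) r"
    if M: "norm M \<le> m" and u: "u \<in> sol_space" "bounded_by u r" for M u
  proof
    show "\<Phi> M u \<in> sol_space" by (rule \<Phi>_space[OF u(1)])
    have "bounded_by (\<lambda>t. \<Phi> M u t - \<Phi> M (\<lambda>_. 0) t) (r / 2)"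
      using u r by (intro contr z zr) auto
    moreover have "bounded_by (\<lambda>t. \<Phi> M (\<lambda>_. 0) t - 0) (r / 2)" using \<Phi>0[OF M] by simp
    ultimately have "bounded_by (\<lambda>t. \<Phi> M u t - 0) (r / 2 + r / 2)" by (rule bounded_by_triangle)
    then show "bounded_by (\<Phi> M u) r" by simp
  qed
  define sol where "sol = (\<lambda>M u. continuous_on {0..T} u \<and> u \<in> C_weighted \<theta> T Y \<and> mild_equation S T f u \<and> bc u M
                  \<and> (\<forall>t\<in>{0..T}. norm (u t) \<le> r) \<and> C_norm \<theta> T Y u \<le> r)"
  have sol_iff: "sol M u \<longleftrightarrow> u \<in> sol_space \<and> bounded_by u r \<and> (\<forall>t\<in>{0..T}. \<Phi> M u t = u t)" for M u
  proof (cases "u \<in> sol_space")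
    case True
    then have uw: "u \<in> C_weighted \<theta> T Y" "continuous_on {0..T} u" by (auto simp: sol_space_def)
    obtain N where N: "forcing N (f u)" using frc[OF True] by blast
    have bnd: "bounded_by u r \<longleftrightarrow> (\<forall>t\<in>{0..T}. norm (u t) \<le> r) \<and> C_norm \<theta> T Y u \<le> r"
    proof
      assume "bounded_by u r"
      then show "(\<forall>t\<in>{0..T}. norm (u t) \<le> r) \<and> C_norm \<theta> T Y u \<le> r"
        using cn[of u r] by (auto simp: bounded_by_def)
    next
      assume "(\<forall>t\<in>{0..T}. norm (u t) \<le> r) \<and> C_norm \<theta> T Y u \<le> r"
      then show "bounded_by u r" unfolding bounded_by_def
        using order_trans[OF Y.C_norm_upper[OF uw(1)], of _ r] sol_space_mem[OF True] by auto
    qed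
    have mild: "mild_equation S T f u \<longleftrightarrow> (\<forall>t\<in>{0..T}. u t = S t (u 0) + duhamel (f u) t)"
      unfolding mild_equation_def
    proof (intro ball_cong refl)
      fix t assume "t \<in> {0..T}"
      then have "((\<lambda>s. S (t - s) (f u s)) has_integral duhamel (f u) t) {0..t}"
        unfolding duhamel_def by (intro integrable_integral kernel_integrable[OF N]) auto
      then show "((\<lambda>s. S (t - s) (f u s)) has_integral u t - S t (u 0)) {0..t} \<longleftrightarrow> u t = S t (u 0) + duhamel (f u) t"
        by (auto dest: has_integral_unique simp: algebra_simps)
    qed
    have cd: "continuous_on {0..T} (duhamel (f u))" by (rule continuous_on_duhamel[OF N dense])
    \<comment> \<open>At time 0 the Duhamel integral vanishes, so a fixed point has initial value
      \<open>R (M + \<Lambda> v)\<close>; this turns the fixed point equation back into the mild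
      equation and the nonlocal condition.\<close>
    have fp: "mild_equation S T f u \<and> bc u M \<longleftrightarrow> (\<forall>t\<in>{0..T}. \<Phi> M u t = u t)"
    proof
      assume mb: "mild_equation S T f u \<and> bc u M"
      then have eq: "u t = S t (u 0) + duhamel (f u) t" if "t \<in> {0..T}" for t using that mild by blast
      have "u 0 = R (M + \<Lambda> (duhamel (f u)))" using bc[OF cd duhamel_zero eq] mb by blast
      then show "\<forall>t\<in>{0..T}. \<Phi> M u t = u t" using eq by (simp add: \<Phi>_def)
    next
      assume fx: "\<forall>t\<in>{0..T}. \<Phi> M u t = u t"
      then have "\<Phi> M u 0 = u 0" using T by simp
      then have u0: "u 0 = R (M + \<Lambda> (duhamel (f u)))" by (simp add: \<Phi>_def)
      have eq: "u t = S t (u 0) + duhamel (f u) t" if "t \<in> {0..T}" for t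
        using fx that by (simp add: u0[unfolded \<Phi>_def] \<Phi>_def)
      then show "mild_equation S T f u \<and> bc u M" using mild bc[OF cd duhamel_zero eq] u0 by blast
    qed
    show ?thesis unfolding sol_def using True uw bnd fp by blast
  qed (auto simp: sol_def sol_space_def)
  have "\<exists>u. sol M u \<and> (\<forall>v. sol M v \<longrightarrow> (\<forall>t\<in>{0..T}. v t = u t)) \<and> reg u" if M: "norm M \<le> m" for M
  proof -
    have "\<exists>u. u \<in> sol_space \<and> bounded_by u r \<and> (\<forall>t\<in>{0..T}. \<Phi> M u t = u t)"
      by (rule contraction_fixed_point(1)[OF r(2)]) (rule maps'[OF M] contr; assumption)+
    then obtain u where u: "u \<in> sol_space" "bounded_by u r" "\<forall>t\<in>{0..T}. \<Phi> M u t = u t" by blast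
    have "sol M u" using u sol_iff by blast
    moreover have "v t = u t" if v: "sol M v" and t: "t \<in> {0..T}" for v t
    proof (rule contraction_fixed_point(2)[OF r(2), of "\<Phi> M" v u t])
      show "\<Phi> M w \<in> sol_space \<and> bounded_by (\<Phi> M w) r" if "w \<in> sol_space" "bounded_by w r" for w
        by (rule maps'[OF M that])
      show "bounded_by (\<lambda>t. \<Phi> M w t - \<Phi> M x t) (e / 2)"
        if "w \<in> sol_space" "x \<in> sol_space" "bounded_by w r" "bounded_by x r" "e \<ge> 0" "bounded_by (\<lambda>t. w t - x t) e"
        for w x e by (rule contr[OF that])
      show "v \<in> sol_space" "bounded_by v r" using v sol_iff by blast+
      show "\<Phi> M v t = v t" if "t \<in> {0..T}" for t using v sol_iff that by blast
    qed (use u t in auto)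
    moreover have "reg u" using \<open>sol M u\<close> unfolding sol_def by (intro reg) auto
    ultimately show ?thesis by blast
  qed
  then show ?thesis unfolding well_posed_small_def Let_def sol_def using m r(2) by blast
qed

end

section \<open>Strong regularity\<close>

context smoothing_semigroup
begin

lemma target_E1: "target_space S E1 A T C E1 C"
proof
  fix x t
  show "x \<in> carr E1 \<Longrightarrow> norm x \<le> C * nrm E1 x" by (rule E1_emb)
  show "x \<in> carr E1 \<and> nrm E1 x \<le> C * nrm E1 x" if "x \<in> carr E1"
    using that mult_right_mono[OF C E1.nrm_ge0[OF that]] by simp
  show "S t x \<in> carr E1 \<and> nrm E1 (S t x) \<le> C * nrm E1 x" if "x \<in> carr E1" "0 \<le> t" "t \<le> T"
    using A_commute[OF that(1,2)] S_E1_bound[OF that(2,3,1)] by simp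
qed (rule C)

lemma S_tendsto: "((\<lambda>t. S t x) \<longlongrightarrow> x) (at_right 0)"
  using S_cont[of x] by (simp add: continuous_on_def at_within_Ici_at_right[symmetric]) force

lemma S_ftc_reversed:
  assumes x: "x \<in> carr E1" and at: "a \<le> t" "t - a \<le> T"
  shows "((\<lambda>s. S (t - s) (A x)) has_integral (S (t - a) x - x)) {a..t}"
proof -
  have "((\<lambda>s. S (t - s) (A x)) has_integral (- S (t - t) x - - S (t - a) x)) {a..t}"
  proof (rule fundamental_theorem_of_calculus_interior)
    show "continuous_on {a..t} (\<lambda>s. - S (t - s) x)"
      using at by (intro continuous_intros continuous_on_S) auto
    fix s assume s: "s \<in> {a<..<t}"
    have 1: "((\<lambda>s. t - s) has_vector_derivative -1) (at s)"
      using has_vector_derivative_diff[OF has_vector_derivative_const has_vector_derivative_id, of t "at s"] by simp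
    have 2: "((\<lambda>r. S r x) has_vector_derivative A (S (t - s) x)) (at (t - s))"
      using s by (intro S_deriv) auto
    have "((\<lambda>s. S (t - s) x) has_vector_derivative - A (S (t - s) x)) (at s)"
      using vector_diff_chain_at[OF 1 2] by (simp add: o_def)
    from has_vector_derivative_minus[OF this]
    show "((\<lambda>s. - S (t - s) x) has_vector_derivative S (t - s) (A x)) (at s)"
      using A_commute[OF x, of "t - s"] s by simp
  qed (use at in auto)
  then show ?thesis by simp
qed

lemma mild_evolves:
  assumes "mild_equation S T f u"
  shows "evolves u (f u)"
proof (rule evolvesI)
  fix t assume t: "0 \<le> t" "t \<le> T"
  then have *: "((\<lambda>s. S (t - s) (f u s)) has_integral (u t - S t (u 0))) {0..t}"
    using assms by (simp add: mild_equation_def)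
  then show "(\<lambda>s. S (t - s) (f u s)) integrable_on {0..t}" by (rule has_integral_integrable)
  show "u t = S t (u 0) + duhamel (f u) t" using integral_unique[OF *] by (simp add: duhamel_def)
qed

text \<open>Since \<open>u a\<close> lies in \<open>E1\<close>, the increment
  \<open>u t - u a\<close> is the integral over \<open>{a..t}\<close> of \<open>S (t - s)\<close>
  applied to \<open>A (u a) + g s\<close>. This integrand is uniformly close to the claimed
  derivative near \<open>t0\<close>, so the quotient is estimated without differentiating a
  convolution.\<close>

lemma strong_derivative:
  assumes u: "evolves u g" and g: "continuous_on {0<..T} g" and ci: "cont_in E1 {0<..T} u"
  shows "\<exists>u'. continuous_on {0<..T} u' \<and> (\<forall>t\<in>{0<..T}.
     (u has_vector_derivative u' t) (at t within {0<..T}) \<and> u' t = A (u t) + g t)"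
proof -
  define u' where "u' = (\<lambda>t. A (u t) + g t)"
  have mem: "u t \<in> carr E1" if "t \<in> {0<..T}" for t using ci that by (simp add: cont_in_def)
  have Alim: "((\<lambda>s. A (u s)) \<longlongrightarrow> A (u t)) (at t within {0<..T})" if t: "t \<in> {0<..T}" for t
  proof (rule LIM_zero_cancel, rule Lim_null_comparison)
    have "\<forall>\<^sub>F s in at t within {0<..T}. s \<in> {0<..T}" by (simp add: eventually_at_filter)
    then show "\<forall>\<^sub>F s in at t within {0<..T}. norm (A (u s) - A (u t)) \<le> C * nrm E1 (u s - u t)"
    proof eventually_elim
      case (elim s)
      show ?case using A_bound[OF E1.diff_mem[OF mem[OF elim] mem[OF t]]] A_diff[OF mem[OF elim] mem[OF t]] by simp
    qed
    show "((\<lambda>s. C * nrm E1 (u s - u t)) \<longlongrightarrow> 0) (at t within {0<..T})"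
      using ci t by (intro tendsto_mult_right_zero) (simp add: cont_in_def)
  qed
  have glim: "(g \<longlongrightarrow> g t) (at t within {0<..T})" if "t \<in> {0<..T}" for t
    using g that by (simp add: continuous_on_def)
  have "continuous_on {0<..T} u'"
    unfolding u'_def continuous_on_def using Alim glim by (auto intro: tendsto_add)
  moreover have "(u has_vector_derivative u' t0) (at t0 within {0<..T})" if t0: "t0 \<in> {0<..T}" for t0
    unfolding has_vector_derivative_iff_quotient
  proof (rule tendstoI)
    fix e :: real assume e: "e > 0"
    define y where "y = u' t0"
    \<comment> \<open>Makes \<open>C * (\<eta> + \<eta>) + \<eta> = e / 2\<close>: errors of
      \<open>A u\<close> and \<open>g\<close> pass through the semigroup, that of \<open>S\<close>
      acting on the limit does not.\<close>
    define \<eta> where "\<eta> = e / (2 * (2 * C + 1))"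
    have half: "P * (e / (2 * P)) = e / 2" if "P > 0" for P using that by simp
    have "C * (\<eta> + \<eta>) + \<eta> = (2 * C + 1) * \<eta>" by (simp add: algebra_simps)
    also have "\<dots> = e / 2" unfolding \<eta>_def by (rule half) (use C in simp)
    finally have \<eta>: "\<eta> > 0" "C * (\<eta> + \<eta>) + \<eta> = e / 2" using e C by (auto simp: \<eta>_def)
    obtain d1 where d1: "d1 > 0" "\<And>s. s \<in> {0<..T} \<Longrightarrow> s \<noteq> t0 \<Longrightarrow> dist s t0 < d1 \<Longrightarrow> dist (A (u s)) (A (u t0)) < \<eta>"
      using tendstoD[OF Alim[OF t0] \<eta>(1)] unfolding eventually_at by auto
    obtain d2 where d2: "d2 > 0" "\<And>s. s \<in> {0<..T} \<Longrightarrow> s \<noteq> t0 \<Longrightarrow> dist s t0 < d2 \<Longrightarrow> dist (g s) (g t0) < \<eta>"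
      using tendstoD[OF glim[OF t0] \<eta>(1)] unfolding eventually_at by auto
    obtain d3 where d3: "d3 > 0" "\<And>r. 0 < r \<Longrightarrow> r < d3 \<Longrightarrow> dist (S r y) y < \<eta>"
      using tendstoD[OF S_tendsto[of y] \<eta>(1)] unfolding eventually_at_right_field by auto
    define d where "d = min d1 (min d2 d3)"
    have nA: "norm (A (u s) - A (u t0)) \<le> \<eta>" if "s \<in> {0<..T}" "\<bar>s - t0\<bar> < d" for s
      using d1(2)[OF that(1)] that(2) \<eta> by (cases "s = t0") (auto simp: d_def dist_norm less_imp_le)
    have ng: "norm (g s - g t0) \<le> \<eta>" if "s \<in> {0<..T}" "\<bar>s - t0\<bar> < d" for s
      using d2(2)[OF that(1)] that(2) \<eta> by (cases "s = t0") (auto simp: d_def dist_norm less_imp_le)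
    have nS: "norm (S r y - y) \<le> \<eta>" if "0 \<le> r" "r < d" for r
      using d3(2)[of r] that \<eta> by (cases "r = 0") (auto simp: d_def dist_norm less_imp_le)
    \<comment> \<open>Letting \<open>t0\<close> be either end point of the interval covers the right
      and the left difference quotient together.\<close>
    have key: "norm ((u t - u a) /\<^sub>R (t - a) - y) \<le> e / 2"
      if at: "a \<in> {0<..T}" "t \<in> {0<..T}" "a < t" "t - a < d" "a = t0 \<or> t = t0" for a t
    proof -
      define k where "k = (\<lambda>s. S (t - s) (A (u a) + g s))"
      have cg: "continuous_on {a..t} g" by (rule continuous_on_subset[OF g]) (use at in auto)
      have ck: "continuous_on {a..t} k" unfolding k_def
        using at by (intro continuous_on_S continuous_intros cg) auto
      have i1: "((\<lambda>s. S (t - s) (A (u a))) has_integral (S (t - a) (u a) - u a)) {a..t}"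
        using at by (intro S_ftc_reversed mem) auto
      have i2: "((\<lambda>s. S (t - s) (g s)) has_integral (u t - S (t - a) (u a))) {a..t}"
      proof -
        have "(\<lambda>s. S (t - s) (g s)) integrable_on {a..t}"
          using at by (intro integrable_continuous_real continuous_on_S continuous_intros cg) auto
        then show ?thesis using evolvesD[OF u, of a t] at integrable_integral by fastforce
      qed
      have "(k has_integral (u t - u a)) {a..t}"
      proof (rule has_integral_eq)
        show "((\<lambda>s. S (t - s) (A (u a)) + S (t - s) (g s)) has_integral (u t - u a)) {a..t}"
          using has_integral_add[OF i1 i2] by (simp add: add.commute)
      qed (simp add: k_def linear_add[OF S_linear])
      moreover have "((\<lambda>s. y) has_integral ((t - a) *\<^sub>R y)) {a..t}"
        using has_integral_const_real[of y a t] at by simp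
      ultimately have i: "((\<lambda>s. k s - y) has_integral (u t - u a - (t - a) *\<^sub>R y)) {a..t}"
        by (rule has_integral_diff)
      have "norm (k s - y) \<le> e / 2" if s: "s \<in> {a..t}" for s
      proof -
        have st: "s \<in> {0<..T}" "\<bar>s - t0\<bar> < d" "\<bar>a - t0\<bar> < d" "0 \<le> t - s" "t - s < d" "t - s \<le> T" using s at by auto
        have "k s - y = S (t - s) ((A (u a) - A (u t0)) + (g s - g t0)) + (S (t - s) y - y)"
          using st by (simp add: k_def y_def u'_def linear_add[OF S_linear] S_diff)
        also have "norm \<dots> \<le> C * (\<eta> + \<eta>) + \<eta>"
        proof (intro order_trans[OF norm_triangle_ineq] add_mono nS st)
          have "norm ((A (u a) - A (u t0)) + (g s - g t0)) \<le> \<eta> + \<eta>"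
            using nA[OF at(1) st(3)] ng[OF st(1,2)] norm_triangle_ineq[of "A (u a) - A (u t0)" "g s - g t0"] by linarith
          then show "norm (S (t - s) ((A (u a) - A (u t0)) + (g s - g t0))) \<le> C * (\<eta> + \<eta>)"
            using C st by (intro order_trans[OF S_bound] mult_left_mono) auto
        qed
        finally show ?thesis using \<eta>(2) by simp
      qed
      then have "norm (integral {a..t} (\<lambda>s. k s - y)) \<le> e / 2 * (t - a)"
        using at by (intro integral_bound continuous_intros ck) auto
      then have le: "norm (u t - u a - (t - a) *\<^sub>R y) \<le> e / 2 * (t - a)" using integral_unique[OF i] by simp
      have "(u t - u a) /\<^sub>R (t - a) - y = (u t - u a - (t - a) *\<^sub>R y) /\<^sub>R (t - a)"
        using at by (simp add: scaleR_diff_right)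
      then have "norm ((u t - u a) /\<^sub>R (t - a) - y) = norm (u t - u a - (t - a) *\<^sub>R y) / (t - a)"
        using at by (simp add: divide_inverse mult.commute)
      also have "\<dots> \<le> e / 2" using le at by (simp add: field_simps)
      finally show ?thesis .
    qed
    have "d > 0" using d1 d2 d3 by (simp add: d_def)
    then have "\<forall>\<^sub>F s in at t0 within {0<..T}. s \<in> {0<..T} \<and> s \<noteq> t0 \<and> \<bar>s - t0\<bar> < d"
      unfolding eventually_at dist_real_def by blast
    then show "\<forall>\<^sub>F s in at t0 within {0<..T}. dist ((u s - u t0) /\<^sub>R (s - t0)) (u' t0) < e"
    proof eventually_elim
      case (elim s)
      have "(u s - u t0) /\<^sub>R (s - t0) = (u t0 - u s) /\<^sub>R (t0 - s)"
        by (metis minus_diff_eq scaleR_minus_left scaleR_minus_right inverse_minus_eq minus_minus)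
      then have "norm ((u s - u t0) /\<^sub>R (s - t0) - y) \<le> e / 2"
        using key[of t0 s] key[of s t0] elim t0 by (cases "t0 < s") auto
      then show ?case using e by (simp add: dist_norm y_def)
    qed
  qed
  ultimately show ?thesis by (intro exI[of _ u']) (auto simp: u'_def)
qed

text \<open>For \<open>x\<close> in \<open>E1\<close> this is the fundamental theorem. For general
  \<open>x\<close> it is applied to the regularised vectors \<open>S (\<tau> n) x\<close>, and
  closedness of \<open>A\<close> carries it to the limit.\<close>

lemma S_integral_E1:
  assumes at: "a \<le> t" "t - a \<le> T"
  shows "integral {a..t} (\<lambda>s. S (t - s) x) \<in> carr E1 \<and> A (integral {a..t} (\<lambda>s. S (t - s) x)) = S (t - a) x - x"
proof -
  define z where "z = integral {a..t} (\<lambda>s. S (t - s) x)"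
  have cont: "continuous_on {a..t} (\<lambda>s. S (t - s) x)" for x using at by (intro continuous_on_S continuous_intros) auto
  define \<tau> where "\<tau> = (\<lambda>n. T * inverse (real (Suc n)))"
  have \<tau>: "0 < \<tau> n" "\<tau> n \<le> T" for n
    using T mult_left_mono[of "inverse (real (Suc n))" 1 T] by (auto simp: \<tau>_def field_simps)
  have "\<tau> \<longlonglongrightarrow> T * 0" unfolding \<tau>_def by (rule tendsto_mult[OF tendsto_const LIMSEQ_inverse_real_of_nat])
  then have "filterlim \<tau> (at_right 0) sequentially"
    using \<tau>(1) by (auto simp: filterlim_at intro!: always_eventually less_imp_neq[symmetric])
  then have lim: "(\<lambda>n. S (\<tau> n) x) \<longlonglongrightarrow> x" for x
    by (rule filterlim_compose[OF S_tendsto])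
  have Az: "A (S (\<tau> n) z) = S (t - a) (S (\<tau> n) x) - S (\<tau> n) x" for n
  proof -
    have "A (S (\<tau> n) z) = integral {a..t} (\<lambda>s. A (S (\<tau> n) (S (t - s) x)))"
      unfolding z_def using integral_linear[OF integrable_continuous_real[OF cont] AS_bounded_linear[OF \<tau>]]
      by (simp add: o_def)
    also have "\<dots> = integral {a..t} (\<lambda>s. S (t - s) (A (S (\<tau> n) x)))"
    proof (rule integral_cong)
      fix s assume "s \<in> {a..t}"
      then have s: "t - s \<ge> 0" by simp
      have "S (\<tau> n) (S (t - s) x) = S (t - s) (S (\<tau> n) x)"
        using S_add[of "\<tau> n" "t - s" x] S_add[of "t - s" "\<tau> n" x] \<tau>(1)[of n] s by (simp add: add.commute)
      then show "A (S (\<tau> n) (S (t - s) x)) = S (t - s) (A (S (\<tau> n) x))"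
        using A_commute[OF S_smooth[OF \<tau>(1)] s] by simp
    qed
    also have "\<dots> = S (t - a) (S (\<tau> n) x) - S (\<tau> n) x"
      by (rule integral_unique[OF S_ftc_reversed[OF S_smooth[OF \<tau>(1)] at]])
    finally show ?thesis .
  qed
  have "(\<lambda>n. A (S (\<tau> n) z)) \<longlonglongrightarrow> S (t - a) x - x"
    unfolding Az using at by (intro tendsto_diff lim bounded_linear.tendsto[OF lin]) auto
  then show ?thesis using A_closed[OF S_smooth[OF \<tau>(1)] lim[of z]] unfolding z_def by blast
qed

text \<open>The kernel from \<open>E0\<close> to \<open>E1\<close> is of order
  \<open>1 / (t - s)\<close>, just not integrable. Subtracting the end value \<open>g t\<close>
  gains \<open>(t - s) powr \<rho>\<close>, so the convolution bound applies with exponent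
  \<open>1 - \<rho>\<close>; the constant part is integrated exactly.\<close>

lemma window_E1:
  assumes at: "a < t" "t - a \<le> T" and g: "continuous_on {a..t} g" and \<rho>: "0 < \<rho>" "\<rho> \<le> 1" and H: "H \<ge> 0"
    and hol: "\<And>s. a \<le> s \<Longrightarrow> s < t \<Longrightarrow> norm (g s - g t) \<le> H * (t - s) powr \<rho>"
  shows "integral {a..t} (\<lambda>s. S (t - s) (g s)) \<in> carr E1"
    "nrm E1 (integral {a..t} (\<lambda>s. S (t - s) (g s))) \<le>
       target_space.conv_const (1 - \<rho>) * (t - a) powr \<rho> * (C * H) + C * (C * norm (g t) * (t - a) + norm (S (t - a) (g t) - g t))"
proof -
  interpret E: target_space S E1 A T C E1 C by (rule target_E1)
  define k where "k = (\<lambda>s. g s - g t)"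
  define v where "v = integral {a..t} (\<lambda>s. S (t - s) (k s))"
  define z where "z = integral {a..t} (\<lambda>s. S (t - s) (g t))"
  have ck: "continuous_on {a..t} k" unfolding k_def by (intro continuous_intros g)
  have bd: "nrm E1 (S (t - s) (k s)) \<le> C * H * (t - s) powr (- (1 - \<rho>))" if s: "a \<le> s" "s < t" for s
  proof -
    have "nrm E1 (S (t - s) (k s)) \<le> C / (t - s) * norm (k s)" using s at by (intro S_smooth_bound) auto
    also have "\<dots> \<le> C / (t - s) * (H * (t - s) powr \<rho>)"
      using s C hol[OF s] by (intro mult_left_mono) (auto simp: k_def)
    also have "\<dots> = C * H * (t - s) powr (- (1 - \<rho>))" using s by (simp add: powr_diff)
    finally show ?thesis .
  qed
  have v: "v \<in> carr E1" "nrm E1 v \<le> E.conv_const (1 - \<rho>) * (t - a) powr \<rho> * (C * H)"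
    unfolding v_def using E.convolution_bound[OF at ck _ _ _ bd] \<rho> C H by auto
  have z: "z \<in> carr E1" "A z = S (t - a) (g t) - g t" unfolding z_def using S_integral_E1[of a t "g t"] at by auto
  have "norm z \<le> C * norm (g t) * (t - a)"
    unfolding z_def using at by (intro integral_bound continuous_on_S continuous_intros S_bound) auto
  then have nz: "nrm E1 z \<le> C * (C * norm (g t) * (t - a) + norm (S (t - a) (g t) - g t))"
    using C z(2) by (intro order_trans[OF graph_bound[OF z(1)]] mult_left_mono) auto
  have "integral {a..t} (\<lambda>s. S (t - s) (k s) + S (t - s) (g t)) = v + z"
    unfolding v_def z_def
    using at by (intro integral_add integrable_continuous_real continuous_on_S continuous_intros ck) auto
  moreover have "integral {a..t} (\<lambda>s. S (t - s) (k s) + S (t - s) (g t)) = integral {a..t} (\<lambda>s. S (t - s) (g s))"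
    by (intro integral_cong) (simp add: k_def S_diff)
  ultimately have eq: "integral {a..t} (\<lambda>s. S (t - s) (g s)) = v + z" by simp
  show "integral {a..t} (\<lambda>s. S (t - s) (g s)) \<in> carr E1" unfolding eq by (rule E1.add_mem[OF v(1) z(1)])
  show "nrm E1 (integral {a..t} (\<lambda>s. S (t - s) (g s))) \<le>
       E.conv_const (1 - \<rho>) * (t - a) powr \<rho> * (C * H) + C * (C * norm (g t) * (t - a) + norm (S (t - a) (g t) - g t))"
    unfolding eq using E1.nrm_triangle[OF v(1) z(1)] v(2) nz by linarith
qed

text \<open>The constant part of \<open>window_E1\<close> leaves
  \<open>S \<epsilon> (g t) - g t\<close>, which has no rate in \<open>\<epsilon>\<close>.
  Compactness of the values of \<open>g\<close> still makes it small uniformly in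
  \<open>t\<close>.\<close>

lemma S_uniformly_continuous:
  assumes g: "continuous_on {a..T} g" and e: "e > 0"
  shows "\<forall>\<^sub>F \<epsilon> in at_right 0. \<forall>t\<in>{a..T}. norm (S \<epsilon> (g t) - g t) < e"
proof -
  have "continuous_on ({0..T} \<times> {a..T}) (\<lambda>p. S (fst p) (g (snd p)))"
    by (intro continuous_on_S continuous_on_compose2[OF g] continuous_intros) auto
  then have "uniformly_continuous_on ({0..T} \<times> {a..T}) (\<lambda>p. S (fst p) (g (snd p)))"
    by (intro compact_uniformly_continuous compact_Times) auto
  then obtain d where d: "d > 0" "\<And>p q. p \<in> {0..T} \<times> {a..T} \<Longrightarrow> q \<in> {0..T} \<times> {a..T} \<Longrightarrow> dist q p < d \<Longrightarrow>
      dist (S (fst q) (g (snd q))) (S (fst p) (g (snd p))) < e"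
    using e unfolding uniformly_continuous_on_def by meson
  have "\<forall>\<^sub>F \<epsilon> in at_right 0. \<epsilon> \<in> {0<..<min d T}" using d(1) T by (intro eventually_at_right_real) auto
  then show ?thesis
  proof eventually_elim
    case (elim \<epsilon>)
    show ?case
    proof
      fix t assume "t \<in> {a..T}"
      then show "norm (S \<epsilon> (g t) - g t) < e"
        using d(2)[of "(0, t)" "(\<epsilon>, t)"] elim T by (simp add: dist_norm dist_Pair_Pair)
    qed
  qed
qed

text \<open>A short final window contributes uniformly little in \<open>E1\<close>. With its length
  \<open>\<epsilon>\<close> fixed, the remaining term
  \<open>S \<epsilon> (u (t - \<epsilon>))\<close> is continuous into \<open>E1\<close>, because
  \<open>S \<epsilon>\<close> smooths and \<open>u\<close> is continuous into
  \<open>E0\<close>.\<close>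

lemma evolves_E1_holder:
  assumes u: "evolves u g" and uc: "continuous_on {0..T} u" and g: "continuous_on {0<..T} g"
    and hol: "\<And>a. 0 < a \<Longrightarrow> a \<le> T \<Longrightarrow> \<exists>H\<ge>0. \<exists>\<rho>. 0 < \<rho> \<and> \<rho> \<le> 1 \<and>
       (\<forall>s\<in>{a..T}. \<forall>t\<in>{a..T}. norm (g s - g t) \<le> H * \<bar>t - s\<bar> powr \<rho>)"
  shows "cont_in E1 {0<..T} u"
  unfolding cont_in_def
proof (intro conjI ballI)
  fix t0 assume t0: "t0 \<in> {0<..T}"
  \<comment> \<open>Times from \<open>2 * a\<close> on, looked back by at most \<open>a\<close>,
    stay in \<open>{a..T}\<close>, where \<open>g\<close> is Hoelder continuous; \<open>t0\<close>
    itself lies strictly beyond \<open>2 * a\<close>.\<close>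
  define a where "a = t0 / 4"
  have a: "0 < a" "a \<le> T" using t0 by (auto simp: a_def)
  obtain H \<rho> where H: "H \<ge> 0" and \<rho>: "0 < \<rho>" "\<rho> \<le> 1"
    and hol': "\<And>s t. s \<in> {a..T} \<Longrightarrow> t \<in> {a..T} \<Longrightarrow> norm (g s - g t) \<le> H * \<bar>t - s\<bar> powr \<rho>"
    using hol[OF a] by blast
  have ga: "continuous_on {a..T} g" by (rule continuous_on_subset[OF g]) (use a in auto)
  have "bounded (g ` {a..T})" by (intro compact_imp_bounded compact_continuous_image ga compact_Icc)
  then obtain G where G: "\<And>t. t \<in> {a..T} \<Longrightarrow> norm (g t) \<le> G"
    unfolding bounded_iff by (auto simp del: atLeastAtMost_iff)
  define W where "W = target_space.conv_const (1 - \<rho>)"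
  define w where "w = (\<lambda>\<epsilon> t. integral {t - \<epsilon>..t} (\<lambda>s. S (t - s) (g s)))"
  have win: "w \<epsilon> t \<in> carr E1 \<and> nrm E1 (w \<epsilon> t) \<le> (W * \<epsilon> powr \<rho> * (C * H) + C * (C * G * \<epsilon>)) + C * norm (S \<epsilon> (g t) - g t)"
    if \<epsilon>: "0 < \<epsilon>" "\<epsilon> \<le> a" and t: "t \<in> {2 * a..T}" for \<epsilon> t
  proof -
    have wt: "t - \<epsilon> < t" "t - (t - \<epsilon>) \<le> T" using \<epsilon> a by auto
    have gc: "continuous_on {t - \<epsilon>..t} g" by (rule continuous_on_subset[OF ga]) (use \<epsilon> t in auto)
    have gh: "norm (g s - g t) \<le> H * (t - s) powr \<rho>" if "t - \<epsilon> \<le> s" "s < t" for s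
      using hol'[of s t] that \<epsilon> t by simp
    note 1 = window_E1[OF wt gc \<rho> H gh]
    have "norm (g t) \<le> G" using G[of t] \<epsilon> t by simp
    then have "C * (C * norm (g t) * \<epsilon>) \<le> C * (C * G * \<epsilon>)"
      using C \<epsilon> by (intro mult_left_mono mult_right_mono) auto
    then show ?thesis using 1 by (simp add: w_def W_def distrib_left)
  qed
  have split: "u t = S \<epsilon> (u (t - \<epsilon>)) + w \<epsilon> t" if "0 < \<epsilon>" "\<epsilon> \<le> a" "t \<in> {2 * a..T}" for \<epsilon> t
    using evolvesD[OF u, of "t - \<epsilon>" t] that a by (simp add: w_def)
  have mem: "u t \<in> carr E1" if "t \<in> {2 * a..T}" for t
    using split[of a t] win[of a t] S_smooth[OF a(1)] that a E1.add_mem by auto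
  show "u t0 \<in> carr E1" using mem t0 by (simp add: a_def)
  have nhd: "at t0 within {0<..T} = at t0 within {2 * a..T}"
    by (rule at_within_nhd[of _ "{2 * a<..}"]) (use t0 a in \<open>auto simp: a_def\<close>)
  show "((\<lambda>s. nrm E1 (u s - u t0)) \<longlongrightarrow> 0) (at t0 within {0<..T})"
    unfolding nhd
  proof (rule tendstoI)
    fix e :: real assume e: "e > 0"
    have t0': "t0 \<in> {2 * a..T}" using t0 by (simp add: a_def)
    have "((\<lambda>\<epsilon>. W * \<epsilon> powr \<rho> * (C * H) + C * (C * G * \<epsilon>)) \<longlongrightarrow> W * 0 * (C * H) + C * (C * G * 0)) (at_right 0)"
      using \<rho> eventually_at_right_less[of "0::real"]
      by (intro tendsto_intros tendsto_zero_powrI[OF tendsto_ident_at tendsto_const]) (auto elim: eventually_mono)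
    then have "\<forall>\<^sub>F \<epsilon> in at_right 0. W * \<epsilon> powr \<rho> * (C * H) + C * (C * G * \<epsilon>) < e / 8"
      using e by (intro order_tendstoD(2)) auto
    moreover have "\<forall>\<^sub>F \<epsilon> in at_right 0. \<forall>t\<in>{a..T}. norm (S \<epsilon> (g t) - g t) < e / (8 * C)"
      using e C by (intro S_uniformly_continuous ga) auto
    moreover have "\<forall>\<^sub>F \<epsilon> in at_right 0. \<epsilon> \<in> {0<..<a}" by (rule eventually_at_right_real[OF a(1)])
    ultimately have "\<forall>\<^sub>F \<epsilon> in at_right 0. W * \<epsilon> powr \<rho> * (C * H) + C * (C * G * \<epsilon>) < e / 8 \<and>
       (\<forall>t\<in>{a..T}. norm (S \<epsilon> (g t) - g t) < e / (8 * C)) \<and> \<epsilon> \<in> {0<..<a}" by (intro eventually_conj)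
    then obtain \<epsilon> where "W * \<epsilon> powr \<rho> * (C * H) + C * (C * G * \<epsilon>) < e / 8 \<and>
       (\<forall>t\<in>{a..T}. norm (S \<epsilon> (g t) - g t) < e / (8 * C)) \<and> \<epsilon> \<in> {0<..<a}"
      using eventually_happens'[OF trivial_limit_at_right_real] by blast
    then have \<epsilon>: "W * \<epsilon> powr \<rho> * (C * H) + C * (C * G * \<epsilon>) < e / 8"
       "\<And>t. t \<in> {a..T} \<Longrightarrow> norm (S \<epsilon> (g t) - g t) < e / (8 * C)" "0 < \<epsilon>" "\<epsilon> \<le> a"
      by (simp_all del: atLeastAtMost_iff)
    have small: "w \<epsilon> t \<in> carr E1" "nrm E1 (w \<epsilon> t) < e / 4" if t: "t \<in> {2 * a..T}" for t
    proof -
      have "C * norm (S \<epsilon> (g t) - g t) < e / 8" using \<epsilon>(2)[of t] t a C by (simp add: field_simps)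
      then show "w \<epsilon> t \<in> carr E1" "nrm E1 (w \<epsilon> t) < e / 4" using win[OF \<epsilon>(3,4) t] \<epsilon>(1) by auto
    qed
    have "continuous_on {2 * a..T} (\<lambda>t. u (t - \<epsilon>))"
      by (rule continuous_on_compose2[OF uc]) (use \<epsilon> a in \<open>auto intro!: continuous_intros\<close>)
    then have "((\<lambda>t. u (t - \<epsilon>)) \<longlongrightarrow> u (t0 - \<epsilon>)) (at t0 within {2 * a..T})"
      using t0' by (simp add: continuous_on_def)
    then have "((\<lambda>t. C / \<epsilon> * norm (u (t - \<epsilon>) - u (t0 - \<epsilon>))) \<longlongrightarrow> 0) (at t0 within {2 * a..T})"
      by (intro tendsto_mult_right_zero tendsto_norm_zero LIM_zero)
    then have "\<forall>\<^sub>F t in at t0 within {2 * a..T}. C / \<epsilon> * norm (u (t - \<epsilon>) - u (t0 - \<epsilon>)) < e / 2"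
      using e by (intro order_tendstoD(2)) auto
    moreover have "\<forall>\<^sub>F t in at t0 within {2 * a..T}. t \<in> {2 * a..T}" by (simp add: eventually_at_filter)
    ultimately show "\<forall>\<^sub>F t in at t0 within {2 * a..T}. dist (nrm E1 (u t - u t0)) 0 < e"
    proof eventually_elim
      case (elim t)
      define y where "y = u (t - \<epsilon>) - u (t0 - \<epsilon>)"
      have eq: "u t - u t0 = S \<epsilon> y + (w \<epsilon> t - w \<epsilon> t0)"
        using split[OF \<epsilon>(3,4) elim(2)] split[OF \<epsilon>(3,4) t0'] \<epsilon>(3) by (simp add: y_def S_diff)
      note sm = small[OF elim(2)] small[OF t0']
      have "nrm E1 (u t - u t0) \<le> nrm E1 (S \<epsilon> y) + (nrm E1 (w \<epsilon> t) + nrm E1 (w \<epsilon> t0))"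
        unfolding eq using E1.nrm_triangle[OF S_smooth[OF \<epsilon>(3)] E1.diff_mem[OF sm(1,3)], of y]
          E1.nrm_diff_le[OF sm(1,3)] by linarith
      also have "nrm E1 (S \<epsilon> y) \<le> C / \<epsilon> * norm y" using \<epsilon> a by (intro S_smooth_bound) auto
      finally have "nrm E1 (u t - u t0) < e" using elim(1) sm unfolding y_def by linarith
      then show ?case using E1.nrm_ge0[OF E1.diff_mem[OF mem[OF elim(2)] mem[OF t0']]] by simp
    qed
  qed
qed

end

section \<open>Interpolation spaces\<close>

lemma sum_space_lower:
  assumes x: "x \<in> carr (sum_space X0 X1)" and c: "c > 0"
    and le: "\<And>x0 x1. x0 \<in> carr X0 \<Longrightarrow> x1 \<in> carr X1 \<Longrightarrow> x = x0 + x1 \<Longrightarrow> p \<le> c * (nrm X0 x0 + nrm X1 x1)"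
  shows "p \<le> c * nrm (sum_space X0 X1) x"
proof -
  have "p / c \<le> nrm (sum_space X0 X1) x"
    unfolding sum_space_def nspace.simps
  proof (rule cInf_greatest)
    show "{nrm X0 x0 + nrm X1 x1 |x0 x1. x0 \<in> carr X0 \<and> x1 \<in> carr X1 \<and> x = x0 + x1} \<noteq> {}"
      using x by (auto simp: sum_space_def)
  next
    fix z assume "z \<in> {nrm X0 x0 + nrm X1 x1 |x0 x1. x0 \<in> carr X0 \<and> x1 \<in> carr X1 \<and> x = x0 + x1}"
    then show "p / c \<le> z" using le c by (auto simp: field_simps)
  qed
  then show ?thesis using c by (simp add: field_simps)
qed

lemma cont_embeddedD:
  assumes "cont_embedded X Z" "banach_over Real_Scalars X"
  obtains c where "c \<ge> 1" "\<And>x. x \<in> carr X \<Longrightarrow> x \<in> carr Z \<and> nrm Z x \<le> c * nrm X x"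
proof -
  interpret banach_nspace X by standard fact
  obtain c where c: "\<And>x. x \<in> carr X \<Longrightarrow> x \<in> carr Z \<and> nrm Z x \<le> c * nrm X x"
    using assms(1) by (auto simp: cont_embedded_def)
  show thesis
  proof (rule that[of "max 1 c"])
    fix x assume x: "x \<in> carr X"
    then show "x \<in> carr Z \<and> nrm Z x \<le> max 1 c * nrm X x"
      using c[OF x] mult_right_mono[OF max.cobounded2[of c 1] nrm_ge0[OF x]] by simp
  qed simp
qed

text \<open>The constant precedes the operator in the quantifiers. It can therefore serve all
  \<open>S t\<close> at once, with the time dependence confined to the end point bounds
  \<open>M0\<close> and \<open>M1\<close>.\<close>

lemma interpolated_bound:
  assumes F: "interpolation_functor K \<eta> F" and X: "couple K X0 X1" and Y: "couple K Y0 Y1"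
  shows "\<exists>c\<ge>0. \<forall>\<Phi> M0 M1. linear_over K UNIV \<Phi> \<longrightarrow> maps_with_bound M0 X0 Y0 \<Phi> \<longrightarrow> maps_with_bound M1 X1 Y1 \<Phi> \<longrightarrow>
     (\<forall>x\<in>carr (F X0 X1). \<Phi> x \<in> carr (F Y0 Y1) \<and>
        nrm (F Y0 Y1) (\<Phi> x) \<le> c * M0 powr (1 - \<eta>) * M1 powr \<eta> * nrm (F X0 X1) x)"
proof -
  have "\<exists>c\<ge>0. \<forall>\<Phi> M0 M1. linear_over K (carr (sum_space X0 X1)) \<Phi> \<and> maps_with_bound M0 X0 Y0 \<Phi> \<and> maps_with_bound M1 X1 Y1 \<Phi>
      \<longrightarrow> maps_with_bound (c * M0 powr (1 - \<eta>) * M1 powr \<eta>) (F X0 X1) (F Y0 Y1) \<Phi>"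
    using F X Y unfolding interpolation_functor_def by blast
  then obtain c where c: "c \<ge> 0" "\<And>\<Phi> M0 M1. linear_over K (carr (sum_space X0 X1)) \<Phi> \<Longrightarrow> maps_with_bound M0 X0 Y0 \<Phi> \<Longrightarrow>
      maps_with_bound M1 X1 Y1 \<Phi> \<Longrightarrow> maps_with_bound (c * M0 powr (1 - \<eta>) * M1 powr \<eta>) (F X0 X1) (F Y0 Y1) \<Phi>"
    by auto
  show ?thesis
  proof (intro exI[of _ c] conjI c(1) allI impI)
    fix \<Phi> M0 M1
    assume "linear_over K UNIV \<Phi>" and m: "maps_with_bound M0 X0 Y0 \<Phi>" "maps_with_bound M1 X1 Y1 \<Phi>"
    then have "linear_over K (carr (sum_space X0 X1)) \<Phi>" by (simp add: linear_over_def)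
    from c(2)[OF this m] show "\<forall>x\<in>carr (F X0 X1). \<Phi> x \<in> carr (F Y0 Y1) \<and>
        nrm (F Y0 Y1) (\<Phi> x) \<le> c * M0 powr (1 - \<eta>) * M1 powr \<eta> * nrm (F X0 X1) x"
      by (simp add: maps_with_bound_def)
  qed
qed

context parabolic
begin

text \<open>What later arguments take from an intermediate space of exponent \<open>\<eta>\<close>:
  its position between \<open>E1\<close> and \<open>E0\<close> and the smoothing from
  \<open>E0\<close> into it and from it into \<open>E1\<close>. No second exponent occurs.\<close>

definition scale_estimates :: "real \<Rightarrow> real \<Rightarrow> 'a nspace \<Rightarrow> bool" where
  "scale_estimates c \<eta> Y \<longleftrightarrow> 1 \<le> c \<and> banach_over Real_Scalars Y
     \<and> (\<forall>x\<in>carr Y. norm x \<le> c * nrm Y x)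
     \<and> (\<forall>x\<in>carr E1. x \<in> carr Y \<and> nrm Y x \<le> c * nrm E1 x)
     \<and> (\<forall>t x. x \<in> carr Y \<longrightarrow> 0 \<le> t \<longrightarrow> t \<le> T \<longrightarrow> S t x \<in> carr Y \<and> nrm Y (S t x) \<le> c * nrm Y x)
     \<and> (\<forall>t x. 0 < t \<longrightarrow> t \<le> T \<longrightarrow> nrm Y (S t x) \<le> c * t powr (-\<eta>) * norm x)
     \<and> (\<forall>t x. x \<in> carr Y \<longrightarrow> 0 < t \<longrightarrow> t \<le> T \<longrightarrow> nrm E1 (S t x) \<le> c * t powr (- (1 - \<eta>)) * nrm Y x)"

lemma scale_estimatesI:
  assumes "1 \<le> c" "banach_over Real_Scalars Y"
    "\<And>x. x \<in> carr Y \<Longrightarrow> norm x \<le> c * nrm Y x"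
    "\<And>x. x \<in> carr E1 \<Longrightarrow> x \<in> carr Y \<and> nrm Y x \<le> c * nrm E1 x"
    "\<And>t x. x \<in> carr Y \<Longrightarrow> 0 \<le> t \<Longrightarrow> t \<le> T \<Longrightarrow> S t x \<in> carr Y \<and> nrm Y (S t x) \<le> c * nrm Y x"
    "\<And>t x. 0 < t \<Longrightarrow> t \<le> T \<Longrightarrow> nrm Y (S t x) \<le> c * t powr (-\<eta>) * norm x"
    "\<And>t x. x \<in> carr Y \<Longrightarrow> 0 < t \<Longrightarrow> t \<le> T \<Longrightarrow> nrm E1 (S t x) \<le> c * t powr (- (1 - \<eta>)) * nrm Y x"
  shows "scale_estimates c \<eta> Y"
  using assms unfolding scale_estimates_def by simp

lemma scale_estimatesD:
  assumes "scale_estimates c \<eta> Y"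
  shows "1 \<le> c" "banach_over Real_Scalars Y"
    "\<And>x. x \<in> carr Y \<Longrightarrow> norm x \<le> c * nrm Y x"
    "\<And>x. x \<in> carr E1 \<Longrightarrow> x \<in> carr Y \<and> nrm Y x \<le> c * nrm E1 x"
    "\<And>t x. x \<in> carr Y \<Longrightarrow> 0 \<le> t \<Longrightarrow> t \<le> T \<Longrightarrow> S t x \<in> carr Y \<and> nrm Y (S t x) \<le> c * nrm Y x"
    "\<And>t x. 0 < t \<Longrightarrow> t \<le> T \<Longrightarrow> nrm Y (S t x) \<le> c * t powr (-\<eta>) * norm x"
    "\<And>t x. x \<in> carr Y \<Longrightarrow> 0 < t \<Longrightarrow> t \<le> T \<Longrightarrow> nrm E1 (S t x) \<le> c * t powr (- (1 - \<eta>)) * nrm Y x"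
  using assms unfolding scale_estimates_def by simp_all

text \<open>The same \<open>S t\<close> is viewed as a map between different couples: from
  \<open>(whole, E1)\<close> to itself for boundedness, from \<open>(whole, whole)\<close> to
  \<open>(whole, E1)\<close> for smoothing out of \<open>E0\<close>, and from
  \<open>(whole, E1)\<close> to \<open>(E1, E1)\<close> for smoothing into
  \<open>E1\<close>.\<close>

lemma interp_estimates:
  assumes F: "\<forall>\<eta>\<in>{0<..<1}. admissible_functor K \<eta> (F \<eta>)" and \<eta>: "0 \<le> \<eta>" "\<eta> \<le> 1"
    and smooth: "smoothing_semigroup S E1 A T C"
  shows "\<exists>c. scale_estimates c \<eta> (interp F E1 \<eta>)"
proof -
  interpret smoothing_semigroup S E1 A T C by (rule smooth)
  interpret E: target_space S E1 A T C E1 C by (rule target_E1)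
  have Cp: "C > 0" using C by simp
  have wb: "banach_over Real_Scalars (whole :: 'a nspace)" by (rule banach_over_whole) simp
  consider "\<eta> = 0" | "\<eta> = 1" | "\<eta> \<in> {0<..<1}" using \<eta> by fastforce
  then show ?thesis
  proof cases
    case 1
    then have I: "interp F E1 \<eta> = whole" by (simp add: interp_def)
    show ?thesis unfolding I
    proof (rule exI, rule scale_estimatesI[OF C])
      show "norm x \<le> C * nrm whole x" for x :: 'a using mult_right_mono[OF C, of "norm x"] by simp
      show "nrm E1 (S t x) \<le> C * t powr (- (1 - \<eta>)) * nrm whole x" if "0 < t" "t \<le> T" for t x
        using S_smooth_bound[OF that, of x] that 1 by (simp add: powr_minus_divide)
    qed (use wb S_bound E1_emb 1 in auto)
  next
    case 2
    then have I: "interp F E1 \<eta> = E1" by (simp add: interp_def)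
    show ?thesis unfolding I
    proof (rule exI, rule scale_estimatesI[OF C])
      show "nrm E1 (S t x) \<le> C * t powr (- \<eta>) * norm x" if "0 < t" "t \<le> T" for t x
        using S_smooth_bound[OF that, of x] that 2 by (simp add: powr_minus_divide)
    qed (use E1.banach E1_emb E.S_Y E.E1_Y 2 in auto)
  next
    case 3
    define G where "G = F \<eta>"
    have I: "interp F E1 \<eta> = G whole E1" using 3 by (simp add: interp_def G_def)
    have IF: "interpolation_functor K \<eta> G" using F 3 by (simp add: admissible_functor_def G_def)
    have wK: "banach_over K (whole :: 'a nspace)" by (rule banach_over_whole[OF scalars])
    have ww: "cont_embedded (whole :: 'a nspace) whole" by (auto simp: cont_embedded_def intro: exI[of _ 1])
    have cp: "couple K whole E1" "couple K whole whole" "couple K E1 E1"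
      using wK E1_banach E1_embedded ww by (auto simp: couple_def)
    have emb: "banach_over K (G X0 X1) \<and> cont_embedded (inter_space X0 X1) (G X0 X1) \<and> cont_embedded (G X0 X1) (sum_space X0 X1)"
      if "couple K X0 X1" for X0 X1 using IF that unfolding interpolation_functor_def by blast
    have GB: "banach_over Real_Scalars (G X0 X1)" if "couple K X0 X1" for X0 X1
      using emb[OF that] banach_over_real[OF scalars] by blast
    interpret G: banach_nspace "G whole E1" by standard (rule GB[OF cp(1)])
    have SK: "linear_over K UNIV (S t)" if "t \<ge> 0" for t
      using analytic_semigroup_smul[OF scalars semigroup that] linear_add[OF S_linear[OF that]]
      by (simp add: linear_over_def)
    have m00: "maps_with_bound C whole whole (S t)" and m11: "maps_with_bound C E1 E1 (S t)" if "0 \<le> t" "t \<le> T" for t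
      using that Cp S_bound E.S_Y by (auto simp: maps_with_bound_def)
    have m01: "maps_with_bound (C / t) whole E1 (S t)" if "0 < t" "t \<le> T" for t
      using that Cp S_smooth S_smooth_bound by (auto simp: maps_with_bound_def)
    have pw: "C powr (1 - \<eta>) * C powr \<eta> = C" using Cp by (simp add: powr_add[symmetric])
    have pt: "C powr (1 - \<eta>) * (C / t) powr \<eta> = C * t powr (-\<eta>)" "(C / t) powr (1 - \<eta>) * C powr \<eta> = C * t powr (-(1 - \<eta>))"
      if "t > 0" for t
      using that pw Cp powr_minus_divide[of t "1 - \<eta>"] by (simp_all add: powr_divide powr_minus_divide)
    obtain c1 where c1: "c1 \<ge> 1" "\<And>x. x \<in> carr (G whole E1) \<Longrightarrow> x \<in> carr (sum_space whole E1) \<and> nrm (sum_space whole E1) x \<le> c1 * nrm (G whole E1) x"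
      using cont_embeddedD[OF conjunct2[OF conjunct2[OF emb[OF cp(1)]]] GB[OF cp(1)]] by blast
    have b1: "norm x \<le> C * c1 * nrm (G whole E1) x" if x: "x \<in> carr (G whole E1)" for x
    proof -
      have "norm x \<le> C * nrm (sum_space whole E1) x"
      proof (rule sum_space_lower[OF conjunct1[OF c1(2)[OF x]] Cp])
        fix x0 x1 assume "x1 \<in> carr E1" "x = x0 + x1"
        then show "norm x \<le> C * (nrm whole x0 + nrm E1 x1)"
          using norm_triangle_ineq[of x0 x1] E1_emb[of x1] mult_right_mono[OF C, of "norm x0"] by (simp add: distrib_left)
      qed
      also have "\<dots> \<le> C * (c1 * nrm (G whole E1) x)" using c1(2)[OF x] Cp by (intro mult_left_mono) auto
      finally show ?thesis by (simp add: mult.assoc)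
    qed
    obtain c2 where c2: "\<And>x. x \<in> carr E1 \<Longrightarrow> x \<in> carr (G whole E1) \<and> nrm (G whole E1) x \<le> c2 * max (norm x) (nrm E1 x)"
      using conjunct1[OF conjunct2[OF emb[OF cp(1)]]] by (auto simp: cont_embedded_def inter_space_def)
    have b2: "nrm (G whole E1) x \<le> \<bar>c2\<bar> * C * nrm E1 x" if x: "x \<in> carr E1" for x
    proof -
      have "max (norm x) (nrm E1 x) \<le> C * nrm E1 x" using E1_emb[OF x] E.E1_Y[OF x] by simp
      then have "c2 * max (norm x) (nrm E1 x) \<le> \<bar>c2\<bar> * (C * nrm E1 x)"
        using E1.nrm_ge0[OF x] by (intro mult_mono) auto
      then show ?thesis using c2[OF x] by (simp add: mult.assoc)
    qed
    obtain c3 where c3: "c3 \<ge> 0" "\<And>\<Phi> M0 M1 x. linear_over K UNIV \<Phi> \<Longrightarrow> maps_with_bound M0 whole whole \<Phi> \<Longrightarrow> maps_with_bound M1 E1 E1 \<Phi> \<Longrightarrow>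
       x \<in> carr (G whole E1) \<Longrightarrow> \<Phi> x \<in> carr (G whole E1) \<and> nrm (G whole E1) (\<Phi> x) \<le> c3 * M0 powr (1 - \<eta>) * M1 powr \<eta> * nrm (G whole E1) x"
      using interpolated_bound[OF IF cp(1) cp(1)] by auto
    have b3: "S t x \<in> carr (G whole E1) \<and> nrm (G whole E1) (S t x) \<le> c3 * C * nrm (G whole E1) x"
      if "x \<in> carr (G whole E1)" "0 \<le> t" "t \<le> T" for t x
      using c3(2)[OF SK m00 m11 that(1)] that pw by (simp add: mult.assoc)
    obtain c4 where c4: "c4 \<ge> 0" "\<And>\<Phi> M0 M1 x. linear_over K UNIV \<Phi> \<Longrightarrow> maps_with_bound M0 whole whole \<Phi> \<Longrightarrow> maps_with_bound M1 whole E1 \<Phi> \<Longrightarrow>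
       x \<in> carr (G whole whole) \<Longrightarrow> \<Phi> x \<in> carr (G whole E1) \<and> nrm (G whole E1) (\<Phi> x) \<le> c4 * M0 powr (1 - \<eta>) * M1 powr \<eta> * nrm (G whole whole) x"
      using interpolated_bound[OF IF cp(2) cp(1)] by auto
    \<comment> \<open>For two equal spaces the intersection is the space itself, so
      \<open>E0\<close> embeds into the interpolation space of \<open>(whole, whole)\<close>; one
      direction is enough at the source.\<close>
    obtain c5 where c5: "\<And>x. x \<in> carr (G whole whole) \<and> nrm (G whole whole) x \<le> c5 * norm x"
      using conjunct1[OF conjunct2[OF emb[OF cp(2)]]] by (auto simp: cont_embedded_def inter_space_def)
    have b4: "nrm (G whole E1) (S t x) \<le> c4 * C * \<bar>c5\<bar> * t powr (-\<eta>) * norm x" if t: "0 < t" "t \<le> T" for t x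
    proof -
      have "nrm (G whole E1) (S t x) \<le> c4 * (C powr (1 - \<eta>) * (C / t) powr \<eta>) * nrm (G whole whole) x"
        using c4(2)[OF SK m00 m01, of t x] c5[of x] t by (simp add: mult.assoc)
      also have "\<dots> \<le> c4 * (C * t powr (-\<eta>)) * (\<bar>c5\<bar> * norm x)"
        unfolding pt[OF t(1)] using c4(1) Cp order_trans[OF conjunct2[OF c5[of x]] mult_right_mono[OF abs_ge_self norm_ge_zero]]
        by (intro mult_left_mono) auto
      finally show ?thesis by (simp add: mult_ac)
    qed
    obtain c6 where c6: "c6 \<ge> 0" "\<And>\<Phi> M0 M1 x. linear_over K UNIV \<Phi> \<Longrightarrow> maps_with_bound M0 whole E1 \<Phi> \<Longrightarrow> maps_with_bound M1 E1 E1 \<Phi> \<Longrightarrow>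
       x \<in> carr (G whole E1) \<Longrightarrow> \<Phi> x \<in> carr (G E1 E1) \<and> nrm (G E1 E1) (\<Phi> x) \<le> c6 * M0 powr (1 - \<eta>) * M1 powr \<eta> * nrm (G whole E1) x"
      using interpolated_bound[OF IF cp(1) cp(3)] by auto
    \<comment> \<open>At the target the other direction is wanted: the interpolation space of
      \<open>(E1, E1)\<close> embeds into the sum space, whose norm dominates \<open>nrm E1\<close>
      by the triangle inequality.\<close>
    obtain c7 where c7: "c7 \<ge> 1" "\<And>x. x \<in> carr (G E1 E1) \<Longrightarrow> x \<in> carr (sum_space E1 E1) \<and> nrm (sum_space E1 E1) x \<le> c7 * nrm (G E1 E1) x"
      using cont_embeddedD[OF conjunct2[OF conjunct2[OF emb[OF cp(3)]]] GB[OF cp(3)]] by blast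
    have b5: "nrm E1 (S t x) \<le> c7 * c6 * C * t powr (-(1 - \<eta>)) * nrm (G whole E1) x"
      if x: "x \<in> carr (G whole E1)" and t: "0 < t" "t \<le> T" for t x
    proof -
      have y: "S t x \<in> carr (G E1 E1)" "nrm (G E1 E1) (S t x) \<le> c6 * (C * t powr (-(1 - \<eta>))) * nrm (G whole E1) x"
        using c6(2)[OF SK m01 m11 x, of t] t pt(2)[OF t(1)] by (simp_all add: mult.assoc)
      have "nrm E1 (S t x) \<le> 1 * nrm (sum_space E1 E1) (S t x)"
      proof (rule sum_space_lower[OF conjunct1[OF c7(2)[OF y(1)]]])
        fix x0 x1 assume "x0 \<in> carr E1" "x1 \<in> carr E1" "S t x = x0 + x1"
        then show "nrm E1 (S t x) \<le> 1 * (nrm E1 x0 + nrm E1 x1)" using E1.nrm_triangle[of x0 x1] by simp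
      qed simp
      also have "\<dots> \<le> c7 * (c6 * (C * t powr (-(1 - \<eta>))) * nrm (G whole E1) x)"
        unfolding mult_1 using c7(1)
        by (intro order_trans[OF conjunct2[OF c7(2)[OF y(1)]]] mult_left_mono y(2)) auto
      finally show ?thesis by (simp add: mult_ac)
    qed
    define c where "c = 1 + C * c1 + \<bar>c2\<bar> * C + c3 * C + c4 * C * \<bar>c5\<bar> + c7 * c6 * C"
    have nn: "0 \<le> C * c1" "0 \<le> \<bar>c2\<bar> * C" "0 \<le> c3 * C" "0 \<le> c4 * C * \<bar>c5\<bar>" "0 \<le> c7 * c6 * C"
      using Cp c1(1) c3(1) c4(1) c6(1) c7(1) by auto
    have le: "1 \<le> c" "C * c1 \<le> c" "\<bar>c2\<bar> * C \<le> c" "c3 * C \<le> c" "c4 * C * \<bar>c5\<bar> \<le> c" "c7 * c6 * C \<le> c"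
      unfolding c_def using nn by linarith+
    show ?thesis unfolding I
    proof (rule exI, rule scale_estimatesI[OF le(1)])
      show "banach_over Real_Scalars (G whole E1)" by (rule GB[OF cp(1)])
      fix x
      show "norm x \<le> c * nrm (G whole E1) x" if "x \<in> carr (G whole E1)"
        using b1[OF that] mult_right_mono[OF le(2) G.nrm_ge0[OF that]] by linarith
      show "x \<in> carr (G whole E1) \<and> nrm (G whole E1) x \<le> c * nrm E1 x" if "x \<in> carr E1"
        using c2[OF that] b2[OF that] mult_right_mono[OF le(3) E1.nrm_ge0[OF that]] by linarith
      fix t
      show "S t x \<in> carr (G whole E1) \<and> nrm (G whole E1) (S t x) \<le> c * nrm (G whole E1) x"
        if "x \<in> carr (G whole E1)" "0 \<le> t" "t \<le> T"
        using b3[OF that] mult_right_mono[OF le(4) G.nrm_ge0[OF that(1)]] by linarith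
      show "nrm (G whole E1) (S t x) \<le> c * t powr (-\<eta>) * norm x" if "0 < t" "t \<le> T"
        using b4[OF that, of x] mult_right_mono[OF mult_right_mono[OF le(5), of "t powr (-\<eta>)"], of "norm x"] by simp
      show "nrm E1 (S t x) \<le> c * t powr (-(1 - \<eta>)) * nrm (G whole E1) x" if "x \<in> carr (G whole E1)" "0 < t" "t \<le> T"
        using b5[OF that] mult_right_mono[OF mult_right_mono[OF le(6), of "t powr (-(1 - \<eta>))"] G.nrm_ge0[OF that(1)]] by simp
    qed
  qed
qed

end

context weighted_forcing
begin

text \<open>Away from time 0 the trajectory is bounded and Hoelder continuous in \<open>Y\<close>,
  so the local Lipschitz estimate makes the forcing Hoelder continuous in \<open>E0\<close>, as
  needed to reach \<open>E1\<close>.\<close>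

lemma local_form_regularity:
  assumes u: "continuous_on {0..T} u" "u \<in> C_weighted \<theta> T Y" "evolves u (f u)" and g: "forcing N (f u)"
    and loc: "local_form Y \<theta> T f"
  shows "cont_in E1 {0<..T} u"
proof (rule evolves_E1_holder[OF u(3,1) forcingD(2)[OF g]])
  have "bounded (u ` {0..T})" by (intro compact_imp_bounded compact_continuous_image u compact_Icc)
  then obtain U where U: "\<And>t. t \<in> {0..T} \<Longrightarrow> norm (u t) \<le> U"
    unfolding bounded_iff by (auto simp del: atLeastAtMost_iff)
  obtain h l c where h: "\<And>t. t \<in> {0<..T} \<Longrightarrow> f u t = h (u t)" and l: "l > 0" and c: "c > 0"
    and hl: "\<And>v w. v \<in> carr Y \<Longrightarrow> w \<in> carr Y \<Longrightarrow>
       norm (h v - h w) \<le> c * (nrm Y v powr l + nrm Y w powr l) * nrm Y (v - w)"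
    using loc u(2) unfolding local_form_def by auto
  fix a assume a: "0 < a" "a \<le> T"
  have "continuous_on {a..T} (\<lambda>t. nrm Y (u t))"
    using u(2) a by (intro continuous_on_subset[OF Y.cont_in_nrm]) (auto simp: C_weighted_def)
  then have "bounded ((\<lambda>t. nrm Y (u t)) ` {a..T})" by (intro compact_imp_bounded compact_continuous_image compact_Icc)
  then obtain B where B: "\<And>t. t \<in> {a..T} \<Longrightarrow> \<bar>nrm Y (u t)\<bar> \<le> B"
    unfolding bounded_iff by (auto simp del: atLeastAtMost_iff)
  define \<rho> where "\<rho> = (1 - \<alpha>) / 4"
  have \<rho>: "0 < \<rho>" "\<rho> \<le> 1" using \<alpha> by (auto simp: \<rho>_def)
  have U': "norm (u t) \<le> U" if "0 \<le> t" "t \<le> T" for t using U that by simp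
  obtain H where H: "H \<ge> 0" "\<And>s t. s \<in> {a..T} \<Longrightarrow> t \<in> {a..T} \<Longrightarrow> nrm Y (u t - u s) \<le> H * \<bar>t - s\<bar> powr \<rho>"
    using evolves_holder[OF u(3) g a U'] unfolding \<rho>_def by blast
  have "norm (f u s - f u t) \<le> c * (B powr l + B powr l) * H * \<bar>t - s\<bar> powr \<rho>"
    if st: "s \<in> {a..T}" "t \<in> {a..T}" for s t
  proof -
    have mem: "u s \<in> carr Y" "u t \<in> carr Y" using Y.C_weighted_mem[OF u(2)] st a by auto
    have Bl: "nrm Y (u r) powr l \<le> B powr l" if "r \<in> {a..T}" "u r \<in> carr Y" for r
      using B[OF that(1)] Y.nrm_ge0[OF that(2)] l by (intro powr_mono2) auto
    have "norm (f u s - f u t) = norm (h (u s) - h (u t))" using h st a by simp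
    also have "\<dots> \<le> c * (nrm Y (u s) powr l + nrm Y (u t) powr l) * nrm Y (u s - u t)" by (rule hl[OF mem])
    also have "\<dots> \<le> c * (B powr l + B powr l) * (H * \<bar>t - s\<bar> powr \<rho>)"
    proof (intro mult_mono add_mono Bl st mem)
      show "nrm Y (u s - u t) \<le> H * \<bar>t - s\<bar> powr \<rho>" using H(2)[OF st(2,1)] by (simp add: abs_minus_commute)
      show "0 \<le> nrm Y (u s - u t)" by (intro Y.nrm_ge0 Y.diff_mem mem)
    qed (use c in auto)
    finally show ?thesis by (simp add: mult.assoc)
  qed
  then show "\<exists>H\<ge>0. \<exists>\<rho>. 0 < \<rho> \<and> \<rho> \<le> 1 \<and> (\<forall>s\<in>{a..T}. \<forall>t\<in>{a..T}. norm (f u s - f u t) \<le> H * \<bar>t - s\<bar> powr \<rho>)"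
    using \<rho> H(1) c by (intro exI[of _ "c * (B powr l + B powr l) * H"] conjI exI[of _ \<rho>]) auto
qed

end

theorem theorem2p7:
  fixes K :: "'a::banach scalars"
    and E1 :: "'a nspace"
    and F :: "real \<Rightarrow> 'a nspace \<Rightarrow> 'a nspace \<Rightarrow> 'a nspace"
    and A :: "'a \<Rightarrow> 'a"
    and S :: "real \<Rightarrow> 'a \<Rightarrow> 'a"
    and f :: "(real \<Rightarrow> 'a) \<Rightarrow> real \<Rightarrow> 'a"
    and T \<gamma> \<theta> \<nu> l cT :: real
  assumes scalars: "scalars_ok K"
    and E1_banach: "banach_over K E1"
    and E1_embedded: "cont_embedded E1 whole"
    and E1_dense: "dense_in E1 whole"
    and functors: "\<forall>\<eta>\<in>{0<..<1}. admissible_functor K \<eta> (F \<eta>)"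
    and semigroup: "analytic_semigroup K S"
    and gen: "generator S (carr E1) A"
    and E1_compact: "compactly_embedded E1"
    and T: "T > 0"
    and \<gamma>: "0 \<le> \<gamma>" "\<gamma> \<le> 1"
    and \<theta>: "0 < \<theta>" "\<theta> \<le> 1"
    and \<gamma>\<theta>: "(\<gamma>, \<theta>) \<noteq> (0, 1)"
    and \<nu>: "0 \<le> \<nu>" "\<nu> < 1"
    and l: "l > 0"
    and cT: "cT > 0"
    and f_maps: "\<forall>u\<in>C_weighted \<theta> T (interp F E1 \<theta>). f u \<in> C_weighted \<nu> T (interp F E1 \<gamma>)"
    and f_zero: "\<forall>t\<in>{0<..T}. f (\<lambda>_. 0) t = 0"
    and f_lipschitz: "\<forall>L. 0 < L \<and> L < 1 \<longrightarrow>
      (\<forall>v\<in>C_weighted \<theta> T (interp F E1 \<theta>). \<forall>w\<in>C_weighted \<theta> T (interp F E1 \<theta>).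
         C_norm \<theta> T (interp F E1 \<theta>) v + C_norm \<theta> T (interp F E1 \<theta>) w \<le> L
         \<and> (\<forall>t\<in>{0<..T}. norm (v t) + norm (w t) \<le> L)
         \<longrightarrow> C_norm \<nu> T (interp F E1 \<gamma>) (\<lambda>t. f v t - f w t)
             \<le> cT * L powr l * C_norm \<theta> T (interp F E1 \<theta>) (\<lambda>t. v t - w t))"
  shows
    "(\<forall>b::real. b \<noteq> 0 \<and> 1 \<notin> (\<lambda>\<mu>. of_real b * exp (of_real T * \<mu>)) ` spectrum_over K (carr E1) A \<longrightarrow>
        well_posed_small S T f (interp F E1 \<theta>) \<theta>
          (\<lambda>u M. u 0 - b *\<^sub>R u T = M)
          (\<lambda>u. \<gamma> > 0 \<or> local_form (interp F E1 \<theta>) \<theta> T f \<longrightarrow> strong_regularity A E1 T f u))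
     \<and> (\<forall>b::real \<Rightarrow> real. continuous_on {0..T} b \<and> (\<exists>t\<in>{0..T}. b t \<noteq> 0)
          \<and> - 1 \<notin> point_spectrum_over K UNIV (\<lambda>x. integral {0..T} (\<lambda>t. b t *\<^sub>R S t x)) \<longrightarrow>
        well_posed_small S T f (interp F E1 \<theta>) \<theta>
          (\<lambda>u M. u 0 + integral {0..T} (\<lambda>t. b t *\<^sub>R u t) = M)
          (\<lambda>u. \<gamma> > 0 \<or> local_form (interp F E1 \<theta>) \<theta> T f \<longrightarrow> strong_regularity A E1 T f u))"
proof -
  interpret parabolic K E1 S A T
    by standard (fact scalars E1_banach E1_embedded semigroup gen T)+
  obtain C where smooth: "smoothing_semigroup S E1 A T C" using smoothing by blast
  interpret smoothing_semigroup S E1 A T C by (rule smooth)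
  define X where "X = interp F E1 \<gamma>"
  define Y where "Y = interp F E1 \<theta>"
  have \<theta>0: "0 \<le> \<theta>" using \<theta> by simp
  obtain cY where "scale_estimates cY \<theta> Y" unfolding Y_def using interp_estimates[OF functors \<theta>0 \<theta>(2) smooth] by blast
  note cY = scale_estimatesD[OF this]
  obtain cX where "scale_estimates cX \<gamma> X" unfolding X_def using interp_estimates[OF functors \<gamma> smooth] by blast
  note cX = scale_estimatesD[OF this]
  interpret X: banach_nspace X by standard (rule cX(2))
  interpret Y: banach_nspace Y by standard (rule cY(2))
  \<comment> \<open>Both factors are at least 1, so the product dominates each; it also bounds the
    passage from \<open>X\<close> through \<open>E0\<close> to \<open>Y\<close> used when
    \<open>\<theta> < 1\<close>.\<close>
  define CY where "CY = cX * cY"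
  have CY: "1 \<le> CY" "cX \<le> CY" "cY \<le> CY"
    using cX(1) cY(1) mult_mono[of 1 cX 1 cY] mult_left_mono[of 1 cY cX] mult_right_mono[of 1 cX cY]
    by (auto simp: CY_def)
  \<comment> \<open>The optimal exponent \<open>\<theta> - \<gamma>\<close> would need reiteration between different functors; an exponent
    below \<open>1\<close> suffices, and \<open>\<theta> = 1\<close> forces \<open>\<gamma> > 0\<close>.\<close>
  define \<alpha> where "\<alpha> = (if \<theta> < 1 then \<theta> else 1 - \<gamma>)"
  interpret W: weighted_forcing S E1 A T C Y CY X \<alpha> \<theta> \<nu>
  proof
    show "0 \<le> \<alpha>" "\<alpha> < 1" "\<alpha> \<le> \<theta>" using \<theta> \<gamma> \<gamma>\<theta> by (auto simp: \<alpha>_def)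
    fix x t
    show "norm x \<le> CY * nrm Y x" if "x \<in> carr Y"
      using cY(3)[OF that] mult_right_mono[OF CY(3) Y.nrm_ge0[OF that]] by linarith
    show "x \<in> carr Y \<and> nrm Y x \<le> CY * nrm E1 x" if "x \<in> carr E1"
      using cY(4)[OF that] mult_right_mono[OF CY(3) E1.nrm_ge0[OF that]] by linarith
    show "S t x \<in> carr Y \<and> nrm Y (S t x) \<le> CY * nrm Y x" if "x \<in> carr Y" "0 \<le> t" "t \<le> T"
      using cY(5)[OF that] mult_right_mono[OF CY(3) Y.nrm_ge0[OF that(1)]] by linarith
    show "norm x \<le> CY * nrm X x" if "x \<in> carr X"
      using cX(3)[OF that] mult_right_mono[OF CY(2) X.nrm_ge0[OF that]] by linarith
    show "nrm Y (S t x) \<le> CY * t powr (-\<theta>) * norm x" if "0 < t" "t \<le> T"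
      using cY(6)[OF that, of x] mult_right_mono[OF mult_right_mono[OF CY(3), of "t powr (-\<theta>)"], of "norm x"] by simp
    show "nrm Y (S t x) \<le> CY * t powr (-\<alpha>) * nrm X x" if x: "x \<in> carr X" and t: "0 < t" "t \<le> T"
    proof (cases "\<theta> < 1")
      case True
      have "nrm Y (S t x) \<le> cY * t powr (-\<theta>) * norm x" by (rule cY(6)[OF t])
      also have "\<dots> \<le> cY * t powr (-\<theta>) * (cX * nrm X x)" using cY(1) by (intro mult_left_mono cX(3) x) auto
      finally show ?thesis using True by (simp add: \<alpha>_def CY_def mult_ac)
    next
      case False
      then have "\<theta> = 1" using \<theta> by simp
      then have "Y = E1" by (simp add: Y_def interp_def)
      have "nrm E1 (S t x) \<le> cX * t powr (- (1 - \<gamma>)) * nrm X x" by (rule cX(7)[OF x t])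
      also have "\<dots> \<le> CY * t powr (- (1 - \<gamma>)) * nrm X x"
        by (intro mult_right_mono CY X.nrm_ge0 x) auto
      finally show ?thesis using False \<open>Y = E1\<close> by (simp add: \<alpha>_def)
    qed
  qed (fact CY \<theta> \<nu> cX(2) cY(2))+
  have reg: "\<gamma> > 0 \<or> local_form Y \<theta> T f \<longrightarrow> strong_regularity A E1 T f u"
    if u: "continuous_on {0..T} u" "u \<in> C_weighted \<theta> T Y" "mild_equation S T f u" for u
  proof
    assume r: "\<gamma> > 0 \<or> local_form Y \<theta> T f"
    have ev: "evolves u (f u)" by (rule mild_evolves[OF u(3)])
    have fu: "f u \<in> C_weighted \<nu> T X" using f_maps u(2) by (simp add: X_def Y_def)
    obtain N where N: "W.forcing N (f u)" using W.forcing_of_weighted[OF fu] by blast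
    have "bounded (u ` {0..T})" by (intro compact_imp_bounded compact_continuous_image u compact_Icc)
    then obtain U where U: "\<And>t. t \<in> {0..T} \<Longrightarrow> norm (u t) \<le> U"
      unfolding bounded_iff by (auto simp del: atLeastAtMost_iff)
    have ci: "cont_in E1 {0<..T} u"
    proof (cases "\<gamma> > 0")
      case True
      interpret E: target_space S E1 A T C E1 C by (rule target_E1)
      define M where "M = cX * C"
      have M: "1 \<le> M" "cX \<le> M" "C \<le> M"
        using cX(1) C mult_mono[of 1 cX 1 C] mult_left_mono[of 1 C cX] mult_right_mono[of 1 cX C]
        by (auto simp: M_def)
      \<comment> \<open>A second instance with target \<open>E1\<close>. For
        \<open>\<gamma> > 0\<close> the smoothing exponent \<open>1 - \<gamma>\<close> from the
        forcing space into \<open>E1\<close> is integrable, so the Hoelder estimate gives continuity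
        into \<open>E1\<close> with no time regularity of the forcing beyond continuity.\<close>
      interpret V: weighted_forcing S E1 A T C E1 M X "1 - \<gamma>" 1 \<nu>
      proof
        show "0 \<le> 1 - \<gamma>" "1 - \<gamma> < 1" "1 - \<gamma> \<le> 1" using True \<gamma> by auto
        fix x t
        show "norm x \<le> M * nrm E1 x" if "x \<in> carr E1"
          using E1_emb[OF that] mult_right_mono[OF M(3) E1.nrm_ge0[OF that]] by linarith
        show "x \<in> carr E1 \<and> nrm E1 x \<le> M * nrm E1 x" if "x \<in> carr E1"
          using that mult_right_mono[OF M(1) E1.nrm_ge0[OF that]] by simp
        show "S t x \<in> carr E1 \<and> nrm E1 (S t x) \<le> M * nrm E1 x" if "x \<in> carr E1" "0 \<le> t" "t \<le> T"
          using E.S_Y[OF that] mult_right_mono[OF M(3) E1.nrm_ge0[OF that(1)]] by linarith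
        show "norm x \<le> M * nrm X x" if "x \<in> carr X"
          using cX(3)[OF that] mult_right_mono[OF M(2) X.nrm_ge0[OF that]] by linarith
        show "nrm E1 (S t x) \<le> M * t powr (- (1 - \<gamma>)) * nrm X x" if "x \<in> carr X" "0 < t" "t \<le> T"
          using cX(7)[OF that] mult_right_mono[OF mult_right_mono[OF M(2), of "t powr (- (1 - \<gamma>))"] X.nrm_ge0[OF that(1)]]
          by simp
        show "nrm E1 (S t x) \<le> M * t powr (- 1) * norm x" if "0 < t" "t \<le> T"
          using S_smooth_bound[OF that, of x] mult_right_mono[OF divide_right_mono[OF M(3), of t], of "norm x"] that
          by (simp add: powr_minus_divide)
      qed (use M \<nu> in auto)
      obtain N where "V.forcing N (f u)" using V.forcing_of_weighted[OF fu] by blast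
      then show ?thesis using U by (intro V.evolves_cont_in[OF ev, of N U]) auto
    next
      case False
      then have "local_form Y \<theta> T f" using r by simp
      then show ?thesis by (rule W.local_form_regularity[of u f, OF u(1,2) ev N])
    qed
    show "strong_regularity A E1 T f u"
      unfolding strong_regularity_def using ci strong_derivative[OF ev W.forcingD(2)[OF N] ci] by blast
  qed
  have maps: "f u \<in> C_weighted \<nu> T X" if "u \<in> C_weighted \<theta> T Y" for u
    using f_maps that by (simp add: X_def Y_def)
  have zero: "f (\<lambda>_. 0) t = 0" if "0 < t" "t \<le> T" for t using f_zero that by simp
  have lip: "C_norm \<nu> T X (\<lambda>t. f v t - f w t) \<le> cT * L powr l * C_norm \<theta> T Y (\<lambda>t. v t - w t)"
    if "0 < L" "L < 1" "v \<in> C_weighted \<theta> T Y" "w \<in> C_weighted \<theta> T Y"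
      "C_norm \<theta> T Y v + C_norm \<theta> T Y w \<le> L" "\<forall>t\<in>{0<..T}. norm (v t) + norm (w t) \<le> L" for L v w
    using f_lipschitz that by (simp add: X_def Y_def)
  have cS: "continuous_on {0..T} (\<lambda>t. S t x)" for x by (rule continuous_on_subset[OF S_cont]) auto
  show ?thesis
    unfolding Y_def[symmetric]
  proof (intro conjI allI impI, goal_cases)
    case (1 b)
    obtain R where R: "bounded_linear R" "\<And>x. R (x - b *\<^sub>R S T x) = x" "\<And>x. R x - b *\<^sub>R S T (R x) = x"
      using boundary_inverse[OF E1_compact conjunct2[OF 1]] by blast
    \<comment> \<open>Here \<open>\<Lambda> v\<close> is \<open>b *\<^sub>R v T\<close>, with
      Lipschitz constant \<open>\<bar>b\<bar>\<close>.\<close>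
    show ?case
    proof (rule W.well_posed_small_fixed_point[OF E1_dense l cT _ maps zero lip R(1)])
      show "norm (b *\<^sub>R v T - b *\<^sub>R w T) \<le> \<bar>b\<bar> * e" if "\<And>t. t \<in> {0..T} \<Longrightarrow> norm (v t - w t) \<le> e" for v w :: "real \<Rightarrow> 'a" and e :: real
        using mult_left_mono[OF that[of T], of "\<bar>b\<bar>"] T by (simp add: scaleR_diff_right[symmetric])
      fix u v :: "real \<Rightarrow> 'a" and u0 M :: 'a
      assume v: "v 0 = 0" and u: "\<And>t. t \<in> {0..T} \<Longrightarrow> u t = S t u0 + v t"
      have "u 0 - b *\<^sub>R u T = M \<longleftrightarrow> u0 - b *\<^sub>R S T u0 = M + b *\<^sub>R v T"
        using u[of 0] u[of T] v T by (auto simp: scaleR_add_right algebra_simps)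
      also have "\<dots> \<longleftrightarrow> u0 = R (M + b *\<^sub>R v T)" (is "_ = ?z \<longleftrightarrow> _")
        using R(2)[of u0] R(3)[of ?z] by auto
      finally show "u 0 - b *\<^sub>R u T = M \<longleftrightarrow> u0 = R (M + b *\<^sub>R v T)" .
    qed (use reg in auto)
  next
    case (2 b)
    then have b: "continuous_on {0..T} b" by blast
    obtain R where R: "bounded_linear R" "\<And>x. R (x + integral {0..T} (\<lambda>t. b t *\<^sub>R S t x)) = x"
      "\<And>x. R x + integral {0..T} (\<lambda>t. b t *\<^sub>R S t (R x)) = x"
      using integral_inverse[OF E1_compact b] 2 by blast
    have "bounded (b ` {0..T})" by (intro compact_imp_bounded compact_continuous_image b compact_Icc)
    then obtain B where B: "\<And>t. t \<in> {0..T} \<Longrightarrow> \<bar>b t\<bar> \<le> B"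
      unfolding bounded_iff by (auto simp del: atLeastAtMost_iff)
    have B0: "B \<ge> 0" using B[of 0] T by simp
    have int: "(\<lambda>t. b t *\<^sub>R v t) integrable_on {0..T}" if "continuous_on {0..T} v" for v :: "real \<Rightarrow> 'a"
      by (intro integrable_continuous_real continuous_intros b that)
    \<comment> \<open>Here \<open>\<Lambda> v\<close> is the negative of the integral of
      \<open>b t *\<^sub>R v t\<close>, with Lipschitz constant \<open>B * T\<close>.\<close>
    show ?case
    proof (rule W.well_posed_small_fixed_point[OF E1_dense l cT _ maps zero lip R(1)])
      show "0 \<le> B * T" using B0 T by simp
      fix v w :: "real \<Rightarrow> 'a" and e :: real
      assume v: "continuous_on {0..T} v" and w: "continuous_on {0..T} w" and e: "\<And>t. t \<in> {0..T} \<Longrightarrow> norm (v t - w t) \<le> e"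
      have "norm (integral {0..T} (\<lambda>t. b t *\<^sub>R (v t - w t))) \<le> (B * e) * (T - 0)"
      proof (rule integral_bound)
        fix t assume t: "t \<in> {0..T}"
        have "\<bar>b t\<bar> * norm (v t - w t) \<le> B * e" using B[OF t] e[OF t] B0 by (intro mult_mono) auto
        then show "norm (b t *\<^sub>R (v t - w t)) \<le> B * e" by simp
      qed (use T in \<open>auto intro!: continuous_intros b v w\<close>)
      moreover have "integral {0..T} (\<lambda>t. b t *\<^sub>R (v t - w t)) =
          integral {0..T} (\<lambda>t. b t *\<^sub>R v t) - integral {0..T} (\<lambda>t. b t *\<^sub>R w t)"
        by (simp add: scaleR_diff_right integral_diff int v w)
      ultimately show "norm (- integral {0..T} (\<lambda>t. b t *\<^sub>R v t) - - integral {0..T} (\<lambda>t. b t *\<^sub>R w t)) \<le> B * T * e"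
        by (simp add: norm_minus_commute mult_ac)
    next
      fix u v :: "real \<Rightarrow> 'a" and u0 M :: 'a
      assume vc: "continuous_on {0..T} v" and v: "v 0 = 0" and u: "\<And>t. t \<in> {0..T} \<Longrightarrow> u t = S t u0 + v t"
      have "integral {0..T} (\<lambda>t. b t *\<^sub>R u t) = integral {0..T} (\<lambda>t. b t *\<^sub>R S t u0 + b t *\<^sub>R v t)"
        by (intro integral_cong) (simp add: u scaleR_add_right)
      also have "\<dots> = integral {0..T} (\<lambda>t. b t *\<^sub>R S t u0) + integral {0..T} (\<lambda>t. b t *\<^sub>R v t)"
        by (intro integral_add int cS vc)
      finally have "u 0 + integral {0..T} (\<lambda>t. b t *\<^sub>R u t) = M \<longleftrightarrow>
          u0 + integral {0..T} (\<lambda>t. b t *\<^sub>R S t u0) = M + - integral {0..T} (\<lambda>t. b t *\<^sub>R v t)"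
        using u[of 0] v T by (auto simp: algebra_simps)
      also have "\<dots> \<longleftrightarrow> u0 = R (M + - integral {0..T} (\<lambda>t. b t *\<^sub>R v t))" (is "_ = ?z \<longleftrightarrow> _")
        using R(2)[of u0] R(3)[of ?z] by auto
      finally show "u 0 + integral {0..T} (\<lambda>t. b t *\<^sub>R u t) = M \<longleftrightarrow> u0 = R (M + - integral {0..T} (\<lambda>t. b t *\<^sub>R v t))" .
    qed (use reg in auto)
  qed
qed

end
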